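(* Let $\Phi_m(r)=\Phi(r)=1/r^a$ for $r>0$ and all $m\ge1$, and let $r_*=1$. For every $a>3$ there exist $\varepsilon_a>0$, $\kappa_a>0$ and $\sigma_a>0$ such that for every $\varepsilon\in(0,\varepsilon_a)$ there is a unique function $V_\varepsilon\in E^3$ with $\|V_\varepsilon\|_{H^1}\le\kappa_a$ such that $$c_\varepsilon^2=a(a+1)\zeta(a)+\frac{a(a+1)}{12}\zeta(a-2)\,\varepsilon^2\quad\text{and}\quad W_\varepsilon(x)=-\frac{\zeta(a-2)}{4(a+2)\zeta(a)}\operatorname{sech}^2\left(\frac{x}{2}\right)+\varepsilon^{\sigma_a}V_\varepsilon(x)$$ solve $$\varepsilon^2c_\varepsilon^2W_\varepsilon=\sum_{m\ge1}m\,\mathcal{A}_{\varepsilon m}\left[\Phi'\left(m+m\varepsilon^2\mathcal{A}_{\varepsilon m}W_\varepsilon\right)-\Phi'(m)\right].$$ If $a\neq5$, this holds with $\sigma_a=\min\{a-3,2\}$. If $a=5$, this holds with $\sigma_a=2-\delta$ for any $\delta\in(0,2)$ (with $\varepsilon_a,\kappa_a$ allowed to depend on $\delta$).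
   Context: $H^s=H^s(\mathbb{R})$ is the usual $L^2$-based Sobolev space, and $E^s:=H^s\cap\{\text{even functions}\}$. $\zeta(a)=\sum_{m\ge1}m^{-a}$. For $h>0$, $\mathcal{A}_hF(x):=\frac1h\int_{x-h/2}^{x+h/2}F(y)\,dy$. The equation is the traveling wave equation for the generalized Calogero-Moser lattice $\ddot u_j=\sum_{m\ge1}\Phi'(u_{j+m}-u_j)-\Phi'(u_j-u_{j-m})$, $j\in\mathbb{Z}$, obtained from the ansatz $u_j(t)=j+\varepsilon U_\varepsilon(\varepsilon(j-c_\varepsilon t))$ with $W_\varepsilon=U_\varepsilon'$. *)

theory Defs
  imports "HOL-Analysis.Analysis"
begin

text \<open>
  Elements of \<open>L\<^sup>2(\<real>)\<close> and of the Sobolev spaces are represented by real-valued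
  functions, and two representatives are identified when they agree almost everywhere.
  All identities between such elements (evenness, solving an equation, uniqueness)
  are therefore meant almost everywhere.
\<close>

definition square_integrable :: "(real \<Rightarrow> real) \<Rightarrow> bool" where
  "square_integrable f \<longleftrightarrow>
     f \<in> borel_measurable lebesgue \<and> integrable lebesgue (\<lambda>x. (f x)\<^sup>2)"

definition test_function :: "(real \<Rightarrow> real) \<Rightarrow> bool" where
  "test_function \<phi> \<longleftrightarrow>
     (\<forall>n x. (deriv ^^ n) \<phi> field_differentiable at x) \<and> compact (closure {x. \<phi> x \<noteq> 0})"

definition has_weak_deriv :: "nat \<Rightarrow> (real \<Rightarrow> real) \<Rightarrow> (real \<Rightarrow> real) \<Rightarrow> bool" where
  "has_weak_deriv j f g \<longleftrightarrow>
     (\<forall>\<phi>. test_function \<phi> \<longrightarrow>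
        (LINT x|lebesgue. f x * (deriv ^^ j) \<phi> x) = (-1) ^ j * (LINT x|lebesgue. g x * \<phi> x))"

text \<open>
  Sobolev spaces of integer order. Membership of \<open>f\<close> itself in \<open>L\<^sup>2\<close> is
  required separately: the Bochner integral of a non-integrable function is 0, so
  \<open>has_weak_deriv\<close> is meaningful only for locally integrable functions.
\<close>

definition sobolev :: "nat \<Rightarrow> (real \<Rightarrow> real) set" where
  "sobolev k =
     {f. square_integrable f \<and>
         (\<forall>j\<in>{1..k}. \<exists>g. square_integrable g \<and> has_weak_deriv j f g)}"

text \<open>A choice among representatives that agree almost everywhere:\<close>

definition weak_deriv :: "nat \<Rightarrow> (real \<Rightarrow> real) \<Rightarrow> real \<Rightarrow> real" where
  "weak_deriv j f = (SOME g. square_integrable g \<and> has_weak_deriv j f g)"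

definition sobolev_norm :: "nat \<Rightarrow> (real \<Rightarrow> real) \<Rightarrow> real" where
  "sobolev_norm k f = sqrt (\<Sum>j\<le>k. LINT x|lebesgue. (weak_deriv j f x)\<^sup>2)"

definition even_sobolev :: "nat \<Rightarrow> (real \<Rightarrow> real) set" where
  "even_sobolev k = {f \<in> sobolev k. AE x in lebesgue. f (- x) = f x}"

definition zeta :: "real \<Rightarrow> real" where
  "zeta a = (\<Sum>m. 1 / real (Suc m) powr a)"

definition average :: "real \<Rightarrow> (real \<Rightarrow> real) \<Rightarrow> real \<Rightarrow> real" where
  "average h F x = 1 / h * (LINT y:{x - h/2..x + h/2}|lebesgue. F y)"

definition potential :: "real \<Rightarrow> real \<Rightarrow> real" where
  "potential a r = 1 / r powr a"

definition strain :: "real \<Rightarrow> (real \<Rightarrow> real) \<Rightarrow> nat \<Rightarrow> real \<Rightarrow> real" where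
  "strain \<epsilon> W m x = real m + real m * \<epsilon>\<^sup>2 * average (\<epsilon> * real m) W x"

text \<open>
  The potential is defined only on \<open>(0,\<infinity>)\<close>, so its arguments in the wave
  equation have to be positive. The summation index \<open>m \<ge> 1\<close> is written as \<open>Suc n\<close>.
\<close>

definition wave_equation :: "real \<Rightarrow> real \<Rightarrow> real \<Rightarrow> (real \<Rightarrow> real) \<Rightarrow> bool" where
  "wave_equation a \<epsilon> c W \<longleftrightarrow>
     (\<forall>m\<ge>1. \<forall>x. strain \<epsilon> W m x > 0) \<and>
     (AE x in lebesgue.
        (\<lambda>n. let m = Suc n in
            real m * average (\<epsilon> * real m)
              (\<lambda>y. deriv (potential a) (strain \<epsilon> W m y) - deriv (potential a) (real m)) x)
        sums (\<epsilon>\<^sup>2 * c\<^sup>2 * W x))"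

definition wave_speed :: "real \<Rightarrow> real \<Rightarrow> real" where
  "wave_speed a \<epsilon> = sqrt (a * (a + 1) * zeta a + a * (a + 1) / 12 * zeta (a - 2) * \<epsilon>\<^sup>2)"

definition wave_profile ::
    "real \<Rightarrow> real \<Rightarrow> real \<Rightarrow> (real \<Rightarrow> real) \<Rightarrow> real \<Rightarrow> real" where
  "wave_profile a \<sigma> \<epsilon> V x =
     - (zeta (a - 2) / (4 * (a + 2) * zeta a)) * (1 / cosh (x / 2))\<^sup>2 + \<epsilon> powr \<sigma> * V x"

definition is_corrector ::
    "real \<Rightarrow> real \<Rightarrow> real \<Rightarrow> real \<Rightarrow> (real \<Rightarrow> real) \<Rightarrow> bool" where
  "is_corrector a \<sigma> \<kappa> \<epsilon> V \<longleftrightarrow>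
     V \<in> even_sobolev 3 \<and> sobolev_norm 1 V \<le> \<kappa> \<and>
     wave_equation a \<epsilon> (wave_speed a \<epsilon>) (wave_profile a \<sigma> \<epsilon> V)"

definition solitary_waves_exist :: "real \<Rightarrow> real \<Rightarrow> bool" where
  "solitary_waves_exist a \<sigma> \<longleftrightarrow>
     (\<exists>\<epsilon>\<^sub>a>0. \<exists>\<kappa>\<^sub>a>0. \<forall>\<epsilon>\<in>{0<..<\<epsilon>\<^sub>a}.
        \<exists>V. is_corrector a \<sigma> \<kappa>\<^sub>a \<epsilon> V \<and>
            (\<forall>V'. is_corrector a \<sigma> \<kappa>\<^sub>a \<epsilon> V' \<longrightarrow> (AE x in lebesgue. V' x = V x)))"

end

theory Submission
  imports Defs
begin

text \<open>
  After division by \<open>\<epsilon>\<^sup>4\<close> the equation reads \<open>B\<^sub>\<epsilon> W = N\<^sub>\<epsilon>(W)\<close>, where \<open>B\<^sub>\<epsilon>\<close> tends formally to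
  a multiple of \<open>1 - \<partial>\<^sup>2\<close> and \<open>N\<^sub>\<epsilon>\<close> to a multiple of \<open>W\<^sup>2\<close>; the limit is the KdV profile equation, solved by
  \<open>W\<^sub>0 = -C\<^sub>0 sech\<^sup>2(x/2)\<close>. The operator \<open>B\<^sub>\<epsilon>\<close> is inverted by a Neumann series, and an energy
  estimate shows that averages of \<open>B\<^sub>\<epsilon>\<^sup>-\<^sup>1 f\<close> gain one derivative uniformly in \<open>\<epsilon>\<close>, so
  that \<open>F\<^sub>\<epsilon> = B\<^sub>\<epsilon>\<^sup>-\<^sup>1 N\<^sub>\<epsilon>\<close> is close, on an \<open>H\<^sup>1\<close> ball around \<open>W\<^sub>0\<close>, to its formal
  limit. Linearised at \<open>W\<^sub>0\<close>, the limiting fixed point equation has the operator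
  \<open>1 - (1 - \<partial>\<^sup>2)\<^sup>-\<^sup>1(3 sech\<^sup>2(x/2) \<cdot>)\<close>, which is inverted on even functions by an explicit Green's function. For
  \<open>W = W\<^sub>0 + \<epsilon>\<^sup>\<sigma> V\<close> this turns the equation into a contraction for \<open>V\<close>; the exponent \<open>\<sigma>\<close> is the
  rate of \<open>F\<^sub>\<epsilon>(W\<^sub>0) - W\<^sub>0\<close>. Finally, averaging gains one derivative for fixed \<open>\<epsilon>\<close>, so
  every square-integrable solution agrees almost everywhere with a smooth one; this gives the \<open>H\<^sup>3\<close>
  regularity and reduces uniqueness to the contraction.
\<close>

section \<open>Continuous square-integrable functions\<close>

text \<open>The weights decay only like m^(-a) while the averages have width \<epsilon> m, so beyond
  m = 1/\<epsilon> a Taylor expansion of the average is useless, and each error is the smaller of a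
  Taylor term and a constant. On the soliton this leaves the sum over m of m^(2-a) min(4,
  (\<epsilon> m)^2): of order \<epsilon>^2 for a > 5, of order \<epsilon>^(a-3) for a < 5, and with
  a logarithm at a = 5, where \<delta> is lost. The cap 2 also reflects \<epsilon>^2 corrections to
  the nonlinearity. As the inverse of the linear part does not smooth uniformly, the argument rests
  on commutation: every summand of the nonlinearity ends with an average, this average commutes with
  the inverse, and so an error that is small only in L^2 becomes small in H^1. Errors may thus cost
  one derivative, just what dropping an average from an H^1 function costs. Symbol estimates in
  Fourier space are replaced by Minkowski's inequality, the parallelogram law and second
  differences, all for continuous functions, so that representatives matter only in the final
  comparison with Sobolev spaces.\<close>

definition l2_bounded :: "(real \<Rightarrow> real) \<Rightarrow> real \<Rightarrow> bool" where
  "l2_bounded u C \<longleftrightarrow> continuous_on UNIV u \<and> 0 \<le> C \<and> (\<integral>\<^sup>+x. ennreal ((u x)^2) \<partial>lborel) \<le> ennreal (C^2)"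

definition l2_norm :: "(real \<Rightarrow> real) \<Rightarrow> real" where
  "l2_norm u = sqrt (LINT x|lborel. (u x)^2)"

abbreviation shiftdiff :: "real \<Rightarrow> (real \<Rightarrow> real) \<Rightarrow> real \<Rightarrow> real" where
  "shiftdiff r u \<equiv> (\<lambda>x. u (x + r) - u x)"

lemma l2_bounded_cont: "l2_bounded u C \<Longrightarrow> continuous_on UNIV u"
  by (simp add: l2_bounded_def)

lemma l2_bounded_nonneg: "l2_bounded u C \<Longrightarrow> 0 \<le> C"
  by (simp add: l2_bounded_def)

lemma cont_meas: "continuous_on UNIV (u::real\<Rightarrow>real) \<Longrightarrow> u \<in> borel_measurable lborel"
  by (simp add: borel_measurable_continuous_onI)

lemma l2_bounded_integrable:
  assumes "l2_bounded u C" shows "integrable lborel (\<lambda>x. (u x)^2)"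
proof -
  have [measurable]: "u \<in> borel_measurable lborel"
    using assms cont_meas l2_bounded_cont by blast
  show ?thesis
    using assms by (intro integrableI_bounded) (auto simp: l2_bounded_def intro: le_less_trans[OF _
        ennreal_less_top])
qed

text \<open>The defining form, an inequality in \<open>ennreal\<close>, passes through Fatou and
  Tonelli without integrability conditions; the form with \<open>l2_norm\<close> is the one in which
  norms can be compared and subtracted.\<close>

lemma l2_bounded_iff: "l2_bounded u C \<longleftrightarrow> continuous_on UNIV u \<and> integrable lborel (\<lambda>x. (u x)^2) \<and> l2_norm u \<le> C"
proof
  assume l: "l2_bounded u C"
  have i: "integrable lborel (\<lambda>x. (u x)^2)" using l by (rule l2_bounded_integrable)
  have "ennreal (LINT x|lborel. (u x)^2) \<le> ennreal (C^2)"
    using l unfolding l2_bounded_def by (subst nn_integral_eq_integral[symmetric]) (auto simp: i)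
  then have "(LINT x|lborel. (u x)^2) \<le> C^2" by (simp add: ennreal_le_iff)
  then have "l2_norm u \<le> C" unfolding l2_norm_def using l2_bounded_nonneg[OF l] real_le_lsqrt by auto
  with i l show "continuous_on UNIV u \<and> integrable lborel (\<lambda>x. (u x)^2) \<and> l2_norm u \<le> C"
    by (simp add: l2_bounded_cont)
next
  assume a: "continuous_on UNIV u \<and> integrable lborel (\<lambda>x. (u x)^2) \<and> l2_norm u \<le> C"
  have p: "0 \<le> (LINT x|lborel. (u x)^2)" by simp
  then have l0: "0 \<le> l2_norm u" by (simp add: l2_norm_def)
  have "(LINT x|lborel. (u x)^2) = (l2_norm u)^2" using p by (simp add: l2_norm_def)
  also have "\<dots> \<le> C^2" using a l0 by (intro power_mono) auto
  finally have "ennreal (LINT x|lborel. (u x)^2) \<le> ennreal (C^2)" by (simp add: ennreal_leI)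
  moreover have "(\<integral>\<^sup>+x. ennreal ((u x)^2) \<partial>lborel) = ennreal (LINT x|lborel. (u x)^2)"
    using a by (intro nn_integral_eq_integral) auto
  ultimately show "l2_bounded u C" unfolding l2_bounded_def using a l0 by auto
qed

lemma l2_bounded_l2_norm: "l2_bounded u C \<Longrightarrow> l2_bounded u (l2_norm u)"
  by (simp add: l2_bounded_iff)

lemma l2_norm_le: "l2_bounded u C \<Longrightarrow> l2_norm u \<le> C"
  by (simp add: l2_bounded_iff)

lemma l2_norm_nonneg: "0 \<le> l2_norm u"
  by (simp add: l2_norm_def)

lemma l2_bounded_mono: "l2_bounded u C \<Longrightarrow> C \<le> D \<Longrightarrow> l2_bounded u D"
  by (auto simp: l2_bounded_iff)

lemma l2_bounded_dom:
  assumes "l2_bounded v C" "continuous_on UNIV u" "0 \<le> k" "\<And>x. \<bar>u x\<bar> \<le> k * \<bar>v x\<bar>"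
  shows "l2_bounded u (k * C)"
proof -
  have [measurable]: "u \<in> borel_measurable lborel" "v \<in> borel_measurable lborel"
    using assms cont_meas l2_bounded_cont by blast+
  have "(u x)^2 \<le> k^2 * (v x)^2" for x
    using power_mono[OF assms(4)[of x], of 2] by (simp add: power_mult_distrib)
  then have "(\<integral>\<^sup>+x. ennreal ((u x)^2) \<partial>lborel) \<le> (\<integral>\<^sup>+x. ennreal (k^2) * ennreal ((v x)^2) \<partial>lborel)"
    by (intro nn_integral_mono) (simp add: ennreal_mult'[symmetric] ennreal_leI)
  also have "\<dots> = ennreal (k^2) * (\<integral>\<^sup>+x. ennreal ((v x)^2) \<partial>lborel)"
    by (rule nn_integral_cmult) measurable
  also have "\<dots> \<le> ennreal (k^2) * ennreal (C^2)"
    using assms(1) by (intro mult_left_mono) (auto simp: l2_bounded_def)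
  also have "\<dots> = ennreal ((k*C)^2)" by (simp add: ennreal_mult'[symmetric] power_mult_distrib)
  finally show ?thesis using assms l2_bounded_nonneg[OF assms(1)] by (simp add: l2_bounded_def)
qed

lemma l2_bounded_scale: "l2_bounded u C \<Longrightarrow> l2_bounded (\<lambda>x. c * u x) (\<bar>c\<bar> * C)"
  using l2_bounded_cont[of u C] by (intro l2_bounded_dom) (auto simp: abs_mult intro!: continuous_intros)

lemma l2_bounded_minus: "l2_bounded u C \<Longrightarrow> l2_bounded (\<lambda>x. - u x) C"
  using l2_bounded_scale[of u C "-1"] by simp

lemma l2_bounded_0: "l2_bounded (\<lambda>x. 0) 0"
  by (simp add: l2_bounded_def)

text \<open>Minkowski's inequality from (p+q)^2 \<le> (1 + b/a) p^2 + (1 + a/b) q^2: with a and b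
  the two norm bounds, the right-hand side integrates to at most (a+b)^2.\<close>

lemma l2_bounded_add:
  assumes u: "l2_bounded u A" and v: "l2_bounded v B"
  shows "l2_bounded (\<lambda>x. u x + v x) (A + B)"
proof -
  have [measurable]: "u \<in> borel_measurable lborel" "v \<in> borel_measurable lborel"
    using assms cont_meas l2_bounded_cont by blast+
  have A0: "0 \<le> A" "0 \<le> B" using assms l2_bounded_nonneg by auto
  have ineq: "(p + q)^2 \<le> (1 + b/a) * p^2 + (1 + a/b) * q^2" if "a > 0" "b > 0" for p q a b :: real
  proof -
    have "0 \<le> (b * p - a * q)^2 / (a * b)" using that by simp
    also have "\<dots> = (1 + b/a) * p^2 + (1 + a/b) * q^2 - (p+q)^2"
      using that by (simp add: field_simps power2_eq_square)
    finally show ?thesis by simp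
  qed
  \<comment> \<open>A and B may be 0, where the weights are undefined; both are raised by e, and e
    tends to 0 at the end.\<close>
  have step: "(\<integral>\<^sup>+x. ennreal ((u x + v x)^2) \<partial>lborel) \<le> ennreal ((A + B + 2*e)^2)" if e: "e > 0" for e
  proof -
    define a b where "a = A + e" and "b = B + e"
    have ab: "a > 0" "b > 0" using A0 e by (auto simp: a_def b_def)
    have "(\<integral>\<^sup>+x. ennreal ((u x + v x)^2) \<partial>lborel)
       \<le> (\<integral>\<^sup>+x. ennreal (1 + b/a) * ennreal ((u x)^2) + ennreal (1 + a/b) * ennreal ((v x)^2) \<partial>lborel)"
      using ab ineq[OF ab]
      by (intro nn_integral_mono) (simp add: ennreal_mult'[symmetric] ennreal_leI flip: ennreal_plus)
    also have "\<dots> = ennreal (1 + b/a) * (\<integral>\<^sup>+x. ennreal ((u x)^2) \<partial>lborel)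
        + ennreal (1 + a/b) * (\<integral>\<^sup>+x. ennreal ((v x)^2) \<partial>lborel)"
      by (simp add: nn_integral_add nn_integral_cmult)
    also have "\<dots> \<le> ennreal (1 + b/a) * ennreal (a^2) + ennreal (1 + a/b) * ennreal (b^2)"
    proof (intro add_mono mult_left_mono)
      show "(\<integral>\<^sup>+x. ennreal ((u x)^2) \<partial>lborel) \<le> ennreal (a^2)"
        using l2_bounded_mono[OF u, of a] e unfolding l2_bounded_def a_def by simp
      show "(\<integral>\<^sup>+x. ennreal ((v x)^2) \<partial>lborel) \<le> ennreal (b^2)"
        using l2_bounded_mono[OF v, of b] e unfolding l2_bounded_def b_def by simp
    qed auto
    also have "\<dots> = ennreal ((1 + b/a) * a^2 + (1 + a/b) * b^2)"
      using ab by (simp add: ennreal_mult'[symmetric] flip: ennreal_plus)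
    also have "(1 + b/a) * a^2 + (1 + a/b) * b^2 = (A + B + 2*e)^2"
    proof -
      have "(1 + b/a) * a^2 + (1 + a/b) * b^2 = (a + b)^2"
        using ab by (simp add: field_simps power2_eq_square)
      moreover have "a + b = A + B + 2 * e" by (simp add: a_def b_def)
      ultimately show ?thesis by simp
    qed
    finally show ?thesis .
  qed
  have "(\<integral>\<^sup>+x. ennreal ((u x + v x)^2) \<partial>lborel) \<le> ennreal ((A + B)^2)"
  proof (rule tendsto_lowerbound)
    show "((\<lambda>e. ennreal ((A + B + 2*e)^2)) \<longlongrightarrow> ennreal ((A + B)^2)) (at_right 0)"
      by (rule tendsto_ennrealI) (auto intro!: tendsto_eq_intros)
    show "\<forall>\<^sub>F e in at_right 0. (\<integral>\<^sup>+x. ennreal ((u x + v x)^2) \<partial>lborel) \<le> ennreal ((A + B + 2*e)^2)"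
      using step by (auto simp: eventually_at_right_field intro: exI[of _ 1])
  qed auto
  then show ?thesis using A0 assms by (auto simp: l2_bounded_def intro: continuous_intros)
qed

lemma l2_bounded_diff: "l2_bounded u A \<Longrightarrow> l2_bounded v B \<Longrightarrow> l2_bounded (\<lambda>x. u x - v x) (A + B)"
  using l2_bounded_add[of u A "\<lambda>x. - v x" B] l2_bounded_minus[of v B] by simp

lemma l2_bounded_affine:
  assumes "l2_bounded u C" "\<bar>c\<bar> = 1" shows "l2_bounded (\<lambda>x. u (t + c * x)) C"
proof -
  have [measurable]: "u \<in> borel_measurable borel"
    using assms cont_meas l2_bounded_cont by force
  have "(\<integral>\<^sup>+x. ennreal ((u x)^2) \<partial>lborel) = ennreal \<bar>c\<bar> * (\<integral>\<^sup>+x. ennreal ((u (t + c * x))^2) \<partial>lborel)"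
    using assms(2) by (intro nn_integral_real_affine) auto
  then show ?thesis
    using assms l2_bounded_cont[OF assms(1)] unfolding l2_bounded_def
    by (auto intro!: continuous_on_compose2[of UNIV u] continuous_intros)
qed

lemma l2_bounded_shift: "l2_bounded u C \<Longrightarrow> l2_bounded (\<lambda>x. u (x + t)) C"
  using l2_bounded_affine[of u C 1 t] by (simp add: add.commute)

lemma l2_bounded_shift': "l2_bounded u C \<Longrightarrow> l2_bounded (\<lambda>x. u (x - t)) C"
  using l2_bounded_shift[of u C "-t"] by simp

text \<open>Fatou. That pointwise convergence is enough later gives completeness, and bounds on
  derivatives from bounds on difference quotients.\<close>

lemma l2_bounded_limit:
  assumes "\<And>n. l2_bounded (f n) C" "\<And>x. (\<lambda>n. f n x) \<longlonglongrightarrow> u x" "continuous_on UNIV u"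
  shows "l2_bounded u C"
proof -
  have [measurable]: "f n \<in> borel_measurable lborel" for n
    using assms cont_meas l2_bounded_cont by blast
  have "(\<integral>\<^sup>+x. ennreal ((u x)^2) \<partial>lborel) = (\<integral>\<^sup>+x. liminf (\<lambda>n. ennreal ((f n x)^2)) \<partial>lborel)"
  proof (rule nn_integral_cong)
    fix x
    have "(\<lambda>n. ennreal ((f n x)^2)) \<longlonglongrightarrow> ennreal ((u x)^2)"
      by (intro tendsto_ennrealI tendsto_power assms)
    then show "ennreal ((u x)^2) = liminf (\<lambda>n. ennreal ((f n x)^2))"
      by (intro lim_imp_Liminf[symmetric]) auto
  qed
  also have "\<dots> \<le> liminf (\<lambda>n. \<integral>\<^sup>+x. ennreal ((f n x)^2) \<partial>lborel)"
    by (rule nn_integral_liminf) measurable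
  also have "\<dots> \<le> ennreal (C^2)"
    using assms(1) by (intro Liminf_le) (auto simp: l2_bounded_def)
  finally show ?thesis using assms l2_bounded_nonneg by (auto simp: l2_bounded_def)
qed

text \<open>Cauchy-Schwarz, as nonnegativity of the integral of (f - m)^2 with m the mean of
  f.\<close>

lemma square_integral_le:
  fixes f :: "real \<Rightarrow> real"
  assumes "\<alpha> \<le> \<beta>" "continuous_on {\<alpha>..\<beta>} f"
  shows "(integral {\<alpha>..\<beta>} f)^2 \<le> (\<beta> - \<alpha>) * integral {\<alpha>..\<beta>} (\<lambda>t. (f t)^2)"
proof (cases "\<alpha> = \<beta>")
  case False
  then have ab: "\<beta> - \<alpha> > 0" using assms by simp
  define m where "m = integral {\<alpha>..\<beta>} f / (\<beta> - \<alpha>)"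
  have i: "f integrable_on {\<alpha>..\<beta>}" "(\<lambda>t. (f t)^2) integrable_on {\<alpha>..\<beta>}"
    using assms by (auto intro!: integrable_continuous_real continuous_intros)
  have "0 \<le> integral {\<alpha>..\<beta>} (\<lambda>t. (f t - m)^2)"
    using assms by (intro integral_nonneg integrable_continuous_real continuous_intros) auto
  also have "(\<lambda>t. (f t - m)^2) = (\<lambda>t. ((f t)^2 - (2*m) * f t) + m^2)"
    by (auto simp: power2_eq_square algebra_simps)
  also have "integral {\<alpha>..\<beta>} \<dots> = integral {\<alpha>..\<beta>} (\<lambda>t. (f t)^2) - 2*m * integral {\<alpha>..\<beta>} f + m^2 * (\<beta> - \<alpha>)"
    using i ab integrable_on_mult_right[OF i(1), of "2*m"]
    by (subst integral_add) (auto intro!: integrable_diff simp: integral_diff)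
  finally have *: "0 \<le> integral {\<alpha>..\<beta>} (\<lambda>t. (f t)^2) - 2*m * integral {\<alpha>..\<beta>} f + m^2 * (\<beta> - \<alpha>)" .
  have "0 \<le> integral {\<alpha>..\<beta>} (\<lambda>t. (f t)^2) - (integral {\<alpha>..\<beta>} f)^2 / (\<beta> - \<alpha>)"
  proof -
    have "m * integral {\<alpha>..\<beta>} f = (integral {\<alpha>..\<beta>} f)^2 / (\<beta> - \<alpha>)"
      "m^2 * (\<beta> - \<alpha>) = (integral {\<alpha>..\<beta>} f)^2 / (\<beta> - \<alpha>)"
      using ab by (simp_all add: m_def power2_eq_square)
    with * show ?thesis by simp
  qed
  then show ?thesis using ab by (simp add: pos_divide_le_eq mult.commute)
qed auto

lemma nn_integral_interval:
  fixes f :: "real \<Rightarrow> real"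
  assumes "continuous_on UNIV f" "\<And>t. 0 \<le> f t"
  shows "(\<integral>\<^sup>+t. ennreal (indicator {\<alpha>..\<beta>} t * f t) \<partial>lborel) = ennreal (integral {\<alpha>..\<beta>} f)"
proof -
  have "(f has_integral integral {\<alpha>..\<beta>} f) {\<alpha>..\<beta>}"
    by (intro integrable_integral integrable_continuous_real continuous_on_subset[OF assms(1)]) auto
  then have "((\<lambda>t. indicator {\<alpha>..\<beta>} t * f t) has_integral integral {\<alpha>..\<beta>} f) UNIV"
    by (subst (asm) has_integral_restrict_UNIV[symmetric])
      (simp add: indicator_def of_bool_def if_distrib[of "\<lambda>x. x * _"] cong: if_cong)
  then show ?thesis
    using assms borel_measurable_continuous_onI[OF assms(1)]
    by (intro nn_integral_has_integral_lborel) auto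
qed

lemma cont_pair1: "continuous_on UNIV (\<lambda>(x,t). g x (t::real)) \<Longrightarrow> continuous_on UNIV (g (x::real))"
  using continuous_on_compose2[of UNIV "\<lambda>(x,t). g x t" UNIV "\<lambda>t. (x,t)"]
    continuous_on_Pair[of UNIV "\<lambda>_. x" "\<lambda>t. t"] by simp

text \<open>Minkowski's inequality for integrals: Cauchy-Schwarz in t, then Tonelli. Averages and
  Taylor remainders are all estimated through this lemma.\<close>

lemma l2_bounded_avg:
  fixes g :: "real \<Rightarrow> real \<Rightarrow> real"
  assumes c: "continuous_on UNIV (\<lambda>(x,t). g x t)" and ab: "\<alpha> \<le> \<beta>"
    and b: "\<And>t. t \<in> {\<alpha>..\<beta>} \<Longrightarrow> l2_bounded (\<lambda>x. g x t) B"
  shows "l2_bounded (\<lambda>x. integral {\<alpha>..\<beta>} (g x)) ((\<beta> - \<alpha>) * B)"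
proof -
  have B0: "0 \<le> B" using b[of \<alpha>] ab l2_bounded_nonneg by auto
  have cg: "continuous_on UNIV (g x)" for x using c by (rule cont_pair1)
  have cont: "continuous_on UNIV (\<lambda>x. integral {\<alpha>..\<beta>} (g x))"
    using integral_continuous_on_param[of UNIV \<alpha> \<beta> g] continuous_on_subset[OF c] by auto
  have [measurable]: "(\<lambda>(x,t). g x t) \<in> borel_measurable (lborel \<Otimes>\<^sub>M lborel)"
    using borel_measurable_continuous_onI[OF c] by (simp add: lborel_prod)
  have "(\<integral>\<^sup>+x. ennreal ((integral {\<alpha>..\<beta>} (g x))^2) \<partial>lborel)
      \<le> (\<integral>\<^sup>+x. ennreal (\<beta> - \<alpha>) * (\<integral>\<^sup>+t. ennreal (indicator {\<alpha>..\<beta>} t * (g x t)^2) \<partial>lborel) \<partial>lborel)"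
  proof (rule nn_integral_mono)
    fix x
    have "(integral {\<alpha>..\<beta>} (g x))^2 \<le> (\<beta> - \<alpha>) * integral {\<alpha>..\<beta>} (\<lambda>t. (g x t)^2)"
      using ab continuous_on_subset[OF cg] by (intro square_integral_le) auto
    then have "ennreal ((integral {\<alpha>..\<beta>} (g x))^2) \<le> ennreal (\<beta> - \<alpha>) * ennreal (integral {\<alpha>..\<beta>} (\<lambda>t. (g
        x t)^2))"
      using ab by (simp add: ennreal_mult'[symmetric] ennreal_leI)
    also have "ennreal (integral {\<alpha>..\<beta>} (\<lambda>t. (g x t)^2)) = (\<integral>\<^sup>+t. ennreal (indicator {\<alpha>..\<beta>} t * (g x
        t)^2) \<partial>lborel)"
      by (intro nn_integral_interval[symmetric]) (auto intro!: continuous_intros cg)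
    finally show "ennreal ((integral {\<alpha>..\<beta>} (g x))^2)
        \<le> ennreal (\<beta> - \<alpha>) * (\<integral>\<^sup>+t. ennreal (indicator {\<alpha>..\<beta>} t * (g x t)^2) \<partial>lborel)" .
  qed
  also have "\<dots> = ennreal (\<beta> - \<alpha>) * (\<integral>\<^sup>+x. \<integral>\<^sup>+t. ennreal (indicator {\<alpha>..\<beta>} t * (g x t)^2) \<partial>lborel \<partial>lborel)"
    by (rule nn_integral_cmult) measurable
  also have "(\<integral>\<^sup>+x. \<integral>\<^sup>+t. ennreal (indicator {\<alpha>..\<beta>} t * (g x t)^2) \<partial>lborel \<partial>lborel)
      = (\<integral>\<^sup>+t. \<integral>\<^sup>+x. ennreal (indicator {\<alpha>..\<beta>} t * (g x t)^2) \<partial>lborel \<partial>lborel)"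
    by (rule lborel_pair.Fubini'[symmetric]) measurable
  also have "\<dots> \<le> (\<integral>\<^sup>+t. ennreal (B^2) * indicator {\<alpha>..\<beta>} t \<partial>lborel)"
    using b by (intro nn_integral_mono) (auto simp: l2_bounded_def split: split_indicator)
  also have "\<dots> = ennreal (B^2) * ennreal (\<beta> - \<alpha>)"
    using ab by (subst nn_integral_cmult_indicator) auto
  finally have "(\<integral>\<^sup>+x. ennreal ((integral {\<alpha>..\<beta>} (g x))^2) \<partial>lborel) \<le> ennreal (\<beta> - \<alpha>) * (ennreal (B^2) *
      ennreal (\<beta> - \<alpha>))"
    using mult_left_mono by force
  also have "\<dots> = ennreal (((\<beta> - \<alpha>) * B)^2)"
    using ab by (simp add: ennreal_mult'[symmetric] power_mult_distrib power2_eq_square mult_ac)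
  finally show ?thesis using cont ab B0 by (simp add: l2_bounded_def)
qed

text \<open>A large difference of two functions of norm at most A forces their sum to be shorter
  than 2A by a definite amount. This is the source of the gain in \<open>avg_energy\<close>.\<close>

lemma l2_bounded_parallelogram:
  assumes "l2_bounded u A" "l2_bounded v A"
  shows "l2_bounded (\<lambda>x. u x + v x) (sqrt (4 * A^2 - (l2_norm (\<lambda>x. u x - v x))^2))"
      "(l2_norm (\<lambda>x. u x - v x))^2 \<le> 4 * A^2"
proof -
  have d: "l2_bounded (\<lambda>x. u x - v x) (A + A)" and s: "l2_bounded (\<lambda>x. u x + v x) (A + A)"
    using assms l2_bounded_diff l2_bounded_add by blast+
  have i: "integrable lborel (\<lambda>x. (u x)^2)" "integrable lborel (\<lambda>x. (v x)^2)"
      "integrable lborel (\<lambda>x. (u x - v x)^2)" "integrable lborel (\<lambda>x. (u x + v x)^2)"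
    using assms d s l2_bounded_integrable by blast+
  have "l2_norm (\<lambda>x. u x - v x) \<le> A + A" using d by (rule l2_norm_le)
  then have "(l2_norm (\<lambda>x. u x - v x))^2 \<le> (A+A)^2" using l2_norm_nonneg power_mono by blast
  then show le: "(l2_norm (\<lambda>x. u x - v x))^2 \<le> 4 * A^2" by (simp add: power2_eq_square)
  have sq: "(l2_norm w)^2 = (LINT x|lborel. (w x)^2)" for w by (simp add: l2_norm_def)
  have "(LINT x|lborel. (u x + v x)^2) + (LINT x|lborel. (u x - v x)^2)
      = (LINT x|lborel. (u x + v x)^2 + (u x - v x)^2)"
    using i by simp
  also have "\<dots> = (LINT x|lborel. 2 * (u x)^2 + 2 * (v x)^2)"
    by (rule Bochner_Integration.integral_cong) (auto simp: power2_eq_square algebra_simps)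
  also have "\<dots> = 2 * (LINT x|lborel. (u x)^2) + 2 * (LINT x|lborel. (v x)^2)" using i by simp
  finally have "(l2_norm (\<lambda>x. u x + v x))^2 + (l2_norm (\<lambda>x. u x - v x))^2 = 2 * (l2_norm u)^2 + 2 *
      (l2_norm v)^2"
    by (simp add: sq)
  also have "\<dots> \<le> 4 * A^2"
    using power_mono[OF l2_norm_le[OF assms(1)] l2_norm_nonneg, of 2] power_mono[OF l2_norm_le[OF
        assms(2)] l2_norm_nonneg, of 2] by simp
  finally have "(l2_norm (\<lambda>x. u x + v x))^2 \<le> 4 * A^2 - (l2_norm (\<lambda>x. u x - v x))^2" by simp
  then have "l2_norm (\<lambda>x. u x + v x) \<le> sqrt (4 * A^2 - (l2_norm (\<lambda>x. u x - v x))^2)"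
    by (rule real_le_rsqrt)
  then show "l2_bounded (\<lambda>x. u x + v x) (sqrt (4 * A^2 - (l2_norm (\<lambda>x. u x - v x))^2))"
    using s by (simp add: l2_bounded_iff)
qed

section \<open>Functions with a continuous derivative\<close>

lemma has_vd: "(f has_real_derivative D) wave_map \<Longrightarrow> (f has_vector_derivative D) wave_map"
  by (simp add: has_real_derivative_iff_has_vector_derivative)

lemma ftc:
  assumes "\<And>x. (u has_real_derivative u' x) (at x)" "\<alpha> \<le> \<beta>"
  shows "(u' has_integral (u \<beta> - u \<alpha>)) {\<alpha>..\<beta>}"
  using assms by (intro fundamental_theorem_of_calculus)
    (auto intro: has_vector_derivative_at_within has_vd)

text \<open>One-dimensional Sobolev embedding. On [x, x+1] the fundamental theorem bounds u(x) -
  u(y) by the norm of u'; averaging over y gives u(x)^2 \<le> 2 N^2 + 2 N^2.\<close>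

lemma sup_bound_C1:
  assumes d: "\<And>x. (u has_real_derivative u' x) (at x)" and u: "l2_bounded u N" and u': "l2_bounded u' N"
  shows "\<bar>u x\<bar> \<le> 2 * N"
proof -
  have N0: "0 \<le> N" using u l2_bounded_nonneg by auto
  have int: "integral {\<alpha>..\<beta>} (\<lambda>t. (w t)^2) \<le> N^2" if w: "l2_bounded w N" for w \<alpha> \<beta>
  proof -
    have "ennreal (integral {\<alpha>..\<beta>} (\<lambda>t. (w t)^2)) = (\<integral>\<^sup>+t. ennreal (indicator {\<alpha>..\<beta>} t * (w t)^2) \<partial>lborel)"
      using l2_bounded_cont[OF w] by (intro nn_integral_interval[symmetric]) (auto intro!: continuous_intros)
    also have "\<dots> \<le> (\<integral>\<^sup>+t. ennreal ((w t)^2) \<partial>lborel)"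
      by (intro nn_integral_mono) (auto split: split_indicator)
    also have "\<dots> \<le> ennreal (N^2)" using w by (simp add: l2_bounded_def)
    finally show ?thesis by (simp add: ennreal_le_iff)
  qed
  have c: "continuous_on UNIV u" "continuous_on UNIV u'" using u u' l2_bounded_cont by auto
  have pt: "(u x)^2 \<le> 2 * (u y)^2 + 2 * N^2" if y: "y \<in> {x..x+1}" for y
  proof -
    have "integral {x..y} u' = u y - u x"
      using ftc[OF d, of x y] y by (intro integral_unique) auto
    then have "(u y - u x)^2 \<le> (y - x) * integral {x..y} (\<lambda>t. (u' t)^2)"
      using y square_integral_le[of x y u'] continuous_on_subset[OF c(2)] by auto
    also have "\<dots> \<le> 1 * N^2"
      using y int[OF u'] by (intro mult_mono integral_nonneg integrable_continuous_real
          continuous_intros continuous_on_subset[OF c(2)]) auto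
    finally have "(u x - u y)^2 \<le> N^2" by (simp add: power2_commute)
    moreover have "(u x)^2 \<le> 2 * (u y)^2 + 2 * (u x - u y)^2"
    proof -
      have "2 * (u y)^2 + 2 * (u x - u y)^2 - (u x)^2 = (u x - 2 * u y)^2"
        by (simp add: power2_eq_square algebra_simps)
      then show ?thesis using zero_le_power2[of "u x - 2 * u y"] by linarith
    qed
    ultimately show ?thesis by simp
  qed
  have "(u x)^2 = integral {x..x+1} (\<lambda>y. (u x)^2)" by simp
  also have "\<dots> \<le> integral {x..x+1} (\<lambda>y. 2 * (u y)^2 + 2 * N^2)"
    using pt by (intro integral_le integrable_continuous_real continuous_intros continuous_on_subset[OF
        c(1)]) auto
  also have "\<dots> = 2 * integral {x..x+1} (\<lambda>y. (u y)^2) + 2 * N^2"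
    by (subst integral_add) (auto intro!: integrable_continuous_real continuous_intros
        continuous_on_subset[OF c(1)])
  also have "\<dots> \<le> (2 * N)^2" using int[OF u, of x "x+1"] by (simp add: power2_eq_square)
  finally show ?thesis using N0 abs_le_square_iff[of "u x" "2*N"] by simp
qed

lemma l2_bounded_shiftdiff_C1:
  assumes d: "\<And>x. (u has_real_derivative u' x) (at x)" and u': "l2_bounded u' N"
  shows "l2_bounded (shiftdiff r u) (N * \<bar>r\<bar>)"
proof -
  have c: "continuous_on UNIV u'" using u' l2_bounded_cont by auto
  have *: "l2_bounded (shiftdiff r u) (N * r)" if r: "r \<ge> 0" for r
  proof -
    have "l2_bounded (\<lambda>x. integral {0..r} (\<lambda>t. u' (x + t))) ((r - 0) * N)"
      using r u' by (intro l2_bounded_avg l2_bounded_shift)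
        (auto simp: case_prod_beta intro!: continuous_on_compose2[OF c] continuous_intros)
    moreover have "integral {0..r} (\<lambda>t. u' (x + t)) = u (x + r) - u x" for x
    proof -
      have "((\<lambda>t. u (x + t)) has_real_derivative u' (x + t)) (at t)" for t
        using DERIV_shift[of u "u' (x+t)" t x] d[of "x+t"] by (simp add: add.commute)
      from ftc[OF this r] show ?thesis by (auto intro: integral_unique)
    qed
    ultimately show ?thesis by (simp add: mult.commute)
  qed
  show ?thesis
  proof (cases "r \<ge> 0")
    case False
    have "l2_bounded (\<lambda>x. shiftdiff (-r) u (x + r)) (N * (-r))"
      using False by (intro l2_bounded_shift *) auto
    from l2_bounded_minus[OF this] show ?thesis using False by simp
  qed (simp add: *)
qed

section \<open>Averages\<close>

text \<open>The signed integral from 0 to x: an integral over \<open>{0..x}\<close> is 0 for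
  negative x, and the second term supplies the missing half-line.\<close>

definition primitive :: "(real \<Rightarrow> real) \<Rightarrow> real \<Rightarrow> real" where
  "primitive f x = integral {0..x} f - integral {x..0} f"

lemma primitive_0 [simp]: "primitive f 0 = 0"
  by (simp add: primitive_def)

lemma primitive_deriv:
  assumes c: "continuous_on UNIV f"
  shows "(primitive f has_real_derivative f x) (at x)"
proof -
  define N where "N = \<bar>x\<bar> + 1"
  have i: "f integrable_on {\<alpha>..\<beta>}" for \<alpha> \<beta>
    using continuous_on_subset[OF c] by (intro integrable_continuous_real) auto
  have eq: "integral {-N..y} f - integral {-N..0} f = primitive f y" if "y \<in> {-N..N}" for y
  proof (cases "y \<ge> 0")
    case True
    then have "integral {-N..0} f + integral {0..y} f = integral {-N..y} f"
      using i by (intro Henstock_Kurzweil_Integration.integral_combine) (auto simp: N_def)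
    moreover have "integral {y..0} f = 0" using True by (cases "y = 0") auto
    ultimately show ?thesis by (simp add: primitive_def)
  next
    case False
    then have "integral {-N..y} f + integral {y..0} f = integral {-N..0} f"
      using i that by (intro Henstock_Kurzweil_Integration.integral_combine) auto
    with False show ?thesis by (simp add: primitive_def)
  qed
  have "((\<lambda>y. integral {-N..y} f) has_vector_derivative f x) (at x within {-N..N})"
    using continuous_on_subset[OF c] by (intro integral_has_vector_derivative) (auto simp: N_def)
  then have "((\<lambda>y. integral {-N..y} f - integral {-N..0} f) has_vector_derivative f x) (at x within {-N..N})"
    using has_vector_derivative_diff[OF _ has_vector_derivative_const] by fastforce
  then have "((\<lambda>y. integral {-N..y} f - integral {-N..0} f) has_real_derivative f x) (at x within {-N..N})"
    by (simp add: has_real_derivative_iff_has_vector_derivative)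
  moreover have "at x within {-N..N} = at x"
    by (rule at_within_interior) (auto simp: N_def)
  ultimately have "((\<lambda>y. integral {-N..y} f - integral {-N..0} f) has_real_derivative f x) (at x)" by simp
  moreover have "\<forall>\<^sub>F y in nhds x. y \<in> {-N<..<N}"
    by (rule eventually_nhds_in_open) (auto simp: N_def)
  then have "\<forall>\<^sub>F y in nhds x. integral {-N..y} f - integral {-N..0} f = primitive f y"
    by (rule eventually_mono) (auto intro: eq)
  ultimately show ?thesis
    by (subst (asm) DERIV_cong_ev[OF refl _ refl]) auto
qed

text \<open>A fixed window of translates instead of a moving interval, so that
  \<open>l2_bounded_avg\<close> applies directly. On continuous functions this is
  \<open>average\<close>, by \<open>average_eq_avg\<close>.\<close>

definition avg :: "real \<Rightarrow> (real \<Rightarrow> real) \<Rightarrow> real \<Rightarrow> real" where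
  "avg h u x = (1 / h) * integral {-h/2..h/2} (\<lambda>t. u (x + t))"

lemma cont_shift_pair: "continuous_on UNIV u \<Longrightarrow> continuous_on UNIV (\<lambda>(x,t). u (x + t :: real))"
  by (auto simp: case_prod_beta intro!: continuous_on_compose2[of UNIV u] continuous_intros)

lemma cont_shift: "continuous_on UNIV (u :: real \<Rightarrow> real) \<Longrightarrow> continuous_on S (\<lambda>t. u (x + t))"
  by (auto intro!: continuous_on_compose2[of UNIV u] continuous_intros)

lemma int_shift: "continuous_on UNIV (u :: real \<Rightarrow> real) \<Longrightarrow> (\<lambda>t. u (x + t)) integrable_on {\<alpha>..\<beta>}"
  by (intro integrable_continuous_real cont_shift)

lemma integral_shift_primitive:
  assumes "continuous_on UNIV u" "\<alpha> \<le> \<beta>"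
  shows "integral {\<alpha>..\<beta>} (\<lambda>t. u (x + t)) = primitive u (x + \<beta>) - primitive u (x + \<alpha>)"
proof -
  have "((\<lambda>t. primitive u (x + t)) has_real_derivative u (x + t)) (at t)" for t
    using DERIV_shift[of "primitive u" "u (x+t)" t x] primitive_deriv[OF assms(1), of "x+t"]
        by (simp add: add.commute)
  from ftc[OF this assms(2)] show ?thesis by (auto intro: integral_unique)
qed

lemma avg_primitive:
  assumes "continuous_on UNIV u" "h > 0"
  shows "avg h u x = (primitive u (x + h/2) - primitive u (x - h/2)) / h"
  using integral_shift_primitive[OF assms(1), of "-h/2" "h/2" x] assms(2) by (simp add: avg_def)

lemma avg_deriv:
  assumes "continuous_on UNIV u" "h > 0"
  shows "(avg h u has_real_derivative (u (x + h/2) - u (x - h/2)) / h) (at x)"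
proof -
  have s: "((\<lambda>x. primitive u (x + c)) has_real_derivative u (x + c)) (at x)" for c
    using DERIV_shift[of "primitive u" "u (x+c)" x c] primitive_deriv[OF assms(1), of "x+c"] by simp
  have "avg h u = (\<lambda>x. (primitive u (x + h/2) - primitive u (x + (- (h/2)))) / h)"
    using avg_primitive[OF assms] by auto
  then show ?thesis
    using DERIV_cdivide[OF DERIV_diff[OF s[of "h/2"] s[of "-(h/2)"]], of h] by simp
qed

lemma avg_cont: "continuous_on UNIV u \<Longrightarrow> h > 0 \<Longrightarrow> continuous_on UNIV (avg h u)"
  by (rule DERIV_continuous_on) (rule has_field_derivative_at_within[OF avg_deriv])

lemma avg_l2_bounded:
  assumes "l2_bounded u C" "h > 0" shows "l2_bounded (avg h u) C"
proof -
  have "l2_bounded (\<lambda>x. integral {-h/2..h/2} (\<lambda>t. u (x + t))) ((h/2 - (-h/2)) * C)"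
    using assms cont_shift_pair[OF l2_bounded_cont[OF assms(1)]] by (intro l2_bounded_avg l2_bounded_shift) auto
  from l2_bounded_scale[OF this, of "1/h"] show ?thesis using assms(2) by (simp add: avg_def[abs_def])
qed

lemma avg_scale: "avg h (\<lambda>x. c * u x) = (\<lambda>x. c * avg h u x)"
  by (auto simp: avg_def)

lemma avg_add:
  "continuous_on UNIV u \<Longrightarrow> continuous_on UNIV v \<Longrightarrow> avg h (\<lambda>x. u x + v x) = (\<lambda>x. avg h u x + avg h v x)"
  by (auto simp: avg_def integral_add int_shift algebra_simps)

lemma avg_diff:
  "continuous_on UNIV u \<Longrightarrow> continuous_on UNIV v \<Longrightarrow> avg h (\<lambda>x. u x - v x) = (\<lambda>x. avg h u x - avg h v x)"
  by (auto simp: avg_def integral_diff int_shift algebra_simps)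

lemma avg_shift: "avg h (\<lambda>x. u (x + r)) x = avg h u (x + r)"
  by (simp add: avg_def add.assoc add.left_commute add.commute)

lemma avg_shiftdiff:
  "continuous_on UNIV u \<Longrightarrow> avg h (shiftdiff r u) = shiftdiff r (avg h u)"
  using avg_shift[of h u r] by (subst avg_diff) (auto intro!: continuous_on_compose2[of UNIV u]
      continuous_intros)

lemma avg_even: assumes "\<And>x. u (-x) = u x" shows "avg h u (-x) = avg h u x"
proof -
  have "integral {-h/2..h/2} (\<lambda>t. u (- x + t)) = integral {-h/2..h/2} (\<lambda>t. u (x + t))"
    using Henstock_Kurzweil_Integration.integral_reflect_real[where f="\<lambda>t. u (x + t)" and a="-h/2" and b="h/2"]
      assms[of "x - _"] by (simp add: algebra_simps)
  then show ?thesis by (simp add: avg_def)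
qed

lemma avg_abs_le:
  assumes "continuous_on UNIV u" "h > 0" "\<And>t. \<bar>t\<bar> \<le> h/2 \<Longrightarrow> \<bar>u (x + t)\<bar> \<le> M"
  shows "\<bar>avg h u x\<bar> \<le> M"
proof -
  have "norm (integral {-h/2..h/2} (\<lambda>t. u (x + t))) \<le> M * (h/2 - (-h/2))"
    using assms by (intro integral_bound cont_shift) auto
  then show ?thesis using assms(2) by (simp add: avg_def abs_mult field_simps)
qed

lemma avg_commute:
  assumes c: "continuous_on UNIV u" and "h > 0" "k > 0"
  shows "avg h (avg k u) = avg k (avg h u)"
proof
  fix x
  have c2: "continuous_on (cbox (-h/2,-k/2) (h/2,k/2)) (\<lambda>(s,t). u (x + s + t))"
    by (auto simp: case_prod_beta intro!: continuous_on_compose2[OF c] continuous_intros)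
  have "integral {-h/2..h/2} (\<lambda>s. integral {-k/2..k/2} (\<lambda>t. u (x + s + t)))
      = integral {-k/2..k/2} (\<lambda>t. integral {-h/2..h/2} (\<lambda>s. u (x + s + t)))"
    using integral_swap_continuous[OF c2] by simp
  then show "avg h (avg k u) x = avg k (avg h u) x"
    by (simp add: avg_def algebra_simps)
qed

text \<open>The average of width h is also the average, over the left half of the window, of the
  arithmetic mean of u(x+t) and u(x+t+h/2). By the parallelogram law this mean is shorter than u
  according to the size of the difference at distance h/2. Hence an average that loses little norm
  forces that difference to be small.\<close>

lemma avg_energy:
  assumes u: "l2_bounded u A" and h: "h > 0"
  shows "(l2_norm (shiftdiff (h/2) u))^2 \<le> 4 * (A^2 - (l2_norm (avg h u))^2)"
proof -
  have c: "continuous_on UNIV u" using u l2_bounded_cont by auto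
  let ?D = "l2_norm (shiftdiff (h/2) u)"
  have us: "l2_bounded (\<lambda>x. u (x + h/2)) A" using u by (rule l2_bounded_shift)
  have s: "l2_bounded (\<lambda>x. u (x + h/2) + u x) (sqrt (4 * A^2 - ?D^2))" and le: "?D^2 \<le> 4 * A^2"
    using l2_bounded_parallelogram[OF us u] by auto
  have "l2_bounded (\<lambda>x. integral {-h/2..0} (\<lambda>t. u (x + t + h/2) + u (x + t))) ((0 - (-h/2)) * sqrt (4 *
      A^2 - ?D^2))"
    using h l2_bounded_shift[OF s] by (intro l2_bounded_avg)
      (auto simp: case_prod_beta intro!: continuous_on_compose2[OF c] continuous_intros)
  from l2_bounded_scale[OF this, of "1/h"]
  have "l2_bounded (\<lambda>x. 1/h * integral {-h/2..0} (\<lambda>t. u (x + t + h/2) + u (x + t))) (sqrt (4 * A^2 - ?D^2) / 2)"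
    using h by simp
  moreover have "1/h * integral {-h/2..0} (\<lambda>t. u (x + t + h/2) + u (x + t)) = avg h u x" for x
  proof -
    have "integral {-h/2..0} (\<lambda>t. u (x + t + h/2) + u (x + t))
        = integral {-h/2..0} (\<lambda>t. u ((x + h/2) + t)) + integral {-h/2..0} (\<lambda>t. u (x + t))"
      using int_shift[OF c, of "x + h/2"] int_shift[OF c, of x]
      by (subst integral_add[symmetric]) (auto simp: ac_simps)
    also have "\<dots> = primitive u (x + h/2) - primitive u (x - h/2)"
      using h by (simp add: integral_shift_primitive[OF c])
    finally show ?thesis using avg_primitive[OF c h] by simp
  qed
  ultimately have "l2_bounded (avg h u) (sqrt (4 * A^2 - ?D^2) / 2)" by simp
  then have "(l2_norm (avg h u))^2 \<le> (sqrt (4 * A^2 - ?D^2) / 2)^2"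
    using l2_norm_le l2_norm_nonneg power_mono by blast
  also have "\<dots> = (4 * A^2 - ?D^2) / 4" using le by (simp add: power_divide)
  finally show ?thesis by simp
qed

text \<open>The derivative of the average is a difference quotient of u with step exactly h, so a
  bound at this single step controls all steps r of the average.\<close>

lemma avg_lip:
  assumes u: "l2_bounded u A" and h: "h > 0" and d: "l2_bounded (shiftdiff h u) D"
  shows "l2_bounded (shiftdiff r (avg h u)) (D / h * \<bar>r\<bar>)"
proof (rule l2_bounded_shiftdiff_C1)
  show "(avg h u has_real_derivative (u (x + h/2) - u (x - h/2)) / h) (at x)" for x
    using avg_deriv[OF l2_bounded_cont[OF u] h] .
  have "l2_bounded (\<lambda>x. (1/h) * shiftdiff h u (x - h/2)) (\<bar>1/h\<bar> * D)"
    by (intro l2_bounded_scale l2_bounded_shift' d)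
  then show "l2_bounded (\<lambda>x. (u (x + h/2) - u (x - h/2)) / h) (D / h)"
    using h by (simp add: diff_divide_distrib algebra_simps)
qed

section \<open>Taylor expansion of averages by second differences\<close>

definition second_diff :: "real \<Rightarrow> (real \<Rightarrow> real) \<Rightarrow> real \<Rightarrow> real" where
  "second_diff t u x = u (x + t) + u (x - t) - 2 * u x"

lemma second_diff_pair_cont: "continuous_on UNIV u \<Longrightarrow> continuous_on UNIV (\<lambda>(x,t). second_diff t u x)"
  by (auto simp: case_prod_beta second_diff_def intro!: continuous_on_compose2[of UNIV u] continuous_intros)

text \<open>Folding the window at its centre pairs x+t with x-t, so that first-order terms
  cancel.\<close>

lemma avg_minus_id:
  assumes c: "continuous_on UNIV u" and h: "h > 0"
  shows "avg h u x - u x = (1/h) * integral {0..h/2} (\<lambda>t. second_diff t u x)"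
proof -
  have i: "(\<lambda>t. u (x - t)) integrable_on {0..h/2}"
    by (intro integrable_continuous_real continuous_on_compose2[OF c] continuous_intros) auto
  have "integral {0..h/2} (\<lambda>t. second_diff t u x) = integral {0..h/2} (\<lambda>t. u (x + t)) + integral
      {0..h/2} (\<lambda>t. u (x - t)) - h * u x"
    using int_shift[OF c, of x 0 "h/2"] i h unfolding second_diff_def
    by (subst integral_diff) (auto intro!: integrable_add simp: integral_add)
  also have "integral {0..h/2} (\<lambda>t. u (x - t)) = integral {-h/2..0} (\<lambda>t. u (x + t))"
    using Henstock_Kurzweil_Integration.integral_reflect_real[where f="\<lambda>t. u (x + t)" and a="-(h/2)"
        and b=0] by simp
  finally show ?thesis
    using h integral_shift_primitive[OF c, of 0 "h/2" x] integral_shift_primitive[OF c, of "-h/2" 0 x]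
    by (simp add: avg_primitive[OF c h] divide_simps)
qed

lemma l2_bounded_avg_minus_id:
  assumes c: "continuous_on UNIV u" and h: "h > 0"
    and b: "\<And>s. 0 \<le> s \<Longrightarrow> s \<le> h/2 \<Longrightarrow> l2_bounded (second_diff s u) B"
  shows "l2_bounded (\<lambda>x. avg h u x - u x) B"
proof -
  have "l2_bounded (\<lambda>x. integral {0..h/2} (\<lambda>t. second_diff t u x)) ((h/2 - 0) * B)"
    using h b second_diff_pair_cont[OF c] by (intro l2_bounded_avg) auto
  from l2_bounded_scale[OF this, of "1/h"] have "l2_bounded (\<lambda>x. avg h u x - u x) (B/2)"
    using h by (simp add: avg_minus_id[OF c h])
  then show ?thesis by (rule l2_bounded_mono) (use b[of 0] h l2_bounded_nonneg in force)
qed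

text \<open>Parity and norm bounds are kept out of the assumptions so that the estimates apply to
  the differences \<open>shiftdiff r u\<close> as well as to u; this turns each L^2 estimate into an
  H^1 estimate.\<close>

locale twice_diff =
  fixes u u' d :: "real \<Rightarrow> real"
  assumes d1: "\<And>x. (u has_real_derivative u' x) (at x)"
    and d2: "\<And>x. (u' has_real_derivative d x) (at x)"
    and cd: "continuous_on UNIV d"
begin

lemma cu: "continuous_on UNIV u" using d1 DERIV_continuous_on has_field_derivative_at_within by blast

lemma taylor2:
  assumes t: "0 \<le> t"
  shows "((\<lambda>s. (t - s) * (d (x + s) + d (x - s))) has_integral second_diff t u x) {0..t}"
proof -
  let ?F = "\<lambda>s. (t - s) * (u' (x + s) - u' (x - s)) + u (x + s) + u (x - s)"
  have der: "(?F has_real_derivative (t - s) * (d (x + s) + d (x - s))) (at s)" for s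
    by (rule derivative_eq_intros DERIV_chain2[OF d1] DERIV_chain2[OF d2] refl | simp)+
  from ftc[OF this t] show ?thesis by (simp add: second_diff_def)
qed

lemma l2_bounded_second_diff:
  assumes t: "0 \<le> t" and b: "l2_bounded d D"
  shows "l2_bounded (second_diff t u) (2 * t^2 * D)"
proof -
  have "l2_bounded (\<lambda>x. integral {0..t} (\<lambda>s. (t - s) * (d (x + s) + d (x - s)))) ((t - 0) * (t * (D + D)))"
  proof (intro l2_bounded_avg t)
    show "continuous_on UNIV (\<lambda>(x, s). (t - s) * (d (x + s) + d (x - s)))"
      by (auto simp: case_prod_beta intro!: continuous_on_compose2[OF cd] continuous_intros)
    fix s assume s: "s \<in> {0..t}"
    have "l2_bounded (\<lambda>x. (t - s) * (d (x + s) + d (x - s))) (\<bar>t - s\<bar> * (D + D))"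
      by (intro l2_bounded_scale l2_bounded_add l2_bounded_shift l2_bounded_shift' b)
    then show "l2_bounded (\<lambda>x. (t - s) * (d (x + s) + d (x - s))) (t * (D + D))"
      by (rule l2_bounded_mono) (use s l2_bounded_nonneg[OF b] in \<open>auto intro!: mult_right_mono\<close>)
  qed
  moreover have "integral {0..t} (\<lambda>s. (t - s) * (d (x + s) + d (x - s))) = second_diff t u x" for x
    using taylor2[OF t] by (rule integral_unique)
  ultimately show ?thesis by (simp add: power2_eq_square algebra_simps)
qed

text \<open>Subtracting t^2 d(x) from \<open>taylor2\<close> leaves second differences of d. The
  bound B on these stays a parameter: it will be constant, of first order or of second order in the
  width, depending on the regularity of d.\<close>

lemma l2_bounded_second_diff_remainder:
  assumes t: "0 \<le> t" and b: "\<And>s. 0 \<le> s \<Longrightarrow> s \<le> t \<Longrightarrow> l2_bounded (second_diff s d) B"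
  shows "l2_bounded (\<lambda>x. second_diff t u x - t^2 * d x) (t^2 * B)"
proof -
  have "l2_bounded (\<lambda>x. integral {0..t} (\<lambda>s. (t - s) * second_diff s d x)) ((t - 0) * (t * B))"
  proof (intro l2_bounded_avg t)
    show "continuous_on UNIV (\<lambda>(x, s). (t - s) * second_diff s d x)"
      by (auto simp: case_prod_beta second_diff_def intro!: continuous_on_compose2[OF cd] continuous_intros)
    fix s assume s: "s \<in> {0..t}"
    have "l2_bounded (\<lambda>x. (t - s) * second_diff s d x) (\<bar>t - s\<bar> * B)"
      using s by (intro l2_bounded_scale b) auto
    then show "l2_bounded (\<lambda>x. (t - s) * second_diff s d x) (t * B)"
      by (rule l2_bounded_mono) (use s l2_bounded_nonneg[OF b[of s]] in \<open>auto intro!: mult_right_mono\<close>)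
  qed
  moreover have "integral {0..t} (\<lambda>s. (t - s) * second_diff s d x) = second_diff t u x - t^2 * d x" for x
  proof -
    have "((\<lambda>s. (t - s) * (2 * d x)) has_integral t^2 * d x) {0..t}"
    proof -
      have "((\<lambda>s. - ((t - s)^2 * d x)) has_real_derivative (t - s) * (2 * d x)) (at s)" for s
        by (auto intro!: derivative_eq_intros simp: algebra_simps)
      from ftc[OF this t] show ?thesis by simp
    qed
    from has_integral_diff[OF taylor2[OF t] this]
    have "((\<lambda>s. (t - s) * second_diff s d x) has_integral (second_diff t u x - t^2 * d x)) {0..t}"
      unfolding second_diff_def[of _ d] by (simp only: right_diff_distrib[symmetric])
    then show ?thesis by (rule integral_unique)
  qed
  ultimately have "l2_bounded (\<lambda>x. second_diff t u x - t^2 * d x) ((t - 0) * (t * B))" by (simp only:)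
  then show ?thesis by (simp add: power2_eq_square mult.assoc)
qed

text \<open>The coefficient 1/24 is the integral of t^2 over [0, h/2], divided by h^3.\<close>

lemma l2_bounded_avg_taylor:
  assumes h: "h > 0" and b: "\<And>s. 0 \<le> s \<Longrightarrow> s \<le> h/2 \<Longrightarrow> l2_bounded (second_diff s d) B"
  shows "l2_bounded (\<lambda>x. avg h u x - u x - h^2/24 * d x) (h^2 * B)"
proof -
  have B0: "0 \<le> B" using b[of 0] h l2_bounded_nonneg by auto
  have "l2_bounded (\<lambda>x. integral {0..h/2} (\<lambda>t. second_diff t u x - t^2 * d x)) ((h/2 - 0) * ((h/2)^2 * B))"
  proof (intro l2_bounded_avg)
    show "continuous_on UNIV (\<lambda>(x, t). second_diff t u x - t^2 * d x)"
      by (auto simp: case_prod_beta second_diff_def intro!: continuous_on_compose2[OF cd]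
          continuous_on_compose2[OF cu] continuous_intros)
    fix t assume t: "t \<in> {0..h/2}"
    have "l2_bounded (\<lambda>x. second_diff t u x - t^2 * d x) (t^2 * B)"
      using t b by (intro l2_bounded_second_diff_remainder) auto
    then show "l2_bounded (\<lambda>x. second_diff t u x - t^2 * d x) ((h/2)^2 * B)"
      by (rule l2_bounded_mono) (use t B0 in \<open>auto intro!: mult_right_mono power_mono\<close>)
  qed (use h in auto)
  from l2_bounded_scale[OF this, of "1/h"]
  have "l2_bounded (\<lambda>x. 1/h * integral {0..h/2} (\<lambda>t. second_diff t u x - t^2 * d x)) (h^2 * B / 8)"
    using h by (simp add: power2_eq_square field_simps)
  moreover have "1/h * integral {0..h/2} (\<lambda>t. second_diff t u x - t^2 * d x) = avg h u x - u x - h^2/24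
      * d x" for x
  proof -
    have "((\<lambda>s. s^3/3 * d x) has_real_derivative s^2 * d x) (at s)" for s
      by (auto intro!: derivative_eq_intros)
    from ftc[OF this, of 0 "h/2"] h have "((\<lambda>t. t^2 * d x) has_integral h^3/24 * d x) {0..h/2}"
      by (simp add: power_divide)
    then have j: "(\<lambda>t. t^2 * d x) integrable_on {0..h/2}" "integral {0..h/2} (\<lambda>t. t^2 * d x) = h^3/24 * d x"
      by (blast intro: has_integral_integrable, rule integral_unique)
    have "(\<lambda>t. second_diff t u x) integrable_on {0..h/2}"
      unfolding second_diff_def by (intro integrable_continuous_real continuous_intros
          continuous_on_compose2[OF cu]) auto
    then have "integral {0..h/2} (\<lambda>t. second_diff t u x - t^2 * d x) = integral {0..h/2} (\<lambda>t.
        second_diff t u x) - h^3/24 * d x"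
      using j by (simp add: integral_diff)
    then show ?thesis using h by (simp add: avg_minus_id[OF cu h] field_simps power3_eq_cube power2_eq_square)
  qed
  ultimately have "l2_bounded (\<lambda>x. avg h u x - u x - h^2/24 * d x) (h^2 * B / 8)" by simp
  then show ?thesis by (rule l2_bounded_mono) (use B0 in auto)
qed

text \<open>With A the average, D the second derivative and R = A - 1 - (h^2/24) D, one has A^2 - 1
  - (h^2/12) D = A R + R + (h^2/24) (A - 1) D, which reduces the squared average to the single
  one.\<close>

lemma l2_bounded_avg2_taylor:
  assumes h: "h > 0" and b: "\<And>s. 0 \<le> s \<Longrightarrow> s \<le> h/2 \<Longrightarrow> l2_bounded (second_diff s d) B"
  shows "l2_bounded (\<lambda>x. avg h (avg h u) x - u x - h^2/12 * d x) (3 * h^2 * B)"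
proof -
  let ?R = "\<lambda>x. avg h u x - u x - h^2/24 * d x"
  have B0: "0 \<le> B" using b[of 0] h l2_bounded_nonneg by auto
  have R: "l2_bounded ?R (h^2 * B)" using l2_bounded_avg_taylor[OF h b] .
  have "l2_bounded (\<lambda>x. (avg h ?R x + ?R x) + h^2/24 * (avg h d x - d x)) ((h^2 * B + h^2 * B) + \<bar>h^2/24\<bar> * B)"
    by (intro l2_bounded_add l2_bounded_scale avg_l2_bounded R h l2_bounded_avg_minus_id cd b)
  moreover have "(avg h ?R x + ?R x) + h^2/24 * (avg h d x - d x) = avg h (avg h u) x - u x - h^2/12 * d
      x" for x
  proof -
    have "avg h ?R x = avg h (avg h u) x - avg h u x - h^2/24 * avg h d x"
    proof -
      have "avg h ?R = (\<lambda>x. avg h (\<lambda>x. avg h u x - u x) x - avg h (\<lambda>x. h^2/24 * d x) x)"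
        using avg_cont[OF cu h] cu cd by (intro avg_diff continuous_intros) auto
      also have "avg h (\<lambda>x. avg h u x - u x) = (\<lambda>x. avg h (avg h u) x - avg h u x)"
        using avg_cont[OF cu h] cu by (intro avg_diff)
      finally show ?thesis using avg_scale[of h "h^2/24" d] by simp
    qed
    then show ?thesis by (simp only:) (simp add: field_simps)
  qed
  ultimately have "l2_bounded (\<lambda>x. avg h (avg h u) x - u x - h^2/12 * d x) (h^2 * B + h^2 * B + \<bar>h^2/24\<bar>
      * B)" by (simp only:)
  then show ?thesis by (rule l2_bounded_mono) (use B0 in \<open>auto intro!: mult_right_mono simp: algebra_simps\<close>)
qed

end

section \<open>The Banach space of even \<open>H\<^sup>1\<close> functions\<close>

text \<open>Bounds on difference quotients survive pointwise limits by Fatou and do not presuppose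
  that a derivative exists.\<close>

definition h1_bounded :: "(real \<Rightarrow> real) \<Rightarrow> real \<Rightarrow> bool" where
  "h1_bounded u C \<longleftrightarrow> l2_bounded u C \<and> (\<forall>r. l2_bounded (shiftdiff r u) (C * \<bar>r\<bar>))"

lemma h1bI: "l2_bounded u C \<Longrightarrow> (\<And>r. l2_bounded (shiftdiff r u) (C * \<bar>r\<bar>)) \<Longrightarrow> h1_bounded u C"
  by (simp add: h1_bounded_def)

lemma h1_bounded_l2_bounded: "h1_bounded u C \<Longrightarrow> l2_bounded u C" and h1_bounded_lip: "h1_bounded u C \<Longrightarrow>
    l2_bounded (shiftdiff r u) (C * \<bar>r\<bar>)"
  by (auto simp: h1_bounded_def)

lemma h1_bounded_cont: "h1_bounded u C \<Longrightarrow> continuous_on UNIV u"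
  using h1_bounded_l2_bounded l2_bounded_cont by blast

lemma h1_bounded_nonneg: "h1_bounded u C \<Longrightarrow> 0 \<le> C"
  using h1_bounded_l2_bounded l2_bounded_nonneg by blast

lemma h1_bounded_mono: "h1_bounded u C \<Longrightarrow> C \<le> D \<Longrightarrow> h1_bounded u D"
  unfolding h1_bounded_def by (meson abs_ge_zero l2_bounded_mono mult_right_mono)

lemma h1_bounded_0: "h1_bounded (\<lambda>x. 0) 0"
  by (simp add: h1_bounded_def l2_bounded_0)

lemma h1_bounded_add:
  assumes "h1_bounded u A" "h1_bounded v B" shows "h1_bounded (\<lambda>x. u x + v x) (A + B)"
proof (rule h1bI)
  show "l2_bounded (\<lambda>x. u x + v x) (A + B)" by (intro l2_bounded_add h1_bounded_l2_bounded assms)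
  have "l2_bounded (\<lambda>x. shiftdiff r u x + shiftdiff r v x) (A * \<bar>r\<bar> + B * \<bar>r\<bar>)" for r
    by (intro l2_bounded_add h1_bounded_lip assms)
  then show "l2_bounded (shiftdiff r (\<lambda>x. u x + v x)) ((A + B) * \<bar>r\<bar>)" for r
    by (simp add: add_diff_add distrib_right)
qed

lemma h1_bounded_scale:
  assumes "h1_bounded u A" shows "h1_bounded (\<lambda>x. c * u x) (\<bar>c\<bar> * A)"
proof (rule h1bI)
  show "l2_bounded (\<lambda>x. c * u x) (\<bar>c\<bar> * A)" by (intro l2_bounded_scale h1_bounded_l2_bounded assms)
  have "l2_bounded (\<lambda>x. c * shiftdiff r u x) (\<bar>c\<bar> * (A * \<bar>r\<bar>))" for r
    by (intro l2_bounded_scale h1_bounded_lip assms)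
  then show "l2_bounded (shiftdiff r (\<lambda>x. c * u x)) (\<bar>c\<bar> * A * \<bar>r\<bar>)" for r
    by (simp add: right_diff_distrib mult.assoc)
qed

lemma h1_bounded_diff: "h1_bounded u A \<Longrightarrow> h1_bounded v B \<Longrightarrow> h1_bounded (\<lambda>x. u x - v x) (A + B)"
  using h1_bounded_add[of u A "\<lambda>x. - 1 * v x" B] h1_bounded_scale[of v B "-1"] by simp

lemma h1_bounded_limit:
  assumes "\<And>n. h1_bounded (f n) C" "\<And>x. (\<lambda>n. f n x) \<longlonglongrightarrow> u x" "continuous_on UNIV u"
  shows "h1_bounded u C"
proof (rule h1bI)
  show "l2_bounded u C" by (rule l2_bounded_limit[OF h1_bounded_l2_bounded[OF assms(1)] assms(2,3)])
  fix r
  have "continuous_on UNIV (\<lambda>x. u (x + r))"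
    by (rule continuous_on_compose2[OF assms(3)]) (auto intro: continuous_intros)
  then have c: "continuous_on UNIV (shiftdiff r u)" by (intro continuous_on_diff assms(3))
  show "l2_bounded (shiftdiff r u) (C * \<bar>r\<bar>)"
    by (rule l2_bounded_limit[of "\<lambda>n. shiftdiff r (f n)", OF h1_bounded_lip[OF assms(1)] tendsto_diff[OF
        assms(2) assms(2)] c])
qed

lemma h1_bounded_avg:
  assumes u: "h1_bounded u C" and h: "h > 0" shows "h1_bounded (avg h u) C"
proof (rule h1bI)
  show "l2_bounded (avg h u) C" by (intro avg_l2_bounded h1_bounded_l2_bounded u h)
  show "l2_bounded (shiftdiff r (avg h u)) (C * \<bar>r\<bar>)" for r
    using avg_l2_bounded[OF h1_bounded_lip[OF u] h, of r]
        by (simp only: avg_shiftdiff[OF h1_bounded_cont[OF u]])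
qed

text \<open>The function u need not be differentiable, so \<open>sup_bound_C1\<close> is applied to
  its averages, which obey the same bounds, and the width tends to 0.\<close>

lemma h1_bounded_sup:
  assumes u: "h1_bounded u C" shows "\<bar>u x\<bar> \<le> 2 * C"
proof -
  have c: "continuous_on UNIV u" using u h1_bounded_cont by blast
  have bound: "\<bar>avg h u x\<bar> \<le> 2 * C" if h: "h > 0" for h
  proof (rule sup_bound_C1[where u="avg h u"])
    show "(avg h u has_real_derivative (u (x + h/2) - u (x - h/2)) / h) (at x)" for x
      by (rule avg_deriv[OF c h])
    show "l2_bounded (avg h u) C" by (intro avg_l2_bounded h1_bounded_l2_bounded u h)
    have "l2_bounded (\<lambda>x. (1/h) * shiftdiff h u (x - h/2)) (\<bar>1/h\<bar> * (C * \<bar>h\<bar>))"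
      by (intro l2_bounded_scale l2_bounded_shift' h1_bounded_lip u)
    then show "l2_bounded (\<lambda>x. (u (x + h/2) - u (x - h/2)) / h) C"
      using h by (simp add: diff_divide_distrib algebra_simps)
  qed
  have "((\<lambda>h. (primitive u (x + h/2) - primitive u (x - h/2)) / h) \<longlongrightarrow> u x) (at_right 0)"
  proof -
    have "((\<lambda>h. primitive u (x + h/2) - primitive u (x - h/2)) has_real_derivative u x) (at 0)"
      using primitive_deriv[OF c] by (auto intro!: derivative_eq_intros DERIV_chain2[OF primitive_deriv[OF c]])
    then have "((\<lambda>h. (primitive u (x + h/2) - primitive u (x - h/2)) / h) \<longlongrightarrow> u x) (at 0)"
      by (simp add: DERIV_def)
    then show ?thesis by (rule filterlim_mono) (auto simp: at_within_le_at)
  qed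
  then have "((\<lambda>h. \<bar>(primitive u (x + h/2) - primitive u (x - h/2)) / h\<bar>) \<longlongrightarrow> \<bar>u x\<bar>) (at_right 0)"
    by (rule tendsto_rabs)
  then show ?thesis
  proof (rule tendsto_upperbound)
    show "eventually (\<lambda>h. \<bar>(primitive u (x + h/2) - primitive u (x - h/2)) / h\<bar> \<le> 2 * C) (at_right 0)"
      using bound avg_primitive[OF c] by (auto simp: eventually_at_right_field intro: exI[of _ 1])
  qed auto
qed

text \<open>
  The first derivative enters only through \<open>L\<^sup>2\<close>-bounded difference quotients; the norm defined below is
  the maximum of the \<open>L\<^sup>2\<close> norms of \<open>u\<close> and \<open>u'\<close>.
\<close>

typedef h1 = "{u :: real \<Rightarrow> real. (\<exists>C. h1_bounded u C) \<and> (\<forall>x. u (-x) = u x)}"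
  morphisms fn Abs_h1
  using h1_bounded_0 by (intro exI[of _ "\<lambda>x. 0"]) auto

lemma fn_even [simp]: "fn u (-x) = fn u x"
  using fn[of u] by simp

lemma h1_eqI: "(\<And>x. fn u x = fn v x) \<Longrightarrow> u = v"
  using fn_inject by blast

lemma fn_Abs: "h1_bounded u C \<Longrightarrow> (\<And>x. u (-x) = u x) \<Longrightarrow> fn (Abs_h1 u) = u"
  by (rule Abs_h1_inverse) auto

instantiation h1 :: real_vector
begin

definition "0 = Abs_h1 (\<lambda>x. 0)"
definition "u + v = Abs_h1 (\<lambda>x. fn u x + fn v x)"
definition "u - v = Abs_h1 (\<lambda>x. fn u x - fn v x)"
definition "- u = Abs_h1 (\<lambda>x. - 1 * fn u x)"
definition "c *\<^sub>R u = Abs_h1 (\<lambda>x. c * fn u x)"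

lemma fn_ex: "\<exists>C. h1_bounded (fn u) C"
  using fn[of u] by simp

lemma fn_zero [simp]: "fn 0 x = 0"
  by (simp add: zero_h1_def fn_Abs[OF h1_bounded_0])

lemma fn_plus [simp]: "fn (u + v) x = fn u x + fn v x"
  using fn_ex[of u] fn_ex[of v] by (auto simp: plus_h1_def fn_Abs[OF h1_bounded_add])

lemma fn_minus [simp]: "fn (u - v) x = fn u x - fn v x"
  using fn_ex[of u] fn_ex[of v] by (auto simp: minus_h1_def fn_Abs[OF h1_bounded_diff])

lemma fn_uminus [simp]: "fn (- u) x = - fn u x"
proof -
  obtain C where "h1_bounded (fn u) C" using fn_ex by auto
  from fn_Abs[OF h1_bounded_scale[OF this, of "-1"]] show ?thesis by (simp add: uminus_h1_def)
qed

lemma fn_scaleR [simp]: "fn (c *\<^sub>R u) x = c * fn u x"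
  using fn_ex[of u] by (auto simp: scaleR_h1_def fn_Abs[OF h1_bounded_scale])

instance
  by standard (auto intro!: h1_eqI simp: algebra_simps)

end

lemma fn_plus_fun: "fn (u + v) = (\<lambda>x. fn u x + fn v x)"
  and fn_minus_fun: "fn (u - v) = (\<lambda>x. fn u x - fn v x)"
  and fn_scaleR_fun: "fn (c *\<^sub>R u) = (\<lambda>x. c * fn u x)"
  and fn_zero_fun: "fn 0 = (\<lambda>x. 0)"
  by auto

instantiation h1 :: real_normed_vector
begin

definition "norm u = Inf {C. h1_bounded (fn u) C}"
definition "dist u v = norm (u - v :: h1)"
definition "sgn u = u /\<^sub>R norm (u :: h1)"
definition [code del]: "uniformity = (INF e\<in>{0 <..}. principal {(x, y :: h1). dist x y < e})"
definition [code del]: "open (U :: h1 set) \<longleftrightarrow> (\<forall>x\<in>U. eventually (\<lambda>(x', y). x' = x \<longrightarrow> y \<in> U) uniformity)"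

lemma norm_h1_le: "h1_bounded (fn u) C \<Longrightarrow> norm u \<le> C"
  unfolding norm_h1_def by (rule cInf_lower) (auto intro!: bdd_belowI[of _ 0] dest: h1_bounded_nonneg)

text \<open>The infimum is attained, because every condition on C is a closed upper bound for a
  fixed L^2 norm or for a quotient of such a norm by \<bar>r\<bar>.\<close>

lemma h1_bounded_norm: "h1_bounded (fn u) (norm u)"
proof -
  let ?S = "{C. h1_bounded (fn u) C}"
  have ne: "?S \<noteq> {}" using fn_ex by auto
  obtain C where C: "h1_bounded (fn u) C" using fn_ex by auto
  have "l2_norm (fn u) \<le> norm u"
    unfolding norm_h1_def using ne by (intro cInf_greatest) (auto intro: l2_norm_le h1_bounded_l2_bounded)
  then have 1: "l2_bounded (fn u) (norm u)" using h1_bounded_l2_bounded[OF C] by (simp add: l2_bounded_iff)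
  have 2: "l2_bounded (shiftdiff r (fn u)) (norm u * \<bar>r\<bar>)" for r
  proof (cases "r = 0")
    case True then show ?thesis by (simp add: l2_bounded_0)
  next
    case False
    have "l2_norm (shiftdiff r (fn u)) / \<bar>r\<bar> \<le> norm u"
      unfolding norm_h1_def using ne False
      by (intro cInf_greatest) (auto intro: l2_norm_le h1_bounded_lip simp: pos_divide_le_eq)
    then show ?thesis using False h1_bounded_lip[OF C, of r] by (simp add: l2_bounded_iff pos_divide_le_eq)
  qed
  show ?thesis using 1 2 by (rule h1bI)
qed

instance
proof
  fix u v :: h1 and c :: real
  show "dist u v = norm (u - v)" by (rule dist_h1_def)
  show "sgn u = u /\<^sub>R norm u" by (rule sgn_h1_def)
  show "uniformity = (INF e\<in>{0 <..}. principal {(x, y :: h1). dist x y < e})" by (rule uniformity_h1_def)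
  show "open U \<longleftrightarrow> (\<forall>x\<in>U. \<forall>\<^sub>F (x', y) in uniformity. x' = x \<longrightarrow> y \<in> U)" for U :: "h1 set" by (rule open_h1_def)
  show "norm u = 0 \<longleftrightarrow> u = 0"
  proof
    assume "norm u = 0"
    then have "\<bar>fn u x\<bar> \<le> 0" for x using h1_bounded_sup[OF h1_bounded_norm[of u], of x] by simp
    then show "u = 0" by (intro h1_eqI) simp
  next
    assume "u = 0"
    moreover have "norm (0::h1) \<le> 0" by (rule norm_h1_le) (simp add: fn_zero_fun h1_bounded_0)
    ultimately show "norm u = 0" using h1_bounded_nonneg[OF h1_bounded_norm[of u]] by simp
  qed
  show "norm (u + v) \<le> norm u + norm v"
    using h1_bounded_add[OF h1_bounded_norm[of u] h1_bounded_norm[of v]]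
        by (intro norm_h1_le) (simp add: fn_plus_fun)
  have le: "norm (c *\<^sub>R u) \<le> \<bar>c\<bar> * norm u" for c and u :: h1
    using h1_bounded_scale[OF h1_bounded_norm[of u], of c] by (intro norm_h1_le) (simp add: fn_scaleR_fun)
  show "norm (c *\<^sub>R u) = \<bar>c\<bar> * norm u"
  proof (cases "c = 0")
    case True then show ?thesis using le[of 0 u] h1_bounded_nonneg[OF h1_bounded_norm[of "0 *\<^sub>R u"]] by simp
  next
    case False
    have "norm u \<le> \<bar>1/c\<bar> * norm (c *\<^sub>R u)" using le[of "1/c" "c *\<^sub>R u"] False by simp
    then show ?thesis using le[of c u] False by (simp add: field_simps)
  qed
qed

end

lemma fn_l2_bounded: "l2_bounded (fn u) (norm u)"
  using h1_bounded_norm h1_bounded_l2_bounded by blast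

lemma fn_lip: "l2_bounded (shiftdiff r (fn u)) (norm u * \<bar>r\<bar>)"
  using h1_bounded_norm h1_bounded_lip by blast

lemma fn_cont: "continuous_on UNIV (fn u)"
  using fn_l2_bounded l2_bounded_cont by blast

lemma fn_sup: "\<bar>fn u x\<bar> \<le> 2 * norm u"
  using h1_bounded_norm h1_bounded_sup by blast

lemma l2_norm_fn_le: "l2_norm (fn u) \<le> norm u"
  using fn_l2_bounded l2_norm_le by blast

lemma fn_l2_norm: "l2_bounded (fn u) (l2_norm (fn u))"
  using fn_l2_bounded l2_bounded_l2_norm by blast

lemma bounded_linear_fn: "bounded_linear (\<lambda>u. fn u x)"
  by (rule bounded_linear_intro[where K=2]) (use fn_sup in \<open>auto simp: mult.commute\<close>)

text \<open>The sup bound gives a uniform, hence continuous, limit u. That u is also the limit in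
  norm follows by sending the second index of the Cauchy condition to infinity in
  \<open>h1_bounded_limit\<close>.\<close>

instance h1 :: banach
proof
  fix X :: "nat \<Rightarrow> h1" assume X: "Cauchy X"
  have "Cauchy (\<lambda>n. fn (X n) x)" for x
    using bounded_linear.Cauchy[OF bounded_linear_fn X] .
  then have conv: "convergent (\<lambda>n. fn (X n) x)" for x by (simp add: Cauchy_convergent_iff)
  define u where "u x = lim (\<lambda>n. fn (X n) x)" for x
  have lim: "(\<lambda>n. fn (X n) x) \<longlonglongrightarrow> u x" for x using conv convergent_LIMSEQ_iff u_def by auto
  have unif: "\<exists>N. \<forall>n\<ge>N. \<forall>m\<ge>N. norm (X n - X m) < e" if "e > 0" for e
    using X that unfolding Cauchy_def dist_norm by auto
  have "uniform_limit UNIV (\<lambda>n. fn (X n)) u sequentially"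
  proof (rule uniform_limitI)
    fix e :: real assume e: "e > 0"
    obtain N where N: "\<And>n m. n \<ge> N \<Longrightarrow> m \<ge> N \<Longrightarrow> norm (X n - X m) < e/4" using unif[of "e/4"] e by auto
    have "dist (fn (X n) x) (u x) < e" if n: "n \<ge> N" for n x
    proof -
      have "\<bar>fn (X n) x - u x\<bar> \<le> e/2"
      proof (rule tendsto_upperbound)
        show "(\<lambda>m. \<bar>fn (X n) x - fn (X m) x\<bar>) \<longlonglongrightarrow> \<bar>fn (X n) x - u x\<bar>" by (intro tendsto_intros lim)
        show "\<forall>\<^sub>F m in sequentially. \<bar>fn (X n) x - fn (X m) x\<bar> \<le> e/2"
          using eventually_ge_at_top[of N]
        proof eventually_elim
          case (elim m)
          then show ?case using fn_sup[of "X n - X m" x] N[OF n, of m] by simp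
        qed
      qed simp
      then show ?thesis using e by (simp add: dist_real_def)
    qed
    then show "\<forall>\<^sub>F n in sequentially. \<forall>x\<in>UNIV. dist (fn (X n) x) (u x) < e"
      unfolding eventually_sequentially by blast
  qed
  then have cu: "continuous_on UNIV u"
    by (rule uniform_limit_theorem[rotated]) (auto intro!: always_eventually fn_cont)
  have close: "\<exists>N. \<forall>n\<ge>N. h1_bounded (\<lambda>x. fn (X n) x - u x) e" if e: "e > 0" for e
  proof -
    obtain N where N: "\<And>n m. n \<ge> N \<Longrightarrow> m \<ge> N \<Longrightarrow> norm (X n - X m) < e" using unif[of e] e by auto
    have "h1_bounded (\<lambda>x. fn (X n) x - u x) e" if n: "n \<ge> N" for n
    proof (rule h1_bounded_limit[of "\<lambda>m x. fn (X n - X (m + N)) x"])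
      show "h1_bounded (fn (X n - X (m + N))) e" for m
        using h1_bounded_mono[OF h1_bounded_norm less_imp_le[OF N[OF n, of "m+N"]]] by simp
      show "(\<lambda>m. fn (X n - X (m + N)) x) \<longlonglongrightarrow> fn (X n) x - u x" for x
        using LIMSEQ_ignore_initial_segment[OF lim[of x], of N] by (auto intro!: tendsto_intros)
      show "continuous_on UNIV (\<lambda>x. fn (X n) x - u x)" by (rule continuous_on_diff[OF fn_cont cu])
    qed
    then show ?thesis by blast
  qed
  obtain N where "h1_bounded (\<lambda>x. fn (X N) x - u x) 1" using close[of 1] by auto
  from h1_bounded_diff[OF h1_bounded_norm[of "X N"] this] have hu: "h1_bounded u (norm (X N) + 1)" by simp
  have eu: "u (-x) = u x" for x by (simp add: u_def)
  have fu: "fn (Abs_h1 u) = u" using hu eu by (rule fn_Abs)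
  have "X \<longlonglongrightarrow> Abs_h1 u"
  proof (rule LIMSEQ_I)
    fix e :: real assume e: "e > 0"
    obtain N where N: "\<And>n. n \<ge> N \<Longrightarrow> h1_bounded (\<lambda>x. fn (X n) x - u x) (e/2)" using close[of "e/2"] e by auto
    have "norm (X n - Abs_h1 u) < e" if "n \<ge> N" for n
    proof -
      have "fn (X n - Abs_h1 u) = (\<lambda>x. fn (X n) x - u x)" by (auto simp: fu)
      then have "norm (X n - Abs_h1 u) \<le> e/2" using N[OF that] by (intro norm_h1_le) simp
      then show ?thesis using e by simp
    qed
    then show "\<exists>no. \<forall>n\<ge>no. norm (X n - Abs_h1 u) < e" by blast
  qed
  then show "convergent X" by (auto simp: convergent_def)
qed

lemma l2_norm_fn_triangle: "l2_norm (fn (u + v)) \<le> l2_norm (fn u) + l2_norm (fn v)"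
  unfolding fn_plus_fun by (rule l2_norm_le[OF l2_bounded_add[OF fn_l2_norm[of u] fn_l2_norm[of v]]])

lemma l2_norm_fn_scale: "l2_norm (fn (c *\<^sub>R u)) \<le> \<bar>c\<bar> * l2_norm (fn u)"
  unfolding fn_scaleR_fun by (rule l2_norm_le[OF l2_bounded_scale[OF fn_l2_norm[of u], of c]])

text \<open>The series converges in H^1, but its L^2 norm is wanted separately: where an error costs
  a derivative, only the termwise L^2 bounds are small.\<close>

lemma l2_norm_fn_suminf:
  assumes "summable (u :: nat \<Rightarrow> h1)" "\<And>n. l2_norm (fn (u n)) \<le> b n" "summable b"
  shows "l2_norm (fn (suminf u)) \<le> suminf b"
proof -
  have b0: "0 \<le> b n" for n using assms(2)[of n] l2_norm_nonneg[of "fn (u n)"] by linarith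
  have "l2_bounded (fn (suminf u)) (suminf b)"
  proof (rule l2_bounded_limit)
    show "l2_bounded (fn (sum u {..<n})) (suminf b)" for n
    proof -
      have "l2_norm (fn (sum u {..<n})) \<le> sum b {..<n}"
      proof (induction n)
        case (Suc n)
        then show ?case using l2_norm_fn_triangle[of "sum u {..<n}" "u n"] assms(2)[of n]
          unfolding sum.lessThan_Suc by linarith
      qed (simp add: l2_norm_def)
      also have "\<dots> \<le> suminf b" using assms(3) b0 by (intro sum_le_suminf) auto
      finally show ?thesis using fn_l2_norm l2_bounded_mono by blast
    qed
    show "(\<lambda>n. fn (sum u {..<n}) x) \<longlonglongrightarrow> fn (suminf u) x" for x
      using bounded_linear.tendsto[OF bounded_linear_fn summable_LIMSEQ[OF assms(1)]] .
  qed (rule fn_cont)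
  then show ?thesis by (rule l2_norm_le)
qed

section \<open>Averages, products and compositions as operations on the space\<close>

definition avg_h1 :: "real \<Rightarrow> h1 \<Rightarrow> h1" where "avg_h1 h u = Abs_h1 (avg h (fn u))"

lemma fn_avg_h1: "h > 0 \<Longrightarrow> fn (avg_h1 h u) = avg h (fn u)"
  unfolding avg_h1_def by (rule fn_Abs[OF h1_bounded_avg[OF h1_bounded_norm]]) (auto intro: avg_even)

lemma norm_avg_h1: "h > 0 \<Longrightarrow> norm (avg_h1 h u) \<le> norm u"
  by (rule norm_h1_le) (simp add: fn_avg_h1 h1_bounded_avg h1_bounded_norm)

lemma bounded_linear_avg_h1: "h > 0 \<Longrightarrow> bounded_linear (avg_h1 h)"
proof (rule bounded_linear_intro[where K=1])
  assume h: "h > 0"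
  note e = fn_plus_fun fn_scaleR_fun
  show "avg_h1 h (u + v) = avg_h1 h u + avg_h1 h v" for u v
    by (rule h1_eqI) (simp add: fn_avg_h1[OF h] e avg_add[OF fn_cont fn_cont])
  show "avg_h1 h (c *\<^sub>R u) = c *\<^sub>R avg_h1 h u" for c u
    by (rule h1_eqI) (simp add: fn_avg_h1[OF h] e avg_scale)
qed (simp add: norm_avg_h1)

lemma l2_norm_avg_h1: "h > 0 \<Longrightarrow> l2_norm (fn (avg_h1 h u)) \<le> l2_norm (fn u)"
  using l2_norm_le[OF avg_l2_bounded[OF fn_l2_norm]] by (simp add: fn_avg_h1)

lemma avg_h1_commute: "h > 0 \<Longrightarrow> k > 0 \<Longrightarrow> avg_h1 h (avg_h1 k u) = avg_h1 k (avg_h1 h u)"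
  by (rule h1_eqI) (simp add: fn_avg_h1 avg_commute[OF fn_cont])

definition mult_h1 :: "h1 \<Rightarrow> h1 \<Rightarrow> h1" where "mult_h1 u v = Abs_h1 (\<lambda>x. fn u x * fn v x)"

text \<open>H^1 is an algebra in one dimension: the discrete product rule, with the sup bounds 2A
  and 2B on the factors that are not differenced.\<close>

lemma h1_bounded_mult:
  assumes "h1_bounded u A" "h1_bounded v B" shows "h1_bounded (\<lambda>x. u x * v x) (4 * A * B)"
proof (rule h1bI)
  have c: "continuous_on UNIV u" "continuous_on UNIV v" using assms h1_bounded_cont by auto
  have n: "0 \<le> A" "0 \<le> B" using assms h1_bounded_nonneg by auto
  have m: "l2_bounded (\<lambda>x. u (x + r) * w x) (2 * A * C)" if "l2_bounded w C" for w r C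
    using n h1_bounded_sup[OF assms(1)] by (intro l2_bounded_dom[OF that])
      (auto simp: abs_mult intro!: continuous_intros l2_bounded_cont[OF that] continuous_on_compose2[OF
          c(1)] mult_right_mono)
  have m': "l2_bounded (\<lambda>x. v x * w x) (2 * B * C)" if "l2_bounded w C" for w C
    using n h1_bounded_sup[OF assms(2)] by (intro l2_bounded_dom[OF that])
      (auto simp: abs_mult intro!: continuous_intros l2_bounded_cont[OF that] c mult_right_mono)
  have "l2_bounded (\<lambda>x. u x * v x) (2 * A * B)" using m[of v B 0] h1_bounded_l2_bounded[OF assms(2)] by simp
  then show "l2_bounded (\<lambda>x. u x * v x) (4 * A * B)" by (rule l2_bounded_mono) (use n in auto)
  fix r
  have "l2_bounded (\<lambda>x. u (x + r) * shiftdiff r v x + v x * shiftdiff r u x) (2 * A * (B * \<bar>r\<bar>) + 2 * B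
      * (A * \<bar>r\<bar>))"
    by (intro l2_bounded_add m m' h1_bounded_lip assms)
  then show "l2_bounded (shiftdiff r (\<lambda>x. u x * v x)) (4 * A * B * \<bar>r\<bar>)"
    by (simp add: algebra_simps)
qed

lemma fn_mult_h1 [simp]: "fn (mult_h1 u v) x = fn u x * fn v x"
  unfolding mult_h1_def by (subst fn_Abs[OF h1_bounded_mult[OF h1_bounded_norm h1_bounded_norm]]) auto

lemma norm_mult_h1: "norm (mult_h1 u v) \<le> 4 * norm u * norm v"
proof (rule norm_h1_le)
  have "fn (mult_h1 u v) = (\<lambda>x. fn u x * fn v x)" by auto
  then show "h1_bounded (fn (mult_h1 u v)) (4 * norm u * norm v)"
    using h1_bounded_mult[OF h1_bounded_norm[of u] h1_bounded_norm[of v]] by simp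
qed

definition comp_h1 :: "(real \<Rightarrow> real) \<Rightarrow> h1 \<Rightarrow> h1" where "comp_h1 f u = Abs_h1 (\<lambda>x. f (fn u x))"

text \<open>The Lipschitz condition is confined to [-M, M], since the potential is singular and the
  nonlinearity is controlled only for small strains.\<close>

lemma h1_bounded_comp_h1:
  assumes u: "h1_bounded (fn u) C" and M: "\<And>x. \<bar>fn u x\<bar> \<le> M" and f0: "f 0 = 0"
    and f: "\<And>p q. \<bar>p\<bar> \<le> M \<Longrightarrow> \<bar>q\<bar> \<le> M \<Longrightarrow> \<bar>f p - f q\<bar> \<le> L * \<bar>p - q\<bar>" and L: "0 \<le> L"
  shows "h1_bounded (\<lambda>x. f (fn u x)) (L * C)"
proof -
  have M0: "0 \<le> M" using M[of 0] by auto
  have cf: "continuous_on {-M..M} f"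
    by (rule lipschitz_on_continuous_on[where L=L], rule lipschitz_onI)
      (use f L in \<open>auto simp: dist_real_def abs_le_iff\<close>)
  have c: "continuous_on UNIV (\<lambda>x. f (fn u x))"
    by (rule continuous_on_compose2[OF cf fn_cont]) (use M in \<open>auto simp: abs_le_iff minus_le_iff\<close>)
  show ?thesis
  proof (rule h1bI)
    show "l2_bounded (\<lambda>x. f (fn u x)) (L * C)"
      using f[of _ 0] M M0 f0 by (intro l2_bounded_dom[OF h1_bounded_l2_bounded[OF u] c L]) simp
    show "l2_bounded (shiftdiff r (\<lambda>x. f (fn u x))) (L * C * \<bar>r\<bar>)" for r
      using f M L unfolding mult.assoc
      by (intro l2_bounded_dom[OF h1_bounded_lip[OF u]]) (auto intro!: continuous_intros c
          continuous_on_compose2[OF c])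
  qed
qed

lemma
  assumes M: "\<And>x. \<bar>fn u x\<bar> \<le> M" and f0: "f 0 = 0"
    and f: "\<And>p q. \<bar>p\<bar> \<le> M \<Longrightarrow> \<bar>q\<bar> \<le> M \<Longrightarrow> \<bar>f p - f q\<bar> \<le> L * \<bar>p - q\<bar>" and L: "0 \<le> L"
  shows fn_comp_h1: "fn (comp_h1 f u) x = f (fn u x)" and norm_comp_h1: "norm (comp_h1 f u) \<le> L * norm u"
proof -
  have b: "h1_bounded (\<lambda>x. f (fn u x)) (L * norm u)"
      by (rule h1_bounded_comp_h1[OF h1_bounded_norm M f0 f L]) auto
  have e: "fn (comp_h1 f u) = (\<lambda>x. f (fn u x))" unfolding comp_h1_def by (rule fn_Abs[OF b]) simp
  then show "fn (comp_h1 f u) x = f (fn u x)" by simp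
  show "norm (comp_h1 f u) \<le> L * norm u" using b e by (intro norm_h1_le) simp
qed

section \<open>The linear part of the equation\<close>

text \<open>The first derivative of an even function is odd and hence in general not an element of
  \<open>h1\<close>, so it is quantified as a plain function. As d lies in \<open>h1\<close>, the
  relation describes an H^3 function together with its second derivative.\<close>

definition second_deriv :: "h1 \<Rightarrow> h1 \<Rightarrow> bool" where
  "second_deriv u d \<longleftrightarrow> (\<exists>u'. (\<forall>x. (fn u has_real_derivative u' x) (at x)) \<and> (\<forall>x. (u' has_real_derivative
      fn d x) (at x)))"

text \<open>Formally of order h^4 when d is the second derivative of u; how much of that is realised
  depends on the regularity of d.\<close>

definition avg_remainder :: "real \<Rightarrow> h1 \<Rightarrow> h1 \<Rightarrow> h1" where
  "avg_remainder h u d = avg_h1 h (avg_h1 h u) - u - (h^2/12) *\<^sub>R d"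

lemma second_deriv_twice_diff:
  assumes "second_deriv u d"
  obtains u' where "twice_diff (fn u) u' (fn d)"
    "\<And>r. twice_diff (shiftdiff r (fn u)) (shiftdiff r u') (shiftdiff r (fn d))"
proof -
  obtain u' where u': "\<And>x. (fn u has_real_derivative u' x) (at x)" "\<And>x. (u' has_real_derivative fn d x) (at x)"
    using assms unfolding second_deriv_def by blast
  show thesis
  proof (rule that[of u'])
    show "twice_diff (fn u) u' (fn d)" using u' fn_cont by unfold_locales auto
    fix r
    have s: "((\<lambda>x. g (x + r)) has_real_derivative g' (x + r)) (at x)"
      if "\<And>x. (g has_real_derivative g' x) (at x)" for g g' :: "real \<Rightarrow> real" and x
      using DERIV_shift[of g "g' (x+r)" x r] that[of "x+r"] by simp
    have "continuous_on UNIV (\<lambda>x. fn d (x + r))"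
      by (rule continuous_on_compose2[OF fn_cont]) (auto intro: continuous_intros)
    then show "twice_diff (shiftdiff r (fn u)) (shiftdiff r u') (shiftdiff r (fn d))"
      by unfold_locales (intro DERIV_diff s u' continuous_on_diff fn_cont)+
  qed
qed

lemma fn_avg_remainder: "h > 0 \<Longrightarrow> fn (avg_remainder h u d) = (\<lambda>x. avg h (avg h (fn u)) x - fn u x -
    h^2/12 * fn d x)"
  by (simp add: avg_remainder_def fn_minus_fun fn_scaleR_fun fn_avg_h1)

lemma second_diff_shiftdiff: "second_diff s (shiftdiff r v) = shiftdiff r (second_diff s v)"
  by (auto simp: second_diff_def algebra_simps)

lemma l2_norm_avg_remainder:
  assumes D: "second_deriv u d" and h: "h > 0" and B: "\<And>s. 0 \<le> s \<Longrightarrow> s \<le> h/2 \<Longrightarrow>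
      l2_bounded (second_diff s (fn d)) B"
  shows "l2_norm (fn (avg_remainder h u d)) \<le> 3 * h^2 * B"
proof -
  obtain u' where "twice_diff (fn u) u' (fn d)" using second_deriv_twice_diff[OF D] by metis
  from twice_diff.l2_bounded_avg2_taylor[OF this h B] show ?thesis
    unfolding fn_avg_remainder[OF h] by (rule l2_norm_le)
qed

lemma norm_avg_remainder:
  assumes D: "second_deriv u d" and h: "h > 0" and B: "\<And>s. 0 \<le> s \<Longrightarrow> s \<le> h/2 \<Longrightarrow>
      h1_bounded (second_diff s (fn d)) B"
  shows "norm (avg_remainder h u d) \<le> 3 * h^2 * B"
proof (rule norm_h1_le, rule h1bI)
  obtain u' where u': "twice_diff (fn u) u' (fn d)"
    "\<And>r. twice_diff (shiftdiff r (fn u)) (shiftdiff r u') (shiftdiff r (fn d))"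
        using second_deriv_twice_diff[OF D] by metis
  show "l2_bounded (fn (avg_remainder h u d)) (3 * h^2 * B)"
    unfolding fn_avg_remainder[OF h] using B h1_bounded_l2_bounded
        by (intro twice_diff.l2_bounded_avg2_taylor[OF u'(1) h]) blast
  fix r
  have "l2_bounded (second_diff s (shiftdiff r (fn d))) (B * \<bar>r\<bar>)" if "0 \<le> s" "s \<le> h/2" for s
    using h1_bounded_lip[OF B[OF that], of r] by (simp add: second_diff_shiftdiff)
  from twice_diff.l2_bounded_avg2_taylor[OF u'(2) h this]
  have "l2_bounded (\<lambda>x. avg h (avg h (shiftdiff r (fn u))) x - shiftdiff r (fn u) x - h\<^sup>2 / 12 *
      shiftdiff r (fn d) x)
     (3 * h^2 * (B * \<bar>r\<bar>))" by simp
  also have "avg h (avg h (shiftdiff r (fn u))) = shiftdiff r (avg h (avg h (fn u)))"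
    by (simp only: avg_shiftdiff[OF fn_cont] avg_shiftdiff[OF avg_cont[OF fn_cont h]])
  finally have "l2_bounded (\<lambda>x. shiftdiff r (avg h (avg h (fn u))) x - shiftdiff r (fn u) x - h^2/12 *
      shiftdiff r (fn d) x)
     (3 * h^2 * (B * \<bar>r\<bar>))" .
  moreover have "(\<lambda>x. shiftdiff r (avg h (avg h (fn u))) x - shiftdiff r (fn u) x - h^2/12 * shiftdiff r
      (fn d) x)
     = shiftdiff r (fn (avg_remainder h u d))" unfolding fn_avg_remainder[OF h] by (auto simp: field_simps)
  ultimately show "l2_bounded (shiftdiff r (fn (avg_remainder h u d))) (3 * h^2 * B * \<bar>r\<bar>)"
    by (simp only: mult.assoc)
qed

lemma norm_avg_h1_minus_id:
  assumes D: "second_deriv u d" and h: "h > 0"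
  shows "norm (avg_h1 h u - u) \<le> h^2 * norm d"
proof (rule norm_h1_le, rule h1bI)
  obtain u' where u': "twice_diff (fn u) u' (fn d)"
    "\<And>r. twice_diff (shiftdiff r (fn u)) (shiftdiff r u') (shiftdiff r (fn d))"
        using second_deriv_twice_diff[OF D] by metis
  have f: "fn (avg_h1 h u - u) = (\<lambda>x. avg h (fn u) x - fn u x)" by (simp add: fn_minus_fun fn_avg_h1 h)
  have main: "l2_bounded (\<lambda>x. avg h v x - v x) (h^2 * C)"
      if v: "twice_diff v v' g" and g: "l2_bounded g C" for v v' g C
  proof (rule l2_bounded_avg_minus_id[OF twice_diff.cu[OF v] h])
    fix s :: real assume s: "0 \<le> s" "s \<le> h/2"
    have "s^2 \<le> (h/2)^2" using s by (intro power_mono) auto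
    then have "s^2 \<le> h^2 / 4" by (simp add: power_divide)
    with zero_le_power2[of s] have "2 * s^2 \<le> h^2" by linarith
    then have "2 * s^2 * C \<le> h^2 * C"
      using l2_bounded_nonneg[OF g] by (intro mult_right_mono)
    with twice_diff.l2_bounded_second_diff[OF v s(1) g] show "l2_bounded (second_diff s v) (h^2 * C)"
        by (rule l2_bounded_mono)
  qed
  show "l2_bounded (fn (avg_h1 h u - u)) (h^2 * norm d)" unfolding f by (rule main[OF u'(1) fn_l2_bounded])
  show "l2_bounded (shiftdiff r (fn (avg_h1 h u - u))) (h^2 * norm d * \<bar>r\<bar>)" for r
    using main[OF u'(2) fn_lip, of r] unfolding f avg_shiftdiff[OF fn_cont]
    by (simp add: algebra_simps)
qed

lemma l2_bounded_second_diff_lip: "l2_bounded (second_diff s (fn u)) ((norm u * \<bar>s\<bar>) + (norm u * \<bar>s\<bar>))"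
proof -
  have "l2_bounded (shiftdiff (-s) (fn u)) (norm u * \<bar>s\<bar>)" using fn_lip[of u "-s"] by simp
  from l2_bounded_add[OF fn_lip[of u s] this]
  have "l2_bounded (\<lambda>x. shiftdiff s (fn u) x + shiftdiff (-s) (fn u) x) ((norm u * \<bar>s\<bar>) + (norm u * \<bar>s\<bar>))" .
  moreover have "(\<lambda>x. shiftdiff s (fn u) x + shiftdiff (-s) (fn u) x) = second_diff s (fn u)"
    by (auto simp: second_diff_def)
  ultimately show ?thesis by simp
qed

lemma l2_norm_avg_h1_minus_id:
  assumes h: "h > 0" shows "l2_norm (fn (avg_h1 h u - u)) \<le> h * norm u"
proof -
  have "l2_bounded (second_diff s (fn u)) (h * norm u)" if s: "0 \<le> s" "s \<le> h/2" for s
  proof -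
    have "(norm u * \<bar>s\<bar>) + (norm u * \<bar>s\<bar>) \<le> h * norm u"
      using mult_right_mono[of "2 * s" h "norm u"] s by (simp add: algebra_simps)
    with l2_bounded_second_diff_lip show ?thesis by (rule l2_bounded_mono)
  qed
  from l2_bounded_avg_minus_id[OF fn_cont h this] show ?thesis
    by (intro l2_norm_le) (simp add: fn_minus_fun fn_avg_h1 h)
qed

lemma h1_bounded_second_diff:
  assumes "h1_bounded u C" shows "h1_bounded (second_diff s u) (4 * C)"
proof -
  have sh: "h1_bounded (\<lambda>x. u (x + t)) C" for t
  proof (rule h1bI)
    show "l2_bounded (\<lambda>x. u (x + t)) C" by (intro l2_bounded_shift h1_bounded_l2_bounded assms)
    show "l2_bounded (shiftdiff r (\<lambda>x. u (x + t))) (C * \<bar>r\<bar>)" for r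
      using l2_bounded_shift[OF h1_bounded_lip[OF assms, of r], of t]
          by (simp add: add.assoc add.commute[of t r])
  qed
  have "h1_bounded (\<lambda>x. (u (x + s) + u (x + (-s))) - 2 * u x) ((C + C) + \<bar>2\<bar> * C)"
    by (intro h1_bounded_diff h1_bounded_add h1_bounded_scale sh assms)
  then show ?thesis by (simp add: second_diff_def[abs_def])
qed

lemma h1_bounded_second_diff_second_deriv:
  assumes D: "second_deriv d e" and s: "0 \<le> s" shows "h1_bounded (second_diff s (fn d)) (2 * s^2 * norm e)"
proof (rule h1bI)
  obtain u' where u': "twice_diff (fn d) u' (fn e)"
    "\<And>r. twice_diff (shiftdiff r (fn d)) (shiftdiff r u') (shiftdiff r (fn e))"
        using second_deriv_twice_diff[OF D] by metis
  show "l2_bounded (second_diff s (fn d)) (2 * s^2 * norm e)"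
      by (rule twice_diff.l2_bounded_second_diff[OF u'(1) s fn_l2_bounded])
  show "l2_bounded (shiftdiff r (second_diff s (fn d))) (2 * s^2 * norm e * \<bar>r\<bar>)" for r
    using twice_diff.l2_bounded_second_diff[OF u'(2) s fn_lip, of r]
        by (simp add: second_diff_shiftdiff mult.assoc)
qed

lemma l2_bounded_shiftdiff_mult:
  assumes c: "continuous_on UNIV u" and d: "l2_bounded (shiftdiff r u) D"
  shows "l2_bounded (shiftdiff (real m * r) u) (real m * D)"
proof (induction m)
  case (Suc m)
  have "l2_bounded (\<lambda>x. shiftdiff r u (x + real m * r) + shiftdiff (real m * r) u x) (D + real m * D)"
    by (intro l2_bounded_add l2_bounded_shift d Suc)
  then show ?case by (simp add: algebra_simps)
qed (simp add: l2_bounded_0)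

section \<open>Weights, the linear operator and its inverse\<close>

locale wave =
  fixes a :: real
  assumes a3: "a > 3"
begin

text \<open>By homogeneity of the potential, m times its derivative at m(1+s) is m^(-a) times its
  derivative at 1+s. Here m = n+1.\<close>

definition w :: "nat \<Rightarrow> real" where "w n = 1 / real (Suc n) powr a"
definition b where "b = a * (a + 1)"
definition zeta_a where "zeta_a = zeta a"
definition zeta_a2 where "zeta_a2 = zeta (a - 2)"
text \<open>The coefficient of \<epsilon>^2 in the squared wave speed. It coincides with the
  coefficient of the second derivative in the expansion of the averages, which is why the limit
  profile decays at rate exactly 1.\<close>

definition disp_coeff where "disp_coeff = b * zeta_a2 / 12"
definition h :: "real \<Rightarrow> nat \<Rightarrow> real" where "h \<epsilon> n = \<epsilon> * real (Suc n)"

lemma b_pos: "b > 0" using a3 by (simp add: b_def)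

lemma summable_zeta: "p > 1 \<Longrightarrow> summable (\<lambda>n. 1 / real (Suc n) powr p)"
proof -
  assume p: "p > 1"
  have "summable (\<lambda>n. real n powr (-p))" using p by (simp add: summable_real_powr_iff)
  then have "summable (\<lambda>n. real (Suc n) powr (-p))" by (subst (asm) summable_Suc_iff[symmetric])
  then show ?thesis by (simp add: powr_minus divide_inverse)
qed

lemma zeta_sums: "p > 1 \<Longrightarrow> (\<lambda>n. 1 / real (Suc n) powr p) sums zeta p"
  unfolding zeta_def using summable_zeta by (simp add: summable_sums)

lemma zeta_pos: "p > 1 \<Longrightarrow> zeta p > 0"
  unfolding zeta_def by (intro suminf_pos summable_zeta) auto

lemma w_pos: "w n > 0" by (simp add: w_def)

lemma w_0: "w 0 = 1" by (simp add: w_def)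

lemma h_pos: "\<epsilon> > 0 \<Longrightarrow> h \<epsilon> n > 0" by (simp add: h_def)

lemma w_sums: "w sums zeta_a"
  using zeta_sums[of a] a3 by (simp add: w_def[abs_def] zeta_a_def)

lemma w2_sums: "(\<lambda>n. w n * real (Suc n)^2) sums zeta_a2"
proof -
  have "1 / real (Suc n) powr (a - 2) = w n * real (Suc n)^2" for n
  proof -
    have "real (Suc n) powr 2 = real (Suc n)^2" using powr_realpow[of "real (Suc n)" 2] by simp
    then show ?thesis by (simp only: w_def powr_diff) simp
  qed
  then show ?thesis using zeta_sums[of "a-2"] a3 by (simp add: zeta_a2_def)
qed

lemma zeta_a_pos: "zeta_a > 0" and zeta_a2_pos: "zeta_a2 > 0" and disp_coeff_pos: "disp_coeff > 0"
  using zeta_pos[of a] zeta_pos[of "a-2"] a3 b_pos by (simp_all add: zeta_a_def zeta_a2_def disp_coeff_def)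

lemma weight2_sums: "(\<lambda>n. w n * h \<epsilon> n^2) sums (\<epsilon>^2 * zeta_a2)"
  using sums_mult[OF w2_sums, of "\<epsilon>^2"] by (simp add: h_def power_mult_distrib mult_ac)

lemma summable_w_bounded:
  fixes u :: "nat \<Rightarrow> h1"
  assumes "\<And>n. norm (u n) \<le> C"
  shows "summable (\<lambda>n. w n *\<^sub>R u n)" "norm (\<Sum>n. w n *\<^sub>R u n) \<le> zeta_a * C"
proof -
  have s: "summable (\<lambda>n. w n * C)" "(\<Sum>n. w n * C) = zeta_a * C"
    using w_sums sums_mult2[OF w_sums, of C] by (auto simp: sums_iff)
  have le: "norm (w n *\<^sub>R u n) \<le> w n * C" for n
    using assms[of n] w_pos[of n] by simp
  show "summable (\<lambda>n. w n *\<^sub>R u n)"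
    by (rule summable_comparison_test[OF _ s(1)]) (use le in auto)
  show "norm (\<Sum>n. w n *\<^sub>R u n) \<le> zeta_a * C"
    using norm_suminf_le[OF le s(1)] s(2) by simp
qed

definition avg_sum :: "real \<Rightarrow> h1 \<Rightarrow> h1" where
  "avg_sum \<epsilon> u = (\<Sum>n. w n *\<^sub>R avg_h1 (h \<epsilon> n) (avg_h1 (h \<epsilon> n) u))"

lemma norm_Av2: "\<epsilon> > 0 \<Longrightarrow> norm (avg_h1 (h \<epsilon> n) (avg_h1 (h \<epsilon> n) u)) \<le> norm u"
  by (meson norm_avg_h1 h_pos order_trans)

lemma bounded_linear_avg_sum: assumes "\<epsilon> > 0" shows "bounded_linear (avg_sum \<epsilon>)"
proof (rule bounded_linear_intro[where K=zeta_a])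
  note S = summable_w_bounded(1)[OF norm_Av2[OF assms]]
  note L = bounded_linear_compose[OF bounded_linear_avg_h1[OF h_pos[OF assms]] bounded_linear_avg_h1[OF
      h_pos[OF assms]]]
  show "avg_sum \<epsilon> (u + v) = avg_sum \<epsilon> u + avg_sum \<epsilon> v" for u v
    unfolding avg_sum_def suminf_add[OF S S]
    by (simp add: linear_simps(1)[OF L] scaleR_add_right)
  show "avg_sum \<epsilon> (c *\<^sub>R u) = c *\<^sub>R avg_sum \<epsilon> u" for c u
    unfolding avg_sum_def bounded_linear.suminf[OF bounded_linear_scaleR_right S]
    by (simp add: linear_simps(5)[OF L] mult.commute)
  show "norm (avg_sum \<epsilon> u) \<le> norm u * zeta_a" for u
    using summable_w_bounded(2)[OF norm_Av2[OF assms]] by (simp add: avg_sum_def mult.commute)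
qed

lemma norm_avg_sum: "\<epsilon> > 0 \<Longrightarrow> norm (avg_sum \<epsilon> u) \<le> zeta_a * norm u"
  using summable_w_bounded(2)[OF norm_Av2] by (simp add: avg_sum_def)

lemma avg_h1_avg_sum: assumes "\<epsilon> > 0" "k > 0" shows "avg_h1 k (avg_sum \<epsilon> u) = avg_sum \<epsilon> (avg_h1 k u)"
proof -
  have "avg_h1 k (avg_h1 (h \<epsilon> n) (avg_h1 (h \<epsilon> n) u)) = avg_h1 (h \<epsilon> n) (avg_h1 (h \<epsilon> n) (avg_h1 k u))" for n
    unfolding avg_h1_commute[OF assms(2) h_pos[OF assms(1)], of n u, symmetric]
      avg_h1_commute[OF assms(2) h_pos[OF assms(1)], of n "avg_h1 (h \<epsilon> n) u"] ..
  then show ?thesis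
    unfolding avg_sum_def bounded_linear.suminf[OF bounded_linear_avg_h1[OF assms(2)]
        summable_w_bounded(1)[OF norm_Av2[OF assms(1)]]]
    by (simp only: linear_simps(5)[OF bounded_linear_avg_h1[OF assms(2)]])
qed

text \<open>All averages are contractions. The loss of norm is kept only for m = 1, where the weight
  is 1 and the width is \<epsilon>; this deficit drives \<open>lin_inv_smoothing\<close>.\<close>

lemma l2_norm_avg_sum:
  assumes "\<epsilon> > 0"
  shows "l2_norm (fn (avg_sum \<epsilon> u)) \<le> zeta_a * l2_norm (fn u) - (l2_norm (fn u) - l2_norm (fn (avg_h1 \<epsilon> u)))"
proof -
  let ?b = "\<lambda>n. w n * l2_norm (fn u) - (if n = 0 then l2_norm (fn u) - l2_norm (fn (avg_h1 \<epsilon> u)) else 0)"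
  have s: "?b sums (zeta_a * l2_norm (fn u) - (l2_norm (fn u) - l2_norm (fn (avg_h1 \<epsilon> u))))"
    by (intro sums_diff sums_mult2 w_sums) (rule sums_single[of 0 "\<lambda>_. l2_norm (fn u) - l2_norm (fn
        (avg_h1 \<epsilon> u))"])
  have "l2_norm (fn (avg_sum \<epsilon> u)) \<le> suminf ?b"
    unfolding avg_sum_def
  proof (rule l2_norm_fn_suminf)
    show "summable (\<lambda>n. w n *\<^sub>R avg_h1 (h \<epsilon> n) (avg_h1 (h \<epsilon> n) u))"
        by (rule summable_w_bounded(1)[OF norm_Av2[OF assms]])
    show "summable ?b" using s by (simp add: sums_iff)
    fix n
    have "l2_norm (fn (w n *\<^sub>R avg_h1 (h \<epsilon> n) (avg_h1 (h \<epsilon> n) u))) \<le> w n * l2_norm (fn (avg_h1 (h \<epsilon> n)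
        (avg_h1 (h \<epsilon> n) u)))"
      using l2_norm_fn_scale[of "w n"] w_pos[of n] by (simp add: less_imp_le)
    also have "\<dots> \<le> w n * l2_norm (fn (avg_h1 (h \<epsilon> n) u))"
      using w_pos[of n] l2_norm_avg_h1[OF h_pos[OF assms]] by simp
    also have "\<dots> \<le> ?b n"
      using w_pos[of n] l2_norm_avg_h1[OF h_pos[OF assms], of n u] by (cases n) (auto simp: w_0 h_def)
    finally show "l2_norm (fn (w n *\<^sub>R avg_h1 (h \<epsilon> n) (avg_h1 (h \<epsilon> n) u))) \<le> ?b n" .
  qed
  then show ?thesis using s by (simp add: sums_iff)
qed

text \<open>
  Divided by \<open>\<epsilon>\<^sup>4\<close>, the wave equation is \<open>lin_op \<epsilon> W = nonlin_sum \<epsilon> W\<close>. As \<open>\<epsilon> \<rightarrow> 0\<close>, \<open>lin_op \<epsilon>\<close>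
  tends to \<open>disp_coeff (1 - \<partial>\<^sup>2)\<close>, and \<open>lin_remainder\<close> is the difference.
\<close>

definition lin_op :: "real \<Rightarrow> h1 \<Rightarrow> h1" where
  "lin_op \<epsilon> u = (disp_coeff + b * zeta_a / \<epsilon>^2) *\<^sub>R u - (b / \<epsilon>^2) *\<^sub>R avg_sum \<epsilon> u"

lemma bounded_linear_lin_op: "\<epsilon> > 0 \<Longrightarrow> bounded_linear (lin_op \<epsilon>)"
  using bounded_linear_sub[OF bounded_linear_scaleR_right
      bounded_linear_compose[OF bounded_linear_scaleR_right bounded_linear_avg_sum]]
  by (simp add: lin_op_def[abs_def])

lemma lin_op_eq: "lin_op \<epsilon> u = (disp_coeff + b / \<epsilon>^2 * zeta_a) *\<^sub>R u - (b / \<epsilon>^2) *\<^sub>R avg_sum \<epsilon> u"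
  by (simp add: lin_op_def)

text \<open>The wave is supersonic by the \<open>disp_coeff\<close> term, so that after division by
  k the averaging part has norm at most \<open>q * zeta_a / k\<close>, below 1. This factor tends to
  1 as \<epsilon> tends to 0, yet the bound of \<open>norm_lin_inv\<close> is uniform.\<close>

lemma lin_op_bij: assumes e: "\<epsilon> > 0" shows "\<exists>!u. lin_op \<epsilon> u = f"
proof -
  define q where "q = b / \<epsilon>^2"
  have q: "q > 0" using b_pos e by (simp add: q_def)
  define k where "k = disp_coeff + q * zeta_a"
  have k: "k > 0" using q zeta_a_pos disp_coeff_pos by (simp add: k_def add_pos_pos)
  let ?F = "\<lambda>u. (1 / k) *\<^sub>R (f + q *\<^sub>R avg_sum \<epsilon> u)"
  have iff: "lin_op \<epsilon> u = f \<longleftrightarrow> ?F u = u" for u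
  proof -
    have "lin_op \<epsilon> u = f \<longleftrightarrow> k *\<^sub>R u = f + q *\<^sub>R avg_sum \<epsilon> u"
      unfolding lin_op_eq q_def[symmetric] k_def[symmetric] by (simp add: diff_eq_eq)
    also have "\<dots> \<longleftrightarrow> ?F u = u"
    proof
      assume "k *\<^sub>R u = f + q *\<^sub>R avg_sum \<epsilon> u"
      then have "?F u = (1 / k) *\<^sub>R (k *\<^sub>R u)" by simp
      then show "?F u = u" using k by simp
    next
      assume "?F u = u"
      then have "k *\<^sub>R u = k *\<^sub>R ?F u" by simp
      also have "\<dots> = f + q *\<^sub>R avg_sum \<epsilon> u" using k by simp
      finally show "k *\<^sub>R u = f + q *\<^sub>R avg_sum \<epsilon> u" .
    qed
    finally show ?thesis .
  qed
  have "\<exists>!u. ?F u = u"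
  proof (rule banach_fix_type)
    show "0 \<le> q * zeta_a / k" using q k zeta_a_pos by simp
    show "q * zeta_a / k < 1" using k disp_coeff_pos by (simp add: k_def)
    show "\<forall>x y. dist (?F x) (?F y) \<le> q * zeta_a / k * dist x y"
    proof (intro allI)
      fix x y
      have "?F x - ?F y = (q / k) *\<^sub>R avg_sum \<epsilon> (x - y)"
        by (simp add: linear_simps(2)[OF bounded_linear_avg_sum[OF e]] scaleR_diff_right scaleR_add_right)
      then have "dist (?F x) (?F y) = q / k * norm (avg_sum \<epsilon> (x - y))"
        using q k by (simp add: dist_norm)
      also have "\<dots> \<le> q / k * (zeta_a * norm (x - y))"
        using q k by (intro mult_left_mono norm_avg_sum e) auto
      also have "\<dots> = q * zeta_a / k * dist x y" by (simp add: dist_norm)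
      finally show "dist (?F x) (?F y) \<le> q * zeta_a / k * dist x y" .
    qed
  qed
  then show ?thesis by (simp only: iff)
qed

definition lin_inv :: "real \<Rightarrow> h1 \<Rightarrow> h1" where "lin_inv \<epsilon> f = (THE u. lin_op \<epsilon> u = f)"

lemma lin_op_lin_inv: "\<epsilon> > 0 \<Longrightarrow> lin_op \<epsilon> (lin_inv \<epsilon> f) = f"
  unfolding lin_inv_def by (rule theI'[OF lin_op_bij])

lemma lin_inv_lin_op: "\<epsilon> > 0 \<Longrightarrow> lin_inv \<epsilon> (lin_op \<epsilon> u) = u"
  using lin_op_bij[of \<epsilon> "lin_op \<epsilon> u"] lin_op_lin_inv[of \<epsilon> "lin_op \<epsilon> u"] by blast

lemma norm_lin_inv: assumes e: "\<epsilon> > 0" shows "norm (lin_inv \<epsilon> f) \<le> norm f / disp_coeff"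
proof -
  let ?u = "lin_inv \<epsilon> f"
  have P: "b * zeta_a / \<epsilon>^2 > 0" using b_pos zeta_a_pos e by auto
  have "(disp_coeff + b * zeta_a / \<epsilon>^2) *\<^sub>R ?u = f + (b / \<epsilon>^2) *\<^sub>R avg_sum \<epsilon> ?u"
    using lin_op_lin_inv[OF e, of f] unfolding lin_op_def by (simp add: diff_eq_eq)
  then have "(disp_coeff + b * zeta_a / \<epsilon>^2) * norm ?u = norm (f + (b / \<epsilon>^2) *\<^sub>R avg_sum \<epsilon> ?u)"
    using P disp_coeff_pos by (metis abs_of_pos add_pos_pos norm_scaleR)
  also have "\<dots> \<le> norm f + (b / \<epsilon>^2) * norm (avg_sum \<epsilon> ?u)"
    using norm_triangle_ineq[of f "(b / \<epsilon>^2) *\<^sub>R avg_sum \<epsilon> ?u"] b_pos by simp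
  also have "\<dots> \<le> norm f + (b / \<epsilon>^2) * (zeta_a * norm ?u)"
    using b_pos by (intro add_left_mono mult_left_mono norm_avg_sum e) auto
  finally have "disp_coeff * norm ?u \<le> norm f" by (simp add: algebra_simps)
  then show ?thesis using disp_coeff_pos by (simp add: field_simps)
qed

lemma bounded_linear_lin_inv: assumes e: "\<epsilon> > 0" shows "bounded_linear (lin_inv \<epsilon>)"
proof (rule bounded_linear_intro[where K="1/disp_coeff"])
  show "lin_inv \<epsilon> (f + g) = lin_inv \<epsilon> f + lin_inv \<epsilon> g" for f g
    using lin_inv_lin_op[OF e, of "lin_inv \<epsilon> f + lin_inv \<epsilon> g"]
        by (simp add: linear_simps(1)[OF bounded_linear_lin_op[OF e]] lin_op_lin_inv[OF e])
  show "lin_inv \<epsilon> (c *\<^sub>R f) = c *\<^sub>R lin_inv \<epsilon> f" for c f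
    using lin_inv_lin_op[OF e, of "c *\<^sub>R lin_inv \<epsilon> f"]
        by (simp add: linear_simps(5)[OF bounded_linear_lin_op[OF e]] lin_op_lin_inv[OF e])
qed (use norm_lin_inv[OF e] in auto)

text \<open>\<open>lin_op\<close> is built from averages, which commute with one another, so its
  inverse commutes with them too. Moving the outer average of each nonlinear term through the
  inverse makes \<open>lin_inv_smoothing\<close> applicable.\<close>

lemma avg_h1_lin_inv: assumes e: "\<epsilon> > 0" and k: "k > 0" shows "avg_h1 k (lin_inv \<epsilon> f) = lin_inv \<epsilon> (avg_h1 k f)"
proof -
  have "lin_op \<epsilon> (avg_h1 k (lin_inv \<epsilon> f)) = avg_h1 k (lin_op \<epsilon> (lin_inv \<epsilon> f))"
    unfolding lin_op_def by (simp add: avg_h1_avg_sum[OF e k] linear_simps(2)[OF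
        bounded_linear_avg_h1[OF k]] linear_simps(5)[OF bounded_linear_avg_h1[OF k]])
  then have "lin_op \<epsilon> (avg_h1 k (lin_inv \<epsilon> f)) = avg_h1 k f" by (simp add: lin_op_lin_inv[OF e])
  then show ?thesis using lin_inv_lin_op[OF e] by metis
qed

text \<open>The first summand bounds the function and the second its difference quotients in
  \<open>lin_inv_smoothing\<close>; the factor 2 arises because the energy estimate works at step
  \<epsilon>/2.\<close>

definition smoothing_const where "smoothing_const = 1 / disp_coeff + 2 * sqrt (8 / (b * disp_coeff))"

lemma smoothing_const_pos: "smoothing_const > 0" unfolding smoothing_const_def
    using b_pos disp_coeff_pos by (intro add_pos_nonneg) auto

text \<open>
  For \<open>lin_op \<epsilon> u = f\<close>, the triangle inequality in \<open>L\<^sup>2\<close> bounds \<open>\<parallel>u\<parallel> - \<parallel>A u\<parallel>\<close> for the average \<open>A\<close> of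
  width \<open>\<epsilon>\<close>, which by \<open>avg_energy\<close> controls a difference quotient of \<open>u\<close>. Hence the averaged
  inverse gains one derivative uniformly in \<open>\<epsilon>\<close>, although the inverse alone gains none.
\<close>

lemma lin_inv_smoothing:
  assumes e: "\<epsilon> > 0" shows "norm (avg_h1 (h \<epsilon> n) (lin_inv \<epsilon> f)) \<le> smoothing_const * l2_norm (fn f)"
proof -
  let ?u = "lin_inv \<epsilon> f" let ?U = "l2_norm (fn (lin_inv \<epsilon> f))" and ?V = "l2_norm (fn (avg_h1 \<epsilon> (lin_inv
      \<epsilon> f)))" and ?f = "l2_norm (fn f)"
  define q where "q = b / \<epsilon>^2"
  have q: "q > 0" using b_pos e by (simp add: q_def)
  define k where "k = disp_coeff + q * zeta_a"
  have k: "k > 0" using q zeta_a_pos disp_coeff_pos by (simp add: k_def add_pos_pos)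
  have u: "?u = (1/k) *\<^sub>R (f + q *\<^sub>R avg_sum \<epsilon> ?u)"
  proof -
    have "k *\<^sub>R ?u = f + q *\<^sub>R avg_sum \<epsilon> ?u"
      using lin_op_lin_inv[OF e, of f] unfolding lin_op_eq q_def[symmetric] k_def[symmetric]
          by (simp add: diff_eq_eq)
    then have "(1/k) *\<^sub>R (f + q *\<^sub>R avg_sum \<epsilon> ?u) = (1/k) *\<^sub>R (k *\<^sub>R ?u)" by simp
    then show ?thesis using k by simp
  qed
  have "?U \<le> 1/k * l2_norm (fn (f + q *\<^sub>R avg_sum \<epsilon> ?u))"
    using l2_norm_fn_scale[of "1/k" "f + q *\<^sub>R avg_sum \<epsilon> ?u"] k u by (simp del: fn_plus)
  also have "\<dots> \<le> 1/k * (?f + q * (zeta_a * ?U - (?U - ?V)))"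
  proof (intro mult_left_mono)
    have "l2_norm (fn (q *\<^sub>R avg_sum \<epsilon> ?u)) \<le> q * l2_norm (fn (avg_sum \<epsilon> ?u))"
      using l2_norm_fn_scale[of q "avg_sum \<epsilon> ?u"] q by simp
    also have "\<dots> \<le> q * (zeta_a * ?U - (?U - ?V))"
      using q by (intro mult_left_mono l2_norm_avg_sum e) auto
    finally show "l2_norm (fn (f + q *\<^sub>R avg_sum \<epsilon> ?u)) \<le> ?f + q * (zeta_a * ?U - (?U - ?V))"
      using l2_norm_fn_triangle[of f "q *\<^sub>R avg_sum \<epsilon> ?u"] by linarith
  qed (use k in auto)
  finally have "k * ?U \<le> ?f + q * (zeta_a * ?U - (?U - ?V))"
    using k by (simp add: field_simps)
  \<comment> \<open>The terms with \<open>zeta_a\<close> cancel. What remains bounds the norm and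
    also, with the large factor q of order \<epsilon>^(-2), the norm lost under averaging.\<close>
  then have en: "disp_coeff * ?U + q * (?U - ?V) \<le> ?f" by (simp add: k_def algebra_simps)
  have VU: "?V \<le> ?U" using l2_norm_avg_h1[OF e] .
  have "q * (?U - ?V) \<ge> 0" using q VU by simp
  then have U: "?U \<le> ?f / disp_coeff" using en disp_coeff_pos by (simp add: field_simps)
  have "disp_coeff * ?U \<ge> 0" using disp_coeff_pos l2_norm_nonneg by simp
  then have "q * (?U - ?V) \<le> ?f" using en by linarith
  then have UV: "?U - ?V \<le> \<epsilon>^2 / b * ?f" using b_pos e by (simp add: q_def field_simps)
  \<comment> \<open>A factor of order 1 times a deficit of order \<epsilon>^2: by
    \<open>avg_energy\<close> the difference at distance \<epsilon>/2 is then of order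
    \<epsilon>.\<close>
  have "?U^2 - ?V^2 = (?U + ?V) * (?U - ?V)" by (simp add: power2_eq_square algebra_simps)
  also have "\<dots> \<le> (2 * (?f / disp_coeff)) * (\<epsilon>^2 / b * ?f)"
    using U UV VU l2_norm_nonneg disp_coeff_pos by (intro mult_mono) auto
  finally have "4 * (?U^2 - ?V^2) \<le> 4 * ((2 * (?f / disp_coeff)) * (\<epsilon>^2 / b * ?f))" by simp
  also have "\<dots> = 8 / (b * disp_coeff) * (\<epsilon> * ?f)^2" by (simp add: power2_eq_square mult_ac)
  finally have "4 * (?U^2 - ?V^2) \<le> 8 / (b * disp_coeff) * (\<epsilon> * ?f)^2" .
  moreover have "(l2_norm (shiftdiff (\<epsilon>/2) (fn ?u)))^2 \<le> 4 * (?U^2 - ?V^2)"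
    using avg_energy[OF fn_l2_norm e, of ?u] by (simp only: fn_avg_h1[OF e])
  ultimately have "(l2_norm (shiftdiff (\<epsilon>/2) (fn ?u)))^2 \<le> 8 / (b * disp_coeff) * (\<epsilon> * ?f)^2"
      by (rule order_trans[rotated])
  then have "l2_norm (shiftdiff (\<epsilon>/2) (fn ?u)) \<le> sqrt (8 / (b * disp_coeff) * (\<epsilon> * ?f)^2)"
      by (rule real_le_rsqrt)
  also have "\<dots> = sqrt (8 / (b * disp_coeff)) * (\<epsilon> * ?f)"
    using e l2_norm_nonneg[of "fn f"] unfolding real_sqrt_mult by simp
  finally have "l2_bounded (shiftdiff (\<epsilon>/2) (fn ?u)) (sqrt (8 / (b * disp_coeff)) * (\<epsilon> * ?f))"
    using fn_lip l2_bounded_l2_norm l2_bounded_mono by blast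
  \<comment> \<open>The width \<epsilon>(n+1) consists of 2(n+1) steps of length \<epsilon>/2;
    telescoping makes the difference quotient independent of n.\<close>
  from l2_bounded_shiftdiff_mult[OF fn_cont this, of "2 * Suc n"]
  have d: "l2_bounded (shiftdiff (h \<epsilon> n) (fn ?u)) (2 * sqrt (8 / (b * disp_coeff)) * h \<epsilon> n * ?f)"
    by (simp add: h_def algebra_simps)
  have f0: "?f \<ge> 0" by (rule l2_norm_nonneg)
  have c: "1 / disp_coeff * ?f \<le> smoothing_const * ?f" "2 * sqrt (8 / (b * disp_coeff)) * ?f
      \<le> smoothing_const * ?f"
    unfolding smoothing_const_def using b_pos disp_coeff_pos f0 by (intro mult_right_mono; simp)+
  show ?thesis
  proof (rule norm_h1_le, rule h1bI)
    show "l2_bounded (fn (avg_h1 (h \<epsilon> n) ?u)) (smoothing_const * ?f)"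
      unfolding fn_avg_h1[OF h_pos[OF e]]
      by (rule l2_bounded_mono[OF avg_l2_bounded[OF fn_l2_norm h_pos[OF e]]]) (use U c in simp)
    show "l2_bounded (shiftdiff r (fn (avg_h1 (h \<epsilon> n) ?u))) (smoothing_const * ?f * \<bar>r\<bar>)" for r
      unfolding fn_avg_h1[OF h_pos[OF e]]
      by (rule l2_bounded_mono[OF avg_lip[OF fn_l2_norm h_pos[OF e] d]])
        (use mult_right_mono[OF c(2), of "\<bar>r\<bar>"] h_pos[OF e, of n] in \<open>simp add: algebra_simps\<close>)
  qed
qed

definition lin_remainder :: "real \<Rightarrow> h1 \<Rightarrow> h1 \<Rightarrow> h1" where
  "lin_remainder \<epsilon> u d = (\<Sum>n. w n *\<^sub>R ((b / \<epsilon>^2) *\<^sub>R avg_remainder (h \<epsilon> n) u d))"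

lemma norm_avg_remainder_simple:
  assumes "second_deriv u d" "k > 0" shows "norm (avg_remainder k u d) \<le> 12 * k^2 * norm d"
  using norm_avg_remainder[OF assms h1_bounded_second_diff[OF h1_bounded_norm]]
      by (simp only: mult.assoc mult.left_commute)

lemma summable_weight2:
  fixes u :: "nat \<Rightarrow> h1"
  assumes "\<And>n. norm (u n) \<le> C * h \<epsilon> n^2"
  shows "summable (\<lambda>n. w n *\<^sub>R u n)"
proof (rule summable_comparison_test)
  have "summable (\<lambda>n. w n * h \<epsilon> n^2 * C)" using weight2_sums sums_summable summable_mult2 by blast
  then show "summable (\<lambda>n. w n * (C * h \<epsilon> n^2))" by (simp add: mult_ac)
  show "\<exists>N. \<forall>n\<ge>N. norm (w n *\<^sub>R u n) \<le> w n * (C * h \<epsilon> n^2)"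
    using assms w_pos by (auto intro!: mult_left_mono simp: less_imp_le)
qed

lemma lin_remainder_summable:
  assumes D: "second_deriv u d" and e: "\<epsilon> > 0"
  shows "summable (\<lambda>n. w n *\<^sub>R ((b / \<epsilon>^2) *\<^sub>R avg_remainder (h \<epsilon> n) u d))"
proof (rule summable_weight2)
  fix n
  have "norm ((b / \<epsilon>^2) *\<^sub>R avg_remainder (h \<epsilon> n) u d) = b / \<epsilon>^2 * norm (avg_remainder (h \<epsilon> n) u d)"
      using b_pos by simp
  also have "\<dots> \<le> b / \<epsilon>^2 * (12 * h \<epsilon> n^2 * norm d)"
    using b_pos by (intro mult_left_mono norm_avg_remainder_simple D h_pos e) auto
  finally show "norm ((b / \<epsilon>^2) *\<^sub>R avg_remainder (h \<epsilon> n) u d) \<le> (b / \<epsilon>^2 * (12 * norm d)) * h \<epsilon> n^2"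
      by (simp add: mult_ac)
qed

text \<open>In the expansion of the squared averages the zeroth-order terms cancel the part
  \<open>b * zeta_a / \<epsilon>^2\<close> of \<open>lin_op\<close>, and by
  \<open>weight2_sums\<close> the second-order terms add up to \<open>disp_coeff\<close>.\<close>

lemma lin_op_lin_remainder:
  assumes D: "second_deriv u d" and e: "\<epsilon> > 0"
  shows "lin_op \<epsilon> u = disp_coeff *\<^sub>R (u - d) - lin_remainder \<epsilon> u d"
proof -
  have 1: "(\<lambda>n. w n *\<^sub>R avg_h1 (h \<epsilon> n) (avg_h1 (h \<epsilon> n) u)) sums avg_sum \<epsilon> u"
    unfolding avg_sum_def using summable_w_bounded(1)[OF norm_Av2[OF e]] by (rule summable_sums)
  have 2: "(\<lambda>n. w n *\<^sub>R u) sums (zeta_a *\<^sub>R u)"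
    by (rule bounded_linear.sums[OF bounded_linear_scaleR_left w_sums])
  have 3: "(\<lambda>n. (w n * h \<epsilon> n^2) *\<^sub>R ((1/12) *\<^sub>R d)) sums ((\<epsilon>^2 * zeta_a2) *\<^sub>R ((1/12) *\<^sub>R d))"
    by (rule bounded_linear.sums[OF bounded_linear_scaleR_left weight2_sums])
  have "(\<lambda>n. (b / \<epsilon>^2) *\<^sub>R ((w n *\<^sub>R avg_h1 (h \<epsilon> n) (avg_h1 (h \<epsilon> n) u) - w n *\<^sub>R u) - (w n * h \<epsilon> n^2)
      *\<^sub>R ((1/12) *\<^sub>R d)))
      sums ((b / \<epsilon>^2) *\<^sub>R ((avg_sum \<epsilon> u - zeta_a *\<^sub>R u) - (\<epsilon>^2 * zeta_a2) *\<^sub>R ((1/12) *\<^sub>R d)))"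
    by (rule bounded_linear.sums[OF bounded_linear_scaleR_right sums_diff[OF sums_diff[OF 1 2] 3]])
  moreover have "(b / \<epsilon>^2) *\<^sub>R ((w n *\<^sub>R avg_h1 (h \<epsilon> n) (avg_h1 (h \<epsilon> n) u) - w n *\<^sub>R u) - (w n * h \<epsilon>
      n^2) *\<^sub>R ((1/12) *\<^sub>R d))
     = w n *\<^sub>R ((b / \<epsilon>^2) *\<^sub>R avg_remainder (h \<epsilon> n) u d)" for n
    by (rule h1_eqI) (simp add: avg_remainder_def algebra_simps)
  ultimately have "lin_remainder \<epsilon> u d = (b / \<epsilon>^2) *\<^sub>R ((avg_sum \<epsilon> u - zeta_a *\<^sub>R u) - (\<epsilon>^2 * zeta_a2)
      *\<^sub>R ((1/12) *\<^sub>R d))"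
    unfolding lin_remainder_def using sums_unique by force
  also have "\<dots> = (b / \<epsilon>^2) *\<^sub>R avg_sum \<epsilon> u - (b / \<epsilon>^2 * zeta_a) *\<^sub>R u - disp_coeff *\<^sub>R d"
    using e by (simp add: scaleR_diff_right disp_coeff_def)
  finally show ?thesis by (simp add: lin_op_eq scaleR_add_left scaleR_diff_right)
qed

text \<open>
  The rates of \<open>lin_remainder \<epsilon> u u''\<close> for \<open>u''\<close> with one or two derivatives, respectively.
\<close>

definition error_rate :: "real \<Rightarrow> real" where "error_rate \<epsilon> = (\<Sum>n. b / \<epsilon>^2 * (w n * (3 * h \<epsilon> n^2 * min 4
    (h \<epsilon> n))))"
definition residual_rate :: "real \<Rightarrow> real"
    where "residual_rate \<epsilon> = (\<Sum>n. b / \<epsilon>^2 * (w n * (3 * h \<epsilon> n^2 * min 4 (h \<epsilon> n^2))))"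

text \<open>The cap 4 alone gives summability, since the sum of m^(2-a) converges for a > 3.\<close>

lemma error_rate_summable:
  assumes "\<epsilon> > 0" "\<And>n. 0 \<le> m n" "\<And>n. m n \<le> (4::real)"
  shows "summable (\<lambda>n. b / \<epsilon>^2 * (w n * (3 * h \<epsilon> n^2 * m n)))"
proof (rule summable_comparison_test)
  have "summable (\<lambda>n. w n * h \<epsilon> n^2 * (b / \<epsilon>^2 * 12))" using weight2_sums sums_summable summable_mult2 by blast
  then show "summable (\<lambda>n. b / \<epsilon>^2 * (w n * (3 * h \<epsilon> n^2 * 4)))" by (simp add: mult_ac)
  show "\<exists>N. \<forall>n\<ge>N. norm (b / \<epsilon>^2 * (w n * (3 * h \<epsilon> n^2 * m n))) \<le> b / \<epsilon>^2 * (w n * (3 * h \<epsilon> n^2 * 4))"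
  proof (intro exI allI impI)
    fix n
    have "\<bar>b / \<epsilon>^2 * (w n * (3 * h \<epsilon> n^2 * m n))\<bar> = b / \<epsilon>^2 * (w n * (3 * h \<epsilon> n^2 * m n))"
      using assms(2)[of n] w_pos[of n] b_pos by (intro abs_of_nonneg) simp
    also have "\<dots> \<le> b / \<epsilon>^2 * (w n * (3 * h \<epsilon> n^2 * 4))"
      using assms(3)[of n] w_pos[of n] b_pos by (intro mult_left_mono) auto
    finally show "norm (b / \<epsilon>^2 * (w n * (3 * h \<epsilon> n^2 * m n))) \<le> b / \<epsilon>^2 * (w n * (3 * h \<epsilon> n^2 * 4))" by simp
  qed
qed

lemma l2_norm_lin_remainder:
  assumes D: "second_deriv u d" and e: "\<epsilon> > 0"
  shows "l2_norm (fn (lin_remainder \<epsilon> u d)) \<le> error_rate \<epsilon> * norm d"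
proof -
  have s: "summable (\<lambda>n. b / \<epsilon>^2 * (w n * (3 * h \<epsilon> n^2 * min 4 (h \<epsilon> n))))"
    using e h_pos[OF e] by (intro error_rate_summable) (auto simp: less_imp_le)
  have "l2_norm (fn (lin_remainder \<epsilon> u d)) \<le> (\<Sum>n. b / \<epsilon>^2 * (w n * (3 * h \<epsilon> n^2 * min 4 (h \<epsilon> n))) * norm d)"
    unfolding lin_remainder_def
  proof (rule l2_norm_fn_suminf)
    show "summable (\<lambda>n. w n *\<^sub>R ((b / \<epsilon>^2) *\<^sub>R avg_remainder (h \<epsilon> n) u d))"
        by (rule lin_remainder_summable[OF D e])
    show "summable (\<lambda>n. b / \<epsilon>^2 * (w n * (3 * h \<epsilon> n^2 * min 4 (h \<epsilon> n))) * norm d)"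
      using s by (rule summable_mult2)
    fix n
    \<comment> \<open>The Lipschitz bound alone would lead to the sum of m^(3-a), which diverges for
      a \<le> 4; hence the minimum with the trivial bound 4.\<close>
    have "l2_bounded (second_diff s (fn d)) (min 4 (h \<epsilon> n) * norm d)" if s: "0 \<le> s" "s \<le> h \<epsilon> n / 2" for s
    proof -
      have "(norm d * \<bar>s\<bar>) + (norm d * \<bar>s\<bar>) \<le> h \<epsilon> n * norm d"
        using mult_right_mono[of "2 * s" "h \<epsilon> n" "norm d"] s by (simp add: algebra_simps)
      with l2_bounded_second_diff_lip have "l2_bounded (second_diff s (fn d)) (h \<epsilon> n * norm d)"
          by (rule l2_bounded_mono)
      moreover have "l2_bounded (second_diff s (fn d)) (4 * norm d)"
          by (intro h1_bounded_l2_bounded h1_bounded_second_diff h1_bounded_norm)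
      ultimately show ?thesis by (simp add: min_def)
    qed
    from l2_norm_avg_remainder[OF D h_pos[OF e] this]
    have P: "l2_norm (fn (avg_remainder (h \<epsilon> n) u d)) \<le> 3 * h \<epsilon> n^2 * (min 4 (h \<epsilon> n) * norm d)" by simp
    have "l2_norm (fn ((w n * (b / \<epsilon>^2)) *\<^sub>R avg_remainder (h \<epsilon> n) u d)) \<le> \<bar>w n * (b / \<epsilon>^2)\<bar> * l2_norm
        (fn (avg_remainder (h \<epsilon> n) u d))"
      by (rule l2_norm_fn_scale)
    also have "\<dots> \<le> w n * (b / \<epsilon>^2) * (3 * h \<epsilon> n^2 * (min 4 (h \<epsilon> n) * norm d))"
      using P w_pos[of n] b_pos by (simp add: less_imp_le mult_left_mono divide_right_mono)
    finally show "l2_norm (fn (w n *\<^sub>R ((b / \<epsilon>^2) *\<^sub>R avg_remainder (h \<epsilon> n) u d))) \<le> b / \<epsilon>^2 * (w n * (3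
        * h \<epsilon> n^2 * min 4 (h \<epsilon> n))) * norm d"
      by (simp add: mult_ac)
  qed
  also have "\<dots> = error_rate \<epsilon> * norm d" unfolding error_rate_def using s by (rule suminf_mult2[symmetric])
  finally show ?thesis .
qed

text \<open>Meant for the soliton, whose higher derivatives are available: the error is then small
  in H^1 itself, without recourse to smoothing.\<close>

lemma norm_lin_remainder:
  assumes D: "second_deriv u d" and D': "second_deriv d d'" and e: "\<epsilon> > 0"
  shows "norm (lin_remainder \<epsilon> u d) \<le> residual_rate \<epsilon> * (norm d + norm d')"
proof -
  have s: "summable (\<lambda>n. b / \<epsilon>^2 * (w n * (3 * h \<epsilon> n^2 * min 4 (h \<epsilon> n^2))))"
    using e h_pos[OF e] by (intro error_rate_summable) (auto simp: less_imp_le)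
  have "norm (lin_remainder \<epsilon> u d) \<le> (\<Sum>n. b / \<epsilon>^2 * (w n * (3 * h \<epsilon> n^2 * min 4 (h \<epsilon> n^2))) * (norm d +
      norm d'))"
    unfolding lin_remainder_def
  proof (rule norm_suminf_le)
    show "summable (\<lambda>n. b / \<epsilon>^2 * (w n * (3 * h \<epsilon> n^2 * min 4 (h \<epsilon> n^2))) * (norm d + norm d'))"
      using s by (rule summable_mult2)
    fix n
    have "h1_bounded (second_diff s (fn d)) (min 4 (h \<epsilon> n^2) * (norm d + norm d'))"
        if s: "0 \<le> s" "s \<le> h \<epsilon> n / 2" for s
    proof -
      have "s^2 \<le> (h \<epsilon> n/2)^2" using s by (intro power_mono) auto
      then have "s^2 \<le> h \<epsilon> n^2 / 4" by (simp add: power_divide)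
      with zero_le_power2[of s] have "2 * s^2 \<le> h \<epsilon> n^2" by linarith
      then have "2 * s^2 * norm d' \<le> h \<epsilon> n^2 * (norm d + norm d')" by (intro mult_mono) auto
      then have "h1_bounded (second_diff s (fn d)) (h \<epsilon> n^2 * (norm d + norm d'))"
        by (rule h1_bounded_mono[OF h1_bounded_second_diff_second_deriv[OF D' s(1)]])
      moreover have "h1_bounded (second_diff s (fn d)) (4 * (norm d + norm d'))"
        by (rule h1_bounded_mono[OF h1_bounded_second_diff[OF h1_bounded_norm]]) auto
      ultimately show ?thesis by (simp add: min_def)
    qed
    from norm_avg_remainder[OF D h_pos[OF e] this]
    have P: "norm (avg_remainder (h \<epsilon> n) u d) \<le> 3 * h \<epsilon> n^2 * (min 4 (h \<epsilon> n^2) * (norm d + norm d'))" by simp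
    have "norm (w n *\<^sub>R ((b / \<epsilon>^2) *\<^sub>R avg_remainder (h \<epsilon> n) u d)) = w n * (b / \<epsilon>^2) * norm
        (avg_remainder (h \<epsilon> n) u d)"
      using w_pos[of n] b_pos by (simp add: abs_mult)
    also have "\<dots> \<le> w n * (b / \<epsilon>^2) * (3 * h \<epsilon> n^2 * (min 4 (h \<epsilon> n^2) * (norm d + norm d')))"
      using P w_pos[of n] b_pos by (intro mult_left_mono) (auto simp: less_imp_le)
    finally show "norm (w n *\<^sub>R ((b / \<epsilon>^2) *\<^sub>R avg_remainder (h \<epsilon> n) u d)) \<le> b / \<epsilon>^2 * (w n * (3 * h \<epsilon>
        n^2 * min 4 (h \<epsilon> n^2))) * (norm d + norm d')"
      by (simp add: mult_ac)
  qed
  also have "\<dots> = residual_rate \<epsilon> * (norm d + norm d')" unfolding residual_rate_def using s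
      by (rule suminf_mult2[symmetric])
  finally show ?thesis .
qed

end

section \<open>The linearised Korteweg-de Vries profile equation\<close>

lemma cont_of_deriv:
  assumes "\<And>x. (f has_real_derivative f' x) (at x)" shows "continuous_on S f"
  by (rule DERIV_continuous_on) (rule has_field_derivative_at_within[OF assms])

lemma deriv_reflect:
  assumes "\<And>x. (f has_real_derivative f' x) (at x)"
  shows "((\<lambda>x. f (- x)) has_real_derivative - f' (- x)) (at (x::real))"
  using assms[of "- x"] by (simp add: DERIV_mirror)

lemma abs_tanh_le_1: "\<bar>tanh (x::real)\<bar> \<le> 1"
  using tanh_real_lt_1[of x] tanh_real_gt_neg1[of x] by (simp add: abs_le_iff)

definition sech_sq :: "real \<Rightarrow> real" where "sech_sq x = 1 - (tanh (x/2))^2"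

lemma sech_sq_cosh: "sech_sq x = (1 / cosh (x/2))^2"
proof -
  have "(cosh (x/2))^2 - (sinh (x/2))^2 = 1" by (rule hyperbolic_pythagoras)
  then show ?thesis
    using cosh_real_pos[of "x/2"] by (simp add: sech_sq_def tanh_def power_divide diff_divide_eq_iff)
qed

lemma tanh_half_deriv: "((\<lambda>x. tanh (x/2)) has_real_derivative sech_sq x / 2) (at x)"
  by (auto simp: sech_sq_def intro!: derivative_eq_intros)

lemma sech_sq_deriv: "(sech_sq has_real_derivative - tanh (x/2) * sech_sq x) (at x)"
  unfolding sech_sq_def[abs_def]
  by (auto intro!: derivative_eq_intros simp: algebra_simps power2_eq_square)

lemma sech_sq_even [simp]: "sech_sq (-x) = sech_sq x"
  by (simp add: sech_sq_def)

lemma sech_sq_pos: "0 < sech_sq x"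
  by (simp add: sech_sq_cosh)

lemma sech_sq_le_1: "sech_sq x \<le> 1"
  by (simp add: sech_sq_def)

lemma sech_sq_exp: "sech_sq x \<le> 4 * exp (-\<bar>x\<bar>)"
proof -
  have "cosh (x/2) = cosh (\<bar>x\<bar>/2)" by (simp add: abs_if)
  also have "\<dots> \<ge> exp (\<bar>x\<bar>/2) / 2" by (simp add: cosh_def)
  finally have "(exp (\<bar>x\<bar>/2) / 2)^2 \<le> (cosh (x/2))^2" by (intro power_mono) auto
  then have "exp \<bar>x\<bar> / 4 \<le> (cosh (x/2))^2" by (simp add: power_divide exp_double[symmetric])
  then have "1 / (cosh (x/2))^2 \<le> 1 / (exp \<bar>x\<bar> / 4)" by (intro divide_left_mono) auto
  then show ?thesis by (simp add: sech_sq_cosh power_divide exp_minus field_simps)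
qed

lemma inv_sech_sq_exp: "1 / sech_sq x \<le> exp \<bar>x\<bar>"
proof -
  have "cosh (x/2) = cosh (\<bar>x\<bar>/2)" by (simp add: abs_if)
  also have "\<dots> \<le> exp (\<bar>x\<bar>/2)" by (simp add: cosh_def)
  finally have "(cosh (x/2))^2 \<le> (exp (\<bar>x\<bar>/2))^2" by (intro power_mono) auto
  then show ?thesis by (simp add: sech_sq_cosh power_divide exp_double[symmetric])
qed

lemma l2_bounded_exp_decay:
  assumes c: "continuous_on UNIV z" and b: "\<And>x. \<bar>z x\<bar> \<le> M * exp (-\<bar>x\<bar>/2)"
  shows "l2_bounded z (2 * M)"
proof -
  have M0: "0 \<le> M" using order_trans[OF abs_ge_zero b[of 0]] by simp
  have one: "(\<integral>\<^sup>+x. ennreal (exp (-x)) * indicator {0..} x \<partial>lborel) = 1"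
    using nn_integral_has_integral_lebesgue'[of "{0..}" "\<lambda>x. exp (-x)"
        1] has_integral_exp_minus_to_infinity[of 1 0] by simp
  have two: "(\<integral>\<^sup>+x. ennreal (exp x) * indicator {..0} x \<partial>lborel) = 1"
    using one by (subst nn_integral_real_affine[where c="-1" and t=0]) (auto simp: indicator_def)
  have "(\<integral>\<^sup>+x. ennreal ((z x)^2) \<partial>lborel)
      \<le> (\<integral>\<^sup>+x. ennreal (M^2) * (ennreal (exp (-x)) * indicator {0..} x + ennreal (exp x) * indicator
          {..0} x) \<partial>lborel)"
  proof (rule nn_integral_mono)
    fix x
    have "(z x)^2 \<le> (M * exp (-\<bar>x\<bar>/2))^2"
        using b[of x] abs_le_square_iff[of "z x" "M * exp (-\<bar>x\<bar>/2)"] M0 by simp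
    also have "\<dots> = M^2 * exp (-\<bar>x\<bar>)" by (simp add: power_mult_distrib exp_double[symmetric])
    finally have "ennreal ((z x)^2) \<le> ennreal (M^2) * ennreal (exp (-\<bar>x\<bar>))"
        by (simp add: ennreal_mult'[symmetric] ennreal_leI)
    also have "\<dots> \<le> ennreal (M^2) * (ennreal (exp (-x)) * indicator {0..} x + ennreal (exp x) * indicator
        {..0} x)"
      by (intro mult_left_mono) (auto simp: indicator_def abs_if)
    finally show "ennreal ((z x)^2) \<le> ennreal (M^2) * (ennreal (exp (-x)) * indicator {0..} x + ennreal
        (exp x) * indicator {..0} x)" .
  qed
  also have "\<dots> = ennreal (M^2) * (1 + 1)"
    by (simp add: nn_integral_cmult nn_integral_add one two)
  also have "\<dots> \<le> ennreal (M^2) * ennreal 4" by (intro mult_left_mono) auto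
  also have "\<dots> = ennreal ((2 * M)^2)" by (simp add: ennreal_mult[symmetric] power_mult_distrib
      mult.commute del: ennreal_numeral)
  finally show ?thesis using c M0 by (simp add: l2_bounded_def)
qed

lemma h1_bounded_exp_decay:
  assumes d: "\<And>x. (z has_real_derivative z' x) (at x)" and c: "continuous_on UNIV z'"
    and b: "\<And>x. \<bar>z x\<bar> \<le> M * exp (-\<bar>x\<bar>/2)" "\<And>x. \<bar>z' x\<bar> \<le> M * exp (-\<bar>x\<bar>/2)"
  shows "h1_bounded z (2 * M)"
proof (rule h1bI)
  have "continuous_on UNIV z" using d by (rule cont_of_deriv)
  then show "l2_bounded z (2 * M)" using b by (intro l2_bounded_exp_decay)
  show "l2_bounded (shiftdiff r z) (2 * M * \<bar>r\<bar>)" for r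
    by (rule l2_bounded_shiftdiff_C1[OF d l2_bounded_exp_decay[OF c b(2)]])
qed

definition sech_sq_h1 :: h1 where "sech_sq_h1 = Abs_h1 sech_sq"

lemma sech_sq_cont: "continuous_on S sech_sq"
  using sech_sq_deriv by (rule cont_of_deriv)

lemma exp_half: "exp (-\<bar>x\<bar>) \<le> exp (-\<bar>x::real\<bar>/2)"
  by simp

lemma fn_sech_sq_h1 [simp]: "fn sech_sq_h1 x = sech_sq x"
proof -
  have le: "\<bar>sech_sq x\<bar> \<le> 4 * exp (-\<bar>x\<bar>/2)" for x
    using sech_sq_exp[of x] sech_sq_pos[of x] exp_half[of x] by linarith
  have "h1_bounded sech_sq (2 * 4)"
  proof (rule h1_bounded_exp_decay[OF sech_sq_deriv])
    show "continuous_on UNIV (\<lambda>x. - tanh (x/2) * sech_sq x)"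
      by (intro continuous_intros sech_sq_cont) auto
    show "\<bar>- tanh (x/2) * sech_sq x\<bar> \<le> 4 * exp (-\<bar>x\<bar>/2)" for x
      using mult_mono[of "\<bar>tanh (x/2)\<bar>" 1 "\<bar>sech_sq x\<bar>" "4 * exp (-\<bar>x\<bar>/2)"] le[of x] abs_tanh_le_1[of "x/2"]
      by (simp add: abs_mult)
  qed (rule le)
  then show ?thesis unfolding sech_sq_h1_def by (subst fn_Abs) auto
qed

text \<open>Decay singles out one solution of the inhomogeneous equation, so that the Green operator
  is characterised by its equation. The rate is 1/2 and not 1 because variation of parameters
  produces terms like x exp(-x).\<close>

definition decaying_deriv :: "h1 \<Rightarrow> h1 \<Rightarrow> bool" where
  "decaying_deriv u d \<longleftrightarrow> (\<exists>u' M. (\<forall>x. (fn u has_real_derivative u' x) (at x)) \<and>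
      (\<forall>x. (u' has_real_derivative fn d x) (at x))
     \<and> (\<forall>x. \<bar>fn u x\<bar> \<le> M * exp (-\<bar>x\<bar>/2)) \<and> (\<forall>x. \<bar>u' x\<bar> \<le> M * exp (-\<bar>x\<bar>/2)))"

lemma decaying_deriv_second_deriv: "decaying_deriv u d \<Longrightarrow> second_deriv u d"
  unfolding decaying_deriv_def second_deriv_def by blast

lemma decaying_deriv_add:
  assumes "decaying_deriv u d" "decaying_deriv v e" shows "decaying_deriv (u + v) (d + e)"
proof -
  obtain u' M where u: "\<And>x. (fn u has_real_derivative u' x) (at x)" "\<And>x. (u' has_real_derivative fn d x) (at x)"
    "\<And>x. \<bar>fn u x\<bar> \<le> M * exp (-\<bar>x\<bar>/2)" "\<And>x. \<bar>u' x\<bar> \<le> M * exp (-\<bar>x\<bar>/2)"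
    using assms(1) unfolding decaying_deriv_def by blast
  obtain v' N where v: "\<And>x. (fn v has_real_derivative v' x) (at x)" "\<And>x. (v' has_real_derivative fn e x) (at x)"
    "\<And>x. \<bar>fn v x\<bar> \<le> N * exp (-\<bar>x\<bar>/2)" "\<And>x. \<bar>v' x\<bar> \<le> N * exp (-\<bar>x\<bar>/2)"
    using assms(2) unfolding decaying_deriv_def by blast
  show ?thesis
    unfolding decaying_deriv_def fn_plus_fun
    using u v by (intro exI[of _ "\<lambda>x. u' x + v' x"] exI[of _ "M + N"] conjI allI DERIV_add)
      (auto simp: distrib_right intro: order_trans[OF abs_triangle_ineq add_mono])
qed

lemma decaying_deriv_scale:
  assumes "decaying_deriv u d" shows "decaying_deriv (c *\<^sub>R u) (c *\<^sub>R d)"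
proof -
  obtain u' M where u: "\<And>x. (fn u has_real_derivative u' x) (at x)" "\<And>x. (u' has_real_derivative fn d x) (at x)"
    "\<And>x. \<bar>fn u x\<bar> \<le> M * exp (-\<bar>x\<bar>/2)" "\<And>x. \<bar>u' x\<bar> \<le> M * exp (-\<bar>x\<bar>/2)"
    using assms(1) unfolding decaying_deriv_def by blast
  show ?thesis
    unfolding decaying_deriv_def fn_scaleR_fun
    using u by (intro exI[of _ "\<lambda>x. c * u' x"] exI[of _ "\<bar>c\<bar> * M"] conjI allI DERIV_cmult)
      (auto simp: abs_mult mult.assoc intro!: mult_left_mono)
qed

lemma decaying_deriv_diff: "decaying_deriv u d \<Longrightarrow> decaying_deriv v e \<Longrightarrow> decaying_deriv (u - v) (d - e)"
  using decaying_deriv_add[of u d "(-1) *\<^sub>R v" "(-1) *\<^sub>R e"] decaying_deriv_scale[of v e "-1"] by simp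

text \<open>
  \<open>y1\<close> decays at \<open>+\<infinity>\<close>, and \<open>y2\<close> grows there but has derivative 0 at 0, so that Green's function built from
  them solves \<open>y'' - (1 - 3 c sech\<^sup>2(x/2)) y = -r\<close> for even \<open>r\<close> by an even function. For \<open>c = 0\<close> this is
  \<open>(1 - \<partial>\<^sup>2)\<^sup>-\<^sup>1\<close>, for \<open>c = 1\<close> the inverse of the linearised operator.
\<close>

locale green =
  fixes c K :: real and y1 y1' y2 y2' :: "real \<Rightarrow> real"
  assumes y1: "\<And>x. (y1 has_real_derivative y1' x) (at x)"
    and y1': "\<And>x. (y1' has_real_derivative (1 - 3 * c * sech_sq x) * y1 x) (at x)"
    and y2: "\<And>x. (y2 has_real_derivative y2' x) (at x)"
    and y2': "\<And>x. (y2' has_real_derivative (1 - 3 * c * sech_sq x) * y2 x) (at x)"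
    and W: "\<And>x. y1 x * y2' x - y1' x * y2 x = 1"
    and y2'0: "y2' 0 = 0"
    and b1: "\<And>x. 0 \<le> x \<Longrightarrow> \<bar>y1 x\<bar> \<le> K * exp (-x)" "\<And>x. 0 \<le> x \<Longrightarrow> \<bar>y1' x\<bar> \<le> K * exp (-x)"
    and b2: "\<And>x. 0 \<le> x \<Longrightarrow> \<bar>y2 x\<bar> \<le> K * exp x" "\<And>x. 0 \<le> x \<Longrightarrow> \<bar>y2' x\<bar> \<le> K * exp x"
begin

abbreviation "q x \<equiv> 1 - 3 * c * sech_sq x"

lemma K0: "0 \<le> K" using order_trans[OF abs_ge_zero b1(1)[of 0]] by simp

lemma c1: "continuous_on UNIV y1" and c2: "continuous_on UNIV y2"
  by (rule cont_of_deriv, rule y1 y2)+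

text \<open>The Wronskians of d with y1 and with y2 are constant and vanish at 0. As y1 and y2 have
  Wronskian 1, d is a combination of these two zeros.\<close>

lemma homogeneous_zero:
  assumes d: "\<And>x. (d has_real_derivative d' x) (at x)" "\<And>x. (d' has_real_derivative q x * d x) (at x)"
    and d'0: "d' 0 = 0" and W0: "d 0 * y1' 0 - d' 0 * y1 0 = 0"
  shows "d x = 0"
proof -
  have "((\<lambda>x. d x * y1' x - d' x * y1 x) has_real_derivative 0) (at x)" for x
    by (rule DERIV_cong[OF DERIV_diff[OF DERIV_mult[OF d(1) y1'] DERIV_mult[OF d(2) y1]]]) (simp
        add: algebra_simps)
  from DERIV_isconst_all[of "\<lambda>x. d x * y1' x - d' x * y1 x", OF allI, OF this, of x 0]
  have 1: "d x * y1' x = d' x * y1 x" using W0 by simp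
  have "((\<lambda>x. d x * y2' x - d' x * y2 x) has_real_derivative 0) (at x)" for x
    by (rule DERIV_cong[OF DERIV_diff[OF DERIV_mult[OF d(1) y2'] DERIV_mult[OF d(2) y2]]]) (simp
        add: algebra_simps)
  from DERIV_isconst_all[of "\<lambda>x. d x * y2' x - d' x * y2 x", OF allI, OF this, of x 0]
  have 2: "d x * y2' x = d' x * y2 x" using d'0 y2'0 by simp
  have "d x = d x * (y1 x * y2' x - y1' x * y2 x)" using W by simp
  also have "\<dots> = y1 x * (d x * y2' x) - y2 x * (d x * y1' x)" by (simp add: algebra_simps)
  also have "\<dots> = 0" unfolding 1 2 by simp
  finally show ?thesis .
qed

text \<open>Evenness gives u'(0) = 0. The Wronskian of u with y1 is constant, and it tends to 0 at
  +\<infinity>, where u and u' stay bounded while y1 and y1' decay; hence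
  \<open>homogeneous_zero\<close> applies.\<close>

lemma decaying_zero:
  assumes "decaying_deriv u (u - (3 * c) *\<^sub>R mult_h1 sech_sq_h1 u)"
  shows "u = 0"
proof (rule h1_eqI)
  fix x
  obtain u' M where u: "\<And>x. (fn u has_real_derivative u' x) (at x)" "\<And>x. (u' has_real_derivative q x *
      fn u x) (at x)"
    "\<And>x. \<bar>fn u x\<bar> \<le> M * exp (-\<bar>x\<bar>/2)" "\<And>x. \<bar>u' x\<bar> \<le> M * exp (-\<bar>x\<bar>/2)"
    using assms unfolding decaying_deriv_def by (auto simp: algebra_simps)
  have M0: "0 \<le> M" using order_trans[OF abs_ge_zero u(3)[of 0]] by simp
  have "((\<lambda>x. fn u (- x)) has_real_derivative - u' 0) (at 0)"
    using deriv_reflect[OF u(1), of 0] by simp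
  then have "(fn u has_real_derivative - u' 0) (at 0)" by simp
  from DERIV_unique[OF u(1) this] have u'0: "u' 0 = 0" by simp
  let ?W = "\<lambda>x. fn u x * y1' x - u' x * y1 x"
  have "(?W has_real_derivative 0) (at x)" for x
    by (rule DERIV_cong[OF DERIV_diff[OF DERIV_mult[OF u(1) y1'] DERIV_mult[OF u(2) y1]]]) (simp
        add: algebra_simps)
  then have const: "?W x = ?W 0" for x
    using DERIV_isconst_all[of ?W x 0] by blast
  have bound: "\<bar>?W 0\<bar> \<le> 2 * (M * K) * exp (-x)" if x: "0 \<le> x" for x
  proof -
    have e: "M * exp (-\<bar>x\<bar>/2) \<le> M" using M0 x by (simp add: mult_left_le)
    have "\<bar>?W x\<bar> \<le> \<bar>fn u x\<bar> * \<bar>y1' x\<bar> + \<bar>u' x\<bar> * \<bar>y1 x\<bar>" by (metis abs_mult abs_triangle_ineq4)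
    also have "\<dots> \<le> M * (K * exp (-x)) + M * (K * exp (-x))"
      using u(3,4)[of x] e b1[OF x] M0 by (intro add_mono mult_mono) auto
    finally show ?thesis using const[of x] by (simp add: algebra_simps)
  qed
  have "\<bar>?W 0\<bar> \<le> 0"
  proof (rule tendsto_lowerbound)
    show "((\<lambda>x. 2 * (M * K) * exp (-x)) \<longlongrightarrow> 0) at_top"
      using tendsto_mult_left[OF filterlim_compose[OF exp_at_bot filterlim_uminus_at_bot_at_top], of "2
          * (M * K)"] by simp
    show "\<forall>\<^sub>F x in at_top. \<bar>?W 0\<bar> \<le> 2 * (M * K) * exp (-x)"
      using eventually_ge_at_top[of 0] by eventually_elim (rule bound)
  qed auto
  then have "fn u x = 0" using u u'0 by (intro homogeneous_zero[of "fn u" u']) auto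
  then show "fn u x = fn 0 x" by simp
qed

text \<open>The integral of y1 r over [x, \<infinity>), written so that it can be differentiated at
  negative x as well.\<close>

definition I1 where "I1 r x = integral {0..} (\<lambda>y. y1 y * r y) - primitive (\<lambda>y. y1 y * r y) x"
definition I2 where "I2 r x = primitive (\<lambda>y. y2 y * r y) x"
definition G where "G r x = y1 x * I2 r x + y2 x * I1 r x"
definition G' where "G' r x = y1' x * I2 r x + y2' x * I1 r x"

lemma I1_deriv: "continuous_on UNIV r \<Longrightarrow> (I1 r has_real_derivative - (y1 x * r x)) (at x)"
  unfolding I1_def[abs_def]
  using DERIV_diff[OF DERIV_const primitive_deriv[OF continuous_on_mult[OF c1]], of r] by simp

lemma I2_deriv: "continuous_on UNIV r \<Longrightarrow> (I2 r has_real_derivative y2 x * r x) (at x)"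
  unfolding I2_def[abs_def] by (rule primitive_deriv) (intro continuous_intros c2)

lemma G_deriv:
  assumes "continuous_on UNIV r"
  shows "(G r has_real_derivative G' r x) (at x)"
    and "(G' r has_real_derivative q x * G r x - r x) (at x)"
proof -
  show "(G r has_real_derivative G' r x) (at x)"
    unfolding G_def[abs_def] G'_def
    by (rule DERIV_cong[OF DERIV_add[OF DERIV_mult[OF y1 I2_deriv] DERIV_mult[OF y2 I1_deriv]]])
      (use assms in \<open>auto simp: algebra_simps\<close>)
  have "r x = r x * (y1 x * y2' x - y1' x * y2 x)" using W by simp
  then show "(G' r has_real_derivative q x * G r x - r x) (at x)"
    unfolding G'_def[abs_def] G_def
    by (intro DERIV_cong[OF DERIV_add[OF DERIV_mult[OF y1' I2_deriv] DERIV_mult[OF y2' I1_deriv]]])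
      (use assms in \<open>auto simp: algebra_simps\<close>)
qed

text \<open>G(x) - G(-x) solves the homogeneous equation, and its data at 0 vanish because I2(0) = 0
  and y2'(0) = 0.\<close>

lemma G_even:
  assumes r: "continuous_on UNIV r" "\<And>x. r (-x) = r x"
  shows "G r (-x) = G r x"
proof -
  note m = deriv_reflect
  have "G r x - G r (-x) = 0"
  proof (rule homogeneous_zero[where d="\<lambda>x. G r x - G r (-x)"])
    show "((\<lambda>x. G r x - G r (-x)) has_real_derivative G' r x + G' r (-x)) (at x)" for x
      using DERIV_diff[OF G_deriv(1)[OF r(1)] m[OF G_deriv(1)[OF r(1)]]] by simp
    show "((\<lambda>x. G' r x + G' r (-x)) has_real_derivative q x * (G r x - G r (-x))) (at x)" for x
      by (rule DERIV_cong[OF DERIV_add[OF G_deriv(2)[OF r(1)] m[OF G_deriv(2)[OF r(1)]]]])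
        (simp add: r(2) algebra_simps)
  qed (auto simp: G'_def I2_def y2'0)
  then show ?thesis by simp
qed

text \<open>The bounds on y1 and y2 are given for x \<ge> 0 only, so the estimates are proved there
  and carried over by parity. The bound on I2 grows linearly, which is absorbed by giving up half of
  the decay rate.\<close>

lemma G_bound:
  assumes r: "continuous_on UNIV r" "\<And>x. r (-x) = r x" "\<And>x. \<bar>r x\<bar> \<le> N * exp (-\<bar>x\<bar>)"
  shows "\<bar>G r x\<bar> \<le> 3 * K^2 * N * exp (-\<bar>x\<bar>/2)" "\<bar>G' r x\<bar> \<le> 3 * K^2 * N * exp (-\<bar>x\<bar>/2)"
proof -
  have N0: "0 \<le> N" using order_trans[OF abs_ge_zero r(3)[of 0]] by simp
  have KN: "0 \<le> K * N" using K0 N0 by simp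
  let ?f = "\<lambda>y. y1 y * r y"
  have cf: "continuous_on UNIV ?f" by (intro continuous_intros c1 r)
  have fb: "\<bar>?f y\<bar> \<le> K * N * exp (-2 * y)" if "0 \<le> y" for y
  proof -
    have "\<bar>?f y\<bar> \<le> (K * exp (-y)) * (N * exp (-y))"
      unfolding abs_mult using b1(1)[OF that] r(3)[of y] that K0 by (intro mult_mono) auto
    then show ?thesis by (simp add: algebra_simps exp_add[symmetric])
  qed
  have gi: "((\<lambda>y. K * N * exp (-2 * y)) has_integral (K * N * (exp (-2 * x) / 2))) {x..}" for x
    using has_integral_mult_right[OF has_integral_exp_minus_to_infinity[of 2 x], of "K * N"] by simp
  have fi: "?f integrable_on {x..}" if x: "0 \<le> x" for x
  proof (rule measurable_bounded_by_integrable_imp_integrable)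
    show "?f \<in> borel_measurable (lebesgue_on {x..})"
      by (intro continuous_imp_measurable_on_sets_lebesgue continuous_on_subset[OF cf]) auto
    show "(\<lambda>y. K * N * exp (-2 * y)) integrable_on {x..}" using gi by blast
    show "norm (?f y) \<le> K * N * exp (-2 * y)" if "y \<in> {x..}" for y
      using fb[of y] that x by simp
  qed auto
  have I1: "\<bar>I1 r x\<bar> \<le> K * N * exp (-2 * x)" if x: "0 \<le> x" for x
  proof -
    have "(?f has_integral (integral {0..x} ?f + integral {x..} ?f)) ({0..x} \<union> {x..})"
    proof (rule has_integral_Un)
      show "(?f has_integral integral {0..x} ?f) {0..x}"
        by (intro integrable_integral integrable_continuous_real continuous_on_subset[OF cf]) auto
      show "(?f has_integral integral {x..} ?f) {x..}" using fi[OF x] by (rule integrable_integral)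
      have "{0..x} \<inter> {x..} = {x}" using x by auto
      then show "negligible ({0..x} \<inter> {x..})" by simp
    qed
    moreover have "{0..x} \<union> {x..} = {0..}" using x by auto
    ultimately have "integral {0..} ?f = integral {0..x} ?f + integral {x..} ?f" by (simp add: integral_unique)
    moreover have "primitive ?f x = integral {0..x} ?f" using x by (cases "x = 0") (auto simp: primitive_def)
    ultimately have "I1 r x = integral {x..} ?f" by (simp add: I1_def)
    also have "norm \<dots> \<le> integral {x..} (\<lambda>y. K * N * exp (-2 * y))"
      using fi[OF x] gi fb x by (intro integral_norm_bound_integral) auto
    also have "\<dots> = K * N * (exp (-2 * x) / 2)" using gi by (rule integral_unique)
    also have "\<dots> \<le> K * N * exp (-2 * x)" using KN by (intro mult_left_mono) auto
    finally show ?thesis by simp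
  qed
  have I2: "\<bar>I2 r x\<bar> \<le> K * N * x" if x: "0 \<le> x" for x
  proof -
    have "I2 r x = integral {0..x} (\<lambda>y. y2 y * r y)"
        using x by (cases "x = 0") (auto simp: I2_def primitive_def)
    also have "norm \<dots> \<le> (K * N) * (x - 0)"
    proof (rule integral_bound[OF x])
      show "continuous_on {0..x} (\<lambda>y. y2 y * r y)"
        by (intro continuous_intros continuous_on_subset[OF c2] continuous_on_subset[OF r(1)]) auto
      fix y assume y: "y \<in> {0..x}"
      have "\<bar>y2 y * r y\<bar> \<le> (K * exp y) * (N * exp (-y))"
        unfolding abs_mult using b2(1)[of y] r(3)[of y] y K0 by (intro mult_mono) auto
      then show "norm (y2 y * r y) \<le> K * N" by (simp add: algebra_simps exp_add[symmetric])
    qed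
    finally show ?thesis by simp
  qed
  have main: "\<bar>p * I2 r x + s * I1 r x\<bar> \<le> 3 * K^2 * N * exp (-\<bar>x\<bar>/2)"
    if x: "0 \<le> x" and p: "\<bar>p\<bar> \<le> K * exp (-x)" and s: "\<bar>s\<bar> \<le> K * exp x" for p s x
  proof -
    have "\<bar>p * I2 r x + s * I1 r x\<bar> \<le> \<bar>p\<bar> * \<bar>I2 r x\<bar> + \<bar>s\<bar> * \<bar>I1 r x\<bar>" by (metis abs_mult abs_triangle_ineq)
    also have "\<dots> \<le> (K * exp (-x)) * (K * N * x) + (K * exp x) * (K * N * exp (-2 * x))"
      using p s I1[OF x] I2[OF x] K0 KN x by (intro add_mono mult_mono) auto
    also have "\<dots> = K^2 * N * (x * exp (-x) + exp (-x))"
      by (simp add: algebra_simps power2_eq_square exp_add[symmetric])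
    also have "\<dots> \<le> K^2 * N * (3 * exp (-x/2))"
    proof (intro mult_left_mono)
      have "x \<le> 2 * exp (x/2)" using exp_ge_add_one_self[of "x/2"] x by linarith
      then have "x * exp (-x) \<le> 2 * exp (x/2) * exp (-x)" by (intro mult_right_mono) auto
      also have "\<dots> = 2 * exp (-x/2)" by (simp add: exp_add[symmetric])
      finally have "x * exp (-x) \<le> 2 * exp (-x/2)" .
      moreover have "exp (-x) \<le> exp (-x/2)" using x by simp
      ultimately show "x * exp (-x) + exp (-x) \<le> 3 * exp (-x/2)" by linarith
    qed (use N0 in auto)
    finally show ?thesis using x by simp
  qed
  have G: "\<bar>G r x\<bar> \<le> 3 * K^2 * N * exp (-\<bar>x\<bar>/2)" if "0 \<le> x" for x
    unfolding G_def using main[OF that b1(1)[OF that] b2(1)[OF that]] .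
  have G': "\<bar>G' r x\<bar> \<le> 3 * K^2 * N * exp (-\<bar>x\<bar>/2)" if "0 \<le> x" for x
    unfolding G'_def using main[OF that b1(2)[OF that] b2(2)[OF that]] .
  have odd: "G' r (-x) = - G' r x" for x
  proof -
    have "((\<lambda>x. G r (- x)) has_real_derivative - G' r (-x)) (at x)"
      by (rule deriv_reflect[OF G_deriv(1)[OF r(1)]])
    then have "(G r has_real_derivative - G' r (-x)) (at x)" by (simp add: G_even[OF r(1,2)])
    from DERIV_unique[OF G_deriv(1)[OF r(1), of x] this] show ?thesis by simp
  qed
  show "\<bar>G r x\<bar> \<le> 3 * K^2 * N * exp (-\<bar>x\<bar>/2)"
    using G[of x] G[of "-x"] G_even[OF r(1,2), of x] by (cases "0 \<le> x") auto
  show "\<bar>G' r x\<bar> \<le> 3 * K^2 * N * exp (-\<bar>x\<bar>/2)"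
    using G'[of x] G'[of "-x"] odd[of x] by (cases "0 \<le> x") auto
qed

text \<open>The factor 3 sech^2(x/2) is part of the operator because it supplies the exponential
  decay that \<open>G_bound\<close> asks of the right-hand side; V itself is merely bounded.\<close>

definition green_h1 :: "h1 \<Rightarrow> h1" where "green_h1 V = Abs_h1 (G (\<lambda>x. 3 * sech_sq x * fn V x))"

lemma
  shows decaying_deriv_green_h1: "decaying_deriv (green_h1 V) (green_h1 V - (3 * c) *\<^sub>R mult_h1
      sech_sq_h1 (green_h1 V) - 3 *\<^sub>R mult_h1 sech_sq_h1 V)"
    and norm_green_h1: "norm (green_h1 V) \<le> 144 * K^2 * norm V"
proof -
  let ?r = "\<lambda>x. 3 * sech_sq x * fn V x" let ?M = "3 * K^2 * (24 * norm V)"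
  have r: "continuous_on UNIV ?r" "\<And>x. ?r (-x) = ?r x" by (auto intro!: continuous_intros sech_sq_cont fn_cont)
  have rb: "\<bar>?r x\<bar> \<le> (24 * norm V) * exp (-\<bar>x\<bar>)" for x
  proof -
    have "\<bar>?r x\<bar> \<le> 3 * (4 * exp (-\<bar>x\<bar>)) * (2 * norm V)"
      unfolding abs_mult using sech_sq_exp[of x] sech_sq_pos[of x] fn_sup[of V x] by (intro mult_mono) auto
    then show ?thesis by (simp add: algebra_simps)
  qed
  note b = G_bound[OF r rb]
  have cG': "continuous_on UNIV (G' ?r)"
    using G_deriv(2)[OF r(1)] by (rule cont_of_deriv)
  have h: "h1_bounded (G ?r) (2 * ?M)"
    by (rule h1_bounded_exp_decay[OF G_deriv(1)[OF r(1)] cG' b])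
  have f: "fn (green_h1 V) = G ?r" unfolding green_h1_def by (rule fn_Abs[OF h G_even[OF r]])
  show "norm (green_h1 V) \<le> 144 * K^2 * norm V" using h f by (intro norm_h1_le) (simp add: algebra_simps)
  show "decaying_deriv (green_h1 V) (green_h1 V - (3 * c) *\<^sub>R mult_h1 sech_sq_h1 (green_h1 V) - 3 *\<^sub>R
      mult_h1 sech_sq_h1 V)"
    unfolding decaying_deriv_def
  proof (intro exI conjI allI)
    fix x
    show "(fn (green_h1 V) has_real_derivative G' ?r x) (at x)" unfolding f by (rule G_deriv(1)[OF r(1)])
    show "(G' ?r has_real_derivative fn (green_h1 V - (3 * c) *\<^sub>R mult_h1 sech_sq_h1 (green_h1 V) - 3
        *\<^sub>R mult_h1 sech_sq_h1 V) x) (at x)"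
      by (rule DERIV_cong[OF G_deriv(2)[OF r(1)]]) (simp add: f algebra_simps)
    show "\<bar>fn (green_h1 V) x\<bar> \<le> ?M * exp (-\<bar>x\<bar>/2)" unfolding f by (rule b(1))
    show "\<bar>G' ?r x\<bar> \<le> ?M * exp (-\<bar>x\<bar>/2)" by (rule b(2))
  qed
qed

text \<open>Linearity and the inverse identities for \<open>limit_op\<close> are read off from the
  differential equation by this uniqueness and not from the integral formula.\<close>

lemma green_h1_unique:
  assumes "decaying_deriv u (u - (3 * c) *\<^sub>R mult_h1 sech_sq_h1 u - 3 *\<^sub>R mult_h1 sech_sq_h1 V)"
  shows "u = green_h1 V"
proof -
  let ?d = "u - green_h1 V"
  have "decaying_deriv ?d ((u - (3 * c) *\<^sub>R mult_h1 sech_sq_h1 u - 3 *\<^sub>R mult_h1 sech_sq_h1 V) -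
      (green_h1 V - (3 * c) *\<^sub>R mult_h1 sech_sq_h1 (green_h1 V) - 3 *\<^sub>R mult_h1 sech_sq_h1 V))"
    by (intro decaying_deriv_diff assms decaying_deriv_green_h1)
  also have "(u - (3 * c) *\<^sub>R mult_h1 sech_sq_h1 u - 3 *\<^sub>R mult_h1 sech_sq_h1 V) - (green_h1 V - (3 * c)
      *\<^sub>R mult_h1 sech_sq_h1 (green_h1 V) - 3 *\<^sub>R mult_h1 sech_sq_h1 V)
     = ?d - (3 * c) *\<^sub>R mult_h1 sech_sq_h1 ?d" by (rule h1_eqI) (simp add: algebra_simps)
  finally have "?d = 0" by (rule decaying_zero)
  then show ?thesis by simp
qed

lemma bounded_linear_green_h1: "bounded_linear green_h1"
proof (rule bounded_linear_intro[where K="144 * K^2"])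
  show "green_h1 (U + V) = green_h1 U + green_h1 V" for U V
  proof (rule green_h1_unique[symmetric])
    have "decaying_deriv (green_h1 U + green_h1 V) ((green_h1 U - (3 * c) *\<^sub>R mult_h1 sech_sq_h1
        (green_h1 U) - 3 *\<^sub>R mult_h1 sech_sq_h1 U) + (green_h1 V - (3 * c) *\<^sub>R mult_h1 sech_sq_h1
        (green_h1 V) - 3 *\<^sub>R mult_h1 sech_sq_h1 V))"
      by (intro decaying_deriv_add decaying_deriv_green_h1)
    also have "(green_h1 U - (3 * c) *\<^sub>R mult_h1 sech_sq_h1 (green_h1 U) - 3 *\<^sub>R mult_h1 sech_sq_h1 U) +
        (green_h1 V - (3 * c) *\<^sub>R mult_h1 sech_sq_h1 (green_h1 V) - 3 *\<^sub>R mult_h1 sech_sq_h1 V)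
      = green_h1 U + green_h1 V - (3 * c) *\<^sub>R mult_h1 sech_sq_h1 (green_h1 U + green_h1 V) - 3 *\<^sub>R
          mult_h1 sech_sq_h1 (U + V)" by (rule h1_eqI) (simp add: algebra_simps)
    finally show "decaying_deriv (green_h1 U + green_h1 V) (green_h1 U + green_h1 V - (3 * c) *\<^sub>R
        mult_h1 sech_sq_h1 (green_h1 U + green_h1 V) - 3 *\<^sub>R mult_h1 sech_sq_h1 (U + V))" .
  qed
  show "green_h1 (k *\<^sub>R V) = k *\<^sub>R green_h1 V" for k V
  proof (rule green_h1_unique[symmetric])
    have "decaying_deriv (k *\<^sub>R green_h1 V) (k *\<^sub>R (green_h1 V - (3 * c) *\<^sub>R mult_h1 sech_sq_h1
        (green_h1 V) - 3 *\<^sub>R mult_h1 sech_sq_h1 V))"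
      by (intro decaying_deriv_scale decaying_deriv_green_h1)
    also have "k *\<^sub>R (green_h1 V - (3 * c) *\<^sub>R mult_h1 sech_sq_h1 (green_h1 V) - 3 *\<^sub>R mult_h1 sech_sq_h1 V)
      = k *\<^sub>R green_h1 V - (3 * c) *\<^sub>R mult_h1 sech_sq_h1 (k *\<^sub>R green_h1 V) - 3 *\<^sub>R mult_h1 sech_sq_h1
          (k *\<^sub>R V)" by (rule h1_eqI) (simp add: algebra_simps)
    finally show "decaying_deriv (k *\<^sub>R green_h1 V) (k *\<^sub>R green_h1 V - (3 * c) *\<^sub>R mult_h1 sech_sq_h1
        (k *\<^sub>R green_h1 V) - 3 *\<^sub>R mult_h1 sech_sq_h1 (k *\<^sub>R V))" .
  qed
qed (use norm_green_h1 in \<open>simp add: mult_ac\<close>)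

end

section \<open>The free and the linearised equation\<close>

abbreviation "th x \<equiv> tanh (x / 2 :: real)"

interpretation free: green 0 2 "\<lambda>x. exp (-x)" "\<lambda>x. - exp (-x)" cosh sinh
proof
  fix x :: real
  show "((\<lambda>x. exp (-x)) has_real_derivative - exp (-x)) (at x)" by (auto intro!: derivative_eq_intros)
  show "((\<lambda>x. - exp (-x)) has_real_derivative (1 - 3 * 0 * sech_sq x) * exp (-x)) (at x)"
      by (auto intro!: derivative_eq_intros)
  show "(cosh has_real_derivative sinh x) (at x)" by (auto intro!: derivative_eq_intros)
  show "(sinh has_real_derivative (1 - 3 * 0 * sech_sq x) * cosh x) (at x)"
      by (auto intro!: derivative_eq_intros)
  show "exp (-x) * sinh x - - exp (-x) * cosh x = 1"
    by (simp add: sinh_def cosh_def field_simps exp_add[symmetric])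
  assume x: "0 \<le> x"
  then have "exp (-x) \<le> exp x" by simp
  then show "\<bar>cosh x\<bar> \<le> 2 * exp x"
    using exp_gt_zero[of x] exp_gt_zero[of "-x"] unfolding abs_le_iff cosh_field_def by (intro conjI; argo)
  show "\<bar>sinh x\<bar> \<le> 2 * exp x" using \<open>exp (-x) \<le> exp x\<close>
    using exp_gt_zero[of x] exp_gt_zero[of "-x"] unfolding abs_le_iff sinh_field_def by (intro conjI; argo)
qed auto

text \<open>\<open>y1\<close> is the derivative of the soliton up to sign, and \<open>y2\<close> comes from reduction of order.\<close>

interpretation lin: green 1 20 "\<lambda>x. th x * sech_sq x" "\<lambda>x. 3/2 * (sech_sq x)^2 - sech_sq x"
  "\<lambda>x. 1/(2 * sech_sq x) + 5/4 - 15/4 * sech_sq x + 15/8 * (x * (th x * sech_sq x))"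
  "\<lambda>x. th x / (2 * sech_sq x) + 15/4 * (th x * sech_sq x) + 15/8 * (th x * sech_sq x + x * (3/2 *
      (sech_sq x)^2 - sech_sq x))"
proof
  fix x :: real
  note D [derivative_intros] = tanh_half_deriv sech_sq_deriv
  have t2: "(th y)^2 = 1 - sech_sq y" for y by (simp add: sech_sq_def)
  have tt: "th y * th y = 1 - sech_sq y" "th y * (th y * z) = (1 - sech_sq y) * z" for y z
    using t2[of y] by (simp_all add: power2_eq_square mult.assoc[symmetric])
  have S0: "sech_sq y \<noteq> 0" for y using sech_sq_pos[of y] by simp
  have S2: "1 - (th y)^2 = sech_sq y" for y by (simp add: sech_sq_def)
  have d1: "((\<lambda>x. th x * sech_sq x) has_real_derivative 3/2 * (sech_sq x)^2 - sech_sq x) (at x)" for x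
    by (rule DERIV_cong[OF DERIV_mult[OF tanh_half_deriv sech_sq_deriv]]) (simp add: power2_eq_square
        algebra_simps tt)
  show "((\<lambda>x. th x * sech_sq x) has_real_derivative 3/2 * (sech_sq x)^2 - sech_sq x) (at x)" by (rule d1)
  have d1': "((\<lambda>x. 3/2 * (sech_sq x)^2 - sech_sq x) has_real_derivative (1 - 3 * sech_sq x) * (th x *
      sech_sq x)) (at x)" for x
    by (rule DERIV_cong[OF DERIV_diff[OF DERIV_cmult[OF DERIV_power[OF sech_sq_deriv]] sech_sq_deriv]])
        (simp add: power2_eq_square algebra_simps)
  then show "((\<lambda>x. 3/2 * (sech_sq x)^2 - sech_sq x) has_real_derivative (1 - 3 * 1 * sech_sq x) * (th x
      * sech_sq x)) (at x)" by simp
  have di: "((\<lambda>x. 1/(2 * sech_sq x)) has_real_derivative th x / (2 * sech_sq x)) (at x)" for x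
    by (rule DERIV_cong[OF DERIV_divide[OF DERIV_const DERIV_cmult[OF sech_sq_deriv]]]) (simp_all
        add: S0 field_simps)
  show "((\<lambda>x. 1/(2 * sech_sq x) + 5/4 - 15/4 * sech_sq x + 15/8 * (x * (th x * sech_sq x))) has_real_derivative
     th x / (2 * sech_sq x) + 15/4 * (th x * sech_sq x) + 15/8 * (th x * sech_sq x + x * (3/2 * (sech_sq
         x)^2 - sech_sq x))) (at x)"
    by (rule DERIV_cong[OF DERIV_add[OF DERIV_diff[OF DERIV_add[OF di DERIV_const] DERIV_cmult[OF
        sech_sq_deriv]]
            DERIV_cmult[OF DERIV_mult[OF DERIV_ident d1]]]]) (simp add: algebra_simps)
  have dti: "((\<lambda>x. th x / (2 * sech_sq x)) has_real_derivative 1/4 + (1 - sech_sq x) / (2 * sech_sq x))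
      (at x)" for x
    by (rule DERIV_cong[OF DERIV_divide[OF tanh_half_deriv DERIV_cmult[OF sech_sq_deriv]]])
      (simp_all add: S0 field_simps tt)
  show "((\<lambda>x. th x / (2 * sech_sq x) + 15/4 * (th x * sech_sq x) + 15/8 * (th x * sech_sq x + x * (3/2 *
      (sech_sq x)^2 - sech_sq x)))
    has_real_derivative (1 - 3 * 1 * sech_sq x) * (1/(2 * sech_sq x) + 5/4 - 15/4 * sech_sq x + 15/8 *
        (x * (th x * sech_sq x)))) (at x)"
    by (rule DERIV_cong[OF DERIV_add[OF DERIV_add[OF dti DERIV_cmult[OF d1]]
            DERIV_cmult[OF DERIV_add[OF d1 DERIV_mult[OF DERIV_ident d1']]]]])
      (use S0[of x] in \<open>simp add: field_simps power2_eq_square\<close>)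
  show "th x * sech_sq x * (th x / (2 * sech_sq x) + 15/4 * (th x * sech_sq x) + 15/8 * (th x * sech_sq
      x + x * (3/2 * (sech_sq x)^2 - sech_sq x)))
    - (3/2 * (sech_sq x)^2 - sech_sq x) * (1/(2 * sech_sq x) + 5/4 - 15/4 * sech_sq x + 15/8 * (x * (th
        x * sech_sq x))) = 1"
    using S0[of x] by (simp add: field_simps power2_eq_square tt)
  assume x: "0 \<le> x"
  have t: "\<bar>th x\<bar> \<le> 1" by (rule abs_tanh_le_1)
  have S: "0 < sech_sq x" "sech_sq x \<le> 1" "sech_sq x \<le> 4 * exp (-x)" "1 / sech_sq x \<le> exp x"
    using sech_sq_pos sech_sq_le_1 sech_sq_exp[of x] inv_sech_sq_exp[of x] x by auto
  have tS: "\<bar>th x * sech_sq x\<bar> \<le> sech_sq x" using mult_right_mono[OF t, of "sech_sq x"] S(1)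
      by (simp add: abs_mult)
  have SS: "(sech_sq x)^2 \<le> sech_sq x" using S by (simp add: power2_eq_square mult_left_le)
  have SS0: "0 \<le> (sech_sq x)^2" by simp
  have A: "\<bar>3/2 * (sech_sq x)^2 - sech_sq x\<bar> \<le> 5/2 * sech_sq x" using SS SS0 S(1) unfolding abs_le_iff
      by linarith
  show "\<bar>th x * sech_sq x\<bar> \<le> 20 * exp (-x)" using tS S(3) exp_gt_zero[of "-x"] by linarith
  show "\<bar>3/2 * (sech_sq x)^2 - sech_sq x\<bar> \<le> 20 * exp (-x)" using A S(3) exp_gt_zero[of "-x"] by linarith
  have ex: "1 \<le> exp x" "x \<le> exp x" using x exp_ge_add_one_self[of x] by linarith+
  have ab: "\<bar>x * y\<bar> \<le> m * exp x" if "\<bar>y\<bar> \<le> m" for y m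
  proof -
    have "x * \<bar>y\<bar> \<le> exp x * m" using ex x that by (intro mult_mono) auto
    then show ?thesis using x by (simp add: abs_mult mult.commute)
  qed
  have B: "\<bar>x * (th x * sech_sq x)\<bar> \<le> 1 * exp x" using tS S by (intro ab) linarith
  have C: "\<bar>x * (3/2 * (sech_sq x)^2 - sech_sq x)\<bar> \<le> 5/2 * exp x"
    using A S by (intro ab) linarith
  have D: "0 \<le> 1/(2 * sech_sq x)" "1/(2 * sech_sq x) \<le> exp x / 2" using S by (auto simp: field_simps)
  have E: "\<bar>th x / (2 * sech_sq x)\<bar> \<le> exp x / 2"
    using mult_mono[OF t D(2)] S D by (simp add: abs_mult)
  show "\<bar>1/(2 * sech_sq x) + 5/4 - 15/4 * sech_sq x + 15/8 * (x * (th x * sech_sq x))\<bar> \<le> 20 * exp x"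
    using B D S ex unfolding abs_le_iff by linarith
  show "\<bar>th x / (2 * sech_sq x) + 15/4 * (th x * sech_sq x) + 15/8 * (th x * sech_sq x + x * (3/2 *
      (sech_sq x)^2 - sech_sq x))\<bar> \<le> 20 * exp x"
    using E C tS S ex unfolding abs_le_iff by (intro conjI; argo)
qed simp

definition limit_op :: "h1 \<Rightarrow> h1" where "limit_op = free.green_h1"
text \<open>The resolvent identity (1 - L^-1 M)^-1 = 1 + (L - M)^-1 M, with L = 1 - \<partial>^2 and
  M the multiplication by 3 sech^2(x/2).\<close>

definition limit_inv :: "h1 \<Rightarrow> h1" where "limit_inv V = V + lin.green_h1 V"

lemma bounded_linear_limit_op: "bounded_linear limit_op"
  unfolding limit_op_def by (rule free.bounded_linear_green_h1)

lemma bounded_linear_limit_inv: "bounded_linear limit_inv"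
  unfolding limit_inv_def[abs_def] by (intro bounded_linear_add bounded_linear_ident
      lin.bounded_linear_green_h1)

lemma decaying_deriv_limit_op: "decaying_deriv (limit_op V) (limit_op V - 3 *\<^sub>R mult_h1 sech_sq_h1 V)"
  using free.decaying_deriv_green_h1[of V] by (simp add: limit_op_def)

text \<open>The solution z of (L - M) z = M V also satisfies L z = M (V + z), so it is
  \<open>limit_op\<close> applied to V + z.\<close>

lemma limit_inv_right: "limit_inv V - limit_op (limit_inv V) = V"
proof -
  let ?z = "lin.green_h1 V"
  have "decaying_deriv ?z (?z - (3 * 1) *\<^sub>R mult_h1 sech_sq_h1 ?z - 3 *\<^sub>R mult_h1 sech_sq_h1 V)"
      by (rule lin.decaying_deriv_green_h1)
  also have "?z - (3 * 1) *\<^sub>R mult_h1 sech_sq_h1 ?z - 3 *\<^sub>R mult_h1 sech_sq_h1 V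
      = ?z - (3 * 0) *\<^sub>R mult_h1 sech_sq_h1 ?z - 3 *\<^sub>R mult_h1 sech_sq_h1 (limit_inv V)"
    by (rule h1_eqI) (simp add: limit_inv_def algebra_simps)
  finally have "?z = limit_op (limit_inv V)" unfolding limit_op_def by (rule free.green_h1_unique)
  then show ?thesis by (simp add: limit_inv_def)
qed

lemma limit_inv_left: "limit_inv (V - limit_op V) = V"
proof -
  have "decaying_deriv (limit_op V) (limit_op V - 3 *\<^sub>R mult_h1 sech_sq_h1 V)" by (rule decaying_deriv_limit_op)
  also have "limit_op V - 3 *\<^sub>R mult_h1 sech_sq_h1 V = limit_op V - (3 * 1) *\<^sub>R mult_h1 sech_sq_h1
      (limit_op V) - 3 *\<^sub>R mult_h1 sech_sq_h1 (V - limit_op V)"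
    by (rule h1_eqI) (simp add: algebra_simps)
  finally have "limit_op V = lin.green_h1 (V - limit_op V)" by (rule lin.green_h1_unique)
  then show ?thesis by (simp add: limit_inv_def)
qed

text \<open>The KdV profile equation before scaling by the amplitude.\<close>

lemma second_deriv_sech_sq_h1: "second_deriv sech_sq_h1 (sech_sq_h1 - (3/2) *\<^sub>R mult_h1 sech_sq_h1 sech_sq_h1)"
proof -
  have tt: "th y * th y = 1 - sech_sq y" "th y * (th y * z) = (1 - sech_sq y) * z" for y z
    by (simp_all add: sech_sq_def power2_eq_square)
  have f: "fn sech_sq_h1 = sech_sq" by auto
  have "((\<lambda>x. - th x * sech_sq x) has_real_derivative sech_sq x - 3/2 * (sech_sq x * sech_sq x)) (at x)" for x
    by (rule DERIV_cong[OF DERIV_mult[OF DERIV_minus[OF tanh_half_deriv] sech_sq_deriv]]) (simp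
        add: algebra_simps tt)
  then show ?thesis unfolding second_deriv_def using sech_sq_deriv
      by (intro exI[of _ "\<lambda>x. - th x * sech_sq x"]) (simp add: f)
qed

lemma second_deriv_Sh2: "second_deriv (mult_h1 sech_sq_h1 sech_sq_h1) (4 *\<^sub>R mult_h1 sech_sq_h1
    sech_sq_h1 - 5 *\<^sub>R mult_h1 sech_sq_h1 (mult_h1 sech_sq_h1 sech_sq_h1))"
proof -
  have tt: "th y * th y = 1 - sech_sq y" "th y * (th y * z) = (1 - sech_sq y) * z" for y z
    by (simp_all add: sech_sq_def power2_eq_square)
  have f: "fn (mult_h1 sech_sq_h1 sech_sq_h1) = (\<lambda>x. sech_sq x * sech_sq x)" by auto
  have 1: "((\<lambda>x. sech_sq x * sech_sq x) has_real_derivative - 2 * (th x * (sech_sq x * sech_sq x))) (at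
      x)" for x
    by (rule DERIV_cong[OF DERIV_mult[OF sech_sq_deriv sech_sq_deriv]]) (simp add: algebra_simps)
  have "((\<lambda>x. - 2 * (th x * (sech_sq x * sech_sq x))) has_real_derivative 4 * (sech_sq x * sech_sq x) -
      5 * (sech_sq x * (sech_sq x * sech_sq x))) (at x)" for x
    by (rule DERIV_cong[OF DERIV_cmult[OF DERIV_mult[OF tanh_half_deriv 1]]]) (simp add: algebra_simps tt)
  with 1 show ?thesis unfolding second_deriv_def by (intro exI[of _ "\<lambda>x. - 2 * (th x * (sech_sq x *
      sech_sq x))"]) (simp add: f)
qed

lemma second_deriv_add: "second_deriv u d \<Longrightarrow> second_deriv v e \<Longrightarrow> second_deriv (u + v) (d + e)"
  unfolding second_deriv_def fn_plus_fun
  apply (elim exE conjE)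
  subgoal for u' v' by (intro exI[of _ "\<lambda>x. u' x + v' x"] conjI allI DERIV_add; simp)
  done

lemma second_deriv_scale: "second_deriv u d \<Longrightarrow> second_deriv (c *\<^sub>R u) (c *\<^sub>R d)"
  unfolding second_deriv_def fn_scaleR_fun
  apply (elim exE conjE)
  subgoal for u' by (intro exI[of _ "\<lambda>x. c * u' x"] conjI allI DERIV_cmult; simp)
  done

section \<open>Rates and the nonlinearity\<close>

text \<open>Two applications of the mean value inequality, on \<bar>s\<bar> \<le> 1/2 where 1 + s
  stays away from the singularity.\<close>

lemma powr_Taylor:
  fixes p :: real assumes p: "p > 0"
  shows "\<exists>C>0. \<forall>s. \<bar>s\<bar> \<le> 1/2 \<longrightarrow> \<bar>(1 + s) powr (-p) - 1 + p * s\<bar> \<le> C * s^2"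
proof -
  define L where "L = (p + 1) * (1/2) powr (-p-2)"
  have L0: "L > 0" using p by (simp add: L_def)
  have lip: "\<bar>(1 + s) powr (-p-1) - 1\<bar> \<le> L * \<bar>s\<bar>" if s: "\<bar>s\<bar> \<le> 1/2" for s
  proof -
    have "norm ((1 + s) powr (-p-1) - (1 + 0) powr (-p-1)) \<le> L * norm (s - 0)"
    proof (rule field_differentiable_bound[where S="{-1/2..1/2}" and f'="\<lambda>s. (-p-1) * (1 + s) powr (-p-2)"])
      fix z :: real assume z: "z \<in> {-1/2..1/2}"
      show "((\<lambda>s. (1 + s) powr (-p-1)) has_field_derivative (-p-1) * (1 + z) powr (-p-2)) (at z within
          {-1/2..1/2})"
        using z by (auto intro!: derivative_eq_intros simp: algebra_simps)
      have "(1 + z) powr (-p-2) \<le> (1/2) powr (-p-2)"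
        using z p by (intro powr_mono2') auto
      then have "(p + 1) * (1 + z) powr (-p-2) \<le> L" unfolding L_def using p by (intro mult_left_mono) auto
      moreover have "\<bar>-p-1\<bar> = p + 1" using p by simp
      ultimately show "norm ((-p-1) * (1 + z) powr (-p-2)) \<le> L"
          by (simp only: real_norm_def abs_mult abs_mult) simp
    qed (use s in auto)
    then show ?thesis by simp
  qed
  have "\<bar>(1 + s) powr (-p) - 1 + p * s\<bar> \<le> (p * L) * s^2" if s: "\<bar>s\<bar> \<le> 1/2" for s
  proof -
    let ?f = "\<lambda>s. (1 + s) powr (-p) - 1 + p * s"
    \<comment> \<open>On the interval of radius \<bar>s\<bar> the derivative of the remainder is
      itself at most of size \<bar>s\<bar>, which yields the square.\<close>
    have "norm (?f s - ?f 0) \<le> (p * (L * \<bar>s\<bar>)) * norm (s - 0)"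
    proof (rule field_differentiable_bound[where S="{-\<bar>s\<bar>..\<bar>s\<bar>}" and f'="\<lambda>s. - p * ((1 + s) powr (-p-1) - 1)"])
      fix z :: real assume z: "z \<in> {-\<bar>s\<bar>..\<bar>s\<bar>}"
      then have zs: "\<bar>z\<bar> \<le> \<bar>s\<bar>" by auto
      show "(?f has_field_derivative - p * ((1 + z) powr (-p-1) - 1)) (at z within {-\<bar>s\<bar>..\<bar>s\<bar>})"
        using zs s by (auto intro!: derivative_eq_intros simp: algebra_simps)
      have "\<bar>(1 + z) powr (-p-1) - 1\<bar> \<le> L * \<bar>s\<bar>"
        using lip[of z] zs s L0 mult_left_mono[OF zs, of L] by linarith
      then have "p * \<bar>(1 + z) powr (-p-1) - 1\<bar> \<le> p * (L * \<bar>s\<bar>)" using p by (intro mult_left_mono) auto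
      then show "norm (- p * ((1 + z) powr (-p-1) - 1)) \<le> p * (L * \<bar>s\<bar>)" using p by (simp add: abs_mult)
    qed auto
    then show ?thesis by (simp add: power2_eq_square)
  qed
  then show ?thesis using p L0 by (intro exI[of _ "p * L"]) auto
qed

text \<open>Comparison with the telescoping increments m^q - (m-1)^q, which are at least q/(1+q)
  m^(q-1). The detour through exp treats increasing and decreasing summands alike.\<close>

lemma sum_powr_le:
  fixes q :: real assumes q: "q > 0"
  shows "(\<Sum>n<N. real (Suc n) powr (q - 1)) \<le> (1 + q) / q * real N powr q"
proof (induction N)
  case (Suc N)
  let ?m = "real (Suc N)"
  have m: "?m > 0" by simp
  have N: "real N = ?m * (1 - 1/?m)" by (simp add: field_simps)
  have "real N powr q = ?m powr q * (1 - 1/?m) powr q"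
    unfolding N by (rule powr_mult)
  also have "(1 - 1/?m) powr q \<le> exp (- (q / ?m))"
  proof (cases "N = 0")
    case False
    have "(1 - 1/?m) \<le> exp (- (1/?m))" using exp_ge_add_one_self[of "- (1/?m)"] by simp
    then have "(1 - 1/?m) powr q \<le> exp (- (1/?m)) powr q"
      using q by (intro powr_mono2) auto
    then show ?thesis by (simp add: powr_def mult.commute)
  qed simp
  finally have "real N powr q \<le> ?m powr q * exp (- (q/?m))" using mult_left_mono by simp
  also have "exp (- (q/?m)) \<le> 1 / (1 + q/?m)"
    using exp_ge_add_one_self[of "q/?m"] q by (simp add: exp_minus field_simps)
  \<comment> \<open>As m \<ge> 1, one has m + q \<le> (1 + q) m; this is where the constant (1 +
    q)/q originates.\<close>
  also have "1 / (1 + q/?m) \<le> 1 - q / ((1 + q) * ?m)"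
  proof -
    have "1 / (1 + q/?m) = 1 - q / (?m + q)" using q m by (simp add: divide_simps)
    moreover have "?m + q \<le> (1 + q) * ?m" using q mult_left_mono[of 1 ?m q] by (simp add: algebra_simps)
    then have "q / ((1 + q) * ?m) \<le> q / (?m + q)" using q m by (intro divide_left_mono mult_pos_pos) auto
    ultimately show ?thesis by simp
  qed
  finally have "real N powr q \<le> ?m powr q * (1 - q / ((1 + q) * ?m))" using mult_left_mono by simp
  then have "q / (1 + q) * (?m powr q / ?m) \<le> ?m powr q - real N powr q"
    by (simp add: algebra_simps)
  also have "?m powr q / ?m = ?m powr (q - 1)" by (simp add: powr_diff)
  finally have "?m powr (q - 1) \<le> (1 + q) / q * (?m powr q - real N powr q)"
    using q by (simp add: field_simps)
  then show ?case using Suc.IH by (simp add: algebra_simps)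
qed simp

text \<open>Telescoping again: m^(-r-1) \<le> ((m-1)^(-r) - m^(-r)) / r, by 1 + x \<le> exp x used
  twice.\<close>

lemma tail_powr_le:
  fixes r :: real assumes r: "r > 0" and N: "N \<ge> 1"
  shows "summable (\<lambda>n. real (Suc (n + N)) powr (-r - 1))"
    "(\<Sum>n. real (Suc (n + N)) powr (-r - 1)) \<le> 1/r * real N powr (-r)"
proof -
  let ?g = "\<lambda>n. real (n + N) powr (-r)"
  have step: "real (Suc (n + N)) powr (-r - 1) \<le> 1/r * (?g n - ?g (Suc n))" for n
  proof -
    let ?m = "real (Suc (n + N))"
    have m: "?m > 1" using N by simp
    have N: "real (n + N) = ?m * (1 - 1/?m)" by (simp add: field_simps)
    have "?m powr (-r) * (1 + r/?m) \<le> ?m powr (-r) * (1 - 1/?m) powr (-r)"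
    proof (intro mult_left_mono)
      have "1 + r/?m \<le> exp (r/?m)" by (rule exp_ge_add_one_self)
      also have "\<dots> = exp (- (1/?m)) powr (-r)" by (simp add: powr_def)
      also have "\<dots> \<le> (1 - 1/?m) powr (-r)"
        using r m exp_ge_add_one_self[of "- (1/?m)"] by (intro powr_mono2') auto
      finally show "1 + r/?m \<le> (1 - 1/?m) powr (-r)" .
    qed auto
    also have "\<dots> = real (n + N) powr (-r)" unfolding N by (rule powr_mult[symmetric])
    finally have "?m powr (-r) * (1 + r/?m) \<le> ?g n" .
    then have "r * (?m powr (-r) / ?m) \<le> ?g n - ?g (Suc n)" by (simp add: algebra_simps)
    also have "?m powr (-r) / ?m = ?m powr (-r - 1)" using m by (simp add: powr_diff)
    finally show ?thesis using r by (simp add: field_simps)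
  qed
  have "filterlim (\<lambda>n. real (n + N)) at_top sequentially"
    using filterlim_compose[OF filterlim_real_sequentially filterlim_add_const_nat_at_top] .
  then have "?g \<longlonglongrightarrow> 0" using tendsto_neg_powr[of "-r" "\<lambda>n. real (n + N)" sequentially] r by simp
  from telescope_sums'[OF this] have "(\<lambda>n. ?g n - ?g (Suc n)) sums (real N powr (-r))" by simp
  from sums_mult[OF this, of "1/r"] have s: "(\<lambda>n. 1/r * (?g n - ?g (Suc n))) sums (1/r * real N powr (-r))" .
  show sm: "summable (\<lambda>n. real (Suc (n + N)) powr (-r - 1))"
    by (rule summable_comparison_test[OF _ sums_summable[OF s]]) (use step in auto)
  show "(\<Sum>n. real (Suc (n + N)) powr (-r - 1)) \<le> 1/r * real N powr (-r)"
    using suminf_le[OF step sm sums_summable[OF s]] s by (simp add: sums_iff)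
qed

context wave begin

text \<open>The square of the width contributes \<epsilon>^2, which cancels the prefactor, so that
  powers of \<epsilon> come from y alone.\<close>

lemma term_scaled: "\<epsilon> > 0 \<Longrightarrow> b / \<epsilon>^2 * (w n * (3 * h \<epsilon> n^2 * y)) = 3 * b * (real (Suc n) powr (2 - a) * y)"
proof -
  assume e: "\<epsilon> > 0"
  have "real (Suc n) powr 2 = real (Suc n)^2" using powr_realpow[of "real (Suc n)" 2] by simp
  then have "real (Suc n) powr (2 - a) = real (Suc n)^2 * w n" by (simp add: powr_diff w_def)
  then show ?thesis using e by (simp add: h_def power_mult_distrib)
qed

text \<open>The bound 4 x^s trades s powers of \<epsilon> for s powers of m, which the series
  tolerates as long as s < a - 3.\<close>

lemma error_rate_powr_le:
  assumes e: "\<epsilon> > 0" and s: "0 < s" "a - 2 - s > 1"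
    and m: "\<And>x. 0 < x \<Longrightarrow> 0 \<le> m x" "\<And>x. 0 < x \<Longrightarrow> m x \<le> 4" "\<And>x. 0 < x \<Longrightarrow> m x \<le> 4 * x powr s"
  shows "(\<Sum>n. b / \<epsilon>^2 * (w n * (3 * h \<epsilon> n^2 * m (h \<epsilon> n)))) \<le> 12 * b * zeta (a - 2 - s) * \<epsilon> powr s"
proof -
  have "(\<Sum>n. b / \<epsilon>^2 * (w n * (3 * h \<epsilon> n^2 * m (h \<epsilon> n)))) \<le> (\<Sum>n. 12 * b * \<epsilon> powr s * (1 / real (Suc n)
      powr (a - 2 - s)))"
  proof (rule suminf_le)
    show "summable (\<lambda>n. b / \<epsilon>^2 * (w n * (3 * h \<epsilon> n^2 * m (h \<epsilon> n))))"
      using m h_pos[OF e] by (intro error_rate_summable e) auto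
    show "summable (\<lambda>n. 12 * b * \<epsilon> powr s * (1 / real (Suc n) powr (a - 2 - s)))"
      using s by (intro summable_mult summable_zeta)
    fix n
    have "m (h \<epsilon> n) \<le> 4 * (\<epsilon> powr s * real (Suc n) powr s)"
      using m(3)[OF h_pos[OF e, of n]] e by (simp add: h_def powr_mult)
    then have "real (Suc n) powr (2 - a) * m (h \<epsilon> n) \<le> real (Suc n) powr (2 - a) * (4 * (\<epsilon> powr s * real
        (Suc n) powr s))"
      by (intro mult_left_mono) auto
    also have "\<dots> = 4 * \<epsilon> powr s * real (Suc n) powr (2 - a + s)" by (simp add: powr_add)
    also have "real (Suc n) powr (2 - a + s) = 1 / real (Suc n) powr (a - 2 - s)"
      using powr_minus[of "real (Suc n)" "a - 2 - s"] by (simp add: divide_inverse algebra_simps)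
    finally have fin: "real (Suc n) powr (2 - a) * m (h \<epsilon> n) \<le> 4 * \<epsilon> powr s * (1 / real (Suc n) powr (a
        - 2 - s))" .
    show "b / \<epsilon>^2 * (w n * (3 * h \<epsilon> n^2 * m (h \<epsilon> n))) \<le> 12 * b * \<epsilon> powr s * (1 / real (Suc n) powr (a - 2 - s))"
    proof -
      from fin have "3 * b * (real (Suc n) powr (2 - a) * m (h \<epsilon> n)) \<le> 3 * b * (4 * \<epsilon> powr s * (1 / real
          (Suc n) powr (a - 2 - s)))"
        using b_pos by (intro mult_left_mono) auto
      also have "\<dots> = 12 * b * \<epsilon> powr s * (1 / real (Suc n) powr (a - 2 - s))" by simp
      finally show ?thesis unfolding term_scaled[OF e] .
    qed
  qed
  also have "\<dots> = 12 * b * \<epsilon> powr s * zeta (a - 2 - s)"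
    using sums_mult[OF zeta_sums[OF s(2)], of "12 * b * \<epsilon> powr s"] by (simp add: sums_iff)
  finally show ?thesis by (simp add: mult_ac)
qed

lemma min_powr_le: "min 4 x \<le> 4 * x powr s" if "0 < x" "0 < s" "s \<le> 1" for x s :: real
proof (cases "x \<le> 1")
  case True
  then have "x powr 1 \<le> x powr s" using that by (intro powr_mono') auto
  then show ?thesis using that by simp
next
  case False
  then have "1 \<le> x powr s" using that by (simp add: ge_one_powr_ge_zero)
  then show ?thesis by simp
qed

text \<open>Smallness without a rate is enough here: \<open>error_rate\<close> enters the
  contraction factor and not the exponent \<sigma>.\<close>

lemma error_rate_tendsto_0: "(error_rate \<longlongrightarrow> 0) (at_right 0)"
proof -
  \<comment> \<open>Any s with 0 < s \<le> 1 and s < a - 3 would do.\<close>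
  define s where "s = min 1 ((a - 3) / 2)"
  have s: "0 < s" "s \<le> 1" "a - 2 - s > 1" using a3 unfolding s_def min_def
      by (auto split: if_splits) (simp_all add: field_simps)
  have ev: "\<forall>\<^sub>F \<epsilon>::real in at_right 0. \<epsilon> > 0" by (simp add: eventually_at_right_less)
  show ?thesis
  proof (rule real_tendsto_sandwich)
    show "\<forall>\<^sub>F \<epsilon> in at_right 0. 0 \<le> error_rate \<epsilon>" using ev
    proof eventually_elim
      case (elim \<epsilon>)
      have p: "0 \<le> h \<epsilon> n" for n using h_pos[OF elim, of n] by simp
      show ?case unfolding error_rate_def
        using b_pos w_pos p by (intro suminf_nonneg error_rate_summable elim) (auto simp: less_imp_le)
    qed
    show "\<forall>\<^sub>F \<epsilon> in at_right 0. error_rate \<epsilon> \<le> 12 * b * zeta (a - 2 - s) * \<epsilon> powr s" using ev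
    proof eventually_elim
      case (elim \<epsilon>)
      show ?case unfolding error_rate_def
        by (rule error_rate_powr_le[OF elim s(1,3), of "min 4"]) (use min_powr_le[OF _ s(1,2)] in auto)
    qed
    show "((\<lambda>\<epsilon>. 12 * b * zeta (a - 2 - s) * \<epsilon> powr s) \<longlongrightarrow> 0) (at_right 0)"
    proof -
      have "\<forall>\<^sub>F \<epsilon>::real in at_right 0. 0 \<le> \<epsilon>" by (rule eventually_mono[OF ev]) simp
      then have "((\<lambda>\<epsilon>. \<epsilon> powr s) \<longlongrightarrow> 0 powr s) (at_right 0)"
        using s by (intro tendsto_powr2 tendsto_const) (auto intro: tendsto_eq_intros)
      from tendsto_mult_left[OF this] show ?thesis using s by simp
    qed
  qed auto
qed

text \<open>The condition is s < a - 3. It admits s = 2 for a > 5 and every s < 2 for a = 5; the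
  endpoint s = a - 3 for a < 5 is left to \<open>residual_rate_le_powr_critical\<close>.\<close>

lemma residual_rate_le_powr:
  assumes s: "0 < s" "s \<le> 2" "a - 2 - s > 1"
  shows "\<exists>C>0. \<forall>\<epsilon>\<in>{0<..1}. residual_rate \<epsilon> \<le> C * \<epsilon> powr s"
proof (intro exI[of _ "12 * b * zeta (a - 2 - s)"] conjI ballI)
  show "12 * b * zeta (a - 2 - s) > 0" using b_pos zeta_pos[OF s(3)] by simp
  fix \<epsilon> :: real assume "\<epsilon> \<in> {0<..1}"
  then have e: "\<epsilon> > 0" by simp
  have m: "min 4 (x^2) \<le> 4 * x powr s" if "0 < x" for x :: real
  proof -
    have "(x^2) powr (s/2) = x powr s"
      using powr_powr[of x 2 "s/2"] powr_realpow[OF that, of 2] by simp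
    then show ?thesis using min_powr_le[of "x^2" "s/2"] that s by simp
  qed
  show "residual_rate \<epsilon> \<le> 12 * b * zeta (a - 2 - s) * \<epsilon> powr s" unfolding residual_rate_def
    by (rule error_rate_powr_le[OF e s(1,3), of "\<lambda>x. min 4 (x^2)"]) (use m in auto)
qed

text \<open>At the endpoint the interpolated series diverges, so the sum is split at N about
  1/\<epsilon>. Below, \<epsilon>^2 times the sum of m^(4-a) is at most of order \<epsilon>^2
  N^(5-a), which needs a < 5; above, the sum of m^(2-a) is at most of order N^(3-a). Both are of
  order \<epsilon>^(a-3).\<close>

lemma residual_rate_le_powr_critical:
  assumes a5: "a < 5"
  shows "\<exists>C>0. \<forall>\<epsilon>\<in>{0<..1}. residual_rate \<epsilon> \<le> C * \<epsilon> powr (a - 3)"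
proof -
  let ?q = "5 - a" let ?r = "a - 3"
  define C where "C = 12 * b * ((1 + ?q) / ?q + 1/?r * 2 powr ?r)"
  have C: "C > 0" unfolding C_def using a3 a5 b_pos by (intro mult_pos_pos add_pos_pos) auto
  have "residual_rate \<epsilon> \<le> C * \<epsilon> powr ?r" if "\<epsilon> \<in> {0<..1}" for \<epsilon>
  proof -
    have e: "0 < \<epsilon>" "\<epsilon> \<le> 1" using that by auto
    define N where "N = nat \<lfloor>1/\<epsilon>\<rfloor>"
    have fl: "\<lfloor>1/\<epsilon>\<rfloor> \<ge> 1" using e by (simp add: le_floor_iff)
    have N1: "N \<ge> 1" using fl unfolding N_def by linarith
    have Nr: "real N \<le> 1/\<epsilon>" "1/\<epsilon> < real N + 1"
    proof -
      have "real N = of_int \<lfloor>1/\<epsilon>\<rfloor>" unfolding N_def by (rule of_nat_nat) (use fl in linarith)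
      then show "real N \<le> 1/\<epsilon>" "1/\<epsilon> < real N + 1" using floor_correct[of "1/\<epsilon>"] by auto
    qed
    \<comment> \<open>Rounding loses at most a factor 2, the source of \<open>2 powr ?r\<close> in
      C.\<close>
    have Nl: "1/(2*\<epsilon>) \<le> real N" using Nr N1 by (simp add: field_simps)
    let ?f = "\<lambda>n. b / \<epsilon>^2 * (w n * (3 * h \<epsilon> n^2 * min 4 (h \<epsilon> n^2)))"
    have sf: "summable ?f" by (rule error_rate_summable[OF e(1)]) auto
    have "residual_rate \<epsilon> = (\<Sum>n. ?f (n + N)) + (\<Sum>n<N. ?f n)"
      unfolding residual_rate_def by (rule suminf_split_initial_segment[OF sf])
    also have "(\<Sum>n<N. ?f n) \<le> (\<Sum>n<N. 12 * b * \<epsilon>^2 * real (Suc n) powr (?q - 1))"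
    proof (rule sum_mono)
      fix n
      have "real (Suc n) powr 2 = real (Suc n)^2" using powr_realpow[of "real (Suc n)" 2] by simp
      moreover have "real (Suc n) powr (?q - 1) = real (Suc n) powr (2 - a) * real (Suc n) powr 2"
        proof -
        have "?q - 1 = (2 - a) + 2" by simp
        then show ?thesis using powr_add[of "real (Suc n)" "2 - a" 2] by (simp only:)
      qed
      ultimately have x: "real (Suc n) powr (?q - 1) = real (Suc n) powr (2 - a) * real (Suc n)^2"
          by (simp only:)
      have "min 4 (h \<epsilon> n^2) \<le> 4 * h \<epsilon> n^2" by (simp add: min_def)
      then have "?f n \<le> b / \<epsilon>^2 * (w n * (3 * h \<epsilon> n^2 * (4 * h \<epsilon> n^2)))"
        using b_pos w_pos[of n] by (intro mult_left_mono) (auto simp: less_imp_le)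
      also have "\<dots> = 12 * b * \<epsilon>^2 * real (Suc n) powr (?q - 1)"
        unfolding term_scaled[OF e(1)] x by (simp add: h_def power_mult_distrib)
      finally show "?f n \<le> 12 * b * \<epsilon>^2 * real (Suc n) powr (?q - 1)" .
    qed
    also have "\<dots> = 12 * b * \<epsilon>^2 * (\<Sum>n<N. real (Suc n) powr (?q - 1))" by (simp add: sum_distrib_left)
    also have "\<dots> \<le> 12 * b * \<epsilon>^2 * ((1 + ?q) / ?q * real N powr ?q)"
      using b_pos a5 by (intro mult_left_mono sum_powr_le) auto
    also have "\<dots> \<le> 12 * b * \<epsilon>^2 * ((1 + ?q) / ?q * (1/\<epsilon>) powr ?q)"
      using b_pos a5 Nr(1) by (intro mult_left_mono powr_mono2) auto
    also have "\<dots> = 12 * b * ((1 + ?q) / ?q) * \<epsilon> powr ?r"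
    proof -
      have "\<epsilon>^2 * (1/\<epsilon>) powr ?q = \<epsilon> powr 2 * \<epsilon> powr (- ?q)"
        using powr_realpow[OF e(1), of 2] powr_divide[of 1 \<epsilon> ?q] powr_minus_divide[of \<epsilon> ?q] by simp
      also have "\<dots> = \<epsilon> powr ?r" by (simp add: powr_add[symmetric])
      finally show ?thesis by simp
    qed
    also have "(\<Sum>n. ?f (n + N)) \<le> (\<Sum>n. 12 * b * real (Suc (n + N)) powr (- ?r - 1))"
    proof (rule suminf_le)
      show "?f (n + N) \<le> 12 * b * real (Suc (n + N)) powr (- ?r - 1)" for n
      proof -
        have "?f (n + N) \<le> b / \<epsilon>^2 * (w (n + N) * (3 * h \<epsilon> (n + N)^2 * 4))"
          using b_pos w_pos[of "n + N"] by (intro mult_left_mono) (auto simp: less_imp_le)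
        then show ?thesis unfolding term_scaled[OF e(1)] by simp
      qed
      show "summable (\<lambda>n. ?f (n + N))" using summable_iff_shift[of ?f N] sf by blast
      show "summable (\<lambda>n. 12 * b * real (Suc (n + N)) powr (- ?r - 1))"
        using a3 by (intro summable_mult tail_powr_le N1) auto
    qed
    also have "\<dots> = 12 * b * (\<Sum>n. real (Suc (n + N)) powr (- ?r - 1))"
      using a3 by (intro suminf_mult tail_powr_le N1) auto
    also have "\<dots> \<le> 12 * b * (1/?r * real N powr (- ?r))"
      using a3 b_pos by (intro mult_left_mono tail_powr_le N1) auto
    also have "\<dots> \<le> 12 * b * (1/?r * (2 powr ?r * \<epsilon> powr ?r))"
    proof -
      have "real N powr (- ?r) \<le> (1/(2*\<epsilon>)) powr (- ?r)"
        using Nl e a3 by (intro powr_mono2') auto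
      also have "\<dots> = 2 powr ?r * \<epsilon> powr ?r"
        unfolding powr_minus_divide powr_divide powr_mult by simp
      finally show ?thesis using b_pos a3 by (intro mult_left_mono) auto
    qed
    finally show ?thesis by (simp add: C_def algebra_simps)
  qed
  then show ?thesis using C by blast
qed

text \<open>The third derivative of the potential at 1.\<close>

definition nonlin_coeff where "nonlin_coeff = - b * (a + 2)"

text \<open>The derivative of the potential at 1 + \<epsilon>^2 v without its affine part, divided
  by \<epsilon>^4. Its limit is \<open>nonlin_coeff / 2 * v^2\<close>; the linear part has gone into
  \<open>lin_op\<close>.\<close>

definition nonlin :: "real \<Rightarrow> real \<Rightarrow> real" where
  "nonlin \<epsilon> v = - a * ((1 + \<epsilon>^2 * v) powr (-a-1) - 1 + (a + 1) * (\<epsilon>^2 * v)) / \<epsilon>^4"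

lemma nonlin_0: "nonlin \<epsilon> 0 = 0" by (simp add: nonlin_def)

lemma nonlin_deriv:
  assumes "\<epsilon> > 0" "\<epsilon>^2 * \<bar>v\<bar> \<le> 1/2"
  shows "(nonlin \<epsilon> has_real_derivative b * ((1 + \<epsilon>^2 * v) powr (-a-2) - 1) / \<epsilon>^2) (at v)"
proof -
  have "\<bar>\<epsilon>^2 * v\<bar> \<le> 1/2" using assms by (simp add: abs_mult)
  then have p: "1 + \<epsilon>^2 * v > 0" by linarith
  have "((\<lambda>v. (1 + \<epsilon>^2 * v) powr (-a-1)) has_real_derivative (-a-1) * (1 + \<epsilon>^2 * v) powr (-a-2) * \<epsilon>^2) (at v)"
    using p by (auto intro!: derivative_eq_intros simp: algebra_simps)
  note D = this
  have "(nonlin \<epsilon> has_real_derivative - a * ((-a-1) * (1 + \<epsilon>^2 * v) powr (-a-2) * \<epsilon>^2 - 0 + (a+1) * \<epsilon>^2)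
      / \<epsilon>^4) (at v)"
    unfolding nonlin_def[abs_def]
    by (rule DERIV_cong, rule DERIV_cdivide, rule DERIV_cmult, rule DERIV_add, rule DERIV_diff, rule D,
        rule DERIV_const, rule DERIV_cmult, rule DERIV_cmult, rule DERIV_ident) simp
  moreover have "- a * ((-a-1) * (1 + \<epsilon>^2 * v) powr (-a-2) * \<epsilon>^2 - 0 + (a+1) * \<epsilon>^2) / \<epsilon>^4
      = b * ((1 + \<epsilon>^2 * v) powr (-a-2) - 1) / \<epsilon>^2"
    using assms(1) by (simp add: b_def divide_simps power2_eq_square power4_eq_xxxx) (simp add: algebra_simps)
  ultimately show ?thesis by simp
qed

definition nonlin_const where "nonlin_const = (SOME C. C > 0 \<and> (\<forall>s. \<bar>s\<bar> \<le> 1/2 \<longrightarrow>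
    \<bar>(1 + s) powr (-(a+2)) - 1 + (a+2) * s\<bar> \<le> C * s^2))"

lemma nonlin_const: "nonlin_const > 0" "\<bar>s\<bar> \<le> 1/2 \<Longrightarrow> \<bar>(1 + s) powr (-(a+2)) - 1 + (a+2) * s\<bar>
    \<le> nonlin_const * s^2"
  using someI_ex[OF powr_Taylor[of "a+2"]] a3 unfolding nonlin_const_def by auto

lemma nonlin_deriv_bound:
  assumes e: "\<epsilon> > 0" and v: "\<epsilon>^2 * \<bar>v\<bar> \<le> 1/2"
  shows "\<bar>b * ((1 + \<epsilon>^2 * v) powr (-a-2) - 1) / \<epsilon>^2 - nonlin_coeff * v\<bar> \<le> b * nonlin_const * (\<epsilon>^2 * v^2)"
proof -
  have "\<bar>\<epsilon>^2 * v\<bar> \<le> 1/2" using v by (simp add: abs_mult)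
  from nonlin_const(2)[OF this] have "\<bar>(1 + \<epsilon>^2 * v) powr (-(a+2)) - 1 + (a+2) * (\<epsilon>^2 * v)\<bar>
      \<le> nonlin_const * (\<epsilon>^2 * v)^2" .
  then have *: "b / \<epsilon>^2 * \<bar>(1 + \<epsilon>^2 * v) powr (-(a+2)) - 1 + (a+2) * (\<epsilon>^2 * v)\<bar>
      \<le> b / \<epsilon>^2 * (nonlin_const * (\<epsilon>^2 * v)^2)"
    using b_pos by (intro mult_left_mono) auto
  have "b * ((1 + \<epsilon>^2 * v) powr (-a-2) - 1) / \<epsilon>^2 - nonlin_coeff * v
      = b / \<epsilon>^2 * ((1 + \<epsilon>^2 * v) powr (-(a+2)) - 1 + (a+2) * (\<epsilon>^2 * v))"
    using e by (simp add: nonlin_coeff_def field_simps)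
  then have "\<bar>b * ((1 + \<epsilon>^2 * v) powr (-a-2) - 1) / \<epsilon>^2 - nonlin_coeff * v\<bar>
      = b / \<epsilon>^2 * \<bar>(1 + \<epsilon>^2 * v) powr (-(a+2)) - 1 + (a+2) * (\<epsilon>^2 * v)\<bar>" using b_pos by (simp add: abs_mult)
  also note *
  also have "b / \<epsilon>^2 * (nonlin_const * (\<epsilon>^2 * v)^2) = b * nonlin_const * (\<epsilon>^2 * v^2)"
    using e by (simp add: field_simps power2_eq_square)
  finally show ?thesis .
qed

text \<open>The derivative of \<open>nonlin\<close> at x is \<open>nonlin_coeff * x\<close> up to
  order \<epsilon>^2, and freezing it at v costs the distance t. In \<open>remainder_term\<close> v
  is a value of the averaged soliton.\<close>

lemma nonlin_lin:
  assumes e: "\<epsilon> > 0" and M: "\<epsilon>^2 * M \<le> 1/2" "\<bar>p\<bar> \<le> M" "\<bar>q\<bar> \<le> M" and v: "\<bar>p - v\<bar> \<le> t" "\<bar>q - v\<bar> \<le> t"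
  shows "\<bar>nonlin \<epsilon> p - nonlin \<epsilon> q - nonlin_coeff * v * (p - q)\<bar> \<le> (\<bar>nonlin_coeff\<bar> * t + b * nonlin_const
      * (\<epsilon>^2 * M^2)) * \<bar>p - q\<bar>"
proof -
  let ?f = "\<lambda>x. nonlin \<epsilon> x - nonlin_coeff * v * x"
  let ?S = "{-M..M} \<inter> {v-t..v+t}"
  have "norm (?f p - ?f q) \<le> (\<bar>nonlin_coeff\<bar> * t + b * nonlin_const * (\<epsilon>^2 * M^2)) * norm (p - q)"
  proof (rule field_differentiable_bound[where S="?S" and f'="\<lambda>x. b * ((1 + \<epsilon>^2 * x) powr (-a-2) - 1) /
      \<epsilon>^2 - nonlin_coeff * v"])
    fix x assume x: "x \<in> ?S"
    then have xM: "\<bar>x\<bar> \<le> M" and xv: "\<bar>x - v\<bar> \<le> t" by auto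
    have ex: "\<epsilon>^2 * \<bar>x\<bar> \<le> 1/2" using mult_left_mono[OF xM, of "\<epsilon>^2"] M(1) by simp
    show "(?f has_field_derivative b * ((1 + \<epsilon>^2 * x) powr (-a-2) - 1) / \<epsilon>^2 - nonlin_coeff * v) (at x
        within ?S)"
      by (rule has_field_derivative_at_within) (rule derivative_eq_intros nonlin_deriv[OF e ex] refl | simp)+
    have "\<bar>b * ((1 + \<epsilon>^2 * x) powr (-a-2) - 1) / \<epsilon>^2 - nonlin_coeff * v\<bar>
      \<le> \<bar>b * ((1 + \<epsilon>^2 * x) powr (-a-2) - 1) / \<epsilon>^2 - nonlin_coeff * x\<bar> + \<bar>nonlin_coeff * (x - v)\<bar>"
      by (simp add: right_diff_distrib)
    also have "\<dots> \<le> b * nonlin_const * (\<epsilon>^2 * x^2) + \<bar>nonlin_coeff\<bar> * t"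
      unfolding abs_mult[of nonlin_coeff] by (intro add_mono nonlin_deriv_bound e ex mult_left_mono xv) auto
    also have "b * nonlin_const * (\<epsilon>^2 * x^2) \<le> b * nonlin_const * (\<epsilon>^2 * M^2)"
      using b_pos nonlin_const(1) power_mono[OF xM, of 2] by (intro mult_left_mono) auto
    finally show "norm (b * ((1 + \<epsilon>^2 * x) powr (-a-2) - 1) / \<epsilon>^2 - nonlin_coeff * v)
        \<le> \<bar>nonlin_coeff\<bar> * t + b * nonlin_const * (\<epsilon>^2 * M^2)"
      by simp
  qed (use M v in \<open>auto simp: abs_le_iff convex_Int\<close>)
  then show ?thesis by (simp add: algebra_simps)
qed

text \<open>The counterpart for the residual, where the whole quadratic part is subtracted. As a
  Lipschitz bound it passes to compositions in H^1.\<close>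

lemma nonlin_quad:
  assumes e: "\<epsilon> > 0" and M: "\<epsilon>^2 * M \<le> 1/2" "\<bar>p\<bar> \<le> M" "\<bar>q\<bar> \<le> M"
  shows "\<bar>(nonlin \<epsilon> p - nonlin_coeff/2 * p^2) - (nonlin \<epsilon> q - nonlin_coeff/2 * q^2)\<bar>
      \<le> (b * nonlin_const * (\<epsilon>^2 * M^2)) * \<bar>p - q\<bar>"
proof -
  let ?f = "\<lambda>x. nonlin \<epsilon> x - nonlin_coeff/2 * x^2"
  have "norm (?f p - ?f q) \<le> (b * nonlin_const * (\<epsilon>^2 * M^2)) * norm (p - q)"
  proof (rule field_differentiable_bound[where S="{-M..M}" and f'="\<lambda>x. b * ((1 + \<epsilon>^2 * x) powr (-a-2) -
      1) / \<epsilon>^2 - nonlin_coeff * x"])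
    fix x assume x: "x \<in> {-M..M}"
    then have xM: "\<bar>x\<bar> \<le> M" by auto
    have ex: "\<epsilon>^2 * \<bar>x\<bar> \<le> 1/2" using mult_left_mono[OF xM, of "\<epsilon>^2"] M(1) by simp
    show "(?f has_field_derivative b * ((1 + \<epsilon>^2 * x) powr (-a-2) - 1) / \<epsilon>^2 - nonlin_coeff * x) (at x
        within {-M..M})"
      by (rule has_field_derivative_at_within) (rule derivative_eq_intros nonlin_deriv[OF e ex] refl | simp)+
    have "b * nonlin_const * (\<epsilon>^2 * x^2) \<le> b * nonlin_const * (\<epsilon>^2 * M^2)"
      using b_pos nonlin_const(1) power_mono[OF xM, of 2] by (intro mult_left_mono) auto
    then show "norm (b * ((1 + \<epsilon>^2 * x) powr (-a-2) - 1) / \<epsilon>^2 - nonlin_coeff * x) \<le> b * nonlin_const *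
        (\<epsilon>^2 * M^2)"
      using nonlin_deriv_bound[OF e ex] by simp
  qed (use M in \<open>auto simp: abs_le_iff\<close>)
  then show ?thesis by simp
qed

end

section \<open>The contraction\<close>

context wave begin

definition amplitude where "amplitude = zeta_a2 / (4 * (a + 2) * zeta_a)"
definition W0 :: h1 where "W0 = (- amplitude) *\<^sub>R sech_sq_h1"
definition nonlin_h1 :: "real \<Rightarrow> h1 \<Rightarrow> nat \<Rightarrow> h1" where "nonlin_h1 \<epsilon> W n = comp_h1 (nonlin \<epsilon>) (avg_h1 (h \<epsilon> n) W)"
definition nonlin_sum :: "real \<Rightarrow> h1 \<Rightarrow> h1"
    where "nonlin_sum \<epsilon> W = (\<Sum>n. w n *\<^sub>R avg_h1 (h \<epsilon> n) (nonlin_h1 \<epsilon> W n))"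
definition wave_map :: "real \<Rightarrow> h1 \<Rightarrow> h1" where "wave_map \<epsilon> W = lin_inv \<epsilon> (nonlin_sum \<epsilon> W)"

text \<open>Functions of norm at most R are bounded by 2R, so \<epsilon>^2 v stays within 1/2, the
  range on which \<open>powr_Taylor\<close> controls the potential.\<close>

definition small :: "real \<Rightarrow> real \<Rightarrow> bool" where
  "small \<epsilon> R \<longleftrightarrow> 0 < \<epsilon> \<and> \<epsilon> \<le> 1 \<and> \<epsilon>^2 * (2 * R) \<le> 1/2"

lemma smallD: "small \<epsilon> R \<Longrightarrow> \<epsilon> > 0" "small \<epsilon> R \<Longrightarrow> \<epsilon> \<le> 1" "small \<epsilon> R \<Longrightarrow> \<epsilon>^2 * (2 * R) \<le> 1/2"
  by (auto simp: small_def)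

lemma small_mono: "small \<epsilon> R \<Longrightarrow> R' \<le> R \<Longrightarrow> small \<epsilon> R'"
proof -
  assume s: "small \<epsilon> R" and R: "R' \<le> R"
  have "\<epsilon>^2 * (2 * R') \<le> \<epsilon>^2 * (2 * R)" using R by (intro mult_left_mono) auto
  with smallD[OF s] show ?thesis unfolding small_def by linarith
qed

lemma fn_avg_h1_sup: "\<epsilon> > 0 \<Longrightarrow> norm W \<le> R \<Longrightarrow> \<bar>fn (avg_h1 (h \<epsilon> n) W) x\<bar> \<le> 2 * R"
  using fn_sup[of "avg_h1 (h \<epsilon> n) W" x] norm_avg_h1[OF h_pos, of \<epsilon> n W] by linarith

lemma nonlin_lip:
  assumes s: "small \<epsilon> R" "norm W \<le> R" and p: "\<bar>p\<bar> \<le> 2 * R" "\<bar>q\<bar> \<le> 2 * R"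
  shows "\<bar>nonlin \<epsilon> p - nonlin \<epsilon> q\<bar> \<le> (\<bar>nonlin_coeff\<bar> * (2 * R) + b * nonlin_const * (\<epsilon>^2 * (2 * R)^2)) *
      \<bar>p - q\<bar>"
proof -
  have "\<bar>nonlin \<epsilon> p - nonlin \<epsilon> q - nonlin_coeff * 0 * (p - q)\<bar> \<le> (\<bar>nonlin_coeff\<bar> * (2 * R) + b *
      nonlin_const * (\<epsilon>^2 * (2 * R)^2)) * \<bar>p - q\<bar>"
    by (rule nonlin_lin[OF smallD(1)[OF s(1)] smallD(3)[OF s(1)] p]) (simp_all only: diff_zero p)
  then show ?thesis by (simp only: mult_zero_right mult_zero_left diff_zero)
qed

lemma lip_const_nonneg: "0 \<le> R \<Longrightarrow> 0 \<le> \<bar>nonlin_coeff\<bar> * (2 * R) + b * nonlin_const * (\<epsilon>^2 * (2 * R)^2)"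
  using b_pos nonlin_const(1) by simp

lemma
  assumes s: "small \<epsilon> R" and W: "norm W \<le> R"
  shows fn_nonlin_h1: "fn (nonlin_h1 \<epsilon> W n) x = nonlin \<epsilon> (fn (avg_h1 (h \<epsilon> n) W) x)"
    and norm_nonlin_h1: "norm (nonlin_h1 \<epsilon> W n) \<le> (\<bar>nonlin_coeff\<bar> * (2 * R) + b * nonlin_const * (\<epsilon>^2 *
        (2 * R)^2)) * R"
proof -
  have e: "\<epsilon> > 0" by (rule smallD(1)[OF s])
  have R: "0 \<le> R" using W norm_ge_zero order_trans by blast
  note c = fn_avg_h1_sup[OF e W, of n] nonlin_0 nonlin_lip[OF s W] lip_const_nonneg[OF R, of \<epsilon>]
  show "fn (nonlin_h1 \<epsilon> W n) x = nonlin \<epsilon> (fn (avg_h1 (h \<epsilon> n) W) x)"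
    unfolding nonlin_h1_def by (rule fn_comp_h1[of _ "2 * R", OF c])
  have "norm (nonlin_h1 \<epsilon> W n) \<le> (\<bar>nonlin_coeff\<bar> * (2 * R) + b * nonlin_const * (\<epsilon>^2 * (2 * R)^2)) *
      norm (avg_h1 (h \<epsilon> n) W)"
    unfolding nonlin_h1_def by (rule norm_comp_h1[of _ "2 * R", OF c])
  also have "\<dots> \<le> (\<bar>nonlin_coeff\<bar> * (2 * R) + b * nonlin_const * (\<epsilon>^2 * (2 * R)^2)) * R"
    using norm_avg_h1[OF h_pos[OF e], of n W] W c(4) by (intro mult_left_mono) linarith+
  finally show "norm (nonlin_h1 \<epsilon> W n) \<le> (\<bar>nonlin_coeff\<bar> * (2 * R) + b * nonlin_const * (\<epsilon>^2 * (2 *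
      R)^2)) * R" .
qed

lemma nonlin_sum_sums:
  assumes s: "small \<epsilon> R" and W: "norm W \<le> R"
  shows "(\<lambda>n. w n *\<^sub>R avg_h1 (h \<epsilon> n) (nonlin_h1 \<epsilon> W n)) sums nonlin_sum \<epsilon> W"
proof -
  have "norm (avg_h1 (h \<epsilon> n) (nonlin_h1 \<epsilon> W n)) \<le> (\<bar>nonlin_coeff\<bar> * (2 * R) + b * nonlin_const * (\<epsilon>^2 *
      (2 * R)^2)) * R" for n
    using norm_avg_h1[OF h_pos[OF smallD(1)[OF s]]] norm_nonlin_h1[OF s W] order_trans by blast
  then show ?thesis unfolding nonlin_sum_def by (intro summable_sums summable_w_bounded(1))
qed

text \<open>The inverse is moved inside each outer average, so that the series can be estimated term
  by term with \<open>lin_inv_smoothing\<close>.\<close>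

lemma wave_map_sums:
  assumes s: "small \<epsilon> R" and W: "norm W \<le> R"
  shows "(\<lambda>n. w n *\<^sub>R avg_h1 (h \<epsilon> n) (lin_inv \<epsilon> (nonlin_h1 \<epsilon> W n))) sums wave_map \<epsilon> W"
proof -
  have e: "\<epsilon> > 0" by (rule smallD(1)[OF s])
  show ?thesis
    using bounded_linear.sums[OF bounded_linear_lin_inv[OF e] nonlin_sum_sums[OF s W]]
    by (simp add: wave_map_def linear_simps(5)[OF bounded_linear_lin_inv[OF e]] avg_h1_lin_inv[OF e
        h_pos[OF e]])
qed

lemma weight_le: assumes e: "0 < \<epsilon>"
  shows "summable (\<lambda>n. w n * h \<epsilon> n)" "(\<Sum>n. w n * h \<epsilon> n) \<le> \<epsilon> * zeta_a2"
proof -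
  have s: "(\<lambda>n. \<epsilon> * (w n * real (Suc n)^2)) sums (\<epsilon> * zeta_a2)" by (intro sums_mult w2_sums)
  have le: "w n * h \<epsilon> n \<le> \<epsilon> * (w n * real (Suc n)^2)" for n
  proof -
    have "real (Suc n) * 1 \<le> real (Suc n) * real (Suc n)" by (intro mult_left_mono) auto
    then have "w n * \<epsilon> * real (Suc n) \<le> w n * \<epsilon> * real (Suc n)^2"
      using e w_pos[of n] unfolding power2_eq_square by (intro mult_left_mono) auto
    then show ?thesis by (simp add: h_def mult_ac)
  qed
  show sm: "summable (\<lambda>n. w n * h \<epsilon> n)"
    using le w_pos h_pos[OF e] by (intro summable_comparison_test[OF _ sums_summable[OF s]])
      (auto simp: less_imp_le abs_mult)
  show "(\<Sum>n. w n * h \<epsilon> n) \<le> \<epsilon> * zeta_a2"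
    using suminf_le[OF le sm sums_summable[OF s]] s by (simp add: sums_iff)
qed

text \<open>The amplitude is chosen such that, after division by \<open>disp_coeff\<close>, the
  nonlinearity linearised at the soliton has the coefficient 3 sech^2(x/2) whatever a is.\<close>

lemma nonlin_coeff_amplitude: "nonlin_coeff * amplitude = - (3 * disp_coeff / zeta_a)"
proof -
  define p where "p = a + 2"
  have "p \<noteq> 0" "zeta_a \<noteq> 0" using a3 zeta_a_pos by (auto simp: p_def)
  then show ?thesis unfolding nonlin_coeff_def amplitude_def disp_coeff_def p_def[symmetric]
      by (simp add: field_simps)
qed

lemma norm_shifted_le:
  assumes "0 \<le> s" "s \<le> 1" "norm U \<le> \<kappa>" shows "norm (W0 + s *\<^sub>R U) \<le> norm W0 + \<kappa>"
proof -
  have "s * norm U \<le> 1 * \<kappa>" using assms by (intro mult_mono) auto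
  then show ?thesis using norm_triangle_ineq[of W0 "s *\<^sub>R U"] assms by simp
qed

text \<open>With u = \<open>limit_op D\<close>, the function 3 \<open>disp_coeff\<close> sech^2(x/2)
  D is \<open>lin_op \<epsilon> u\<close> plus a remainder. As D and hence u'' are only in H^1, this
  remainder is estimated in L^2, at rate \<open>error_rate\<close>, and the average in front of the
  inverse restores H^1.\<close>

lemma main_term:
  assumes e: "\<epsilon> > 0" and d: "d = limit_op D - 3 *\<^sub>R mult_h1 sech_sq_h1 D"
  shows "(\<lambda>n. w n *\<^sub>R avg_h1 (h \<epsilon> n) (lin_inv \<epsilon> (nonlin_coeff *\<^sub>R mult_h1 W0 D)))
      sums (\<Sum>n. w n *\<^sub>R avg_h1 (h \<epsilon> n) (lin_inv \<epsilon> (nonlin_coeff *\<^sub>R mult_h1 W0 D)))"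
    and "norm ((\<Sum>n. w n *\<^sub>R avg_h1 (h \<epsilon> n) (lin_inv \<epsilon> (nonlin_coeff *\<^sub>R mult_h1 W0 D))) - limit_op D)
        \<le> (\<epsilon>^2 * zeta_a2 / zeta_a + smoothing_const * error_rate \<epsilon>) * norm d"
proof -
  let ?u = "limit_op D" and ?r = "lin_remainder \<epsilon> (limit_op D) d"
  have second_deriv: "second_deriv ?u d"
      unfolding d by (rule decaying_deriv_second_deriv[OF decaying_deriv_limit_op])
  have "lin_op \<epsilon> ?u = disp_coeff *\<^sub>R (?u - d) - ?r" by (rule lin_op_lin_remainder[OF second_deriv e])
  then have "(3 * disp_coeff) *\<^sub>R mult_h1 sech_sq_h1 D = lin_op \<epsilon> ?u + ?r" by (simp add: d)
  then have T3: "lin_inv \<epsilon> ((3 * disp_coeff) *\<^sub>R mult_h1 sech_sq_h1 D) = ?u + lin_inv \<epsilon> ?r"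
    by (simp add: linear_simps(1)[OF bounded_linear_lin_inv[OF e]] lin_inv_lin_op[OF e])
  have "nonlin_coeff * - amplitude = 3 * disp_coeff / zeta_a" using nonlin_coeff_amplitude by simp
  then have "nonlin_coeff *\<^sub>R mult_h1 W0 D = (1 / zeta_a) *\<^sub>R ((3 * disp_coeff) *\<^sub>R mult_h1 sech_sq_h1 D)"
  proof (intro h1_eqI)
    fix x
    have "nonlin_coeff * (- amplitude * sech_sq x * fn D x) = (nonlin_coeff * - amplitude) * (sech_sq x
        * fn D x)" by simp
    also have "\<dots> = 1 / zeta_a * (3 * disp_coeff * (sech_sq x * fn D x))"
        using \<open>nonlin_coeff * - amplitude = 3 * disp_coeff / zeta_a\<close> by simp
    finally show "fn (nonlin_coeff *\<^sub>R mult_h1 W0 D) x = fn ((1 / zeta_a) *\<^sub>R ((3 * disp_coeff) *\<^sub>R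
        mult_h1 sech_sq_h1 D)) x"
      by (simp add: W0_def)
  qed
  then have Tl: "lin_inv \<epsilon> (nonlin_coeff *\<^sub>R mult_h1 W0 D) = (1 / zeta_a) *\<^sub>R (?u + lin_inv \<epsilon> ?r)"
    using linear_simps(5)[OF bounded_linear_lin_inv[OF e], of "1 / zeta_a" "(3 * disp_coeff) *\<^sub>R mult_h1
        sech_sq_h1 D"] by (simp only: T3)
  have "norm (avg_h1 (h \<epsilon> n) (lin_inv \<epsilon> (nonlin_coeff *\<^sub>R mult_h1 W0 D)))
      \<le> norm (lin_inv \<epsilon> (nonlin_coeff *\<^sub>R mult_h1 W0 D))" for n
    by (rule norm_avg_h1[OF h_pos[OF e]])
  from summable_w_bounded(1)[OF this]
  show S: "(\<lambda>n. w n *\<^sub>R avg_h1 (h \<epsilon> n) (lin_inv \<epsilon> (nonlin_coeff *\<^sub>R mult_h1 W0 D)))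
      sums (\<Sum>n. w n *\<^sub>R avg_h1 (h \<epsilon> n) (lin_inv \<epsilon> (nonlin_coeff *\<^sub>R mult_h1 W0 D)))"
    by (rule summable_sums)
  have "(\<lambda>n. w n *\<^sub>R ((1/zeta_a) *\<^sub>R ?u)) sums (zeta_a *\<^sub>R ((1/zeta_a) *\<^sub>R ?u))"
    by (rule bounded_linear.sums[OF bounded_linear_scaleR_left w_sums])
  then have "(\<lambda>n. w n *\<^sub>R ((1/zeta_a) *\<^sub>R ?u)) sums ?u" using zeta_a_pos by simp
  from sums_diff[OF S this]
  have S2: "(\<lambda>n. w n *\<^sub>R avg_h1 (h \<epsilon> n) (lin_inv \<epsilon> (nonlin_coeff *\<^sub>R mult_h1 W0 D)) - w n *\<^sub>R
      ((1/zeta_a) *\<^sub>R ?u))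
     sums ((\<Sum>n. w n *\<^sub>R avg_h1 (h \<epsilon> n) (lin_inv \<epsilon> (nonlin_coeff *\<^sub>R mult_h1 W0 D))) - ?u)" .
  have b: "norm (w n *\<^sub>R avg_h1 (h \<epsilon> n) (lin_inv \<epsilon> (nonlin_coeff *\<^sub>R mult_h1 W0 D)) - w n *\<^sub>R
      ((1/zeta_a) *\<^sub>R ?u))
     \<le> (1/zeta_a * norm d) * (w n * h \<epsilon> n^2) + w n * (1/zeta_a * (smoothing_const * (error_rate \<epsilon> * norm
         d)))" for n
  proof -
    note A = bounded_linear_avg_h1[OF h_pos[OF e], of n]
    have "w n *\<^sub>R avg_h1 (h \<epsilon> n) (lin_inv \<epsilon> (nonlin_coeff *\<^sub>R mult_h1 W0 D)) - w n *\<^sub>R ((1/zeta_a) *\<^sub>R ?u)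
      = (w n / zeta_a) *\<^sub>R ((avg_h1 (h \<epsilon> n) ?u - ?u) + avg_h1 (h \<epsilon> n) (lin_inv \<epsilon> ?r))"
      unfolding Tl linear_simps(5)[OF A] linear_simps(1)[OF A] by (simp add: algebra_simps scaleR_diff_right)
    then have "norm (w n *\<^sub>R avg_h1 (h \<epsilon> n) (lin_inv \<epsilon> (nonlin_coeff *\<^sub>R mult_h1 W0 D)) - w n *\<^sub>R
        ((1/zeta_a) *\<^sub>R ?u))
      = (w n / zeta_a) * norm ((avg_h1 (h \<epsilon> n) ?u - ?u) + avg_h1 (h \<epsilon> n) (lin_inv \<epsilon> ?r))"
          using w_pos[of n] zeta_a_pos by simp
    also have "\<dots> \<le> (w n / zeta_a) * (h \<epsilon> n^2 * norm d + smoothing_const * (error_rate \<epsilon> * norm d))"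
    proof (intro mult_left_mono)
      have "norm (avg_h1 (h \<epsilon> n) ?u - ?u) \<le> h \<epsilon> n^2 * norm d"
          by (rule norm_avg_h1_minus_id[OF second_deriv h_pos[OF e]])
      moreover have "norm (avg_h1 (h \<epsilon> n) (lin_inv \<epsilon> ?r)) \<le> smoothing_const * l2_norm (fn ?r)"
          by (rule lin_inv_smoothing[OF e])
      moreover have "smoothing_const * l2_norm (fn ?r) \<le> smoothing_const * (error_rate \<epsilon> * norm d)"
        using smoothing_const_pos by (intro mult_left_mono l2_norm_lin_remainder[OF second_deriv e]) auto
      ultimately show "norm ((avg_h1 (h \<epsilon> n) ?u - ?u) + avg_h1 (h \<epsilon> n) (lin_inv \<epsilon> ?r))
          \<le> h \<epsilon> n^2 * norm d + smoothing_const * (error_rate \<epsilon> * norm d)"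
        using norm_triangle_ineq[of "avg_h1 (h \<epsilon> n) ?u - ?u" "avg_h1 (h \<epsilon> n) (lin_inv \<epsilon> ?r)"] by linarith
    qed (use w_pos[of n] zeta_a_pos in auto)
    finally show ?thesis by (simp add: algebra_simps)
  qed
  have sb: "(\<lambda>n. (1/zeta_a * norm d) * (w n * h \<epsilon> n^2) + w n * (1/zeta_a * (smoothing_const *
      (error_rate \<epsilon> * norm d))))
    sums ((1/zeta_a * norm d) * (\<epsilon>^2 * zeta_a2) + zeta_a * (1/zeta_a * (smoothing_const * (error_rate \<epsilon>
        * norm d))))"
    by (intro sums_add sums_mult sums_mult2 weight2_sums w_sums)
  from norm_suminf_le[OF b sums_summable[OF sb]] sums_unique[OF S2] sums_unique[OF sb]
  have "norm ((\<Sum>n. w n *\<^sub>R avg_h1 (h \<epsilon> n) (lin_inv \<epsilon> (nonlin_coeff *\<^sub>R mult_h1 W0 D))) - ?u)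
    \<le> (1/zeta_a * norm d) * (\<epsilon>^2 * zeta_a2) + zeta_a * (1/zeta_a * (smoothing_const * (error_rate \<epsilon> *
        norm d)))" by simp
  also have "\<dots> = (\<epsilon>^2 * zeta_a2 / zeta_a + smoothing_const * error_rate \<epsilon>) * norm d"
      using zeta_a_pos by (simp add: algebra_simps)
  finally show "norm ((\<Sum>n. w n *\<^sub>R avg_h1 (h \<epsilon> n) (lin_inv \<epsilon> (nonlin_coeff *\<^sub>R mult_h1 W0 D))) - ?u)
      \<le> (\<epsilon>^2 * zeta_a2 / zeta_a + smoothing_const * error_rate \<epsilon>) * norm d" .
qed

text \<open>Three errors arise in the linearisation at \<open>W0\<close>: the coefficient is taken
  at a shifted point (order s), \<open>nonlin\<close> is not exactly quadratic (order \<epsilon>^2),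
  and the inner averages are dropped (order h, at the price of one derivative and hence in L^2
  only).\<close>

lemma remainder_term:
  assumes s: "0 \<le> s" "s \<le> 1" and sm: "small \<epsilon> (norm W0 + \<kappa>)" and V: "norm V \<le> \<kappa>" "norm V' \<le> \<kappa>"
  shows "l2_norm (fn (nonlin_h1 \<epsilon> (W0 + s *\<^sub>R V) n - nonlin_h1 \<epsilon> (W0 + s *\<^sub>R V') n - s *\<^sub>R (nonlin_coeff
      *\<^sub>R mult_h1 W0 (V - V'))))
    \<le> s * norm (V - V') * (2 * \<bar>nonlin_coeff\<bar> * \<kappa> * s + b * nonlin_const * (2 * (norm W0 + \<kappa>))^2 * \<epsilon>^2 +
        4 * \<bar>nonlin_coeff\<bar> * norm W0 * h \<epsilon> n)"
proof -
  have e: "\<epsilon> > 0" by (rule smallD(1)[OF sm])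
  let ?A = "avg_h1 (h \<epsilon> n)" let ?D = "V - V'" let ?R = "norm W0 + \<kappa>"
  have k: "0 \<le> \<kappa>" using V(1) norm_ge_zero order_trans by blast
  note nW = norm_shifted_le[OF s]
  note A = bounded_linear_avg_h1[OF h_pos[OF e], of n]
  let ?c1 = "\<bar>nonlin_coeff\<bar> * (s * (2 * \<kappa>)) + b * nonlin_const * (\<epsilon>^2 * (2 * ?R)^2)"
  have c1: "0 \<le> ?c1" using s k b_pos nonlin_const(1) by simp
  define E where "E = nonlin_h1 \<epsilon> (W0 + s *\<^sub>R V) n - nonlin_h1 \<epsilon> (W0 + s *\<^sub>R V') n - s *\<^sub>R (nonlin_coeff
      *\<^sub>R mult_h1 W0 ?D)"
  \<comment> \<open>With A the average and D = V - V', this is \<open>nonlin_coeff * s\<close> times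
    A W0 A D - W0 D, the error of dropping the averages; E - E2 is then the linearisation error at A
    W0.\<close>
  define E2 where "E2 = (nonlin_coeff * s) *\<^sub>R (mult_h1 (?A W0) (?A ?D - ?D) + mult_h1 ?D (?A W0 - W0))"
  have fA: "fn (?A (W0 + s *\<^sub>R U)) x = fn (?A W0) x + s * fn (?A U) x" for U x
    by (simp add: linear_simps(1)[OF A] linear_simps(5)[OF A])
  have fD: "fn (?A ?D) x = fn (?A V) x - fn (?A V') x" for x
    by (simp add: linear_simps(2)[OF A])
  have E1: "\<bar>fn (E - E2) x\<bar> \<le> (?c1 * s) * \<bar>fn (?A ?D) x\<bar>" for x
  proof -
    let ?p = "fn (?A (W0 + s *\<^sub>R V)) x" let ?q = "fn (?A (W0 + s *\<^sub>R V')) x" let ?v = "fn (?A W0) x"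
    have pq: "?p - ?q = s * fn (?A ?D) x" by (simp add: fA fD algebra_simps)
    have "fn (E - E2) x = nonlin \<epsilon> ?p - nonlin \<epsilon> ?q - nonlin_coeff * ?v * (?p - ?q)"
      unfolding pq by (simp add: E_def E2_def fn_nonlin_h1[OF sm nW[OF V(1)]] fn_nonlin_h1[OF sm nW[OF
          V(2)]] algebra_simps)
    also have "\<bar>\<dots>\<bar> \<le> ?c1 * \<bar>?p - ?q\<bar>"
    proof (rule nonlin_lin[OF e smallD(3)[OF sm]])
      show "\<bar>?p\<bar> \<le> 2 * ?R" "\<bar>?q\<bar> \<le> 2 * ?R" using fn_avg_h1_sup[OF e nW] V by auto
      show "\<bar>?p - ?v\<bar> \<le> s * (2 * \<kappa>)" "\<bar>?q - ?v\<bar> \<le> s * (2 * \<kappa>)"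
        using fn_avg_h1_sup[OF e V(1), of n x] fn_avg_h1_sup[OF e V(2), of n x] s
            by (auto simp: fA abs_mult intro!: mult_left_mono)
    qed
    finally show ?thesis unfolding pq using s by (simp add: abs_mult)
  qed
  have nA: "l2_bounded (fn (?A ?D)) (norm ?D)"
      using fn_l2_bounded l2_bounded_mono norm_avg_h1[OF h_pos[OF e]] by blast
  have "l2_bounded (fn (E - E2)) (?c1 * s * norm ?D)"
    by (rule l2_bounded_dom[OF nA fn_cont]) (use E1 c1 s in auto)
  then have 1: "l2_norm (fn (E - E2)) \<le> ?c1 * s * norm ?D" by (rule l2_norm_le)
  have 2: "l2_norm (fn E2) \<le> 4 * \<bar>nonlin_coeff\<bar> * s * norm W0 * h \<epsilon> n * norm ?D"
  proof -
    have l: "l2_bounded (fn (?A U - U)) (h \<epsilon> n * norm U)" for U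
      using fn_l2_norm[of "?A U - U"] l2_norm_avg_h1_minus_id[OF h_pos[OF e]] l2_bounded_mono by blast
    have a: "l2_bounded (fn (mult_h1 (?A W0) (?A ?D - ?D))) (2 * norm W0 * (h \<epsilon> n * norm ?D))"
      by (rule l2_bounded_dom[OF l fn_cont])
        (use fn_avg_h1_sup[OF e order_refl, of n W0] in \<open>auto simp: abs_mult intro!: mult_right_mono
            simp del: fn_minus\<close>)
    have b: "l2_bounded (fn (mult_h1 ?D (?A W0 - W0))) (2 * norm ?D * (h \<epsilon> n * norm W0))"
      by (rule l2_bounded_dom[OF l fn_cont])
        (use fn_sup[of ?D] in \<open>auto simp: abs_mult intro!: mult_right_mono simp del: fn_minus\<close>)
    have "l2_bounded (fn E2) (\<bar>nonlin_coeff * s\<bar> * (2 * norm W0 * (h \<epsilon> n * norm ?D) + 2 * norm ?D * (h \<epsilon>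
        n * norm W0)))"
      unfolding E2_def fn_scaleR_fun fn_plus_fun[of "mult_h1 _ _"]
          by (intro l2_bounded_scale l2_bounded_add a b)
    from l2_norm_le[OF this] show ?thesis using s by (simp add: abs_mult algebra_simps)
  qed
  have "l2_norm (fn E) \<le> l2_norm (fn (E - E2)) + l2_norm (fn E2)"
      using l2_norm_fn_triangle[of "E - E2" E2] by simp
  also have "\<dots> \<le> ?c1 * s * norm ?D + 4 * \<bar>nonlin_coeff\<bar> * s * norm W0 * h \<epsilon> n * norm ?D" using 1 2
      by (rule add_mono)
  finally show ?thesis unfolding E_def by (simp add: algebra_simps)
qed

lemma limit_op_d_bound: "\<exists>K>0. \<forall>D. norm (limit_op D - 3 *\<^sub>R mult_h1 sech_sq_h1 D) \<le> K * norm D"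
proof -
  obtain K where K: "K > 0" "\<And>D. norm (limit_op D) \<le> norm D * K"
      using bounded_linear.pos_bounded[OF bounded_linear_limit_op] by blast
  have "norm (limit_op D - 3 *\<^sub>R mult_h1 sech_sq_h1 D) \<le> (K + 12 * norm sech_sq_h1) * norm D" for D
    using norm_triangle_ineq4[of "limit_op D" "3 *\<^sub>R mult_h1 sech_sq_h1 D"] K(2)[of D] norm_mult_h1[of
        sech_sq_h1 D] by (simp add: algebra_simps)
  then show ?thesis using K(1) by (intro exI[of _ "K + 12 * norm sech_sq_h1"]) (auto intro: add_pos_nonneg)
qed

text \<open>\<open>limit_op\<close> is the limit of the derivative of \<open>wave_map\<close> at
  \<open>W0\<close>. The error is small in H^1, since the L^2 errors of
  \<open>remainder_term\<close> pass through \<open>lin_inv_smoothing\<close> and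
  \<open>main_term\<close> handles the rest.\<close>

lemma wave_map_difference:
  assumes "0 \<le> \<kappa>"
  shows "\<exists>K>0. \<forall>\<epsilon> s V V'. small \<epsilon> (norm W0 + \<kappa>) \<and> 0 \<le> s \<and> s \<le> 1 \<and> norm V \<le> \<kappa> \<and> norm V' \<le> \<kappa> \<longrightarrow>
    norm (wave_map \<epsilon> (W0 + s *\<^sub>R V) - wave_map \<epsilon> (W0 + s *\<^sub>R V') - s *\<^sub>R limit_op (V - V'))
        \<le> K * (s + \<epsilon> + error_rate \<epsilon>) * s * norm (V - V')"
proof -
  obtain Kd where Kd: "Kd > 0" "\<And>D. norm (limit_op D - 3 *\<^sub>R mult_h1 sech_sq_h1 D) \<le> Kd * norm D"
      using limit_op_d_bound by blast
  define c1 where "c1 = 2 * \<bar>nonlin_coeff\<bar> * \<kappa>"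
  define c2 where "c2 = b * nonlin_const * (2 * (norm W0 + \<kappa>))^2"
  define c3 where "c3 = 4 * \<bar>nonlin_coeff\<bar> * norm W0"
  have c: "0 \<le> c1" "0 \<le> c2" "0 \<le> c3" using assms b_pos nonlin_const(1) by (auto simp: c1_def c2_def c3_def)
  define K where "K = smoothing_const * (zeta_a * c1 + zeta_a * c2 + c3 * zeta_a2) + (zeta_a2 / zeta_a +
      smoothing_const) * Kd"
  have K: "K > 0" unfolding K_def using smoothing_const_pos zeta_a_pos zeta_a2_pos c Kd(1)
      by (intro add_nonneg_pos mult_pos_pos add_pos_pos) auto
  have main: "norm (wave_map \<epsilon> (W0 + s *\<^sub>R V) - wave_map \<epsilon> (W0 + s *\<^sub>R V') - s *\<^sub>R limit_op (V - V'))
      \<le> K * (s + \<epsilon> + error_rate \<epsilon>) * s * norm (V - V')"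
    if sm: "small \<epsilon> (norm W0 + \<kappa>)" and s: "0 \<le> s" "s \<le> 1" and V: "norm V \<le> \<kappa>" "norm V' \<le> \<kappa>" for \<epsilon> s V V'
  proof -
    have e: "\<epsilon> > 0" "\<epsilon> \<le> 1" using smallD[OF sm] by auto
    have e2: "\<epsilon>^2 \<le> \<epsilon>" using e by (simp add: power2_eq_square mult_left_le)
    let ?D = "V - V'"
    note nW = norm_shifted_le[OF s]
    let ?E = "\<lambda>n. nonlin_h1 \<epsilon> (W0 + s *\<^sub>R V) n - nonlin_h1 \<epsilon> (W0 + s *\<^sub>R V') n - s *\<^sub>R (nonlin_coeff *\<^sub>R
        mult_h1 W0 ?D)"
    let ?M = "\<Sum>n. w n *\<^sub>R avg_h1 (h \<epsilon> n) (lin_inv \<epsilon> (nonlin_coeff *\<^sub>R mult_h1 W0 ?D))"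
    have S: "(\<lambda>n. w n *\<^sub>R avg_h1 (h \<epsilon> n) (lin_inv \<epsilon> (?E n)))
        sums (wave_map \<epsilon> (W0 + s *\<^sub>R V) - wave_map \<epsilon> (W0 + s *\<^sub>R V') - s *\<^sub>R ?M)"
    proof -
      note L = bounded_linear_compose[OF bounded_linear_avg_h1[OF h_pos[OF e(1)]]
          bounded_linear_lin_inv[OF e(1)]]
      have "w n *\<^sub>R avg_h1 (h \<epsilon> n) (lin_inv \<epsilon> (?E n)) = w n *\<^sub>R avg_h1 (h \<epsilon> n) (lin_inv \<epsilon> (nonlin_h1 \<epsilon>
          (W0 + s *\<^sub>R V) n))
         - w n *\<^sub>R avg_h1 (h \<epsilon> n) (lin_inv \<epsilon> (nonlin_h1 \<epsilon> (W0 + s *\<^sub>R V') n)) - s *\<^sub>R (w n *\<^sub>R avg_h1 (h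
             \<epsilon> n) (lin_inv \<epsilon> (nonlin_coeff *\<^sub>R mult_h1 W0 ?D)))" for n
        unfolding linear_simps(2)[OF L, of n] linear_simps(5)[OF L, of n s]
            by (simp add: scaleR_diff_right mult.commute)
      then show ?thesis
        using sums_diff[OF sums_diff[OF wave_map_sums[OF sm nW[OF V(1)]] wave_map_sums[OF sm nW[OF V(2)]]]
            bounded_linear.sums[OF bounded_linear_scaleR_right main_term(1)[OF e(1) refl, of ?D], of s]] by simp
    qed
    let ?X = "s * norm ?D"
    have X: "0 \<le> ?X" using s by simp
    have b: "norm (w n *\<^sub>R avg_h1 (h \<epsilon> n) (lin_inv \<epsilon> (?E n))) \<le> w n * (smoothing_const * (?X * (c1 * s +
        c2 * \<epsilon>^2))) + (smoothing_const * (?X * c3)) * (w n * h \<epsilon> n)" for n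
    proof -
      have "norm (w n *\<^sub>R avg_h1 (h \<epsilon> n) (lin_inv \<epsilon> (?E n))) \<le> w n * (smoothing_const * l2_norm (fn (?E n)))"
        using lin_inv_smoothing[OF e(1), of n "?E n"] w_pos[of n] by (simp add: less_imp_le)
      also have "\<dots> \<le> w n * (smoothing_const * (s * norm ?D * (c1 * s + c2 * \<epsilon>^2 + c3 * h \<epsilon> n)))"
        using w_pos[of n] smoothing_const_pos remainder_term[OF s sm V, of n]
        by (intro mult_left_mono) (auto simp: c1_def c2_def c3_def less_imp_le)
      finally show ?thesis by (simp add: algebra_simps)
    qed
    let ?b = "\<lambda>n. w n * (smoothing_const * (?X * (c1 * s + c2 * \<epsilon>^2))) + (smoothing_const * (?X * c3)) *
        (w n * h \<epsilon> n)"
    have sb: "summable ?b" "(\<Sum>n. ?b n) \<le> zeta_a * (smoothing_const * (?X * (c1 * s + c2 * \<epsilon>^2))) +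
        (smoothing_const * (?X * c3)) * (\<epsilon> * zeta_a2)"
    proof -
      have 1: "(\<lambda>n. w n * (smoothing_const * (?X * (c1 * s + c2 * \<epsilon>^2))))
          sums (zeta_a * (smoothing_const * (?X * (c1 * s + c2 * \<epsilon>^2))))"
        by (intro sums_mult2 w_sums)
      have 2: "summable (\<lambda>n. (smoothing_const * (?X * c3)) * (w n * h \<epsilon> n))"
          by (intro summable_mult weight_le e)
      have 3: "(\<Sum>n. (smoothing_const * (?X * c3)) * (w n * h \<epsilon> n)) \<le> (smoothing_const * (?X * c3)) * (\<epsilon>
          * zeta_a2)"
        unfolding suminf_mult[OF weight_le(1)[OF e(1)]] using smoothing_const_pos X c
            by (intro mult_left_mono weight_le e) auto
      show "summable ?b" using 1 2 by (intro summable_add) (auto simp: sums_iff)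
      show "(\<Sum>n. ?b n) \<le> zeta_a * (smoothing_const * (?X * (c1 * s + c2 * \<epsilon>^2))) + (smoothing_const *
          (?X * c3)) * (\<epsilon> * zeta_a2)"
        using 3 sums_unique[OF 1] suminf_add[OF sums_summable[OF 1] 2] by linarith
    qed
    have p1: "norm (wave_map \<epsilon> (W0 + s *\<^sub>R V) - wave_map \<epsilon> (W0 + s *\<^sub>R V') - s *\<^sub>R ?M)
      \<le> zeta_a * (smoothing_const * (?X * (c1 * s + c2 * \<epsilon>^2))) + (smoothing_const * (?X * c3)) * (\<epsilon> * zeta_a2)"
      using norm_suminf_le[OF b sb(1)] sb(2) sums_unique[OF S] by simp
    have om0: "0 \<le> error_rate \<epsilon>" unfolding error_rate_def
      using b_pos w_pos h_pos[OF e(1)] e by (intro suminf_nonneg error_rate_summable) (auto simp: less_imp_le)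
    have p2: "norm (s *\<^sub>R ?M - s *\<^sub>R limit_op ?D) \<le> s * ((\<epsilon>^2 * zeta_a2 / zeta_a + smoothing_const *
        error_rate \<epsilon>) * (Kd * norm ?D))"
    proof -
      have "norm (s *\<^sub>R ?M - s *\<^sub>R limit_op ?D) = s * norm (?M - limit_op ?D)"
          using s by (simp flip: scaleR_diff_right)
      also have "\<dots> \<le> s * ((\<epsilon>^2 * zeta_a2 / zeta_a + smoothing_const * error_rate \<epsilon>) * norm (limit_op ?D
          - 3 *\<^sub>R mult_h1 sech_sq_h1 ?D))"
        using s by (intro mult_left_mono main_term(2)[OF e(1) refl]) auto
      also have "\<dots> \<le> s * ((\<epsilon>^2 * zeta_a2 / zeta_a + smoothing_const * error_rate \<epsilon>) * (Kd * norm ?D))"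
        using s Kd om0 smoothing_const_pos zeta_a2_pos zeta_a_pos by (intro mult_left_mono Kd) auto
      finally show ?thesis .
    qed
    have "norm (wave_map \<epsilon> (W0 + s *\<^sub>R V) - wave_map \<epsilon> (W0 + s *\<^sub>R V') - s *\<^sub>R limit_op ?D)
      \<le> norm (wave_map \<epsilon> (W0 + s *\<^sub>R V) - wave_map \<epsilon> (W0 + s *\<^sub>R V') - s *\<^sub>R ?M) + norm (s *\<^sub>R ?M - s
          *\<^sub>R limit_op ?D)"
      using norm_triangle_ineq[of "wave_map \<epsilon> (W0 + s *\<^sub>R V) - wave_map \<epsilon> (W0 + s *\<^sub>R V') - s *\<^sub>R ?M"
          "s *\<^sub>R ?M - s *\<^sub>R limit_op ?D"] by simp
    also have "\<dots> \<le> (zeta_a * (smoothing_const * (?X * (c1 * s + c2 * \<epsilon>^2))) + (smoothing_const * (?X *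
        c3)) * (\<epsilon> * zeta_a2)) + s * ((\<epsilon>^2 * zeta_a2 / zeta_a + smoothing_const * error_rate \<epsilon>) * (Kd *
        norm ?D))"
      using p1 p2 by (rule add_mono)
    also have "\<dots> = ?X * (smoothing_const * zeta_a * c1 * s + smoothing_const * zeta_a * c2 * \<epsilon>^2 +
        smoothing_const * c3 * zeta_a2 * \<epsilon> + zeta_a2 / zeta_a * Kd * \<epsilon>^2 + smoothing_const * Kd * error_rate \<epsilon>)"
      by (simp add: algebra_simps)
    also have "\<dots> \<le> ?X * (K * (s + \<epsilon> + error_rate \<epsilon>))"
    proof (rule mult_left_mono[OF _ X])
      let ?S = "s + \<epsilon> + error_rate \<epsilon>"
      have S: "s \<le> ?S" "\<epsilon> \<le> ?S" "\<epsilon>^2 \<le> ?S" "error_rate \<epsilon> \<le> ?S" using s e e2 om0 by auto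
      have "smoothing_const * zeta_a * c1 * s + smoothing_const * zeta_a * c2 * \<epsilon>^2 + smoothing_const *
          c3 * zeta_a2 * \<epsilon> + zeta_a2 / zeta_a * Kd * \<epsilon>^2 + smoothing_const * Kd * error_rate \<epsilon>
        \<le> smoothing_const * zeta_a * c1 * ?S + smoothing_const * zeta_a * c2 * ?S + smoothing_const * c3
            * zeta_a2 * ?S + zeta_a2 / zeta_a * Kd * ?S + smoothing_const * Kd * ?S"
        using smoothing_const_pos zeta_a_pos zeta_a2_pos c Kd(1) S by (intro add_mono mult_left_mono) auto
      also have "\<dots> = K * ?S" by (simp add: K_def algebra_simps)
      finally show "smoothing_const * zeta_a * c1 * s + smoothing_const * zeta_a * c2 * \<epsilon>^2 +
          smoothing_const * c3 * zeta_a2 * \<epsilon> + zeta_a2 / zeta_a * Kd * \<epsilon>^2 + smoothing_const * Kd *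
          error_rate \<epsilon> \<le> K * ?S" .
    qed
    finally show ?thesis by (simp add: mult_ac)
  qed
  show ?thesis using K main by blast
qed

text \<open>With S = sech^2(x/2), \<open>d0\<close> and \<open>d0'\<close> are the second and fourth
  derivatives of \<open>W0\<close>, by S'' = S - (3/2) S^2 and (S^2)'' = 4 S^2 - 5 S^3.\<close>

definition d0 :: h1 where "d0 = (- amplitude) *\<^sub>R (sech_sq_h1 - (3/2) *\<^sub>R mult_h1 sech_sq_h1 sech_sq_h1)"
definition d0' :: h1 where "d0' = (- amplitude) *\<^sub>R ((sech_sq_h1 - (3/2) *\<^sub>R mult_h1 sech_sq_h1
    sech_sq_h1) - (3/2) *\<^sub>R (4 *\<^sub>R mult_h1 sech_sq_h1 sech_sq_h1 - 5 *\<^sub>R mult_h1 sech_sq_h1 (mult_h1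
    sech_sq_h1 sech_sq_h1)))"

lemma second_deriv_W0: "second_deriv W0 d0"
    unfolding W0_def d0_def by (intro second_deriv_scale second_deriv_sech_sq_h1)

lemma second_deriv_d0: "second_deriv d0 d0'"
proof -
  have "second_deriv ((- amplitude) *\<^sub>R (sech_sq_h1 + (-3/2) *\<^sub>R mult_h1 sech_sq_h1 sech_sq_h1)) ((-
      amplitude) *\<^sub>R ((sech_sq_h1 - (3/2) *\<^sub>R mult_h1 sech_sq_h1 sech_sq_h1) + (-3/2) *\<^sub>R (4 *\<^sub>R mult_h1
      sech_sq_h1 sech_sq_h1 - 5 *\<^sub>R mult_h1 sech_sq_h1 (mult_h1 sech_sq_h1 sech_sq_h1))))"
    by (intro second_deriv_scale second_deriv_add second_deriv_sech_sq_h1 second_deriv_Sh2)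
  then show ?thesis by (simp add: d0_def d0'_def)
qed

lemma second_deriv_W0_sq: "second_deriv (mult_h1 W0 W0) ((amplitude^2) *\<^sub>R (4 *\<^sub>R mult_h1 sech_sq_h1
    sech_sq_h1 - 5 *\<^sub>R mult_h1 sech_sq_h1 (mult_h1 sech_sq_h1 sech_sq_h1)))"
proof -
  have "mult_h1 W0 W0 = (amplitude^2) *\<^sub>R mult_h1 sech_sq_h1 sech_sq_h1"
    by (rule h1_eqI) (simp add: W0_def power2_eq_square)
  then show ?thesis using second_deriv_scale[OF second_deriv_Sh2, of "amplitude^2"] by simp
qed

text \<open>\<open>W0\<close> solves the limit equation, so what is left is the dispersion error
  \<open>lin_remainder\<close> and errors of order \<epsilon>^2 from the nonlinearity and its
  averages. As \<open>W0\<close> is smooth, all of them are measured in H^1 and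
  \<open>norm_lin_inv\<close> suffices.\<close>

lemma residual:
  "\<exists>K>0. \<forall>\<epsilon>. small \<epsilon> (norm W0) \<longrightarrow> norm (wave_map \<epsilon> W0 - W0) \<le> K * (\<epsilon>^2 + residual_rate \<epsilon>)"
proof -
  let ?s = "(amplitude^2) *\<^sub>R (4 *\<^sub>R mult_h1 sech_sq_h1 sech_sq_h1 - 5 *\<^sub>R mult_h1 sech_sq_h1 (mult_h1
      sech_sq_h1 sech_sq_h1))"
  define c1 where "c1 = b * nonlin_const * (2 * norm W0)^2 * norm W0"
  define c2 where "c2 = \<bar>nonlin_coeff\<bar> / 2 * (8 * norm W0 * norm d0 + norm ?s)"
  define c3 where "c3 = norm d0 + norm d0'"
  have c: "0 \<le> c1" "0 \<le> c2" "0 \<le> c3" using b_pos nonlin_const(1) by (auto simp: c1_def c2_def c3_def)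
  define K where "K = (zeta_a * c1 + zeta_a2 * c2 + c3 + 1) / disp_coeff"
  have K: "K > 0" unfolding K_def using c zeta_a_pos zeta_a2_pos disp_coeff_pos
      by (intro divide_pos_pos add_nonneg_pos) auto
  have "norm (wave_map \<epsilon> W0 - W0) \<le> K * (\<epsilon>^2 + residual_rate \<epsilon>)" if sm: "small \<epsilon> (norm W0)" for \<epsilon>
  proof -
    have e: "\<epsilon> > 0" "\<epsilon> \<le> 1" using smallD[OF sm] by auto
    have M: "\<epsilon>^2 * (2 * norm W0) \<le> 1/2" by (rule smallD(3)[OF sm])
    let ?r = "lin_remainder \<epsilon> W0 d0"
    have B: "lin_op \<epsilon> W0 = (nonlin_coeff / 2 * zeta_a) *\<^sub>R mult_h1 W0 W0 - ?r"
    proof -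
      have "nonlin_coeff / 2 * zeta_a * amplitude^2 = - amplitude * disp_coeff * (3/2)"
      proof -
        have "nonlin_coeff / 2 * zeta_a * amplitude^2 = (nonlin_coeff * amplitude) * zeta_a / 2 *
            amplitude" by (simp add: power2_eq_square)
        then show ?thesis unfolding nonlin_coeff_amplitude using zeta_a_pos by simp
      qed
      \<comment> \<open>The profile equation of \<open>W0\<close>; its right-hand side is the formal
        limit of \<open>nonlin_sum\<close>.\<close>
      then have "disp_coeff *\<^sub>R (W0 - d0) = (nonlin_coeff / 2 * zeta_a) *\<^sub>R mult_h1 W0 W0"
        by (intro h1_eqI) (simp add: W0_def d0_def power2_eq_square algebra_simps)
      then show ?thesis using lin_op_lin_remainder[OF second_deriv_W0 e(1)] by simp
    qed
    have S: "(\<lambda>n. w n *\<^sub>R (avg_h1 (h \<epsilon> n) (nonlin_h1 \<epsilon> W0 n) - (nonlin_coeff/2) *\<^sub>R mult_h1 W0 W0))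
        sums (nonlin_sum \<epsilon> W0 - (nonlin_coeff / 2 * zeta_a) *\<^sub>R mult_h1 W0 W0)"
    proof -
      have "(\<lambda>n. w n *\<^sub>R ((nonlin_coeff/2) *\<^sub>R mult_h1 W0 W0))
          sums (zeta_a *\<^sub>R ((nonlin_coeff/2) *\<^sub>R mult_h1 W0 W0))"
        by (rule bounded_linear.sums[OF bounded_linear_scaleR_left w_sums])
      from sums_diff[OF nonlin_sum_sums[OF sm order_refl] this] show ?thesis
        by (simp add: scaleR_diff_right mult.commute)
    qed
    have b: "norm (w n *\<^sub>R (avg_h1 (h \<epsilon> n) (nonlin_h1 \<epsilon> W0 n) - (nonlin_coeff/2) *\<^sub>R mult_h1 W0 W0))
        \<le> w n * (c1 * \<epsilon>^2) + c2 * (w n * h \<epsilon> n^2)" for n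
    proof -
      let ?A = "avg_h1 (h \<epsilon> n)" let ?P = "avg_h1 (h \<epsilon> n) W0"
      note A = bounded_linear_avg_h1[OF h_pos[OF e(1)], of n]
      let ?f = "\<lambda>v. nonlin \<epsilon> v - nonlin_coeff/2 * v^2"
      define f where "f = comp_h1 ?f ?P"
      have cc: "0 \<le> b * nonlin_const * (\<epsilon>^2 * (2 * norm W0)^2)" using b_pos nonlin_const(1) by simp
      have ff: "fn f x = ?f (fn ?P x)" for x unfolding f_def
        by (rule fn_comp_h1[of _ "2 * norm W0" _ "b * nonlin_const * (\<epsilon>^2 * (2 * norm W0)^2)", OF
            fn_avg_h1_sup[OF e(1) order_refl] _ nonlin_quad[OF e(1) M] cc])
          (auto simp: nonlin_0)
      have nf: "norm f \<le> b * nonlin_const * (\<epsilon>^2 * (2 * norm W0)^2) * norm ?P" unfolding f_def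
        by (rule norm_comp_h1[of _ "2 * norm W0" _ "b * nonlin_const * (\<epsilon>^2 * (2 * norm W0)^2)", OF
            fn_avg_h1_sup[OF e(1) order_refl] _ nonlin_quad[OF e(1) M] cc])
          (auto simp: nonlin_0)
      also have "\<dots> \<le> b * nonlin_const * (\<epsilon>^2 * (2 * norm W0)^2) * norm W0"
        using norm_avg_h1[OF h_pos[OF e(1)]] cc by (intro mult_left_mono) auto
      finally have nf: "norm f \<le> c1 * \<epsilon>^2" by (simp add: c1_def mult_ac)
      \<comment> \<open>The deviation f from the quadratic is of order \<epsilon>^2; from the
        quadratic itself the inner and the outer averages are then removed in turn.\<close>
      have g: "nonlin_h1 \<epsilon> W0 n = f + (nonlin_coeff/2) *\<^sub>R mult_h1 ?P ?P"
        by (rule h1_eqI) (simp add: ff fn_nonlin_h1[OF sm order_refl] power2_eq_square)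
      have eq: "?A (nonlin_h1 \<epsilon> W0 n) - (nonlin_coeff/2) *\<^sub>R mult_h1 W0 W0
         = ?A f + (nonlin_coeff/2) *\<^sub>R (?A (mult_h1 (?P - W0) (?P + W0)) + (?A (mult_h1 W0 W0) - mult_h1
             W0 W0))"
      proof -
        have "mult_h1 (?P - W0) (?P + W0) = mult_h1 ?P ?P - mult_h1 W0 W0"
            by (rule h1_eqI) (simp add: algebra_simps)
        then have "?A (mult_h1 (?P - W0) (?P + W0)) = ?A (mult_h1 ?P ?P) - ?A (mult_h1 W0 W0)"
          by (simp only: linear_simps(2)[OF A])
        then show ?thesis unfolding g linear_simps(1)[OF A] linear_simps(5)[OF A]
          by (simp add: scaleR_diff_right)
      qed
      have n1: "norm (?A f) \<le> c1 * \<epsilon>^2" using norm_avg_h1[OF h_pos[OF e(1)], of n f] nf by linarith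
      have n2: "norm (?A (mult_h1 (?P - W0) (?P + W0))) \<le> 8 * norm W0 * norm d0 * h \<epsilon> n^2"
      proof -
        have "norm (?A (mult_h1 (?P - W0) (?P + W0))) \<le> norm (mult_h1 (?P - W0) (?P + W0))"
            by (rule norm_avg_h1[OF h_pos[OF e(1)]])
        also have "\<dots> \<le> 4 * norm (?P - W0) * norm (?P + W0)" by (rule norm_mult_h1)
        also have "\<dots> \<le> 4 * (h \<epsilon> n^2 * norm d0) * (2 * norm W0)"
          using norm_avg_h1_minus_id[OF second_deriv_W0 h_pos[OF e(1)], of n] norm_avg_h1[OF h_pos[OF
              e(1)], of n W0] norm_triangle_ineq[of ?P W0]
          by (intro mult_mono) auto
        finally show ?thesis by (simp add: mult_ac)
      qed
      have n3: "norm (?A (mult_h1 W0 W0) - mult_h1 W0 W0) \<le> h \<epsilon> n^2 * norm ?s"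
        by (rule norm_avg_h1_minus_id[OF second_deriv_W0_sq h_pos[OF e(1)]])
      have "norm (?A (nonlin_h1 \<epsilon> W0 n) - (nonlin_coeff/2) *\<^sub>R mult_h1 W0 W0)
        \<le> norm (?A f) + \<bar>nonlin_coeff/2\<bar> * norm (?A (mult_h1 (?P - W0) (?P + W0)) + (?A (mult_h1 W0 W0)
            - mult_h1 W0 W0))"
        unfolding eq by (rule order_trans[OF norm_triangle_ineq]) simp
      also have "\<dots> \<le> c1 * \<epsilon>^2 + \<bar>nonlin_coeff/2\<bar> * (8 * norm W0 * norm d0 * h \<epsilon> n^2 + h \<epsilon> n^2 * norm ?s)"
        using n1 n2 n3 norm_triangle_ineq[of "?A (mult_h1 (?P - W0) (?P + W0))"
            "?A (mult_h1 W0 W0) - mult_h1 W0 W0"]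
        by (intro add_mono mult_left_mono) auto
      also have "\<dots> = c1 * \<epsilon>^2 + c2 * h \<epsilon> n^2" by (simp add: c2_def algebra_simps)
      finally have "w n * norm (?A (nonlin_h1 \<epsilon> W0 n) - (nonlin_coeff/2) *\<^sub>R mult_h1 W0 W0)
          \<le> w n * (c1 * \<epsilon>^2 + c2 * h \<epsilon> n^2)"
        using w_pos[of n] by (intro mult_left_mono) auto
      moreover have "norm (w n *\<^sub>R (?A (nonlin_h1 \<epsilon> W0 n) - (nonlin_coeff/2) *\<^sub>R mult_h1 W0 W0))
          = w n * norm (?A (nonlin_h1 \<epsilon> W0 n) - (nonlin_coeff/2) *\<^sub>R mult_h1 W0 W0)"
        using w_pos[of n] by simp
      ultimately show ?thesis by (simp only: distrib_left mult.left_commute[of "w n" c2])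
    qed
    have sb: "(\<lambda>n. w n * (c1 * \<epsilon>^2) + c2 * (w n * h \<epsilon> n^2)) sums (zeta_a * (c1 * \<epsilon>^2) + c2 * (\<epsilon>^2 * zeta_a2))"
      by (intro sums_add sums_mult sums_mult2 weight2_sums w_sums)
    have p: "norm (nonlin_sum \<epsilon> W0 - (nonlin_coeff / 2 * zeta_a) *\<^sub>R mult_h1 W0 W0)
        \<le> zeta_a * (c1 * \<epsilon>^2) + c2 * (\<epsilon>^2 * zeta_a2)"
      using norm_suminf_le[OF b sums_summable[OF sb]] sums_unique[OF S] sums_unique[OF sb] by simp
    have om0: "0 \<le> residual_rate \<epsilon>" unfolding residual_rate_def
      using b_pos w_pos h_pos[OF e(1)] e by (intro suminf_nonneg error_rate_summable) (auto simp: less_imp_le)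
    have "wave_map \<epsilon> W0 - W0 = lin_inv \<epsilon> (nonlin_sum \<epsilon> W0 - lin_op \<epsilon> W0)"
      by (simp add: wave_map_def linear_simps(2)[OF bounded_linear_lin_inv[OF e(1)]] lin_inv_lin_op[OF e(1)])
    then have "norm (wave_map \<epsilon> W0 - W0) \<le> norm (nonlin_sum \<epsilon> W0 - lin_op \<epsilon> W0) / disp_coeff"
        using norm_lin_inv[OF e(1)] by simp
    also have "nonlin_sum \<epsilon> W0 - lin_op \<epsilon> W0 = (nonlin_sum \<epsilon> W0 - (nonlin_coeff / 2 * zeta_a) *\<^sub>R
        mult_h1 W0 W0) + ?r" unfolding B by simp
    also have "norm \<dots> \<le> (zeta_a * (c1 * \<epsilon>^2) + c2 * (\<epsilon>^2 * zeta_a2)) + residual_rate \<epsilon> * c3"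
      using norm_triangle_ineq[of "nonlin_sum \<epsilon> W0 - (nonlin_coeff / 2 * zeta_a) *\<^sub>R mult_h1 W0 W0"
          ?r] p norm_lin_remainder[OF second_deriv_W0 second_deriv_d0 e(1)]
      by (simp add: c3_def)
    also have "\<dots> \<le> (zeta_a * c1 + zeta_a2 * c2 + c3 + 1) * (\<epsilon>^2 + residual_rate \<epsilon>)"
    proof -
      have "(zeta_a * c1 + zeta_a2 * c2 + c3 + 1) * (\<epsilon>^2 + residual_rate \<epsilon>) - ((zeta_a * (c1 * \<epsilon>^2) + c2
          * (\<epsilon>^2 * zeta_a2)) + residual_rate \<epsilon> * c3)
        = (zeta_a * c1 + zeta_a2 * c2 + 1) * residual_rate \<epsilon> + (c3 + 1) * \<epsilon>^2" by (simp add: algebra_simps)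
      moreover have "0 \<le> (zeta_a * c1 + zeta_a2 * c2 + 1) * residual_rate \<epsilon> + (c3 + 1) * \<epsilon>^2"
        using om0 c zeta_a_pos zeta_a2_pos by (intro add_nonneg_nonneg mult_nonneg_nonneg) auto
      ultimately show ?thesis by linarith
    qed
    finally show ?thesis using disp_coeff_pos by (simp add: K_def divide_right_mono)
  qed
  then show ?thesis using K by blast
qed

text \<open>Existence is stated in the ball of radius \<kappa>/2 and uniqueness in that of radius
  \<kappa>, because the norm of \<open>h1\<close> is a maximum while \<open>sobolev_norm\<close> is
  Euclidean: they differ by a factor of at most sqrt 2.\<close>

theorem fixed_point:
  assumes \<sigma>: "0 < \<sigma>" "\<sigma> \<le> 2" and residual_rate: "\<exists>C>0. \<forall>\<epsilon>\<in>{0<..1}. residual_rate \<epsilon> \<le> C * \<epsilon> powr \<sigma>"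
  shows "\<exists>\<kappa>>0. \<exists>\<epsilon>0>0. \<forall>\<epsilon>\<in>{0<..<\<epsilon>0}. small \<epsilon> (norm W0 + \<kappa>) \<and>
    (\<exists>V. norm V \<le> \<kappa>/2 \<and> wave_map \<epsilon> (W0 + \<epsilon> powr \<sigma> *\<^sub>R V) = W0 + \<epsilon> powr \<sigma> *\<^sub>R V \<and>
      (\<forall>V'. norm V' \<le> \<kappa> \<and> wave_map \<epsilon> (W0 + \<epsilon> powr \<sigma> *\<^sub>R V') = W0 + \<epsilon> powr \<sigma> *\<^sub>R V' \<longrightarrow> V' = V))"
proof -
  obtain C where C: "C > 0" "\<And>\<epsilon>. \<epsilon> \<in> {0<..1} \<Longrightarrow> residual_rate \<epsilon> \<le> C * \<epsilon> powr \<sigma>" using residual_rate by blast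
  obtain KR where KR: "KR > 0" "\<And>\<epsilon>. small \<epsilon> (norm W0) \<Longrightarrow> norm (wave_map \<epsilon> W0 - W0)
      \<le> KR * (\<epsilon>^2 + residual_rate \<epsilon>)"
    using residual by blast
  obtain KJ where KJ: "KJ > 0" "\<And>x. norm (limit_inv x) \<le> norm x * KJ"
      using bounded_linear.pos_bounded[OF bounded_linear_limit_inv] by blast
  \<comment> \<open>Chosen so that \<open>\<Psi> 0\<close> has norm at most \<kappa>/4; with
    contraction factor 1/2 the ball of radius \<kappa>/2 is then mapped into itself.\<close>
  define \<kappa> where "\<kappa> = 4 * KJ * KR * (1 + C)"
  have k: "\<kappa> > 0" unfolding \<kappa>_def using KJ(1) KR(1) C(1) by simp
  obtain K where K: "K > 0" "\<And>\<epsilon> s V V'. small \<epsilon> (norm W0 + \<kappa>) \<Longrightarrow> 0 \<le> s \<Longrightarrow> s \<le> 1 \<Longrightarrow> norm V \<le> \<kappa> \<Longrightarrow> norm V' \<le> \<kappa> \<Longrightarrow>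
    norm (wave_map \<epsilon> (W0 + s *\<^sub>R V) - wave_map \<epsilon> (W0 + s *\<^sub>R V') - s *\<^sub>R limit_op (V - V'))
        \<le> K * (s + \<epsilon> + error_rate \<epsilon>) * s * norm (V - V')"
    using wave_map_difference[of \<kappa>] k by (metis less_imp_le)
  let ?R = "norm W0 + \<kappa>"
  have ev0: "\<forall>\<^sub>F \<epsilon>::real in at_right 0. \<epsilon> > 0" by (simp add: eventually_at_right_less)
  have t1: "((\<lambda>\<epsilon>. \<epsilon>) \<longlongrightarrow> (0::real)) (at_right 0)" by (rule tendsto_ident_at)
  have "\<forall>\<^sub>F \<epsilon>::real in at_right 0. 0 \<le> \<epsilon>" by (rule eventually_mono[OF ev0]) simp
  then have "((\<lambda>\<epsilon>. \<epsilon> powr \<sigma>) \<longlongrightarrow> 0 powr \<sigma>) (at_right 0)"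
    using \<sigma> t1 by (intro tendsto_powr2 tendsto_const) auto
  then have t2: "((\<lambda>\<epsilon>. \<epsilon> powr \<sigma>) \<longlongrightarrow> 0) (at_right 0)" using \<sigma> by simp
  have "((\<lambda>\<epsilon>. KJ * K * (\<epsilon> powr \<sigma> + \<epsilon> + error_rate \<epsilon>)) \<longlongrightarrow> KJ * K * (0 + 0 + 0)) (at_right 0)"
    by (intro tendsto_intros t1 t2 error_rate_tendsto_0)
  then have e1: "\<forall>\<^sub>F \<epsilon> in at_right 0. KJ * K * (\<epsilon> powr \<sigma> + \<epsilon> + error_rate \<epsilon>) < 1/2"
      by (rule order_tendstoD) simp
  have "((\<lambda>\<epsilon>. \<epsilon>^2 * (2 * ?R)) \<longlongrightarrow> 0^2 * (2 * ?R)) (at_right 0)" by (intro tendsto_intros t1)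
  then have e2: "\<forall>\<^sub>F \<epsilon> in at_right 0. \<epsilon>^2 * (2 * ?R) < 1/2" by (rule order_tendstoD) simp
  have e3: "\<forall>\<^sub>F \<epsilon> in at_right 0. \<epsilon> < (1::real)" using t1 by (rule order_tendstoD) simp
  have "\<forall>\<^sub>F \<epsilon> in at_right 0. 0 < \<epsilon> \<and> \<epsilon> < 1 \<and> \<epsilon>^2 * (2 * ?R) < 1/2 \<and> KJ * K * (\<epsilon> powr \<sigma> + \<epsilon> + error_rate
      \<epsilon>) < 1/2"
    using ev0 e1 e2 e3 by eventually_elim simp
  then obtain \<epsilon>0 where \<epsilon>0: "\<epsilon>0 > 0" "\<And>\<epsilon>. 0 < \<epsilon> \<Longrightarrow> \<epsilon> < \<epsilon>0 \<Longrightarrow>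
      \<epsilon> < 1 \<and> \<epsilon>^2 * (2 * ?R) < 1/2 \<and> KJ * K * (\<epsilon> powr \<sigma> + \<epsilon> + error_rate \<epsilon>) < 1/2"
    unfolding eventually_at_right_field by auto
  have "small \<epsilon> ?R \<and> (\<exists>V. norm V \<le> \<kappa>/2 \<and> wave_map \<epsilon> (W0 + \<epsilon> powr \<sigma> *\<^sub>R V) = W0 + \<epsilon> powr \<sigma> *\<^sub>R V \<and>
      (\<forall>V'. norm V' \<le> \<kappa> \<and> wave_map \<epsilon> (W0 + \<epsilon> powr \<sigma> *\<^sub>R V') = W0 + \<epsilon> powr \<sigma> *\<^sub>R V' \<longrightarrow> V' = V))"
    if eps: "\<epsilon> \<in> {0<..<\<epsilon>0}" for \<epsilon>
  proof -
    have e: "0 < \<epsilon>" "\<epsilon> < 1" and small: "small \<epsilon> ?R" and eta: "KJ * K * (\<epsilon> powr \<sigma> + \<epsilon> + error_rate \<epsilon>) < 1/2"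
      using \<epsilon>0(2)[of \<epsilon>] eps by (auto simp: small_def)
    define s where "s = \<epsilon> powr \<sigma>"
    have s: "0 < s" "s \<le> 1" using e \<sigma> by (auto simp: s_def intro: powr_le1)
    \<comment> \<open>The equation says that V equals the difference
      \<open>wave_map \<epsilon> (W0 + s V) - W0\<close> divided by s. This is no contraction in V:
      its derivative is close to \<open>limit_op\<close>, which has the eigenvalue 2 at sech^2(x/2).
      Subtracting \<open>limit_op V\<close> on both sides and applying \<open>limit_inv\<close>
      leaves the small error of \<open>wave_map_difference\<close>.\<close>
    define \<Psi> where "\<Psi> V = limit_inv ((1/s) *\<^sub>R (wave_map \<epsilon> (W0 + s *\<^sub>R V) - W0) - limit_op V)" for V
    note JL = linear_simps[OF bounded_linear_limit_inv]
    have fix_iff: "\<Psi> V = V \<longleftrightarrow> wave_map \<epsilon> (W0 + s *\<^sub>R V) = W0 + s *\<^sub>R V" for V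
    proof
      assume "\<Psi> V = V"
      then have "V - limit_op V = (1/s) *\<^sub>R (wave_map \<epsilon> (W0 + s *\<^sub>R V) - W0) - limit_op V"
        using limit_inv_right[of "(1/s) *\<^sub>R (wave_map \<epsilon> (W0 + s *\<^sub>R V) - W0) - limit_op V"] unfolding
            \<Psi>_def by simp
      then have "s *\<^sub>R V = s *\<^sub>R ((1/s) *\<^sub>R (wave_map \<epsilon> (W0 + s *\<^sub>R V) - W0))" by simp
      then have "s *\<^sub>R V = wave_map \<epsilon> (W0 + s *\<^sub>R V) - W0" using s by simp
      then show "wave_map \<epsilon> (W0 + s *\<^sub>R V) = W0 + s *\<^sub>R V" by (simp add: algebra_simps)
    next
      assume "wave_map \<epsilon> (W0 + s *\<^sub>R V) = W0 + s *\<^sub>R V"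
      then have "\<Psi> V = limit_inv (V - limit_op V)" unfolding \<Psi>_def using s by simp
      then show "\<Psi> V = V" by (simp add: limit_inv_left)
    qed
    have contr: "norm (\<Psi> V - \<Psi> V') \<le> 1/2 * norm (V - V')" if "norm V \<le> \<kappa>" "norm V' \<le> \<kappa>" for V V'
    proof -
      have "\<Psi> V - \<Psi> V' = limit_inv ((1/s) *\<^sub>R (wave_map \<epsilon> (W0 + s *\<^sub>R V) - wave_map \<epsilon> (W0 + s *\<^sub>R V') -
          s *\<^sub>R limit_op (V - V')))"
        unfolding \<Psi>_def JL(2)[symmetric] using s
        by (simp add: linear_simps(2)[OF bounded_linear_limit_op] scaleR_diff_right algebra_simps)
      then have "norm (\<Psi> V - \<Psi> V') \<le> (1/s) * norm (wave_map \<epsilon> (W0 + s *\<^sub>R V) - wave_map \<epsilon> (W0 + s *\<^sub>R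
          V') - s *\<^sub>R limit_op (V - V')) * KJ"
        using KJ(2)[of "(1/s) *\<^sub>R (wave_map \<epsilon> (W0 + s *\<^sub>R V) - wave_map \<epsilon> (W0 + s *\<^sub>R V') - s *\<^sub>R
            limit_op (V - V'))"] s by simp
      also have "\<dots> \<le> (1/s) * (K * (s + \<epsilon> + error_rate \<epsilon>) * s * norm (V - V')) * KJ"
        using KJ(1) s that small by (intro mult_right_mono mult_left_mono K(2)) auto
      also have "\<dots> = (KJ * K * (s + \<epsilon> + error_rate \<epsilon>)) * norm (V - V')" using s by simp
      also have "\<dots> \<le> 1/2 * norm (V - V')" using eta by (intro mult_right_mono) (auto simp: s_def)
      finally show ?thesis .
    qed
    have \<Psi>0: "norm (\<Psi> 0) \<le> \<kappa>/4"
    proof -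
      have sm: "small \<epsilon> (norm W0)" using small_mono[OF small] k by simp
      have e2: "\<epsilon>^2 \<le> s"
      proof -
        have "\<epsilon>^2 = \<epsilon> powr 2" using e powr_realpow[of \<epsilon> 2] by simp
        also have "\<dots> \<le> \<epsilon> powr \<sigma>" using e \<sigma> by (intro powr_mono') auto
        finally show ?thesis by (simp add: s_def)
      qed
      have "norm (wave_map \<epsilon> W0 - W0) \<le> KR * (\<epsilon>^2 + residual_rate \<epsilon>)" by (rule KR(2)[OF sm])
      also have "\<dots> \<le> KR * (s + C * s)" using e2 C(2)[of \<epsilon>] e KR(1)
          by (intro mult_left_mono add_mono) (auto simp: s_def)
      finally have n: "norm (wave_map \<epsilon> W0 - W0) \<le> KR * (1 + C) * s" by (simp add: algebra_simps)
      have "limit_op 0 = 0" using linear_simps(3)[OF bounded_linear_limit_op] .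
      then have "norm (\<Psi> 0) \<le> (1/s) * norm (wave_map \<epsilon> W0 - W0) * KJ"
        using KJ(2)[of "(1/s) *\<^sub>R (wave_map \<epsilon> W0 - W0)"] s unfolding \<Psi>_def by simp
      also have "\<dots> \<le> (1/s) * (KR * (1 + C) * s) * KJ"
          using n s KJ(1) by (intro mult_right_mono mult_left_mono) auto
      also have "\<dots> = \<kappa>/4" using s by (simp add: \<kappa>_def)
      finally show ?thesis .
    qed
    have "\<exists>!V. V \<in> cball 0 (\<kappa>/2) \<and> \<Psi> V = V"
    proof (rule Banach_fix[where c="1/2"])
      show "complete (cball (0::h1) (\<kappa>/2))" by (simp add: complete_eq_closed)
      show "cball (0::h1) (\<kappa>/2) \<noteq> {}" using k by simp
      show "\<Psi> ` cball 0 (\<kappa>/2) \<subseteq> cball 0 (\<kappa>/2)"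
      proof (rule image_subsetI)
        fix V :: h1 assume "V \<in> cball 0 (\<kappa>/2)"
        then have V: "norm V \<le> \<kappa>/2" by simp
        have "norm (\<Psi> V) \<le> norm (\<Psi> V - \<Psi> 0) + norm (\<Psi> 0)" using norm_triangle_sub[of "\<Psi> V" "\<Psi> 0"] by simp
        also have "\<dots> \<le> 1/2 * norm (V - 0) + \<kappa>/4" using V k by (intro add_mono contr \<Psi>0) auto
        finally show "\<Psi> V \<in> cball 0 (\<kappa>/2)" using V by simp
      qed
      show "dist (\<Psi> x) (\<Psi> y) \<le> 1/2 * dist x y" if "x \<in> cball 0 (\<kappa>/2)" "y \<in> cball 0 (\<kappa>/2)" for x y
        using k that unfolding dist_norm by (intro contr) auto
    qed auto
    then obtain V where V: "norm V \<le> \<kappa>/2" "\<Psi> V = V" by auto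
    have "V' = V" if "norm V' \<le> \<kappa>" "wave_map \<epsilon> (W0 + s *\<^sub>R V') = W0 + s *\<^sub>R V'" for V'
    proof -
      have "norm (V' - V) \<le> 1/2 * norm (V' - V)"
        using contr[of V' V] that V k unfolding fix_iff[symmetric] by auto
      then show ?thesis by simp
    qed
    then show ?thesis using small V unfolding fix_iff s_def[symmetric] by blast
  qed
  then show ?thesis using k \<epsilon>0(1) by blast
qed

text \<open>Undoing the rescaling: \<epsilon>^4 times a term of the nonlinear sum and b \<epsilon>^2
  times the matching linear term recombine into the derivative of the potential minus its value at
  1.\<close>

lemma wave_map_fixed_iff:
  assumes s: "small \<epsilon> R" and W: "norm W \<le> R"
  shows "wave_map \<epsilon> W = W \<longleftrightarrow> (\<forall>x. (\<lambda>n. w n * avg (h \<epsilon> n) (\<lambda>y. - a * ((1 + \<epsilon>^2 * avg (h \<epsilon> n) (fn W) y)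
      powr (-a-1) - 1)) x)
     sums (\<epsilon>^2 * (b * zeta_a + disp_coeff * \<epsilon>^2) * fn W x))"
proof -
  have e: "\<epsilon> > 0" by (rule smallD(1)[OF s])
  have "wave_map \<epsilon> W = W \<longleftrightarrow> nonlin_sum \<epsilon> W = lin_op \<epsilon> W"
      unfolding wave_map_def using lin_inv_lin_op[OF e] lin_op_lin_inv[OF e] by metis
  also have "\<dots> \<longleftrightarrow> (\<forall>x. fn (nonlin_sum \<epsilon> W) x = fn (lin_op \<epsilon> W) x)" by (metis h1_eqI)
  also have "\<dots> \<longleftrightarrow> (\<forall>x. \<epsilon>^4 * fn (nonlin_sum \<epsilon> W) x + b * \<epsilon>^2 * fn (avg_sum \<epsilon> W) x = \<epsilon>^2 * (b * zeta_a +
      disp_coeff * \<epsilon>^2) * fn W x)"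
  proof (intro all_cong1)
    fix x
    have "fn (nonlin_sum \<epsilon> W) x = fn (lin_op \<epsilon> W) x \<longleftrightarrow> \<epsilon>^4 * fn (nonlin_sum \<epsilon> W) x = \<epsilon>^4 * fn (lin_op \<epsilon>
        W) x" using e by simp
    also have "\<epsilon>^4 * fn (lin_op \<epsilon> W) x = \<epsilon>^2 * (b * zeta_a + disp_coeff * \<epsilon>^2) * fn W x - b * \<epsilon>^2 * fn
        (avg_sum \<epsilon> W) x"
      using e by (simp add: lin_op_def field_simps power2_eq_square power4_eq_xxxx)
    finally show "fn (nonlin_sum \<epsilon> W) x = fn (lin_op \<epsilon> W) x \<longleftrightarrow> \<epsilon>^4 * fn (nonlin_sum \<epsilon> W) x + b * \<epsilon>^2 * fn
        (avg_sum \<epsilon> W) x = \<epsilon>^2 * (b * zeta_a + disp_coeff * \<epsilon>^2) * fn W x"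
      by linarith
  qed
  also have "\<dots> \<longleftrightarrow> (\<forall>x. (\<lambda>n. w n * avg (h \<epsilon> n) (\<lambda>y. - a * ((1 + \<epsilon>^2 * avg (h \<epsilon> n) (fn W) y) powr (-a-1) - 1)) x)
     sums (\<epsilon>^2 * (b * zeta_a + disp_coeff * \<epsilon>^2) * fn W x))"
  proof (intro all_cong1)
    fix x
    have 1: "(\<lambda>n. w n * fn (avg_h1 (h \<epsilon> n) (nonlin_h1 \<epsilon> W n)) x) sums fn (nonlin_sum \<epsilon> W) x"
      using bounded_linear.sums[OF bounded_linear_fn nonlin_sum_sums[OF s W]] by simp
    have 2: "(\<lambda>n. w n * fn (avg_h1 (h \<epsilon> n) (avg_h1 (h \<epsilon> n) W)) x) sums fn (avg_sum \<epsilon> W) x"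
      using bounded_linear.sums[OF bounded_linear_fn summable_sums[OF summable_w_bounded(1)[OF norm_Av2[OF e]]]]
      unfolding avg_sum_def by simp
    have eq: "\<epsilon>^4 * (w n * fn (avg_h1 (h \<epsilon> n) (nonlin_h1 \<epsilon> W n)) x) + b * \<epsilon>^2 * (w n * fn (avg_h1 (h \<epsilon>
        n) (avg_h1 (h \<epsilon> n) W)) x)
      = w n * avg (h \<epsilon> n) (\<lambda>y. - a * ((1 + \<epsilon>^2 * avg (h \<epsilon> n) (fn W) y) powr (-a-1) - 1)) x" for n
    proof -
      have "fn (\<epsilon>^4 *\<^sub>R nonlin_h1 \<epsilon> W n + (b * \<epsilon>^2) *\<^sub>R avg_h1 (h \<epsilon> n) W) = (\<lambda>y. - a * ((1 + \<epsilon>^2 * avg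
          (h \<epsilon> n) (fn W) y) powr (-a-1) - 1))"
      proof
        fix y
        show "fn (\<epsilon>^4 *\<^sub>R nonlin_h1 \<epsilon> W n + (b * \<epsilon>^2) *\<^sub>R avg_h1 (h \<epsilon> n) W) y = - a * ((1 + \<epsilon>^2 * avg (h
            \<epsilon> n) (fn W) y) powr (-a-1) - 1)"
          using e by (simp add: fn_nonlin_h1[OF s W] fn_avg_h1[OF h_pos[OF e]] nonlin_def b_def field_simps)
      qed
      then have "avg (h \<epsilon> n) (\<lambda>y. - a * ((1 + \<epsilon>^2 * avg (h \<epsilon> n) (fn W) y) powr (-a-1) - 1)) x
        = fn (avg_h1 (h \<epsilon> n) (\<epsilon>^4 *\<^sub>R nonlin_h1 \<epsilon> W n + (b * \<epsilon>^2) *\<^sub>R avg_h1 (h \<epsilon> n) W)) x"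
            by (simp add: fn_avg_h1[OF h_pos[OF e]])
      also have "\<dots> = \<epsilon>^4 * fn (avg_h1 (h \<epsilon> n) (nonlin_h1 \<epsilon> W n)) x + b * \<epsilon>^2 * fn (avg_h1 (h \<epsilon> n)
          (avg_h1 (h \<epsilon> n) W)) x"
        by (simp add: linear_simps[OF bounded_linear_avg_h1[OF h_pos[OF e]]])
      finally show ?thesis by (simp add: algebra_simps)
    qed
    have "(\<lambda>n. w n * avg (h \<epsilon> n) (\<lambda>y. - a * ((1 + \<epsilon>^2 * avg (h \<epsilon> n) (fn W) y) powr (-a-1) - 1)) x)
      sums (\<epsilon>^4 * fn (nonlin_sum \<epsilon> W) x + b * \<epsilon>^2 * fn (avg_sum \<epsilon> W) x)"
      using sums_add[OF sums_mult[OF 1, of "\<epsilon>^4"] sums_mult[OF 2, of "b * \<epsilon>^2"]] by (simp only: eq)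
    then show "\<epsilon>^4 * fn (nonlin_sum \<epsilon> W) x + b * \<epsilon>^2 * fn (avg_sum \<epsilon> W) x = \<epsilon>^2 * (b * zeta_a +
        disp_coeff * \<epsilon>^2) * fn W x \<longleftrightarrow>
      (\<lambda>n. w n * avg (h \<epsilon> n) (\<lambda>y. - a * ((1 + \<epsilon>^2 * avg (h \<epsilon> n) (fn W) y) powr (-a-1) - 1)) x)
       sums (\<epsilon>^2 * (b * zeta_a + disp_coeff * \<epsilon>^2) * fn W x)"
      by (auto dest: sums_unique2)
  qed
  finally show ?thesis .
qed

end

section \<open>Weak derivatives\<close>

text \<open>The powers of 1/x are those that differentiating exp(-c/x) brings in.\<close>

definition bump_factor :: "nat \<Rightarrow> real \<Rightarrow> real \<Rightarrow> real" where
  "bump_factor k c x = (if x > 0 then (1/x)^k * exp (- (c/x)) else 0)"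

lemma bump_factor_tendsto:
  assumes c: "c > 0" shows "(bump_factor k c \<longlongrightarrow> 0) (at_right 0)"
proof -
  have 1: "filterlim (\<lambda>x. c / x) at_top (at_right (0::real))"
    using filterlim_tendsto_pos_mult_at_top[OF tendsto_const c filterlim_inverse_at_top_right]
    by (simp add: divide_inverse)
  have "((\<lambda>y. (1/c)^k * (y^k / exp y)) \<longlongrightarrow> (1/c)^k * 0) at_top"
    by (intro tendsto_mult_left tendsto_power_div_exp_0)
  from filterlim_compose[OF this 1]
  have "((\<lambda>x. (1/c)^k * ((c/x)^k / exp (c/x))) \<longlongrightarrow> 0) (at_right 0)" by simp
  moreover have "\<forall>\<^sub>F x in at_right 0. (1/c)^k * ((c/x)^k / exp (c/x)) = bump_factor k c x"
    using eventually_at_right_less[of 0]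
  proof eventually_elim
    case (elim x)
    have "(1/c)^k * (c/x)^k = (1/x)^k" using c by (simp flip: power_mult_distrib)
    then show ?case using elim by (simp add: bump_factor_def exp_minus divide_inverse)
  qed
  ultimately show ?thesis by (rule Lim_transform_eventually)
qed

lemma bump_factor_deriv:
  assumes c: "c > 0"
  shows "(bump_factor k c has_real_derivative (- real k) * bump_factor (Suc k) c x + c * bump_factor
      (Suc (Suc k)) c x) (at x)"
proof -
  consider "x > 0" | "x < 0" | "x = 0" by linarith
  then show ?thesis
  proof cases
    case 1
    have "((\<lambda>x. (1/x)^k) has_real_derivative - real k * (1/x)^(Suc k)) (at x)"
    proof (cases k)
      case (Suc m)
      have "((\<lambda>x. 1/x) has_real_derivative - ((1/x)^2)) (at x)"
        using 1 by (auto intro!: derivative_eq_intros simp: power2_eq_square)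
      from DERIV_power[OF this, of k] show ?thesis
        by (rule DERIV_cong) (simp add: Suc power2_eq_square del: of_nat_Suc)
    qed simp
    moreover have "((\<lambda>x. exp (- (c/x))) has_real_derivative exp (- (c/x)) * (c * (1/x)^2)) (at x)"
      using 1 by (auto intro!: derivative_eq_intros simp: power2_eq_square field_simps)
    ultimately have "((\<lambda>x. (1/x)^k * exp (- (c/x))) has_real_derivative
        (- real k * (1/x)^(Suc k)) * exp (- (c/x)) + (exp (- (c/x)) * (c * (1/x)^2)) * (1/x)^k) (at x)"
      by (rule DERIV_mult)
    also have "(- real k * (1/x)^(Suc k)) * exp (- (c/x)) + (exp (- (c/x)) * (c * (1/x)^2)) * (1/x)^k
      = (- real k) * bump_factor (Suc k) c x + c * bump_factor (Suc (Suc k)) c x"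
      using 1 by (simp add: bump_factor_def power2_eq_square mult_ac)
    finally show ?thesis
      by (rule has_field_derivative_transform_within_open[where S="{0<..}"]) (use 1 in \<open>auto
          simp: bump_factor_def\<close>)
  next
    case 2
    have "((\<lambda>x. 0) has_real_derivative 0) (at x)" by simp
    then have "(bump_factor k c has_real_derivative 0) (at x)"
      by (rule has_field_derivative_transform_within_open[where S="{..<0}"]) (use 2 in \<open>auto
          simp: bump_factor_def\<close>)
    then show ?thesis using 2 by (simp add: bump_factor_def)
  next
    case 3
    \<comment> \<open>From the right the difference quotient at 0 is again a
      \<open>bump_factor\<close>, with k raised by one, so it tends to 0 by
      \<open>bump_factor_tendsto\<close>.\<close>
    have "((\<lambda>y. (bump_factor k c y - bump_factor k c 0) / (y - 0)) \<longlongrightarrow> 0) (at 0)"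
    proof (rule filterlim_split_at)
      have "\<forall>\<^sub>F y in at_left 0. 0 = (bump_factor k c y - bump_factor k c 0) / (y - (0::real))"
        using eventually_at_left_real[of "-1" 0] by (auto elim!: eventually_mono simp: bump_factor_def)
      then show "((\<lambda>y. (bump_factor k c y - bump_factor k c 0) / (y - 0)) \<longlongrightarrow> 0) (at_left 0)"
        by (rule Lim_transform_eventually[OF tendsto_const])
      have "\<forall>\<^sub>F y in at_right 0. bump_factor (Suc k) c y = (bump_factor k c y - bump_factor k c 0) / (y
          - (0::real))"
        using eventually_at_right_less[of 0] by eventually_elim (simp add: bump_factor_def)
      then show "((\<lambda>y. (bump_factor k c y - bump_factor k c 0) / (y - 0)) \<longlongrightarrow> 0) (at_right 0)"
        by (rule Lim_transform_eventually[OF bump_factor_tendsto[OF c]])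
    qed
    then have "(bump_factor k c has_real_derivative 0) (at 0)" by (simp add: has_field_derivative_iff)
    then show ?thesis using 3 by (simp add: bump_factor_def)
  qed
qed

text \<open>
  The span of \<open>exp(-c/(x-p) - c/(q-x))\<close> on \<open>(p, q)\<close> and its multiples
      by powers of \<open>1/(x-p)\<close> and \<open>1/(q-x)\<close> is closed
  under differentiation. As \<open>c \<rightarrow> 0\<close>, the first of these test functions tends to the indicator of \<open>(p, q)\<close>.
\<close>

inductive_set bump_span :: "real \<Rightarrow> real \<Rightarrow> real \<Rightarrow> (real \<Rightarrow> real) set" for p q c where
  base: "(\<lambda>x. bump_factor k c (x - p) * bump_factor l c (q - x)) \<in> bump_span p q c"
| add: "f \<in> bump_span p q c \<Longrightarrow> g \<in> bump_span p q c \<Longrightarrow> (\<lambda>x. f x + g x) \<in> bump_span p q c"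
| scale: "f \<in> bump_span p q c \<Longrightarrow> (\<lambda>x. r * f x) \<in> bump_span p q c"

lemma bump_span_deriv:
  assumes c: "c > 0" and f: "f \<in> bump_span p q c"
  shows "\<exists>f'\<in>bump_span p q c. \<forall>x. (f has_real_derivative f' x) (at x)"
  using f
proof induction
  case (base k l)
  let ?B = "\<lambda>k l x. bump_factor k c (x - p) * bump_factor l c (q - x)"
  let ?f' = "\<lambda>x. (- real k * ?B (Suc k) l x + c * ?B (Suc (Suc k)) l x) + (real l * ?B k (Suc l) x + (-
      c) * ?B k (Suc (Suc l)) x)"
  have "?f' \<in> bump_span p q c" by (intro bump_span.intros)
  moreover have "(?B k l has_real_derivative ?f' x) (at x)" for x
  proof -
    have 1: "((\<lambda>x. x - p) has_real_derivative 1) (at x)" "((\<lambda>x. q - x) has_real_derivative -1) (at x)"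
      by (auto intro!: derivative_eq_intros)
    show ?thesis
      by (rule DERIV_cong[OF DERIV_mult[OF DERIV_chain2[OF bump_factor_deriv[OF c] 1(1)] DERIV_chain2[OF
          bump_factor_deriv[OF c] 1(2)]]])
        (simp add: algebra_simps)
  qed
  ultimately show ?case by (intro bexI[of _ ?f'] allI)
next
  case (add f g)
  then obtain f' g' where "f' \<in> bump_span p q c" "g' \<in> bump_span p q c"
    "\<And>x. (f has_real_derivative f' x) (at x)" "\<And>x. (g has_real_derivative g' x) (at x)" by blast
  then show ?case by (intro bexI[of _ "\<lambda>x. f' x + g' x"]) (auto intro: bump_span.add DERIV_add)
next
  case (scale f r)
  then obtain f' where "f' \<in> bump_span p q c" "\<And>x. (f has_real_derivative f' x) (at x)" by blast
  then show ?case by (intro bexI[of _ "\<lambda>x. r * f' x"]) (auto intro: bump_span.scale DERIV_cmult)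
qed

lemma bump_span_zero: "f \<in> bump_span p q c \<Longrightarrow> x \<le> p \<or> q \<le> x \<Longrightarrow> f x = 0"
  by (induction rule: bump_span.induct) (auto simp: bump_factor_def)

lemma bump_span_test:
  assumes c: "c > 0" and f: "f \<in> bump_span p q c"
  shows "test_function f"
proof -
  have all: "(deriv ^^ n) f \<in> bump_span p q c" for n
  proof (induction n)
    case (Suc n)
    from bump_span_deriv[OF c Suc] obtain f' where f': "f' \<in> bump_span p q c"
      "\<And>x. ((deriv ^^ n) f has_real_derivative f' x) (at x)" by blast
    have "deriv ((deriv ^^ n) f) = f'" by (rule ext) (rule DERIV_imp_deriv[OF f'(2)])
    then show ?case using f'(1) by simp
  qed (simp add: f)
  have "(deriv ^^ n) f field_differentiable at x" for n x
    using bump_span_deriv[OF c all[of n]] unfolding field_differentiable_def by blast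
  moreover have "compact (closure {x. f x \<noteq> 0})"
  proof -
    have "{x. f x \<noteq> 0} \<subseteq> {p..q}"
    proof
      fix x assume "x \<in> {x. f x \<noteq> 0}"
      then have "\<not> (x \<le> p \<or> q \<le> x)" using bump_span_zero[OF f, of x] by blast
      then show "x \<in> {p..q}" by auto
    qed
    then have "bounded {x. f x \<noteq> 0}" by (rule bounded_subset[OF bounded_closed_interval])
    then show ?thesis by simp
  qed
  ultimately show ?thesis by (simp add: test_function_def)
qed

lemma bump_tendsto_indicator:
  fixes p q x :: real
  shows "(\<lambda>n. bump_factor 0 (1 / real (Suc n)) (x - p) * bump_factor 0 (1 / real (Suc n)) (q - x)) \<longlonglongrightarrow>
      indicator {p<..<q} x"
proof (cases "p < x \<and> x < q")
  case True
  have z: "(\<lambda>n. 1 / real (Suc n)) \<longlonglongrightarrow> 0" by (rule LIMSEQ_Suc[OF lim_1_over_n])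
  have "(\<lambda>n. exp (- (1 / real (Suc n) / (x - p))) * exp (- (1 / real (Suc n) / (q - x)))) \<longlonglongrightarrow> exp (- (0 /
      (x - p))) * exp (- (0 / (q - x)))"
    using True by (intro tendsto_intros z) auto
  then show ?thesis using True by (simp add: bump_factor_def indicator_def)
next
  case False
  then show ?thesis by (auto simp: bump_factor_def indicator_def)
qed

lemma bump_factor0_bounds: "c > 0 \<Longrightarrow> 0 \<le> bump_factor 0 c x" "c > 0 \<Longrightarrow> bump_factor 0 c x \<le> 1"
  by (auto simp: bump_factor_def)

lemma sq_int_local:
  fixes g :: "real \<Rightarrow> real"
  assumes [measurable]: "g \<in> borel_measurable lborel" and g: "integrable lborel (\<lambda>x. (g x)^2)"
  shows "integrable lborel (\<lambda>x. g x * indicator {p<..<q} x)"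
proof (rule Bochner_Integration.integrable_bound)
  show "integrable lborel (\<lambda>x. (g x)^2 + indicator {p<..<q} x)"
  proof (intro Bochner_Integration.integrable_add integrable_real_indicator g)
    have "bounded {p<..<q}" by (rule bounded_subset[OF bounded_closed_interval[of p q]]) auto
    then show "emeasure lborel {p<..<q} < \<infinity>" by (rule emeasure_bounded_finite)
  qed simp
  show "AE x in lborel. norm (g x * indicator {p<..<q} x) \<le> norm ((g x)^2 + indicator {p<..<q} x :: real)"
  proof (rule AE_I2)
    fix x
    have "\<bar>g x\<bar> \<le> (g x)^2 + 1"
      using zero_le_power2[of "\<bar>g x\<bar> - 1"] by (simp add: power2_eq_square algebra_simps)
    then show "norm (g x * indicator {p<..<q} x) \<le> norm ((g x)^2 + indicator {p<..<q} x :: real)"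
      by (auto simp: indicator_def)
  qed
qed measurable

lemma integral_zero_imp_parts:
  fixes f :: "'a \<Rightarrow> real"
  assumes f: "integrable M f" and z: "integral\<^sup>L M f = 0"
  shows "(\<integral>\<^sup>+x. ennreal (f x) \<partial>M) = (\<integral>\<^sup>+x. ennreal (- f x) \<partial>M)"
proof -
  have fin: "(\<integral>\<^sup>+x. ennreal (f x) \<partial>M) \<noteq> \<infinity>" "(\<integral>\<^sup>+x. ennreal (- f x) \<partial>M) \<noteq> \<infinity>"
    using f by (auto simp: real_integrable_def)
  have "enn2real (\<integral>\<^sup>+x. ennreal (f x) \<partial>M) = enn2real (\<integral>\<^sup>+x. ennreal (- f x) \<partial>M)"
    using real_lebesgue_integral_def[OF f] z by simp
  then have "ennreal (enn2real (\<integral>\<^sup>+x. ennreal (f x) \<partial>M)) = ennreal (enn2real (\<integral>\<^sup>+x. ennreal (- f x)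
      \<partial>M))" by simp
  then show ?thesis using fin by (simp add: ennreal_enn2real_if)
qed

text \<open>On a bounded interval the positive and the negative part of g are densities of finite
  measures that agree on all half-lines. Hence the measures are equal, and so are the densities
  almost everywhere.\<close>

lemma AE_zero_of_interval_integrals:
  fixes g :: "real \<Rightarrow> real"
  assumes m[measurable]: "g \<in> borel_measurable lborel" and g: "integrable lborel (\<lambda>x. (g x)^2)"
    and z: "\<And>p q. (LINT x|lborel. g x * indicator {p<..<q} x) = 0"
  shows "AE x in lborel. g x = 0"
proof -
  have loc: "AE x in lborel. x \<in> {-K<..<K} \<longrightarrow> g x = 0" for K :: real
  proof -
    let ?f = "\<lambda>x. ennreal (g x * indicator {-K<..<K} x)" let ?h = "\<lambda>x. ennreal (- (g x * indicator
        {-K<..<K} x))"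
    have fin: "(\<integral>\<^sup>+x. ?f x \<partial>lborel) \<noteq> \<infinity>"
      using sq_int_local[OF m g, of "-K" K] by (simp add: real_integrable_def)
    have em: "emeasure (density lborel ?f) {x<..} = (\<integral>\<^sup>+y. ennreal (g y * indicator {max x (-K)<..<K} y)
        \<partial>lborel)"
      "emeasure (density lborel ?h) {x<..} = (\<integral>\<^sup>+y. ennreal (- (g y * indicator {max x (-K)<..<K} y))
          \<partial>lborel)" for x
      by (subst emeasure_density, auto intro!: nn_integral_cong simp: indicator_def)+
    have "density lborel ?f = density lborel ?h"
    proof (rule measure_eqI_lessThan)
      show "emeasure (density lborel ?f) {x<..} < \<infinity>" for x
        unfolding em using sq_int_local[OF m g, of "max x (-K)" K]
            by (simp add: real_integrable_def top.not_eq_extremum)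
      show "emeasure (density lborel ?f) {x<..} = emeasure (density lborel ?h) {x<..}" for x
        unfolding em by (rule integral_zero_imp_parts[OF sq_int_local[OF m g] z])
    qed simp_all
    then have "AE x in lborel. ?f x = ?h x"
      using fin by (subst (asm) finite_density_unique) auto
    then show ?thesis
    proof eventually_elim
      case (elim x)
      then show ?case
      proof (intro impI)
        assume x: "x \<in> {-K<..<K}"
        with elim have "ennreal (g x) = ennreal (- g x)" by simp
        then show "g x = 0" by (cases "g x \<ge> 0") (auto simp: ennreal_eq_0_iff ennreal_neg)
      qed
    qed
  qed
  have "AE x in lborel. \<forall>K::nat. x \<in> {- real K<..<real K} \<longrightarrow> g x = 0"
    unfolding AE_all_countable using loc by blast
  then show ?thesis
  proof eventually_elim
    case (elim x)
    obtain K :: nat where "\<bar>x\<bar> < real K" using reals_Archimedean2 by blast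
    then show ?case using elim[rule_format, of K] by (auto simp: abs_less_iff)
  qed
qed

text \<open>Instead of mollifying g, the test functions are sent to indicators of intervals by
  dominated convergence, which leads to \<open>AE_zero_of_interval_integrals\<close>. A Borel
  representative of g brings the problem to \<open>lborel\<close>.\<close>

lemma fundamental_lemma:
  fixes g :: "real \<Rightarrow> real"
  assumes g: "square_integrable g" and z: "\<And>\<phi>. test_function \<phi> \<Longrightarrow> (LINT x|lebesgue. g x * \<phi> x) = 0"
  shows "AE x in lebesgue. g x = 0"
proof -
  have gm: "g \<in> borel_measurable lebesgue" and gi: "integrable lebesgue (\<lambda>x. (g x)^2)"
    using g by (auto simp: square_integrable_def)
  obtain g' where m[measurable]: "g' \<in> borel_measurable lborel" and ae: "AE x in lborel. g x = g' x"
    using completion_ex_borel_measurable_real[OF gm] by blast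
  have ael: "AE x in lebesgue. g x = g' x" using ae by (rule AE_completion)
  have ml: "g' \<in> borel_measurable lebesgue" using m by (rule measurable_completion)
  have "integrable lebesgue (\<lambda>x. (g' x)^2)"
  proof (rule integrable_cong_AE_imp[OF gi])
    show "(\<lambda>x. (g' x)^2) \<in> borel_measurable lebesgue" using ml by measurable
  qed (use ael in auto)
  then have g'i: "integrable lborel (\<lambda>x. (g' x)^2)" using integrable_completion[of "\<lambda>x. (g' x)^2"
      lborel] by simp
  have "(LINT x|lborel. g' x * indicator {p<..<q} x) = 0" for p q
  proof -
    let ?\<phi> = "\<lambda>n x. bump_factor 0 (1 / real (Suc n)) (x - p) * bump_factor 0 (1 / real (Suc n)) (q - x)"
    have test: "test_function (?\<phi> n)" for n by (rule bump_span_test[OF _ bump_span.base]) simp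
    have c\<phi>: "continuous_on UNIV (?\<phi> n)" for n
    proof -
      have "1 / real (Suc n) > 0" by simp
      from bump_span_deriv[OF this bump_span.base[of 0 _ p 0 q]] obtain f' where
        "\<And>x. (?\<phi> n has_real_derivative f' x) (at x)" by blast
      then show ?thesis by (rule cont_of_deriv)
    qed
    have [measurable]: "?\<phi> n \<in> borel_measurable borel" for n by (rule borel_measurable_continuous_onI[OF c\<phi>])
    have "(\<lambda>n. LINT x|lborel. g' x * ?\<phi> n x) \<longlonglongrightarrow> (LINT x|lborel. g' x * indicator {p<..<q} x)"
    proof (rule integral_dominated_convergence[where w="\<lambda>x. \<bar>g' x * indicator {p<..<q} x\<bar>"])
      show "integrable lborel (\<lambda>x. \<bar>g' x * indicator {p<..<q} x\<bar>)"
        by (intro integrable_abs sq_int_local m g'i)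
      show "AE x in lborel. (\<lambda>n. g' x * ?\<phi> n x) \<longlonglongrightarrow> g' x * indicator {p<..<q} x"
        by (intro AE_I2 tendsto_mult_left bump_tendsto_indicator)
      show "AE x in lborel. norm (g' x * ?\<phi> n x) \<le> \<bar>g' x * indicator {p<..<q} x\<bar>" for n
      proof (rule AE_I2)
        fix x
        have "\<bar>?\<phi> n x\<bar> \<le> indicator {p<..<q} x"
        proof (cases "p < x \<and> x < q")
          case True
          have "bump_factor 0 (1 / real (Suc n)) (x - p) * bump_factor 0 (1 / real (Suc n)) (q - x) \<le> 1 * 1"
            by (intro mult_mono bump_factor0_bounds) auto
          moreover have "0 \<le> ?\<phi> n x" by (intro mult_nonneg_nonneg bump_factor0_bounds) auto
          ultimately show ?thesis using True by simp
        qed (auto simp: bump_factor_def)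
        then have "\<bar>g' x\<bar> * \<bar>?\<phi> n x\<bar> \<le> \<bar>g' x\<bar> * \<bar>indicator {p<..<q} x\<bar>" by (intro mult_left_mono) auto
        then show "norm (g' x * ?\<phi> n x) \<le> \<bar>g' x * indicator {p<..<q} x\<bar>" by (simp only: real_norm_def abs_mult)
      qed
    qed measurable
    moreover have "(LINT x|lborel. g' x * ?\<phi> n x) = 0" for n
    proof -
      have bm: "(\<lambda>x. g' x * ?\<phi> n x) \<in> borel_measurable lborel" by measurable
      have "(LINT x|lborel. g' x * ?\<phi> n x) = (LINT x|lebesgue. g' x * ?\<phi> n x)"
        by (rule integral_completion[OF bm, symmetric])
      also have "\<dots> = (LINT x|lebesgue. g x * ?\<phi> n x)"
      proof (rule integral_cong_AE)
        have pm: "?\<phi> n \<in> borel_measurable lebesgue" by (rule measurable_completion) measurable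
        show "(\<lambda>x. g' x * ?\<phi> n x) \<in> borel_measurable lebesgue" by (intro borel_measurable_times ml pm)
        show "(\<lambda>x. g x * ?\<phi> n x) \<in> borel_measurable lebesgue" by (intro borel_measurable_times gm pm)
      qed (use ael in auto)
      also have "\<dots> = 0" by (rule z[OF test])
      finally show ?thesis .
    qed
    ultimately show ?thesis by (simp add: LIMSEQ_const_iff)
  qed
  from AE_zero_of_interval_integrals[OF m g'i this] have "AE x in lborel. g' x = 0" .
  then have "AE x in lborel. g x = 0" using ae by eventually_elim simp
  then show ?thesis by (rule AE_completion)
qed

section \<open>Classical derivatives as weak derivatives\<close>

lemma test_deriv:
  "test_function \<phi> \<Longrightarrow> ((deriv ^^ n) \<phi> has_real_derivative (deriv ^^ Suc n) \<phi> x) (at x)"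
  by (simp add: test_function_def field_differentiable_derivI)

lemma test_cont: "test_function \<phi> \<Longrightarrow> continuous_on UNIV ((deriv ^^ n) \<phi>)"
  using test_deriv by (rule cont_of_deriv)

text \<open>One N serves all derivatives: the complement of the closed support is open, so vanishing
  there is inherited by every derivative.\<close>

lemma test_support:
  assumes "test_function \<phi>" shows "\<exists>N>0. \<forall>n x. N \<le> \<bar>x\<bar> \<longrightarrow> (deriv ^^ n) \<phi> x = 0"
proof -
  let ?S = "closure {x. \<phi> x \<noteq> 0}"
  have "bounded ?S" using assms by (simp add: test_function_def compact_imp_bounded)
  then obtain N where N: "N > 0" "\<And>x. x \<in> ?S \<Longrightarrow> \<bar>x\<bar> < N" by (auto simp: bounded_pos_less)
  have zero: "(deriv ^^ n) \<phi> x = 0" if "x \<notin> ?S" for n x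
    using that
  proof (induction n arbitrary: x)
    case 0
    then show ?case using closure_subset[of "{x. \<phi> x \<noteq> 0}"] by auto
  next
    case (Suc n)
    have "((\<lambda>x. 0) has_real_derivative 0) (at x)" by simp
    then have "((deriv ^^ n) \<phi> has_real_derivative 0) (at x)"
      by (rule has_field_derivative_transform_within_open[where S="- ?S"]) (use Suc in auto)
    from DERIV_unique[OF test_deriv[OF assms] this] show ?case .
  qed
  show ?thesis
  proof (intro exI[of _ N] conjI allI impI N(1))
    fix n x assume "N \<le> \<bar>x\<bar>"
    then have "x \<notin> ?S" using N(2)[of x] by auto
    then show "(deriv ^^ n) \<phi> x = 0" by (rule zero)
  qed
qed

lemma integral_compact_support:
  fixes f :: "real \<Rightarrow> real"
  assumes c: "continuous_on UNIV f" and z: "\<And>x. N \<le> \<bar>x\<bar> \<Longrightarrow> f x = 0"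
  shows "(LINT x|lebesgue. f x) = integral {-N..N} f" "integrable lebesgue f"
proof -
  have m: "f \<in> borel_measurable lborel" using c by (rule cont_meas)
  have s: "set_integrable lborel {-N..N} f"
    by (intro borel_integrable_atLeastAtMost' continuous_on_subset[OF c]) auto
  have eq: "(\<lambda>x. indicator {-N..N} x *\<^sub>R f x) = f"
  proof
    fix x show "indicator {-N..N} x *\<^sub>R f x = f x"
    proof (cases "N \<le> \<bar>x\<bar>")
      case False
      then have "x \<in> {-N..N}" by auto
      then show ?thesis by simp
    qed (simp add: z)
  qed
  have i: "integrable lborel f" using s unfolding set_integrable_def eq .
  then show "integrable lebesgue f" using integrable_completion[OF m] by simp
  have "(LINT x|lebesgue. f x) = (LINT x|lborel. f x)" by (rule integral_completion[OF m])
  also have "\<dots> = (LINT x:{-N..N}|lborel. f x)" unfolding set_lebesgue_integral_def eq ..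
  also have "\<dots> = integral {-N..N} f" by (rule set_borel_integral_eq_integral(2)[OF s])
  finally show "(LINT x|lebesgue. f x) = integral {-N..N} f" .
qed

lemma weak_ibp:
  assumes u: "\<And>x. (u has_real_derivative u' x) (at x)" "continuous_on UNIV u'" and \<phi>: "test_function \<phi>"
  shows "(LINT x|lebesgue. u x * (deriv ^^ Suc n) \<phi> x) = - (LINT x|lebesgue. u' x * (deriv ^^ n) \<phi> x)"
proof -
  obtain N where N: "N > 0" "\<And>n x. N \<le> \<bar>x\<bar> \<Longrightarrow> (deriv ^^ n) \<phi> x = 0" using test_support[OF \<phi>] by blast
  let ?a = "(deriv ^^ n) \<phi>" and ?b = "(deriv ^^ Suc n) \<phi>"
  have cu: "continuous_on UNIV u" using u(1) by (rule cont_of_deriv)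
  have c1: "continuous_on UNIV (\<lambda>x. u x * ?b x)" by (intro continuous_on_mult cu test_cont \<phi>)
  have c2: "continuous_on UNIV (\<lambda>x. u' x * ?a x)" by (intro continuous_on_mult u(2) test_cont \<phi>)
  have "((\<lambda>x. u' x * ?a x + ?b x * u x) has_integral (u N * ?a N - u (-N) * ?a (-N))) {-N..N}"
    using N(1) by (intro ftc DERIV_mult u(1) test_deriv[OF \<phi>]) auto
  then have "integral {-N..N} (\<lambda>x. u' x * ?a x + ?b x * u x) = 0"
    using N by (simp add: integral_unique)
  moreover have "integral {-N..N} (\<lambda>x. u' x * ?a x + ?b x * u x) = integral {-N..N} (\<lambda>x. u' x * ?a x) +
      integral {-N..N} (\<lambda>x. u x * ?b x)"
    using continuous_on_subset[OF c1] continuous_on_subset[OF c2]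
    by (subst integral_add[symmetric]) (auto intro!: integrable_continuous_real simp: mult.commute)
  ultimately have "integral {-N..N} (\<lambda>x. u x * ?b x) = - integral {-N..N} (\<lambda>x. u' x * ?a x)" by linarith
  note int = this
  show ?thesis
  proof -
    have z: "u x * ?b x = 0" "u' x * ?a x = 0" if "N \<le> \<bar>x\<bar>" for x using N(2)[OF that]
        by (simp_all only: mult_zero_right)
    have "(LINT x|lebesgue. u x * ?b x) = integral {-N..N} (\<lambda>x. u x * ?b x)"
      by (rule integral_compact_support(1)[OF c1]) (rule z(1))
    moreover have "(LINT x|lebesgue. u' x * ?a x) = integral {-N..N} (\<lambda>x. u' x * ?a x)"
      by (rule integral_compact_support(1)[OF c2]) (rule z(2))
    ultimately show ?thesis using int by (simp only:)
  qed
qed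

lemma square_integrable_l2_bounded:
  assumes "l2_bounded u C" shows "square_integrable u" "(LINT x|lebesgue. (u x)^2) = (l2_norm u)^2"
proof -
  have m: "u \<in> borel_measurable lborel" using assms cont_meas l2_bounded_cont by blast
  then have m2: "(\<lambda>x. (u x)^2) \<in> borel_measurable lborel" by measurable
  show "square_integrable u"
    unfolding square_integrable_def
    using measurable_completion[OF m] integrable_completion[OF m2] l2_bounded_integrable[OF assms] by simp
  show "(LINT x|lebesgue. (u x)^2) = (l2_norm u)^2"
    using integral_completion[OF m2] by (simp add: l2_norm_def)
qed

lemma square_integrable_test_mult:
  assumes g: "square_integrable g" and \<phi>: "test_function \<phi>"
  shows "integrable lebesgue (\<lambda>x. g x * \<phi> x)"
proof -
  obtain N where N: "N > 0" "\<And>n x. N \<le> \<bar>x\<bar> \<Longrightarrow> (deriv ^^ n) \<phi> x = 0" using test_support[OF \<phi>] by blast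
  have z: "\<phi> x = 0" if "N \<le> \<bar>x\<bar>" for x using N(2)[of x 0] that by simp
  have c: "continuous_on UNIV \<phi>" using test_cont[OF \<phi>, of 0] by simp
  have gm: "g \<in> borel_measurable lebesgue" using g by (simp add: square_integrable_def)
  have pm: "\<phi> \<in> borel_measurable lebesgue" by (rule measurable_completion[OF cont_meas[OF c]])
  have "integrable lebesgue (\<lambda>x. (\<phi> x)^2)"
    by (rule integral_compact_support(2)[of _ N]) (auto intro!: continuous_intros c simp: z)
  then have "integrable lebesgue (\<lambda>x. (g x)^2 + (\<phi> x)^2)"
    using g by (intro Bochner_Integration.integrable_add) (auto simp: square_integrable_def)
  then show ?thesis
  proof (rule Bochner_Integration.integrable_bound)
    show "(\<lambda>x. g x * \<phi> x) \<in> borel_measurable lebesgue" by (intro borel_measurable_times gm pm)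
    show "AE x in lebesgue. norm (g x * \<phi> x) \<le> norm ((g x)^2 + (\<phi> x)^2)"
    proof (rule AE_I2)
      fix x
      have "0 \<le> (\<bar>g x\<bar> - \<bar>\<phi> x\<bar>)^2" by simp
      then have "2 * (\<bar>g x\<bar> * \<bar>\<phi> x\<bar>) \<le> (g x)^2 + (\<phi> x)^2" by (simp add: power2_diff)
      moreover have "0 \<le> \<bar>g x\<bar> * \<bar>\<phi> x\<bar>" by simp
      ultimately have "\<bar>g x\<bar> * \<bar>\<phi> x\<bar> \<le> (g x)^2 + (\<phi> x)^2" by linarith
      then show "norm (g x * \<phi> x) \<le> norm ((g x)^2 + (\<phi> x)^2)" by (simp add: abs_mult)
    qed
  qed
qed

lemma square_integrable_add:
  assumes "square_integrable f" "square_integrable g" shows "square_integrable (\<lambda>x. f x + c * g x)"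
proof -
  have m: "f \<in> borel_measurable lebesgue" "g \<in> borel_measurable lebesgue"
      using assms by (auto simp: square_integrable_def)
  have "integrable lebesgue (\<lambda>x. 2 * (f x)^2 + 2 * c^2 * (g x)^2)"
    using assms by (auto simp: square_integrable_def)
  then have "integrable lebesgue (\<lambda>x. (f x + c * g x)^2)"
  proof (rule Bochner_Integration.integrable_bound)
    show "(\<lambda>x. (f x + c * g x)^2) \<in> borel_measurable lebesgue" using m by measurable
    show "AE x in lebesgue. norm ((f x + c * g x)^2) \<le> norm (2 * (f x)^2 + 2 * c^2 * (g x)^2)"
    proof (rule AE_I2)
      fix x
      have "0 \<le> (f x - c * g x)^2" by simp
      then have "(f x + c * g x)^2 \<le> 2 * (f x)^2 + 2 * c^2 * (g x)^2"
          by (simp add: power2_eq_square algebra_simps)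
      then show "norm ((f x + c * g x)^2) \<le> norm (2 * (f x)^2 + 2 * c^2 * (g x)^2)" by simp
    qed
  qed
  moreover have "(\<lambda>x. f x + c * g x) \<in> borel_measurable lebesgue" using m by measurable
  ultimately show ?thesis by (simp add: square_integrable_def)
qed

lemma weak_deriv_unique:
  assumes "square_integrable g1" "square_integrable g2" "has_weak_deriv j f g1" "has_weak_deriv j f g2"
  shows "AE x in lebesgue. g1 x = g2 x"
proof -
  have "AE x in lebesgue. g1 x + (-1) * g2 x = 0"
  proof (rule fundamental_lemma[OF square_integrable_add[OF assms(1,2)]])
    fix \<phi> assume \<phi>: "test_function \<phi>"
    have "(-1)^j * (LINT x|lebesgue. g1 x * \<phi> x) = (-1)^j * (LINT x|lebesgue. g2 x * \<phi> x)"
      using assms(3,4) \<phi> by (simp add: has_weak_deriv_def)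
    then have eq: "(LINT x|lebesgue. g1 x * \<phi> x) = (LINT x|lebesgue. g2 x * \<phi> x)" by simp
    have "(LINT x|lebesgue. (g1 x + (-1) * g2 x) * \<phi> x) = (LINT x|lebesgue. g1 x * \<phi> x - g2 x * \<phi> x)"
      by (simp add: left_diff_distrib)
    also have "\<dots> = 0"
      using square_integrable_test_mult[OF assms(1) \<phi>] square_integrable_test_mult[OF assms(2) \<phi>] eq by simp
    finally show "(LINT x|lebesgue. (g1 x + (-1) * g2 x) * \<phi> x) = 0" .
  qed
  then show ?thesis by eventually_elim simp
qed

text \<open>\<open>weak_deriv\<close> is an arbitrary choice, but weak derivatives agree almost
  everywhere, so \<open>sobolev_norm\<close> can be computed from any square-integrable one.\<close>

lemma weak_deriv_integral:
  assumes g: "square_integrable g" "has_weak_deriv j f g"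
  shows "(LINT x|lebesgue. (weak_deriv j f x)^2) = (LINT x|lebesgue. (g x)^2)"
proof -
  have w: "square_integrable (weak_deriv j f) \<and> has_weak_deriv j f (weak_deriv j f)"
    unfolding weak_deriv_def using g by (intro someI[of "\<lambda>g. square_integrable g \<and> has_weak_deriv j f g"]) simp
  show ?thesis
  proof (rule integral_cong_AE)
    show "(\<lambda>x. (weak_deriv j f x)^2) \<in> borel_measurable lebesgue" "(\<lambda>x. (g x)^2) \<in> borel_measurable lebesgue"
      using w g by (auto simp: square_integrable_def)
    have "AE x in lebesgue. weak_deriv j f x = g x" using weak_deriv_unique w g by blast
    then show "AE x in lebesgue. (weak_deriv j f x)^2 = (g x)^2" by eventually_elim simp
  qed
qed

lemma has_weak_deriv_AE:
  assumes ae: "AE x in lebesgue. f x = f' x" and m: "f \<in> borel_measurable lebesgue"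
      "f' \<in> borel_measurable lebesgue"
    and w: "has_weak_deriv j f g"
  shows "has_weak_deriv j f' g"
  unfolding has_weak_deriv_def
proof (intro allI impI)
  fix \<phi> assume \<phi>: "test_function \<phi>"
  have pm: "(deriv ^^ j) \<phi> \<in> borel_measurable lebesgue"
      by (rule measurable_completion[OF cont_meas[OF test_cont[OF \<phi>]]])
  have "(LINT x|lebesgue. f' x * (deriv ^^ j) \<phi> x) = (LINT x|lebesgue. f x * (deriv ^^ j) \<phi> x)"
    by (rule integral_cong_AE) (use ae in \<open>auto intro!: borel_measurable_times m pm\<close>)
  also have "\<dots> = (-1)^j * (LINT x|lebesgue. g x * \<phi> x)" using w \<phi> by (simp add: has_weak_deriv_def)
  finally show "(LINT x|lebesgue. f' x * (deriv ^^ j) \<phi> x) = (-1)^j * (LINT x|lebesgue. g x * \<phi> x)" .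
qed

lemma has_weak_deriv_0: "has_weak_deriv 0 f f"
  by (simp add: has_weak_deriv_def)

lemma has_weak_deriv_C1:
  assumes "\<And>x. (u has_real_derivative u' x) (at x)" "continuous_on UNIV u'"
  shows "has_weak_deriv 1 u u'"
  using weak_ibp[OF assms, of _ 0] by (simp add: has_weak_deriv_def)

lemma sobolev_norm_1:
  assumes V: "square_integrable V" and ae: "AE x in lebesgue. V x = v x"
    and v: "\<And>x. (v has_real_derivative v' x) (at x)" and l: "l2_bounded v A" "l2_bounded v' B"
  shows "sobolev_norm 1 V = sqrt ((l2_norm v)^2 + (l2_norm v')^2)"
proof -
  have m: "V \<in> borel_measurable lebesgue" using V by (simp add: square_integrable_def)
  have mv: "v \<in> borel_measurable lebesgue" using square_integrable_l2_bounded(1)[OF l(1)]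
      by (simp add: square_integrable_def)
  have ae': "AE x in lebesgue. v x = V x" using ae by eventually_elim simp
  have "(LINT x|lebesgue. (weak_deriv 0 V x)^2) = (LINT x|lebesgue. (V x)^2)"
    by (rule weak_deriv_integral[OF V has_weak_deriv_0])
  also have "\<dots> = (LINT x|lebesgue. (v x)^2)"
    by (rule integral_cong_AE) (use ae m mv in auto)
  finally have 0: "(LINT x|lebesgue. (weak_deriv 0 V x)^2) = (l2_norm v)^2"
      using square_integrable_l2_bounded(2)[OF l(1)] by simp
  have "has_weak_deriv 1 V v'"
    by (rule has_weak_deriv_AE[OF ae' mv m has_weak_deriv_C1[OF v l2_bounded_cont[OF l(2)]]])
  then have 1: "(LINT x|lebesgue. (weak_deriv 1 V x)^2) = (l2_norm v')^2"
    using weak_deriv_integral[OF square_integrable_l2_bounded(1)[OF l(2)]]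
        square_integrable_l2_bounded(2)[OF l(2)] by simp
  have "(\<Sum>j\<le>1. LINT x|lebesgue. (weak_deriv j V x)^2) = (l2_norm v)^2 + (l2_norm v')^2"
    using 0 1 by simp
  then show ?thesis by (simp add: sobolev_norm_def)
qed

text \<open>The set where f and g differ is open, and a null set that is open is empty.\<close>

lemma continuous_AE_eq:
  fixes f g :: "real \<Rightarrow> real"
  assumes "continuous_on UNIV f" "continuous_on UNIV g" "AE x in lebesgue. f x = g x"
  shows "f = g"
proof (rule ccontr)
  assume "f \<noteq> g"
  then have ne: "{x. f x \<noteq> g x} \<noteq> {}" by auto
  have op: "open {x. f x \<noteq> g x}" using assms by (rule_tac open_Collect_neq) auto
  from assms(3) have "AE x in lborel. f x = g x" by (simp add: AE_completion_iff)
  then have "{x. f x \<noteq> g x} \<in> null_sets lborel"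
    using op by (subst (asm) AE_iff_null) auto
  then have "negligible {x. f x \<noteq> g x}" by (simp add: negligible_iff_null_sets null_sets_completionI)
  then show False using open_not_negligible[OF op ne] by simp
qed

section \<open>Regularity\<close>

text \<open>One constant bounds u and its first k derivatives, both in L^2 and uniformly. The
  uniform bounds make the class closed under products and powers, and a single constant suits the
  Weierstrass test.\<close>

fun regular :: "nat \<Rightarrow> real \<Rightarrow> (real \<Rightarrow> real) \<Rightarrow> bool" where
  "regular 0 C u \<longleftrightarrow> l2_bounded u C \<and> (\<forall>x. \<bar>u x\<bar> \<le> C)"
| "regular (Suc k) C u \<longleftrightarrow> l2_bounded u C \<and> (\<forall>x. \<bar>u x\<bar> \<le> C) \<and> (\<exists>u'. (\<forall>x. (u has_real_derivative u' x) (at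
    x)) \<and> regular k C u')"

lemma regular_SucI:
  "l2_bounded u C \<Longrightarrow> (\<And>x. \<bar>u x\<bar> \<le> C) \<Longrightarrow> (\<And>x. (u has_real_derivative u' x) (at x)) \<Longrightarrow> regular k C u' \<Longrightarrow>
      regular (Suc k) C u"
  by (simp only: regular.simps) blast

lemma regular_base: "regular k C u \<Longrightarrow> l2_bounded u C \<and> (\<forall>x. \<bar>u x\<bar> \<le> C)"
  by (cases k) auto

lemma regular_cont: "regular k C u \<Longrightarrow> continuous_on UNIV u"
  using regular_base l2_bounded_cont by blast

lemma regular_nonneg: "regular k C u \<Longrightarrow> 0 \<le> C"
  using regular_base l2_bounded_nonneg by blast

lemma regular_mono: "regular k C u \<Longrightarrow> C \<le> D \<Longrightarrow> regular k D u"
proof (induction k arbitrary: u)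
  case 0
  then show ?case by (auto intro: l2_bounded_mono order_trans)
next
  case (Suc k)
  then obtain u' where "\<And>x. (u has_real_derivative u' x) (at x)" "regular k C u'" by auto
  then show ?case using Suc by (auto intro: l2_bounded_mono order_trans)
qed

lemma regular_Suc_imp: "regular (Suc k) C u \<Longrightarrow> regular k C u"
proof (induction k arbitrary: u)
  case (Suc k)
  then obtain u' where "\<And>x. (u has_real_derivative u' x) (at x)" "regular (Suc k) C u'" by auto
  then have "regular k C u'" using Suc.IH by blast
  then show ?case using Suc.prems \<open>\<And>x. (u has_real_derivative u' x) (at x)\<close> by auto
qed auto

lemma regular_add: "regular k A u \<Longrightarrow> regular k B v \<Longrightarrow> regular k (A + B) (\<lambda>x. u x + v x)"
proof (induction k arbitrary: u v)
  case 0
  then show ?case by (auto intro: l2_bounded_add order_trans[OF abs_triangle_ineq add_mono])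
next
  case (Suc k)
  obtain u' v' where d: "\<And>x. (u has_real_derivative u' x) (at x)" "regular k A u'"
    "\<And>x. (v has_real_derivative v' x) (at x)" "regular k B v'" using Suc.prems by auto
  then show ?case using Suc.prems Suc.IH[OF d(2,4)]
    by (auto intro!: l2_bounded_add DERIV_add exI[of _ "\<lambda>x. u' x + v' x"] intro: order_trans[OF
        abs_triangle_ineq add_mono])
qed

lemma regular_scale: "regular k A u \<Longrightarrow> regular k (\<bar>c\<bar> * A) (\<lambda>x. c * u x)"
proof (induction k arbitrary: u)
  case 0
  then show ?case by (auto intro!: l2_bounded_scale mult_left_mono simp: abs_mult)
next
  case (Suc k)
  obtain u' where d: "\<And>x. (u has_real_derivative u' x) (at x)" "regular k A u'" using Suc.prems by auto
  then show ?case using Suc.prems Suc.IH[OF d(2)]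
    by (auto intro!: l2_bounded_scale mult_left_mono DERIV_cmult exI[of _ "\<lambda>x. c * u' x"] simp: abs_mult)
qed

lemma l2_bounded_sup_mult:
  assumes u: "l2_bounded u A" "\<And>x. \<bar>u x\<bar> \<le> A" and v: "l2_bounded v B" "\<And>x. \<bar>v x\<bar> \<le> B" and K: "A * B \<le> K"
  shows "l2_bounded (\<lambda>x. u x * v x) K" "\<bar>u x * v x\<bar> \<le> K"
proof -
  have A: "0 \<le> A" using u(1) l2_bounded_nonneg by blast
  have "l2_bounded (\<lambda>x. u x * v x) (A * B)"
    using u v A by (intro l2_bounded_dom[OF v(1)]) (auto simp: abs_mult intro!: continuous_on_mult
        l2_bounded_cont[OF u(1)] l2_bounded_cont[OF v(1)] mult_right_mono)
  then show "l2_bounded (\<lambda>x. u x * v x) K" using K by (rule l2_bounded_mono)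
  have "\<bar>u x * v x\<bar> \<le> A * B" unfolding abs_mult using u(2)[of x] v(2)[of x] A by (intro mult_mono) auto
  then show "\<bar>u x * v x\<bar> \<le> K" using K by linarith
qed

lemma regular_mult: "regular k A u \<Longrightarrow> regular k B v \<Longrightarrow> regular k (2^k * A * B) (\<lambda>x. u x * v x)"
proof (induction k arbitrary: u v)
  case 0
  then show ?case using l2_bounded_sup_mult[of u A v B "A * B"] by auto
next
  case (Suc k)
  obtain u' v' where d: "\<And>x. (u has_real_derivative u' x) (at x)" "regular k A u'"
    "\<And>x. (v has_real_derivative v' x) (at x)" "regular k B v'" using Suc.prems by auto
  have AB: "0 \<le> A" "0 \<le> B" using Suc.prems regular_nonneg by blast+
  have "1 * (A * B) \<le> 2^Suc k * (A * B)" using AB by (intro mult_right_mono one_le_power) auto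
  then have le: "A * B \<le> 2^Suc k * A * B" by simp
  have "regular k (2^k * A * B + 2^k * A * B) (\<lambda>x. u' x * v x + u x * v' x)"
    by (rule regular_add[OF Suc.IH[OF d(2) regular_Suc_imp[OF Suc.prems(2)]] Suc.IH[OF
        regular_Suc_imp[OF Suc.prems(1)] d(4)]])
  then have r: "regular k (2^Suc k * A * B) (\<lambda>x. u' x * v x + v' x * u x)" by (simp add: mult_ac)
  have D: "((\<lambda>x. u x * v x) has_real_derivative u' x * v x + v' x * u x) (at x)" for x
    by (rule DERIV_mult[OF d(1) d(3)])
  have "l2_bounded u A" "\<And>x. \<bar>u x\<bar> \<le> A" "l2_bounded v B" "\<And>x. \<bar>v x\<bar> \<le> B" using Suc.prems regular_base by blast+
  note b = l2_bounded_sup_mult[OF this le]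
  show ?case by (rule regular_SucI[OF b D r])
qed

lemma regular_shift: "regular k C u \<Longrightarrow> regular k C (\<lambda>x. u (x + t))"
proof (induction k arbitrary: u)
  case 0
  then show ?case by (auto intro: l2_bounded_shift)
next
  case (Suc k)
  obtain u' where d: "\<And>x. (u has_real_derivative u' x) (at x)" "regular k C u'" using Suc.prems by auto
  have "((\<lambda>x. u (x + t)) has_real_derivative u' (x + t)) (at x)" for x
    using DERIV_shift[of u "u' (x+t)" x t] d(1) by simp
  moreover have "l2_bounded (\<lambda>x. u (x + t)) C" "\<And>x. \<bar>u (x + t)\<bar> \<le> C"
    using regular_base[OF Suc.prems] by (auto intro: l2_bounded_shift)
  ultimately show ?case using Suc.IH[OF d(2)] regular_SucI[of "\<lambda>x. u (x + t)" C "\<lambda>x. u' (x + t)" k] by simp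
qed

lemma regular_avg_same: "regular k C u \<Longrightarrow> h > 0 \<Longrightarrow> regular k C (avg h u)"
proof (induction k arbitrary: u)
  case 0
  then show ?case by (auto intro!: avg_l2_bounded avg_abs_le l2_bounded_cont)
next
  case (Suc k)
  obtain u' where d: "\<And>x. (u has_real_derivative u' x) (at x)" "regular k C u'" using Suc.prems by auto
  have c: "continuous_on UNIV u" using Suc.prems(1) by (rule regular_cont)
  have "avg h u' x = (u (x + h/2) - u (x - h/2)) / h" for x
  proof -
    have "((\<lambda>t. u (x + t)) has_real_derivative u' (x + t)) (at t)" for t
      using DERIV_shift[of u "u' (x+t)" t x] d(1)[of "x+t"] by (simp add: add.commute)
    from ftc[OF this, of "-h/2" "h/2"] Suc.prems(2) show ?thesis by (simp add: avg_def integral_unique)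
  qed
  then have "(avg h u has_real_derivative avg h u' x) (at x)" for x using avg_deriv[OF c Suc.prems(2)] by simp
  moreover have "l2_bounded (avg h u) C" "\<And>x. \<bar>avg h u x\<bar> \<le> C"
    using Suc.prems regular_base[OF Suc.prems(1)] by (auto intro!: avg_l2_bounded avg_abs_le c)
  ultimately show ?case using Suc.IH[OF d(2) Suc.prems(2)] by auto
qed

text \<open>The additional derivative is a difference quotient of u and is paid for with 2/h. As all
  widths are at least \<epsilon>, the price stays bounded along the series.\<close>

lemma regular_avg:
  assumes u: "regular k C u" and h: "h > 0" shows "regular (Suc k) (C * (1 + 2/h)) (avg h u)"
proof -
  have c: "continuous_on UNIV u" using u by (rule regular_cont)
  have C: "0 \<le> C" using u by (rule regular_nonneg)
  have le: "C \<le> C * (1 + 2/h)" "2 * C / h \<le> C * (1 + 2/h)" using C h by (auto simp: field_simps)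
  have b: "l2_bounded (avg h u) C" "\<And>x. \<bar>avg h u x\<bar> \<le> C"
    using regular_base[OF u] h by (auto intro!: avg_l2_bounded avg_abs_le c)
  have "regular k (\<bar>1/h\<bar> * (C + \<bar>-1\<bar> * C)) (\<lambda>x. (1/h) * (u (x + h/2) + (-1) * u (x + (-(h/2)))))"
    by (intro regular_scale regular_add regular_shift u)
  then have "regular k (2 * C / h) (\<lambda>x. (u (x + h/2) - u (x - h/2)) / h)" using h by simp
  then have "regular k (C * (1 + 2/h)) (\<lambda>x. (u (x + h/2) - u (x - h/2)) / h)" using le(2) by (rule regular_mono)
  moreover have "l2_bounded (avg h u) (C * (1 + 2/h))" using b(1) le(1) by (rule l2_bounded_mono)
  moreover have "\<bar>avg h u x\<bar> \<le> C * (1 + 2/h)" for x using b(2)[of x] le(1) by linarith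
  ultimately show ?thesis
    using avg_deriv[OF c h] regular_SucI[of "avg h u" "C * (1 + 2/h)" "\<lambda>x. (u (x + h/2) - u (x - h/2)) /
        h" k] by simp
qed

lemma powr_lipschitz:
  fixes \<beta> :: real
  shows "\<exists>L>0. \<forall>s. \<bar>s\<bar> \<le> 1/2 \<longrightarrow> \<bar>(1 + s) powr \<beta> - 1\<bar> \<le> L * \<bar>s\<bar>"
proof -
  define L where "L = \<bar>\<beta>\<bar> * ((1/2) powr (\<beta> - 1) + (3/2) powr (\<beta> - 1)) + 1"
  have L: "L > 0" unfolding L_def by (intro add_nonneg_pos mult_nonneg_nonneg add_nonneg_nonneg) auto
  have "\<bar>(1 + s) powr \<beta> - 1\<bar> \<le> L * \<bar>s\<bar>" if s: "\<bar>s\<bar> \<le> 1/2" for s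
  proof -
    have "norm ((1 + s) powr \<beta> - (1 + 0) powr \<beta>) \<le> L * norm (s - 0)"
    proof (rule field_differentiable_bound[where S="{-1/2..1/2}" and f'="\<lambda>s. \<beta> * (1 + s) powr (\<beta> - 1)"])
      fix z :: real assume z: "z \<in> {-1/2..1/2}"
      show "((\<lambda>s. (1 + s) powr \<beta>) has_field_derivative \<beta> * (1 + z) powr (\<beta> - 1)) (at z within {-1/2..1/2})"
        using z by (auto intro!: derivative_eq_intros)
      have "(1 + z) powr (\<beta> - 1) \<le> (1/2) powr (\<beta> - 1) + (3/2) powr (\<beta> - 1)"
      proof (cases "\<beta> \<ge> 1")
        case True
        then have "(1 + z) powr (\<beta> - 1) \<le> (3/2) powr (\<beta> - 1)" using z by (intro powr_mono2) auto
        then show ?thesis using powr_ge_zero[of "1/2" "\<beta> - 1"] by linarith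
      next
        case False
        then have "(1 + z) powr (\<beta> - 1) \<le> (1/2) powr (\<beta> - 1)" using z by (intro powr_mono2') auto
        then show ?thesis using powr_ge_zero[of "3/2" "\<beta> - 1"] by linarith
      qed
      then have "\<bar>\<beta>\<bar> * (1 + z) powr (\<beta> - 1) \<le> \<bar>\<beta>\<bar> * ((1/2) powr (\<beta> - 1) + (3/2) powr (\<beta> - 1))"
        by (intro mult_left_mono) auto
      then show "norm (\<beta> * (1 + z) powr (\<beta> - 1)) \<le> L" by (simp add: abs_mult L_def)
    qed (use s in auto)
    then show ?thesis by simp
  qed
  then show ?thesis using L by blast
qed

text \<open>D is uniform in p because the lemma is applied to infinitely many averages at once.
  Subtracting 1 keeps the function in L^2, and the induction runs over all exponents since
  differentiation lowers \<beta> by one.\<close>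

lemma regular_powr:
  "\<exists>D. \<forall>p. regular k C p \<and> (\<forall>x. \<bar>p x\<bar> \<le> 1/2) \<longrightarrow> regular k D (\<lambda>x. (1 + p x) powr \<beta> - 1)"
proof (induction k arbitrary: \<beta>)
  case 0
  obtain L where L: "L > 0" "\<And>s. \<bar>s\<bar> \<le> 1/2 \<Longrightarrow> \<bar>(1 + s) powr \<beta> - 1\<bar> \<le> L * \<bar>s\<bar>" using powr_lipschitz by blast
  have "regular 0 (L * C) (\<lambda>x. (1 + p x) powr \<beta> - 1)" if p: "regular 0 C p" "\<And>x. \<bar>p x\<bar> \<le> 1/2" for p
  proof -
    have pos: "1 + p x \<noteq> 0" for x using p(2)[of x] by (auto simp: abs_le_iff)
    have "continuous_on UNIV (\<lambda>x. (1 + p x) powr \<beta> - 1)"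
      using pos by (intro continuous_intros regular_cont[OF p(1)]) auto
    then have "l2_bounded (\<lambda>x. (1 + p x) powr \<beta> - 1) (L * C)"
      using p L by (intro l2_bounded_dom[of p]) auto
    moreover have "\<bar>(1 + p x) powr \<beta> - 1\<bar> \<le> L * C" for x
      using L(2)[OF p(2)[of x]] mult_left_mono[of "\<bar>p x\<bar>" C L] p(1) L(1) by (auto intro: order_trans)
    ultimately show ?thesis by simp
  qed
  then show ?case by blast
next
  case (Suc k)
  obtain L where L: "L > 0" "\<And>s. \<bar>s\<bar> \<le> 1/2 \<Longrightarrow> \<bar>(1 + s) powr \<beta> - 1\<bar> \<le> L * \<bar>s\<bar>" using powr_lipschitz by blast
  obtain D1 where D1: "\<And>p. regular k C p \<Longrightarrow> (\<And>x. \<bar>p x\<bar> \<le> 1/2) \<Longrightarrow> regular k D1 (\<lambda>x. (1 + p x) powr (\<beta> - 1) - 1)"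
    using Suc.IH[of "\<beta> - 1"] by blast
  define D where "D = max (L * C) (\<bar>\<beta>\<bar> * (2^k * D1 * C + C))"
  have "regular (Suc k) D (\<lambda>x. (1 + p x) powr \<beta> - 1)" if p: "regular (Suc k) C p" "\<And>x. \<bar>p x\<bar> \<le> 1/2" for p
  proof -
    obtain p' where p': "\<And>x. (p has_real_derivative p' x) (at x)" "regular k C p'" using p(1) by auto
    have pos: "1 + p x > 0" for x using p(2)[of x] by (auto simp: abs_le_iff)
    have der: "((\<lambda>x. (1 + p x) powr \<beta> - 1) has_real_derivative \<beta> * (((1 + p x) powr (\<beta> - 1) - 1) * p' x
        + p' x)) (at x)" for x
      using p'(1)[of x] pos[of x] by (auto intro!: derivative_eq_intros simp: algebra_simps)
    have "regular k (\<bar>\<beta>\<bar> * (2^k * D1 * C + C)) (\<lambda>x. \<beta> * (((1 + p x) powr (\<beta> - 1) - 1) * p' x + p' x))"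
      by (rule regular_scale[OF regular_add[OF regular_mult[OF D1[OF regular_Suc_imp[OF p(1)] p(2)]
          p'(2)] p'(2)]])
    then have r: "regular k D (\<lambda>x. \<beta> * (((1 + p x) powr (\<beta> - 1) - 1) * p' x + p' x))"
      by (rule regular_mono) (simp add: D_def)
    have "continuous_on UNIV (\<lambda>x. (1 + p x) powr \<beta> - 1)" by (rule cont_of_deriv[OF der])
    then have "l2_bounded (\<lambda>x. (1 + p x) powr \<beta> - 1) (L * C)"
      using p L by (intro l2_bounded_dom[of p]) auto
    then have l: "l2_bounded (\<lambda>x. (1 + p x) powr \<beta> - 1) D" by (rule l2_bounded_mono) (simp add: D_def)
    have "\<bar>(1 + p x) powr \<beta> - 1\<bar> \<le> L * C" for x
      using L(2)[OF p(2)[of x]] mult_left_mono[of "\<bar>p x\<bar>" C L] p(1) L(1) by (auto intro: order_trans)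
    then have "\<bar>(1 + p x) powr \<beta> - 1\<bar> \<le> D" for x by (simp add: D_def max.coboundedI1)
    then show ?thesis by (rule regular_SucI[OF l _ der r])
  qed
  then show ?case by blast
qed

lemma regular_0_suminf:
  assumes f: "\<And>n::nat. l2_bounded (f n) (B n)" "\<And>n x. \<bar>f n x\<bar> \<le> B n" and B: "summable B"
    and u: "\<And>x. (\<lambda>n. f n x) sums u x"
  shows "l2_bounded u (suminf B)" "\<And>x. \<bar>u x\<bar> \<le> suminf B"
proof -
  have B0: "0 \<le> B n" for n using f(1) l2_bounded_nonneg by blast
  have ul: "uniform_limit UNIV (\<lambda>n x. \<Sum>i<n. f i x) (\<lambda>x. \<Sum>i. f i x) sequentially"
    by (rule Weierstrass_m_test[OF _ B]) (use f(2) in auto)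
  have ue: "(\<lambda>x. \<Sum>i. f i x) = u" using u by (auto simp: sums_iff)
  have cu: "continuous_on UNIV u"
    using ul unfolding ue
    by (rule uniform_limit_theorem[rotated]) (auto intro!: always_eventually continuous_on_sum
        l2_bounded_cont[OF f(1)])
  have part: "l2_bounded (\<lambda>x. \<Sum>i<n. f i x) (suminf B)" for n
  proof -
    have "l2_bounded (\<lambda>x. \<Sum>i<n. f i x) (\<Sum>i<n. B i)"
      by (induction n) (auto intro!: l2_bounded_add l2_bounded_0 f(1))
    then show ?thesis using B B0 by (rule_tac l2_bounded_mono) (auto intro!: sum_le_suminf)
  qed
  show "l2_bounded u (suminf B)"
    by (rule l2_bounded_limit[OF part _ cu]) (use u in \<open>simp add: sums_def\<close>)
  show "\<bar>u x\<bar> \<le> suminf B" for x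
    using norm_suminf_le[of "\<lambda>n. f n x" B] f(2) B u[of x] by (simp add: sums_iff)
qed

text \<open>The derivatives of the terms obey the same summable bounds B, so termwise
  differentiation by the Weierstrass test can be repeated.\<close>

lemma regular_suminf:
  assumes "\<And>n::nat. regular k (B n) (f n)" "summable B" "\<And>x. (\<lambda>n. f n x) sums u x"
  shows "regular k (suminf B) u"
  using assms
proof (induction k arbitrary: f u)
  case 0
  then show ?case using regular_0_suminf[of f B u] by auto
next
  case (Suc k)
  have "\<forall>n. \<exists>f'. (\<forall>x. (f n has_real_derivative f' x) (at x)) \<and> regular k (B n) f'" using Suc.prems(1) by simp
  then obtain f' where f': "\<And>n x. (f n has_real_derivative f' n x) (at x)" "\<And>n. regular k (B n) (f' n)" by metis
  have b: "\<And>n. l2_bounded (f n) (B n)" "\<And>n x. \<bar>f n x\<bar> \<le> B n" "\<And>n x. \<bar>f' n x\<bar> \<le> B n"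
    using Suc.prems(1) regular_base f'(2) by blast+
  have sm: "summable (\<lambda>n. f' n x)" for x by (rule summable_comparison_test[OF _ Suc.prems(2)]) (use b(3)
      in auto)
  then have s': "(\<lambda>n. f' n x) sums (\<Sum>n. f' n x)" for x by (rule summable_sums)
  have "((\<lambda>x. \<Sum>n. f n x) has_field_derivative (\<Sum>n. f' n x)) (at x)" for x
  proof (rule has_field_derivative_series'(2)[of UNIV])
    show "uniformly_convergent_on UNIV (\<lambda>n x. \<Sum>i<n. f' i x)"
      by (rule Weierstrass_m_test'[OF _ Suc.prems(2)]) (use b(3) in auto)
    show "summable (\<lambda>n. f n 0)" using Suc.prems(3) sums_summable by blast
  qed (use f'(1) in auto)
  moreover have "(\<lambda>x. \<Sum>n. f n x) = u" using Suc.prems(3) by (auto simp: sums_iff)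
  ultimately have der: "(u has_real_derivative (\<Sum>n. f' n x)) (at x)" for x by simp
  have "regular k (suminf B) (\<lambda>x. \<Sum>n. f' n x)" by (rule Suc.IH[OF f'(2) Suc.prems(2) s'])
  then show ?case by (rule regular_SucI[OF regular_0_suminf[OF b(1,2) Suc.prems(2,3)] der])
qed

lemma regular_weak_deriv:
  "regular k C u \<Longrightarrow> j \<le> k \<Longrightarrow> \<exists>g. square_integrable g \<and> has_weak_deriv j u g"
proof (induction k arbitrary: u j)
  case 0
  then show ?case using square_integrable_l2_bounded(1)[of u C] has_weak_deriv_0 by auto
next
  case (Suc k)
  show ?case
  proof (cases j)
    case 0
    then show ?thesis using square_integrable_l2_bounded(1)[of u C] Suc.prems(1) has_weak_deriv_0 by auto
  next
    case (Suc i)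
    obtain u' where d: "\<And>x. (u has_real_derivative u' x) (at x)" "regular k C u'" using Suc.prems by auto
    then obtain g where g: "square_integrable g" "has_weak_deriv i u' g"
        using Suc.IH[OF d(2), of i] Suc.prems Suc by auto
    have "has_weak_deriv j u g"
      unfolding has_weak_deriv_def
    proof (intro allI impI)
      fix \<phi> assume \<phi>: "test_function \<phi>"
      have "(LINT x|lebesgue. u x * (deriv ^^ j) \<phi> x) = - (LINT x|lebesgue. u' x * (deriv ^^ i) \<phi> x)"
        unfolding Suc by (rule weak_ibp[OF d(1) regular_cont[OF d(2)] \<phi>])
      also have "\<dots> = (-1)^j * (LINT x|lebesgue. g x * \<phi> x)"
        using g(2) \<phi> by (simp add: has_weak_deriv_def Suc)
      finally show "(LINT x|lebesgue. u x * (deriv ^^ j) \<phi> x) = (-1)^j * (LINT x|lebesgue. g x * \<phi> x)" .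
    qed
    then show ?thesis using g(1) by blast
  qed
qed

lemma regular_sobolev: "regular k C u \<Longrightarrow> u \<in> sobolev k"
  using regular_weak_deriv[of k C u] square_integrable_l2_bounded(1)[of u C] regular_base[of k C u]
  by (auto simp: sobolev_def)

text \<open>For S = sech^2(x/2) and T = tanh(x/2), differentiation leads from S to -T S and from T S
  to (3/2) S^2 - S; hence the joint induction for S and T S.\<close>

lemma regular_sech_sq: "\<exists>C. regular k C sech_sq \<and> regular k C (\<lambda>x. tanh (x/2) * sech_sq x)"
proof (induction k)
  case 0
  have t: "\<bar>tanh (x/2) * sech_sq x\<bar> \<le> sech_sq x" for x
    using mult_right_mono[OF abs_tanh_le_1[of "x/2"], of "sech_sq x"] sech_sq_pos[of x] by (simp add: abs_mult)
  have S: "l2_bounded sech_sq (norm sech_sq_h1)" using fn_l2_bounded[of sech_sq_h1]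
      by (simp add: fn_sech_sq_h1[abs_def] flip: fun_eq_iff)
  have "l2_bounded (\<lambda>x. tanh (x/2) * sech_sq x) (1 * norm sech_sq_h1)"
    by (rule l2_bounded_dom[OF S]) (use t sech_sq_pos in \<open>auto intro!: continuous_intros sech_sq_cont
        intro: order_trans[OF _ abs_ge_self]\<close>)
  then have "regular 0 (max 1 (norm sech_sq_h1)) sech_sq \<and> regular 0 (max 1 (norm sech_sq_h1)) (\<lambda>x. tanh
      (x/2) * sech_sq x)"
    using S t sech_sq_le_1 sech_sq_pos by (auto intro: l2_bounded_mono order_trans simp: abs_of_pos
        le_max_iff_disj)
  then show ?case by blast
next
  case (Suc k)
  then obtain C where C: "regular k C sech_sq" "regular k C (\<lambda>x. tanh (x/2) * sech_sq x)" by blast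
  define D where "D = max C (3/2 * (2^k * C * C) + C)"
  have "0 \<le> C" using C regular_nonneg by blast
  have 1: "regular k (\<bar>-1\<bar> * C) (\<lambda>x. (-1) * (tanh (x/2) * sech_sq x))" by (intro regular_scale C)
  have 2: "regular k (\<bar>3/2\<bar> * (2^k * C * C) + \<bar>-1\<bar> * C) (\<lambda>x. 3/2 * (sech_sq x * sech_sq x) + (-1) * sech_sq x)"
    by (intro regular_add regular_scale regular_mult C)
  have r: "regular k D (\<lambda>x. (-1) * (tanh (x/2) * sech_sq x))" "regular k D (\<lambda>x. 3/2 * (sech_sq x *
      sech_sq x) + (-1) * sech_sq x)"
    by (rule regular_mono[OF 1], simp add: D_def) (rule regular_mono[OF 2], simp add: D_def)
  have d1: "(sech_sq has_real_derivative (-1) * (tanh (x/2) * sech_sq x)) (at x)" for x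
      using sech_sq_deriv[of x] by simp
  have tt: "tanh (y/2) * tanh (y/2) = 1 - sech_sq y" "tanh (y/2) * (tanh (y/2) * z)
      = (1 - sech_sq y) * z" for y z :: real
    by (simp_all add: sech_sq_def power2_eq_square)
  have d2: "((\<lambda>x. tanh (x/2) * sech_sq x) has_real_derivative 3/2 * (sech_sq x * sech_sq x) + (-1) *
      sech_sq x) (at x)" for x
    by (rule DERIV_cong[OF DERIV_mult[OF tanh_half_deriv sech_sq_deriv]]) (simp add: algebra_simps tt)
  have b: "regular 0 D sech_sq" "regular 0 D (\<lambda>x. tanh (x/2) * sech_sq x)"
    using regular_base[OF regular_mono[OF C(1)]] regular_base[OF regular_mono[OF C(2)]] by (auto simp: D_def)
  have "regular (Suc k) D sech_sq" "regular (Suc k) D (\<lambda>x. tanh (x/2) * sech_sq x)"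
    using b by (auto simp only: regular.simps(1) intro!: regular_SucI[OF _ _ d1 r(1)] regular_SucI[OF _
        _ d2 r(2)])
  then show ?case by blast
qed

section \<open>Solitary waves\<close>

lemma integrable_lebesgue_indicator: "integrable lebesgue (indicator {p..q} :: real \<Rightarrow> real)"
  using lmeasurable_cbox[of p q] by (simp add: lmeasurable_iff_integrable)

lemma square_integrable_absolutely_integrable:
  assumes "square_integrable f" shows "f absolutely_integrable_on {p..q}"
proof -
  have m: "f \<in> borel_measurable lebesgue" using assms by (simp add: square_integrable_def)
  have "integrable lebesgue (\<lambda>x. indicator {p..q} x + (f x)^2)"
    using assms by (intro Bochner_Integration.integrable_add integrable_lebesgue_indicator) (auto
        simp: square_integrable_def)
  then show ?thesis unfolding set_integrable_def
  proof (rule Bochner_Integration.integrable_bound)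
    show "(\<lambda>x. indicator {p..q} x *\<^sub>R f x) \<in> borel_measurable lebesgue"
        by (intro borel_measurable_scaleR borel_measurable_indicator m) auto
    show "AE x in lebesgue. norm (indicator {p..q} x *\<^sub>R f x) \<le> norm (indicator {p..q} x + (f x)^2 :: real)"
    proof (rule AE_I2)
      fix x
      have "\<bar>f x\<bar> \<le> 1 + (f x)^2"
        using zero_le_power2[of "\<bar>f x\<bar> - 1"] by (simp add: power2_diff)
      then show "norm (indicator {p..q} x *\<^sub>R f x) \<le> norm (indicator {p..q} x + (f x)^2 :: real)"
        by (auto split: split_indicator)
    qed
  qed
qed

lemma average_eq_integral:
  assumes "f absolutely_integrable_on {x - h/2..x + h/2}"
  shows "average h f x = 1/h * integral {x - h/2..x + h/2} f"
  unfolding average_def using set_lebesgue_integral_eq_integral(2)[OF assms] by simp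

lemma average_eq_avg:
  assumes c: "continuous_on UNIV f" and h: "h > 0"
  shows "average h f = avg h f"
proof
  fix x
  have "f absolutely_integrable_on {x - h/2..x + h/2}"
    by (rule absolutely_integrable_continuous_real[OF continuous_on_subset[OF c]]) simp
  moreover have "integral {x - h/2..x + h/2} f = primitive f (x + h/2) - primitive f (x - h/2)"
    using integral_shift_primitive[OF c, of "x - h/2" "x + h/2" 0] h by simp
  ultimately show "average h f x = avg h f x"
    using avg_primitive[OF c h] by (simp add: average_eq_integral)
qed

lemma average_cong_AE:
  assumes "AE x in lebesgue. f x = g x" "f \<in> borel_measurable lebesgue" "g \<in> borel_measurable lebesgue"
  shows "average h f x = average h g x"
  unfolding average_def
  by (subst set_lebesgue_integral_cong_AE[of _ _ f g]) (use assms in auto)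

lemma average_cmult: "average h (\<lambda>y. c * f y) x = c * average h f x"
  by (simp add: average_def)

lemma average_cont:
  assumes f: "square_integrable f" and h: "h > 0"
  shows "continuous_on UNIV (average h f)"
proof -
  have i: "f integrable_on {p..q}" for p q
    using set_lebesgue_integral_eq_integral(1)[OF square_integrable_absolutely_integrable[OF f]] .
  have "continuous_on {-N<..<N} (average h f)" for N
  proof -
    let ?I = "\<lambda>y. integral {-N-h..y} f"
    have c: "continuous_on {-N-h..N+h} ?I" by (rule indefinite_integral_continuous_1[OF i])
    have eq: "1/h * (?I (x + h/2) - ?I (x - h/2)) = average h f x" if "x \<in> {-N<..<N}" for x
    proof -
      have "?I (x - h/2) + integral {x - h/2..x + h/2} f = ?I (x + h/2)"
        by (rule Henstock_Kurzweil_Integration.integral_combine[OF _ _ i]) (use that h in auto)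
      then have "integral {x - h/2..x + h/2} f = ?I (x + h/2) - ?I (x - h/2)" by linarith
      then show ?thesis using average_eq_integral[OF square_integrable_absolutely_integrable[OF f], of h
          x] by simp
    qed
    have "continuous_on {-N<..<N} (\<lambda>x. 1/h * (?I (x + h/2) - ?I (x - h/2)))"
      by (intro continuous_intros continuous_on_compose2[OF c]) (use h in auto)
    then show ?thesis by (rule continuous_on_eq) (rule eq)
  qed
  then have "continuous_on (\<Union>N. {-N<..<N}) (average h f)"
    by (intro continuous_on_open_UN) auto
  moreover have "(\<Union>N. {-N<..<N}) = (UNIV :: real set)"
  proof -
    have "x \<in> {-(\<bar>x\<bar>+1)<..<\<bar>x\<bar>+1}" for x :: real by auto
    then show ?thesis by blast
  qed
  ultimately show ?thesis by simp
qed

text \<open>Integrate \<bar>f\<bar> \<le> (1 + f^2)/2 over the window. A bound of order 1/h is good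
  enough, since it will be multiplied by \<epsilon>^2 with h \<ge> \<epsilon>.\<close>

lemma average_abs_le:
  assumes f: "square_integrable f" and h: "h > 0" and M: "(LINT x|lebesgue. (f x)^2) \<le> M"
  shows "\<bar>average h f x\<bar> \<le> 1/2 + M / (2 * h)"
proof -
  let ?S = "{x - h/2..x + h/2}"
  have i: "set_integrable lebesgue ?S f" by (rule square_integrable_absolutely_integrable[OF f])
  have f2: "integrable lebesgue (\<lambda>x. (f x)^2)" using f by (simp add: square_integrable_def)
  have "\<bar>LINT y:?S|lebesgue. f y\<bar> \<le> (LINT y|lebesgue. \<bar>indicator ?S y *\<^sub>R f y\<bar>)"
    unfolding set_lebesgue_integral_def by (rule integral_abs_bound)
  also have "\<dots> \<le> (LINT y|lebesgue. 1/2 * indicator ?S y + 1/2 * (f y)^2)"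
  proof (rule integral_mono)
    show "integrable lebesgue (\<lambda>y. \<bar>indicator ?S y *\<^sub>R f y\<bar>)"
      using i unfolding set_integrable_def by (rule integrable_abs)
    show "integrable lebesgue (\<lambda>y. 1/2 * indicator ?S y + 1/2 * (f y)^2)"
      using f2 by (intro Bochner_Integration.integrable_add integrable_mult_right
          integrable_lebesgue_indicator) auto
    fix y
    have "\<bar>f y\<bar> \<le> 1/2 + 1/2 * (f y)^2"
      using zero_le_power2[of "\<bar>f y\<bar> - 1"] by (simp add: power2_diff)
    then show "\<bar>indicator ?S y *\<^sub>R f y\<bar> \<le> 1/2 * indicator ?S y + 1/2 * (f y)^2"
      by (auto split: split_indicator)
  qed
  also have "\<dots> = 1/2 * h + 1/2 * (LINT y|lebesgue. (f y)^2)"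
    using f2 h by (subst Bochner_Integration.integral_add) (auto intro!: integrable_lebesgue_indicator)
  also have "\<dots> \<le> 1/2 * h + 1/2 * M" using M by simp
  finally have "\<bar>LINT y:?S|lebesgue. f y\<bar> / h \<le> (1/2 * h + 1/2 * M) / h"
    using h by (intro divide_right_mono) auto
  then show ?thesis using h by (simp add: average_def abs_mult field_simps)
qed

lemma AE_reflect:
  assumes "AE x in lebesgue. P (x::real)" shows "AE x in lebesgue. P (- x)"
proof -
  obtain N where N: "N \<in> null_sets lebesgue" "{x. \<not> P x} \<subseteq> N"
    using assms by (auto simp: eventually_ae_filter)
  have "negligible (uminus ` N)"
    by (rule negligible_differentiable_image_negligible) (use N in \<open>auto simp: negligible_iff_null_sets
        intro!: differentiable_on_minus\<close>)
  then have "uminus ` N \<in> null_sets lebesgue" by (simp add: negligible_iff_null_sets)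
  moreover have "{x. \<not> P (- x)} \<subseteq> uminus ` N"
    using N(2) by (auto intro!: image_eqI[of _ uminus])
  ultimately show ?thesis by (auto simp: eventually_ae_filter)
qed

lemma deriv_potential: "r > 0 \<Longrightarrow> deriv (potential a) r = - a * r powr (-a-1)"
proof -
  assume r: "r > 0"
  have "potential a = (\<lambda>r. r powr (-a))" by (auto simp: potential_def powr_minus_divide)
  then show ?thesis using has_real_derivative_powr[OF r, of "-a"] by (auto intro: DERIV_imp_deriv)
qed

text \<open>Fatou along the steps 1/(n+1): once a classical derivative exists, the norm of
  \<open>h1\<close> controls it.\<close>

lemma l2_bounded_derivative:
  assumes lip: "\<And>r. l2_bounded (shiftdiff r u) (C * \<bar>r\<bar>)"
    and d: "\<And>x. (u has_real_derivative u' x) (at x)" and c: "continuous_on UNIV u'"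
  shows "l2_bounded u' C"
proof (rule l2_bounded_limit[OF _ _ c])
  let ?r = "\<lambda>n. 1 / real (Suc n)"
  show "l2_bounded (\<lambda>x. real (Suc n) * (u (x + ?r n) - u x)) C" for n
    using l2_bounded_scale[OF lip[of "?r n"], of "real (Suc n)"] by simp
  fix x
  have "filterlim ?r (at 0) sequentially"
    unfolding filterlim_at using LIMSEQ_inverse_real_of_nat by (auto simp: inverse_eq_divide)
  from filterlim_compose[OF d[of x, unfolded DERIV_def] this]
  show "(\<lambda>n. real (Suc n) * (u (x + ?r n) - u x)) \<longlonglongrightarrow> u' x" by (simp add: field_simps)
qed

section \<open>The wave equation as a fixed point problem\<close>

context wave
begin

definition profile_eq :: "real \<Rightarrow> (real \<Rightarrow> real) \<Rightarrow> bool" where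
  "profile_eq \<epsilon> W \<longleftrightarrow> (\<forall>x. (\<lambda>n. w n * avg (h \<epsilon> n) (\<lambda>y. - a * ((1 + \<epsilon>^2 * avg (h \<epsilon> n) W y) powr (-a-1) - 1)) x)
     sums (\<epsilon>^2 * (b * zeta_a + disp_coeff * \<epsilon>^2) * W x))"

lemma wave_speed_sq: "(wave_speed a \<epsilon>)^2 = b * zeta_a + disp_coeff * \<epsilon>^2"
proof -
  have "0 \<le> b * zeta_a + disp_coeff * \<epsilon>^2" using b_pos zeta_a_pos disp_coeff_pos by simp
  moreover have "wave_speed a \<epsilon> = sqrt (b * zeta_a + disp_coeff * \<epsilon>^2)"
    by (simp add: wave_speed_def b_def zeta_a_def disp_coeff_def zeta_a2_def)
  ultimately show ?thesis by simp
qed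

text \<open>The bound keeps all arguments of the potential positive, so homogeneity applies and the
  factor m^(-a) can be taken out of each term.\<close>

lemma wave_equation_iff:
  assumes W: "\<And>n y. \<bar>\<epsilon>^2 * average (h \<epsilon> n) W y\<bar> \<le> 1/2"
  shows "wave_equation a \<epsilon> (wave_speed a \<epsilon>) W \<longleftrightarrow>
    (AE x in lebesgue. (\<lambda>n. w n * average (h \<epsilon> n) (\<lambda>y. - a * ((1 + \<epsilon>^2 * average (h \<epsilon> n) W y) powr
        (-a-1) - 1)) x)
      sums (\<epsilon>^2 * (b * zeta_a + disp_coeff * \<epsilon>^2) * W x))"
proof -
  have p: "1 + \<epsilon>^2 * average (h \<epsilon> n) W y > 0" for n y using W[of n y] by (auto simp: abs_le_iff)
  have s: "strain \<epsilon> W (Suc n) y = real (Suc n) * (1 + \<epsilon>^2 * average (h \<epsilon> n) W y)" for n y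
    by (simp only: strain_def h_def) (simp add: algebra_simps)
  have s0: "strain \<epsilon> W (Suc n) y > 0" for n y unfolding s using p[of n y] by (intro mult_pos_pos) auto
  have "m \<ge> 1 \<Longrightarrow> strain \<epsilon> W m x > 0" for m x using s0[of "m - 1" x] by simp
  moreover have "real (Suc n) * average (\<epsilon> * real (Suc n)) (\<lambda>y. deriv (potential a) (strain \<epsilon> W (Suc n)
      y) - deriv (potential a) (real (Suc n))) x
    = w n * average (h \<epsilon> n) (\<lambda>y. - a * ((1 + \<epsilon>^2 * average (h \<epsilon> n) W y) powr (-a-1) - 1)) x" for n x
  proof -
    have "strain \<epsilon> W (Suc n) y powr (-a-1) = real (Suc n) powr (-a-1) * (1 + \<epsilon>^2 * average (h \<epsilon> n) W y)
        powr (-a-1)" for y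
      unfolding s using p[of n y] by (intro powr_mult)
    then have "deriv (potential a) (strain \<epsilon> W (Suc n) y) - deriv (potential a) (real (Suc n))
      = real (Suc n) powr (-a-1) * (- a * ((1 + \<epsilon>^2 * average (h \<epsilon> n) W y) powr (-a-1) - 1))" for y
      using deriv_potential[OF s0[of n y], of a] deriv_potential[of "real (Suc n)" a]
      by (simp add: algebra_simps del: of_nat_Suc)
    moreover have "real (Suc n) * real (Suc n) powr (-a-1) = w n"
      by (simp add: w_def powr_diff powr_minus_divide del: of_nat_Suc)
    ultimately show ?thesis by (simp only: average_cmult h_def mult.assoc[symmetric])
  qed
  ultimately show ?thesis unfolding wave_equation_def Let_def wave_speed_sq by simp
qed

text \<open>The equation expresses W as a series of averages of functions that are as regular as W.
  Each average adds one derivative, with bounds that do not depend on n because the widths are at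
  least \<epsilon>.\<close>

lemma profile_eq_regular_step:
  assumes e: "\<epsilon> > 0" and W: "regular k C W" and p: "\<And>n x. \<bar>\<epsilon>^2 * avg (h \<epsilon> n) W x\<bar> \<le> 1/2"
      and eq: "profile_eq \<epsilon> W"
  shows "\<exists>C'. regular (Suc k) C' W"
proof -
  obtain D where D: "\<And>p. regular k (\<bar>\<epsilon>^2\<bar> * C) p \<Longrightarrow> (\<And>x. \<bar>p x\<bar> \<le> 1/2) \<Longrightarrow>
      regular k D (\<lambda>x. (1 + p x) powr (-a-1) - 1)"
    using regular_powr by blast
  define G where "G n = (\<lambda>y. - a * ((1 + \<epsilon>^2 * avg (h \<epsilon> n) W y) powr (-a-1) - 1))" for n
  define E where "E = \<bar>-a\<bar> * D * (1 + 2/\<epsilon>)"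
  have G: "regular k (\<bar>-a\<bar> * D) (G n)" for n
    unfolding G_def by (rule regular_scale[OF D[OF regular_scale[OF regular_avg_same[OF W h_pos[OF e]]] p]])
  have "regular (Suc k) E (avg (h \<epsilon> n) (G n))" for n
  proof (rule regular_mono[OF regular_avg[OF G h_pos[OF e]]])
    have "\<epsilon> * 1 \<le> h \<epsilon> n" unfolding h_def using e by (intro mult_left_mono) auto
    then have "2 / h \<epsilon> n \<le> 2 / \<epsilon>" using e by (intro divide_left_mono) (auto simp: h_pos)
    then show "\<bar>-a\<bar> * D * (1 + 2 / h \<epsilon> n) \<le> E"
      unfolding E_def using regular_nonneg[OF G] by (intro mult_left_mono) auto
  qed
  then have r: "regular (Suc k) (w n * E) (\<lambda>x. w n * avg (h \<epsilon> n) (G n) x)" for n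
    using regular_scale[of "Suc k" E "avg (h \<epsilon> n) (G n)" "w n"] w_pos[of n] by simp
  define c where "c = \<epsilon>^2 * (b * zeta_a + disp_coeff * \<epsilon>^2)"
  have c: "c > 0" unfolding c_def using e b_pos zeta_a_pos disp_coeff_pos
      by (intro mult_pos_pos add_pos_pos) auto
  have "regular (Suc k) (\<Sum>n. w n * E) (\<lambda>x. c * W x)"
    by (rule regular_suminf[OF r]) (use eq w_sums in \<open>auto simp: profile_eq_def G_def c_def sums_iff
        intro!: summable_mult2\<close>)
  from regular_scale[OF this, of "1 / c"]
  have "regular (Suc k) (\<bar>1 / c\<bar> * (\<Sum>n. w n * E)) (\<lambda>x. 1 / c * (c * W x))" .
  moreover have "(\<lambda>x. 1 / c * (c * W x)) = W" using c by simp
  ultimately have "regular (Suc k) (\<bar>1 / c\<bar> * (\<Sum>n. w n * E)) W" by (simp only:)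
  then show ?thesis by blast
qed

lemma profile_eq_regular:
  assumes e: "\<epsilon> > 0" and W: "regular 0 C W" and p: "\<And>n x. \<bar>\<epsilon>^2 * avg (h \<epsilon> n) W x\<bar> \<le> 1/2"
      and eq: "profile_eq \<epsilon> W"
  shows "\<exists>C'. regular k C' W"
proof (induction k)
  case (Suc k)
  then show ?case using profile_eq_regular_step[OF e _ p eq] by blast
qed (use W in blast)

lemma wave_profile_eq: "wave_profile a \<sigma> \<epsilon> V = (\<lambda>x. fn W0 x + \<epsilon> powr \<sigma> * V x)"
  by (simp add: fun_eq_iff wave_profile_def W0_def amplitude_def fn_sech_sq_h1 sech_sq_cosh zeta_a2_def
      zeta_a_def)

lemma regular_W0: "\<exists>C. regular k C (fn W0)"
proof -
  obtain C where "regular k C sech_sq" using regular_sech_sq by blast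
  from regular_scale[OF this, of "- amplitude"] have "regular k (\<bar>- amplitude\<bar> * C) (fn W0)"
    by (simp only: W0_def fn_scaleR_fun fn_sech_sq_h1[abs_def])
  then show ?thesis by blast
qed

lemma regular_corrector:
  assumes "s > 0" "regular k C (\<lambda>x. fn W0 x + s * v x)" shows "\<exists>C. regular k C v"
proof -
  obtain D where D: "regular k D (fn W0)" using regular_W0 by blast
  have "regular k (\<bar>1/s\<bar> * (C + \<bar>-1\<bar> * D)) (\<lambda>x. 1/s * ((fn W0 x + s * v x) + (-1) * fn W0 x))"
    by (rule regular_scale[OF regular_add[OF assms(2) regular_scale[OF D]]])
  then show ?thesis using assms(1) by auto
qed

lemma strain_small:
  assumes "small \<epsilon> R" "norm W \<le> R" shows "\<bar>\<epsilon>^2 * avg (h \<epsilon> n) (fn W) x\<bar> \<le> 1/2"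
proof -
  note s = smallD[OF assms(1)]
  have "\<bar>fn W y\<bar> \<le> 2 * R" for y using fn_sup[of W y] assms(2) by linarith
  then have "\<bar>avg (h \<epsilon> n) (fn W) x\<bar> \<le> 2 * R" by (intro avg_abs_le fn_cont h_pos s)
  then have "\<epsilon>^2 * \<bar>avg (h \<epsilon> n) (fn W) x\<bar> \<le> \<epsilon>^2 * (2 * R)" by (intro mult_left_mono) auto
  then show ?thesis using s(3) by (simp add: abs_mult)
qed

lemma fixed_point_is_corrector:
  assumes s: "small \<epsilon> (norm W0 + \<kappa>)" and \<sigma>: "\<sigma> > 0" and V: "norm V \<le> \<kappa>/2"
    and fx: "wave_map \<epsilon> (W0 + \<epsilon> powr \<sigma> *\<^sub>R V) = W0 + \<epsilon> powr \<sigma> *\<^sub>R V"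
  shows "is_corrector a \<sigma> \<kappa> \<epsilon> (fn V)"
proof -
  let ?s = "\<epsilon> powr \<sigma>" let ?W = "W0 + \<epsilon> powr \<sigma> *\<^sub>R V"
  note e = smallD[OF s]
  have s1: "?s > 0" "?s \<le> 1" using e(1,2) \<sigma> powr_mono2[of \<sigma> \<epsilon> 1] by auto
  have k0: "\<kappa> \<ge> 0" using V norm_ge_zero[of V] by linarith
  have nW: "norm ?W \<le> norm W0 + \<kappa>" using s1 V k0 by (intro norm_shifted_le) auto
  have Weq: "fn ?W = (\<lambda>x. fn W0 x + ?s * fn V x)" by auto
  have eq: "profile_eq \<epsilon> (fn ?W)" using fx wave_map_fixed_iff[OF s nW] unfolding profile_eq_def by simp
  note p = strain_small[OF s nW]
  have "regular 0 (2 * norm ?W) (fn ?W)"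
    using fn_l2_bounded[of ?W] fn_sup[of ?W] norm_ge_zero[of ?W]
        by (auto simp del: fn_plus fn_scaleR intro: l2_bounded_mono)
  then obtain C where "regular 3 C (fn ?W)" using profile_eq_regular[OF e(1) _ p eq] by blast
  then obtain C where C: "regular 3 C (fn V)" using regular_corrector[OF s1(1)] unfolding Weq by blast
  have "fn V \<in> even_sobolev 3" using regular_sobolev[OF C] by (simp add: even_sobolev_def)
  moreover have "sobolev_norm 1 (fn V) \<le> \<kappa>"
  proof -
    obtain v' where v': "\<And>x. (fn V has_real_derivative v' x) (at x)" "regular 2 C v'"
      using C by (auto simp: numeral_3_eq_3 numeral_2_eq_2)
    have l: "l2_bounded v' (norm V)" by (rule l2_bounded_derivative[OF fn_lip v'(1) regular_cont[OF v'(2)]])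
    have "sobolev_norm 1 (fn V) = sqrt ((l2_norm (fn V))^2 + (l2_norm v')^2)"
      by (rule sobolev_norm_1[OF square_integrable_l2_bounded(1)[OF fn_l2_bounded] _ v'(1) fn_l2_bounded
          l]) simp
    also have "\<dots> \<le> sqrt ((\<kappa>/2)^2 + (\<kappa>/2)^2)"
      using V l2_norm_fn_le[of V] l2_norm_le[OF l] by (intro real_sqrt_le_mono add_mono power_mono
          l2_norm_nonneg) auto
    also have "\<dots> \<le> sqrt (\<kappa>^2)" by (intro real_sqrt_le_mono) (simp add: power2_eq_square)
    finally show ?thesis using k0 by simp
  qed
  moreover have "wave_equation a \<epsilon> (wave_speed a \<epsilon>) (fn ?W)"
  proof -
    have av: "average (h \<epsilon> n) (fn ?W) = avg (h \<epsilon> n) (fn ?W)" for n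
        by (rule average_eq_avg[OF fn_cont h_pos[OF e(1)]])
    have "continuous_on UNIV (\<lambda>y. - a * ((1 + \<epsilon>^2 * avg (h \<epsilon> n) (fn ?W) y) powr (-a-1) - 1))" for n
    proof -
      have "1 + \<epsilon>^2 * avg (h \<epsilon> n) (fn ?W) y \<noteq> 0" for y using p[of n y]
          by (auto simp: abs_le_iff simp del: fn_plus fn_scaleR)
      then show ?thesis by (intro continuous_intros avg_cont fn_cont h_pos e) auto
    qed
    note av2 = average_eq_avg[OF this h_pos[OF e(1)]]
    show ?thesis
      using eq p by (subst wave_equation_iff) (simp_all only: av av2 profile_eq_def AE_I2)
  qed
  ultimately show ?thesis unfolding is_corrector_def wave_profile_eq Weq by simp
qed

text \<open>A corrector is known only almost everywhere. The series of averages in the equation is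
  continuous at once and yields a continuous representative u of the profile; u solves the equation
  at every point, is regular, and its correction lies in \<open>h1\<close>.\<close>

lemma corrector_is_fixed_point:
  assumes s: "small \<epsilon> (norm W0 + \<kappa>)" and \<sigma>: "\<sigma> > 0" and k0: "\<kappa> > 0"
    and e2: "\<epsilon> * (1 + (2 * (norm W0)^2 + 2 * \<kappa>^2)) \<le> 1"
    and V: "is_corrector a \<sigma> \<kappa> \<epsilon> V"
  shows "\<exists>U. norm U \<le> \<kappa> \<and> wave_map \<epsilon> (W0 + \<epsilon> powr \<sigma> *\<^sub>R U) = W0 + \<epsilon> powr \<sigma> *\<^sub>R U \<and>
      (AE x in lebesgue. V x = fn U x)"
proof -
  let ?s = "\<epsilon> powr \<sigma>"
  define M where "M = 2 * (norm W0)^2 + 2 * \<kappa>^2"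
  define W where "W = (\<lambda>x. fn W0 x + ?s * V x)"
  define c where "c = \<epsilon>^2 * (b * zeta_a + disp_coeff * \<epsilon>^2)"
  note e = smallD[OF s]
  have c: "c > 0" unfolding c_def using e b_pos zeta_a_pos disp_coeff_pos
      by (intro mult_pos_pos add_pos_pos) auto
  have s1: "?s > 0" "?s \<le> 1" using e(1,2) \<sigma> powr_mono2[of \<sigma> \<epsilon> 1] by auto
  have Vs: "square_integrable V" "AE x in lebesgue. V (-x) = V x" "sobolev_norm 1 V \<le> \<kappa>"
    "wave_equation a \<epsilon> (wave_speed a \<epsilon>) W"
    using V by (auto simp: is_corrector_def even_sobolev_def sobolev_def wave_profile_eq W_def)
  have Ws: "square_integrable W" unfolding W_def
    by (rule square_integrable_add[OF square_integrable_l2_bounded(1)[OF fn_l2_bounded] Vs(1)])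
  then have Wm: "W \<in> borel_measurable lebesgue" by (simp add: square_integrable_def)
  have M: "(LINT x|lebesgue. (W x)^2) \<le> M"
  proof -
    have "(LINT x|lebesgue. (V x)^2) = (LINT x|lebesgue. (weak_deriv 0 V x)^2)"
      by (rule weak_deriv_integral[OF Vs(1) has_weak_deriv_0, symmetric])
    also have "\<dots> \<le> (\<Sum>j\<le>1. LINT x|lebesgue. (weak_deriv j V x)^2)" by simp
    also have "\<dots> = (sobolev_norm 1 V)^2"
      unfolding sobolev_norm_def by (intro real_sqrt_pow2[symmetric] sum_nonneg) simp
    also have "\<dots> \<le> \<kappa>^2" using Vs(3) unfolding sobolev_norm_def
      by (intro power_mono real_sqrt_ge_zero sum_nonneg) auto
    finally have V2: "(LINT x|lebesgue. (V x)^2) \<le> \<kappa>^2" .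
    have W02: "(LINT x|lebesgue. (fn W0 x)^2) \<le> (norm W0)^2"
      unfolding square_integrable_l2_bounded(2)[OF fn_l2_bounded]
          by (intro power_mono l2_norm_fn_le l2_norm_nonneg)
    have i: "integrable lebesgue (\<lambda>x. (V x)^2)" "integrable lebesgue (\<lambda>x. (fn W0 x)^2)"
        "integrable lebesgue (\<lambda>x. (W x)^2)"
      using Vs(1) Ws square_integrable_l2_bounded(1)[OF fn_l2_bounded, of W0]
          by (auto simp: square_integrable_def)
    have "(LINT x|lebesgue. (W x)^2) \<le> (LINT x|lebesgue. 2 * (fn W0 x)^2 + 2 * (V x)^2)"
    proof (rule integral_mono[OF i(3)])
      show "integrable lebesgue (\<lambda>x. 2 * (fn W0 x)^2 + 2 * (V x)^2)" using i by simp
      fix x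
      have "?s^2 * (V x)^2 \<le> 1 * (V x)^2" using s1 by (intro mult_right_mono power_le_one) auto
      moreover have "0 \<le> (fn W0 x - ?s * V x)^2" by simp
      ultimately show "(W x)^2 \<le> 2 * (fn W0 x)^2 + 2 * (V x)^2"
        unfolding W_def by (simp add: power2_eq_square algebra_simps)
    qed
    also have "\<dots> = 2 * (LINT x|lebesgue. (fn W0 x)^2) + 2 * (LINT x|lebesgue. (V x)^2)"
      using i by simp
    finally show ?thesis using V2 W02 unfolding M_def by linarith
  qed
  have M0: "0 \<le> M" unfolding M_def by simp
  have p: "\<bar>\<epsilon>^2 * average (h \<epsilon> n) W x\<bar> \<le> 1/2" for n x
  proof -
    have "\<epsilon> * 1 \<le> h \<epsilon> n" unfolding h_def using e by (intro mult_left_mono) auto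
    then have "M / (2 * h \<epsilon> n) \<le> M / (2 * \<epsilon>)" using e M0 by (intro divide_left_mono) (auto simp: h_pos)
    then have "\<bar>average (h \<epsilon> n) W x\<bar> \<le> 1/2 + M / (2 * \<epsilon>)"
      using average_abs_le[OF Ws h_pos[OF e(1), of n] M, of x] by linarith
    then have "\<epsilon>^2 * \<bar>average (h \<epsilon> n) W x\<bar> \<le> \<epsilon>^2 * (1/2 + M / (2 * \<epsilon>))" by (intro mult_left_mono) auto
    also have "\<dots> = \<epsilon> * (\<epsilon> + M) / 2" using e(1) by (simp add: field_simps power2_eq_square)
    also have "\<dots> \<le> \<epsilon> * (1 + M) / 2" using e(1,2) by (intro divide_right_mono mult_left_mono) auto
    also have "\<dots> \<le> 1/2" using e2 unfolding M_def by simp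
    finally show ?thesis by (simp add: abs_mult)
  qed
  define G where "G n = (\<lambda>y. - a * ((1 + \<epsilon>^2 * average (h \<epsilon> n) W y) powr (-a-1) - 1))" for n
  have Gc: "continuous_on UNIV (G n)" for n
  proof -
    have "1 + \<epsilon>^2 * average (h \<epsilon> n) W y \<noteq> 0" for y using p[of n y] by (auto simp: abs_le_iff)
    then show ?thesis unfolding G_def by (intro continuous_intros average_cont Ws h_pos e) auto
  qed
  obtain L where L: "L > 0" "\<And>s. \<bar>s\<bar> \<le> 1/2 \<Longrightarrow> \<bar>(1 + s) powr (-a-1) - 1\<bar> \<le> L * \<bar>s\<bar>" using powr_lipschitz by blast
  have Gb: "\<bar>G n y\<bar> \<le> a * (L * (1/2))" for n y
  proof -
    have "\<bar>(1 + \<epsilon>^2 * average (h \<epsilon> n) W y) powr (-a-1) - 1\<bar> \<le> L * (1/2)"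
      using L(2)[OF p[of n y]] mult_left_mono[OF p[of n y], of L] L(1) by linarith
    then show ?thesis unfolding G_def using a3 by (simp add: abs_mult mult_left_mono)
  qed
  have AG: "average (h \<epsilon> n) (G n) = avg (h \<epsilon> n) (G n)" for n by (rule average_eq_avg[OF Gc h_pos[OF e(1)]])
  have AGb: "\<bar>w n * avg (h \<epsilon> n) (G n) x\<bar> \<le> w n * (a * (L * (1/2)))" for n x
    using avg_abs_le[OF Gc[of n] h_pos[OF e(1), of n] Gb, of x] w_pos[of n] by (simp add: abs_mult)
  have sw: "summable (\<lambda>n. w n * (a * (L * (1/2))))" using w_sums by (intro summable_mult2) (simp add: sums_iff)
  have sG: "summable (\<lambda>n. w n * avg (h \<epsilon> n) (G n) x)" for x
    by (rule summable_comparison_test[OF _ sw]) (use AGb in auto)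
  \<comment> \<open>The equation equates the series with c W almost everywhere; solving for W
    defines u at every point.\<close>
  define u where "u x = 1/c * (\<Sum>n. w n * avg (h \<epsilon> n) (G n) x)" for x
  have us: "(\<lambda>n. w n * avg (h \<epsilon> n) (G n) x) sums (c * u x)" for x
    using summable_sums[OF sG[of x]] c by (simp add: u_def)
  have uc: "continuous_on UNIV u"
  proof -
    have "uniform_limit UNIV (\<lambda>N x. \<Sum>n<N. w n * avg (h \<epsilon> n) (G n) x) (\<lambda>x. \<Sum>n. w n * avg (h \<epsilon> n) (G n) x)
        sequentially"
      by (rule Weierstrass_m_test[OF _ sw]) (use AGb in auto)
    then have "continuous_on UNIV (\<lambda>x. \<Sum>n. w n * avg (h \<epsilon> n) (G n) x)"
      by (rule uniform_limit_theorem[rotated])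
        (auto intro!: always_eventually continuous_on_sum continuous_on_mult continuous_on_const
            avg_cont[OF Gc h_pos[OF e(1)]])
    then show ?thesis unfolding u_def by (intro continuous_intros)
  qed
  have um: "u \<in> borel_measurable lebesgue" by (rule measurable_completion[OF cont_meas[OF uc]])
  have Wu: "AE x in lebesgue. W x = u x"
  proof -
    have "AE x in lebesgue. (\<lambda>n. w n * avg (h \<epsilon> n) (G n) x) sums (c * W x)"
      using Vs(4) unfolding wave_equation_iff[OF p] G_def[symmetric] AG c_def[symmetric] .
    then show ?thesis
    proof eventually_elim
      case (elim x)
      from sums_unique2[OF this us[of x]] c show ?case by simp
    qed
  qed
  have ul: "l2_bounded u (l2_norm u)"
  proof -
    have "integrable lebesgue (\<lambda>x. (u x)^2)"
    proof (rule integrable_cong_AE_imp)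
      show "integrable lebesgue (\<lambda>x. (W x)^2)" using Ws by (simp add: square_integrable_def)
      show "(\<lambda>x. (u x)^2) \<in> borel_measurable lebesgue" using um by simp
      show "AE x in lebesgue. (W x)^2 = (u x)^2" using Wu by eventually_elim simp
    qed
    then have "integrable lborel (\<lambda>x. (u x)^2)"
      using cont_meas[OF uc] by (subst (asm) integrable_completion) auto
    then show ?thesis unfolding l2_bounded_iff using uc by simp
  qed
  have ub: "\<bar>u x\<bar> \<le> 1/c * (\<Sum>n. w n * (a * (L * (1/2))))" for x
  proof -
    have "norm (\<Sum>n. w n * avg (h \<epsilon> n) (G n) x) \<le> (\<Sum>n. w n * (a * (L * (1/2))))"
      by (rule norm_suminf_le[OF _ sw]) (use AGb in auto)
    then show ?thesis unfolding u_def using c by (simp add: abs_mult divide_right_mono)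
  qed
  \<comment> \<open>Averages do not see null sets, so u may replace W inside the
    nonlinearity.\<close>
  have Wav: "average (h \<epsilon> n) W y = avg (h \<epsilon> n) u y" for n y
    using average_cong_AE[OF Wu Wm um] average_eq_avg[OF uc h_pos[OF e(1)]] by simp
  have eq: "profile_eq \<epsilon> u" unfolding profile_eq_def Wav[symmetric] G_def[symmetric] c_def[symmetric]
      using us by blast
  have "regular 0 (max (l2_norm u) (1/c * (\<Sum>n. w n * (a * (L * (1/2)))))) u"
    using ul ub by (auto intro: l2_bounded_mono max.coboundedI2)
  then obtain C where C: "regular 1 C u" using profile_eq_regular[OF e(1) _ p[unfolded Wav] eq] by blast
  define v where "v x = (u x - fn W0 x) / ?s" for x
  have uv: "u = (\<lambda>x. fn W0 x + ?s * v x)" using s1 by (auto simp: v_def)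
  obtain D where D: "regular 1 D v" using regular_corrector[OF s1(1)] C unfolding uv by blast
  then obtain v' where v': "\<And>x. (v has_real_derivative v' x) (at x)" "regular 0 D v'"
      by (auto simp: One_nat_def)
  have vl: "l2_bounded v D" "l2_bounded v' D" using regular_base[OF D] regular_base[OF v'(2)] by auto
  have Vv: "AE x in lebesgue. V x = v x"
    using Wu by eventually_elim (use s1 in \<open>simp add: W_def fun_cong[OF uv]\<close>)
  have "sobolev_norm 1 V = sqrt ((l2_norm v)^2 + (l2_norm v')^2)" by (rule sobolev_norm_1[OF Vs(1) Vv v'(1) vl])
  then have le: "sqrt ((l2_norm v)^2 + (l2_norm v')^2) \<le> \<kappa>" using Vs(3) by simp
  then have "l2_norm v \<le> \<kappa>" "l2_norm v' \<le> \<kappa>"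
    using real_sqrt_sum_squares_ge1[of "l2_norm v" "l2_norm v'"] real_sqrt_sum_squares_ge2[of "l2_norm
        v'" "l2_norm v"] by linarith+
  then have vk: "l2_bounded v \<kappa>" "l2_bounded v' \<kappa>"
      using l2_bounded_l2_norm[OF vl(1)] l2_bounded_l2_norm[OF vl(2)] l2_bounded_mono by blast+
  have hv: "h1_bounded v \<kappa>" by (rule h1bI[OF vk(1) l2_bounded_shiftdiff_C1[OF v'(1) vk(2)]])
  \<comment> \<open>Reflection preserves null sets, so the evenness of V passes to v almost
    everywhere, and then everywhere by continuity.\<close>
  have "AE x in lebesgue. v (-x) = v x"
    using Vv AE_reflect[OF Vv] Vs(2) by eventually_elim simp
  then have "(\<lambda>x. v (-x)) = v"
    by (intro continuous_AE_eq continuous_on_compose2[OF l2_bounded_cont[OF vl(1)]] l2_bounded_cont[OF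
        vl(1)] continuous_intros) auto
  then have "v (-x) = v x" for x by (rule fun_cong)
  from fn_Abs[OF hv this] have fv: "fn (Abs_h1 v) = v" .
  have n: "norm (Abs_h1 v) \<le> \<kappa>" using hv fv by (intro norm_h1_le) simp
  have "norm (W0 + ?s *\<^sub>R Abs_h1 v) \<le> norm W0 + \<kappa>" using s1 n by (intro norm_shifted_le) auto
  from wave_map_fixed_iff[OF s this] have "wave_map \<epsilon> (W0 + ?s *\<^sub>R Abs_h1 v) = W0 + ?s *\<^sub>R Abs_h1 v"
    using eq by (simp add: profile_eq_def fn_plus_fun fv uv[symmetric])
  then show ?thesis using n Vv fv by (intro exI[of _ "Abs_h1 v"]) simp
qed

lemma solitary_waves:
  assumes \<sigma>: "0 < \<sigma>" "\<sigma> \<le> 2" and residual_rate: "\<exists>C>0. \<forall>\<epsilon>\<in>{0<..1}. residual_rate \<epsilon> \<le> C * \<epsilon> powr \<sigma>"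
  shows "solitary_waves_exist a \<sigma>"
proof -
  obtain \<kappa> \<epsilon>0 where k: "\<kappa> > 0" and e0: "\<epsilon>0 > 0" and
    fp: "\<And>\<epsilon>. \<epsilon> \<in> {0<..<\<epsilon>0} \<Longrightarrow> small \<epsilon> (norm W0 + \<kappa>) \<and>
    (\<exists>V. norm V \<le> \<kappa>/2 \<and> wave_map \<epsilon> (W0 + \<epsilon> powr \<sigma> *\<^sub>R V) = W0 + \<epsilon> powr \<sigma> *\<^sub>R V \<and>
      (\<forall>V'. norm V' \<le> \<kappa> \<and> wave_map \<epsilon> (W0 + \<epsilon> powr \<sigma> *\<^sub>R V') = W0 + \<epsilon> powr \<sigma> *\<^sub>R V' \<longrightarrow> V' = V))"
    using fixed_point[OF \<sigma> residual_rate] by blast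
  \<comment> \<open>The restriction \<epsilon> < 1/M provides the hypothesis \<open>e2\<close> of
    \<open>corrector_is_fixed_point\<close>.\<close>
  define M where "M = 1 + (2 * (norm W0)^2 + 2 * \<kappa>^2)"
  have M: "M > 0" unfolding M_def by (simp add: add_pos_nonneg)
  have "\<exists>V. is_corrector a \<sigma> \<kappa> \<epsilon> V \<and> (\<forall>V'. is_corrector a \<sigma> \<kappa> \<epsilon> V' \<longrightarrow> (AE x in lebesgue. V' x = V x))"
    if e: "\<epsilon> \<in> {0<..<min \<epsilon>0 (1/M)}" for \<epsilon>
  proof -
    have e': "\<epsilon> \<in> {0<..<\<epsilon>0}" and eM: "\<epsilon> * M \<le> 1" using e M by (auto simp: field_simps)
    from fp[OF e'] obtain V where s: "small \<epsilon> (norm W0 + \<kappa>)" and V: "norm V \<le> \<kappa>/2"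
      "wave_map \<epsilon> (W0 + \<epsilon> powr \<sigma> *\<^sub>R V) = W0 + \<epsilon> powr \<sigma> *\<^sub>R V"
      and un: "\<And>V'. norm V' \<le> \<kappa> \<Longrightarrow> wave_map \<epsilon> (W0 + \<epsilon> powr \<sigma> *\<^sub>R V') = W0 + \<epsilon> powr \<sigma> *\<^sub>R V' \<Longrightarrow> V' = V" by blast
    have "AE x in lebesgue. V' x = fn V x" if V': "is_corrector a \<sigma> \<kappa> \<epsilon> V'" for V'
      using corrector_is_fixed_point[OF s \<sigma>(1) k eM[unfolded M_def] V'] un by blast
    then show ?thesis using fixed_point_is_corrector[OF s \<sigma>(1) V] by blast
  qed
  then show ?thesis unfolding solitary_waves_exist_def
    using k e0 M by (intro exI[of _ "min \<epsilon>0 (1/M)"] conjI exI[of _ \<kappa>]) auto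
qed

end

theorem corollary8:
  fixes a :: real
  assumes "a > 3"
  shows "(\<exists>\<sigma>\<^sub>a>0. solitary_waves_exist a \<sigma>\<^sub>a) \<and>
         (a \<noteq> 5 \<longrightarrow> solitary_waves_exist a (min (a - 3) 2)) \<and>
         (a = 5 \<longrightarrow> (\<forall>\<delta>\<in>{0<..<2}. solitary_waves_exist a (2 - \<delta>)))"
proof -
  interpret wave a by unfold_locales (rule assms)
  \<comment> \<open>The exponent 2 - \<delta> lies strictly below a - 3 = 2, as
    \<open>residual_rate_le_powr\<close> demands.\<close>
  have 5: "solitary_waves_exist a (2 - \<delta>)" if "a = 5" "\<delta> \<in> {0<..<2}" for \<delta>
    by (rule solitary_waves[OF _ _ residual_rate_le_powr]) (use that in auto)
  have ne: "solitary_waves_exist a (min (a - 3) 2)" if "a \<noteq> 5"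
  proof (cases "a < 5")
    case True
    then have "min (a - 3) 2 = a - 3" by simp
    then show ?thesis using solitary_waves[OF _ _ residual_rate_le_powr_critical] True assms by simp
  next
    case False
    then have "a - 2 - 2 > 1" "min (a - 3) 2 = 2" using that by auto
    then show ?thesis using solitary_waves[OF _ _ residual_rate_le_powr[of 2]] by simp
  qed
  have "\<exists>\<sigma>\<^sub>a>0. solitary_waves_exist a \<sigma>\<^sub>a"
  proof (cases "a = 5")
    case True
    then show ?thesis using 5[of 1] by (intro exI[of _ 1]) simp
  next
    case False
    then show ?thesis using ne assms by (intro exI[of _ "min (a - 3) 2"]) simp
  qed
  then show ?thesis using 5 ne by blast
qed

end
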